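(* Let $A$ be a unital C*-algebra with a free action of a compact quantum group $(H,\Delta)$ given by a coaction $\delta\colon A\to A\otimes_{\min}H$, and let $A\circledast^\delta H$ be the equivariant noncommutative join C*-algebra of $A$ and $H$ with the induced free action of $(H,\Delta)$. Suppose that $H$ admits a character $\chi$. Then the following two statements are equivalent: (i) there does not exist an $(H,\Delta)$-equivariant $*$-homomorphism $A\to A\circledast^\delta H$; (ii) there does not exist a $*$-homomorphism $\gamma\colon A\to \mathcal{C}A$ such that $\mathrm{ev}_1\circ\gamma\colon A\to A$ is $H$-colinear (i.e. $(H,\Delta)$-equivariant). Moreover, both statements are true if $\chi$ is different from the counit of $(H,\Delta)$ but some finite convolution power of $\chi$ is the counit.
   Context: All $*$-homomorphisms between unital C*-algebras are unital, and unital C*-algebras are nonzero. "cls" means closed linear span. A compact quantum group $(H,\Delta)$ is a unital C*-algebra $H$ with an injective coassociative $*$-homomorphism $\Delta\colon H\to H\otimes_{\min}H$ such that $\{\Delta(g)(1\otimes h)\mid g,h\in H\}^{cls}=H\otimes_{\min}H=\{(g\otimes1)\Delta(h)\mid g,h\in H\}^{cls}$. An action of $(H,\Delta)$ on a unital C*-algebra $A$ is an injective $*$-homomorphism (coaction) $\delta\colon A\to A\otimes_{\min}H$ with $(\delta\otimes\mathrm{id})\circ\delta=(\mathrm{id}\otimes\Delta)\circ\delta$ and $\{\delta(a)(1\otimes h)\mid a\in A,h\in H\}^{cls}=A\otimes_{\min}H$. It is free iff $\{(x\otimes1)\delta(y)\mid x,y\in A\}^{cls}=A\otimes_{\min}H$.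 A $*$-homomorphism $f\colon (A,\delta_A)\to (B,\delta_B)$ between C*-algebras with $(H,\Delta)$-actions is equivariant (colinear) iff $\delta_B\circ f=(f\otimes\mathrm{id})\circ\delta_A$. The equivariant noncommutative join is $A\circledast^\delta H:=\{f\in C([0,1],A\otimes_{\min}H)\mid f(0)\in\mathbb{C}\otimes H,\ f(1)\in\delta(A)\}$, with the free action of $(H,\Delta)$ induced by $f\mapsto(\mathrm{id}\otimes\Delta)\circ f$. The cone of $A$ is $\mathcal{C}A:=\{f\in C([0,1],A)\mid f(0)\in\mathbb{C}1\}$, and $\mathrm{ev}_1\colon\mathcal{C}A\to A$ is evaluation at $1$. A character of a unital C*-algebra is a unital $*$-homomorphism to $\mathbb{C}$. Characters of $H$ are multiplied by convolution, $\chi_1*\chi_2:=(\chi_1\otimes\chi_2)\circ\Delta$. If $H$ admits a character, then there is a unique character $\varepsilon$ (the counit) that is neutral for the convolution product; it satisfies $(\varepsilon\otimes\mathrm{id})\circ\Delta=\mathrm{id}=(\mathrm{id}\otimes\varepsilon)\circ\Delta$. *)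

theory Defs
  imports "HOL-Analysis.Analysis"
begin

class scaleC =
  fixes scaleC :: "complex \<Rightarrow> 'a \<Rightarrow> 'a"  (infixr \<open>*\<^sub>C\<close> 75)

class star =
  fixes star :: "'a \<Rightarrow> 'a"

class star_algebra = ring + monoid_mult + scaleC + star +
  assumes scaleC_add_right: "c *\<^sub>C (x + y) = c *\<^sub>C x + c *\<^sub>C y"
    and scaleC_add_left: "(c + d) *\<^sub>C x = c *\<^sub>C x + d *\<^sub>C x"
    and scaleC_scaleC: "c *\<^sub>C d *\<^sub>C x = (c * d) *\<^sub>C x"
    and scaleC_one: "1 *\<^sub>C x = x"
    and mult_scaleC_left: "(c *\<^sub>C x) * y = c *\<^sub>C (x * y)"
    and mult_scaleC_right: "x * (c *\<^sub>C y) = c *\<^sub>C (x * y)"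
    and star_star: "star (star x) = x"
    and star_add: "star (x + y) = star x + star y"
    and star_scaleC: "star (c *\<^sub>C x) = cnj c *\<^sub>C star x"
    and star_mult: "star (x * y) = star y * star x"
begin

lemma star_one: "star 1 = 1"
  by (metis mult_1_left mult_1_right star_mult star_star)

lemma scaleC_zero_left: "0 *\<^sub>C x = 0"
  using scaleC_add_left[of 0 0 x] by simp

lemma scaleC_zero_right: "c *\<^sub>C 0 = 0"
  using scaleC_add_right[of c 0 0] by simp

lemma scaleC_minus_one: "(-1) *\<^sub>C x = - x"
  using scaleC_add_left[of 1 "-1" x] by (simp add: scaleC_zero_left scaleC_one eq_neg_iff_add_eq_0 add.commute)

lemma star_zero: "star 0 = 0"
  using star_add[of 0 0] by simp

lemma star_minus: "star (- x) = - star x"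
  using star_add[of x "-x"] by (simp add: star_zero eq_neg_iff_add_eq_0 add.commute)

lemma star_diff: "star (x - y) = star x - star y"
  using star_add[of x "-y"] by (simp add: star_minus)

end

text \<open>Unital C*-algebras. The zero algebra is admitted here, so that the constructions below are instances
  without a separate proof that they do not collapse; the class \<open>nonzero_cstar_algebra\<close> excludes it.\<close>

class cstar_algebra = star_algebra + real_normed_algebra + banach +
  assumes scaleC_of_real: "complex_of_real r *\<^sub>C x = r *\<^sub>R x"
    and cstar_identity: "norm (star x * x) = (norm x)\<^sup>2"

lemma norm_scaleC: "norm (c *\<^sub>C x) = cmod c * norm (x :: 'a::cstar_algebra)"
proof -
  have c: "cnj c * c = complex_of_real ((cmod c)\<^sup>2)"
    by (metis complex_norm_square mult.commute of_real_power)
  have "(norm (c *\<^sub>C x))\<^sup>2 = norm (star (c *\<^sub>C x) * (c *\<^sub>C x))"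
    by (simp add: cstar_identity)
  also have "star (c *\<^sub>C x) * (c *\<^sub>C x) = (cnj c * c) *\<^sub>C (star x * x)"
    by (simp add: star_scaleC mult_scaleC_left mult_scaleC_right scaleC_scaleC mult.commute)
  also have "norm \<dots> = (cmod c * norm x)\<^sup>2"
    by (simp only: c scaleC_of_real norm_scaleR cstar_identity power_mult_distrib) simp
  finally show ?thesis
    by (simp add: power2_eq_iff_nonneg)
qed

lemma norm_star: "norm (star x) = norm (x :: 'a::cstar_algebra)"
proof -
  have le: "norm y \<le> norm (star y)" for y :: 'a
  proof (cases "y = 0")
    case False
    have "norm y * norm y \<le> norm (star y) * norm y"
      using norm_mult_ineq[of "star y" y] by (simp add: cstar_identity power2_eq_square)
    with False show ?thesis by simp
  qed simp
  show ?thesis using le[of x] le[of "star x"] by (simp add: star_star)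
qed

lemma real_idempotent: "r = 1" if "0 < r" "r\<^sup>2 = r" for r :: real
  using that by (simp add: power2_eq_square)

class nonzero_cstar_algebra = cstar_algebra + zero_neq_one
begin

subclass real_normed_algebra_1
proof
  have "norm (1::'a) > 0"
    by (metis norm_eq_zero norm_ge_zero order.order_iff_strict zero_neq_one)
  moreover have "(norm (1::'a))\<^sup>2 = norm (1::'a)"
    using cstar_identity[of 1] by (simp add: star_one)
  ultimately show "norm (1::'a) = 1"
    by (rule real_idempotent)
qed

end

instantiation complex :: nonzero_cstar_algebra
begin

definition scaleC_complex :: "complex \<Rightarrow> complex \<Rightarrow> complex"
  where [simp]: "c *\<^sub>C z = c * z"

definition star_complex :: "complex \<Rightarrow> complex"
  where [simp]: "star z = cnj z"

instance
  by standard (auto simp: algebra_simps scaleR_conv_of_real norm_mult power2_eq_square)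

end

definition clinear :: "('a::star_algebra \<Rightarrow> 'b::star_algebra) \<Rightarrow> bool"
  where "clinear f \<longleftrightarrow> (\<forall>x y. f (x + y) = f x + f y) \<and> (\<forall>c x. f (c *\<^sub>C x) = c *\<^sub>C f x)"

definition cbilinear :: "('a::star_algebra \<Rightarrow> 'b::star_algebra \<Rightarrow> complex) \<Rightarrow> bool"
  where "cbilinear \<beta> \<longleftrightarrow> (\<forall>a. clinear (\<beta> a)) \<and> (\<forall>b. clinear (\<lambda>a. \<beta> a b))"

definition bsum :: "('a \<Rightarrow> 'b \<Rightarrow> complex) \<Rightarrow> ('a \<times> 'b) list \<Rightarrow> complex"
  where "bsum \<beta> xs = (\<Sum>(a, b)\<leftarrow>xs. \<beta> a b)"

lemma bsum_simps [simp]: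
  "bsum \<beta> [] = 0" "bsum \<beta> ((a, b) # xs) = \<beta> a b + bsum \<beta> xs" "bsum \<beta> (xs @ ys) = bsum \<beta> xs + bsum \<beta> ys"
  by (simp_all add: bsum_def)

lemma bsum_add: "bsum (\<lambda>a b. \<beta> a b + \<beta>' a b) xs = bsum \<beta> xs + bsum \<beta>' xs"
  by (induction xs) auto

lemma bsum_cmult: "bsum (\<lambda>a b. c * \<beta> a b) xs = c * bsum \<beta> xs"
  by (induction xs) (auto simp: algebra_simps)

lemma bsum_swap: "bsum (\<lambda>a b. bsum (\<lambda>c d. g a b c d) ys) xs = bsum (\<lambda>c d. bsum (\<lambda>a b. g a b c d) xs) ys"
proof (induction xs)
  case Nil
  show ?case by (induction ys) auto
next
  case (Cons p xs)
  then show ?case by (cases p) (simp add: bsum_add)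
qed

lemma clinear_eqs:
  assumes "clinear f"
  shows "f (x + y) = f x + f y" "f (c *\<^sub>C x) = c *\<^sub>C f x" "f (- x) = - f x" "f 0 = 0" "f (x - y) = f x - f y"
proof -
  show *: "f (x + y) = f x + f y" "f (c *\<^sub>C x) = c *\<^sub>C f x" for x y c
    using assms by (auto simp: clinear_def)
  show m: "f (- x) = - f x" for x
    using *(2)[of "-1" x] by (simp only: scaleC_minus_one)
  show "f 0 = 0" using *(1)[of 0 0] by simp
  show "f (x - y) = f x - f y" using *(1)[of x "-y"] m by simp
qed

lemma cbilinear_eqs:
  assumes "cbilinear \<beta>"
  shows "\<beta> (x + y) b = \<beta> x b + \<beta> y b" "\<beta> a (u + v) = \<beta> a u + \<beta> a v"
    "\<beta> (c *\<^sub>C x) b = c * \<beta> x b" "\<beta> a (c *\<^sub>C u) = c * \<beta> a u"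
    "\<beta> (- x) b = - \<beta> x b" "\<beta> a (- u) = - \<beta> a u"
  using assms clinear_eqs[of "\<beta> a"] clinear_eqs[of "\<lambda>a. \<beta> a b"]
  unfolding cbilinear_def scaleC_complex_def by metis+

lemma cbilinearI:
  assumes "\<And>x y b. \<beta> (x + y) b = \<beta> x b + \<beta> y b" "\<And>a x y. \<beta> a (x + y) = \<beta> a x + \<beta> a y"
    "\<And>c a b. \<beta> (c *\<^sub>C a) b = c * \<beta> a b" "\<And>c a b. \<beta> a (c *\<^sub>C b) = c * \<beta> a b"
  shows "cbilinear \<beta>"
  using assms by (simp add: cbilinear_def clinear_def)

lemma cbilinear_bsum:
  assumes "cbilinear \<beta>"
  shows "cbilinear (\<lambda>a b. bsum (\<lambda>c d. \<beta> (a * c) (b * d)) ys)"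
    "cbilinear (\<lambda>c d. bsum (\<lambda>a b. \<beta> (a * c) (b * d)) ys)"
  by (rule cbilinearI;
      simp add: cbilinear_eqs[OF assms] algebra_simps mult_scaleC_left mult_scaleC_right bsum_add bsum_cmult)+

lemma cbilinear_mult:
  assumes "cbilinear \<beta>"
  shows "cbilinear (\<lambda>a b. \<beta> (x * a) (y * b))" "cbilinear (\<lambda>a b. \<beta> (a * x) (b * y))"
  by (rule cbilinearI; simp add: cbilinear_eqs[OF assms] algebra_simps mult_scaleC_left mult_scaleC_right)+

text \<open>The algebraic tensor product: a list \<open>[(a\<^sub>1, b\<^sub>1), \<dots>]\<close> stands for
  \<open>a\<^sub>1 \<otimes> b\<^sub>1 + \<dots>\<close>, and two such sums are identified iff every bilinear form takes the same value on both.\<close>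

definition alg_tensor_rel :: "('a::star_algebra \<times> 'b::star_algebra) list \<Rightarrow> ('a \<times> 'b) list \<Rightarrow> bool"
  where "alg_tensor_rel xs ys \<longleftrightarrow> (\<forall>\<beta>. cbilinear \<beta> \<longrightarrow> bsum \<beta> xs = bsum \<beta> ys)"

quotient_type (overloaded) ('a, 'b) alg_tensor = "('a::star_algebra \<times> 'b::star_algebra) list" / alg_tensor_rel
  by (intro equivpI reflpI sympI transpI) (auto simp: alg_tensor_rel_def)

lift_definition alg_eval :: "('a::star_algebra \<Rightarrow> 'b::star_algebra \<Rightarrow> complex) \<Rightarrow> ('a, 'b) alg_tensor \<Rightarrow> complex"
  is "\<lambda>\<beta> xs. if cbilinear \<beta> then bsum \<beta> xs else 0"
  by (simp add: alg_tensor_rel_def)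

lemma alg_tensor_eqI: "(\<And>\<beta>. cbilinear \<beta> \<Longrightarrow> alg_eval \<beta> x = alg_eval \<beta> y) \<Longrightarrow> x = y"
  by transfer (auto simp: alg_tensor_rel_def)

lift_definition elem_tensor :: "'a::star_algebra \<Rightarrow> 'b::star_algebra \<Rightarrow> ('a, 'b) alg_tensor"
  is "\<lambda>a b. [(a, b)]" .

instantiation alg_tensor :: (star_algebra, star_algebra) star_algebra
begin

lift_definition zero_alg_tensor :: "('a, 'b) alg_tensor" is "[]" .

lift_definition one_alg_tensor :: "('a, 'b) alg_tensor" is "[(1, 1)]" .

lift_definition plus_alg_tensor :: "('a, 'b) alg_tensor \<Rightarrow> ('a, 'b) alg_tensor \<Rightarrow> ('a, 'b) alg_tensor"
  is "(@)"
  by (simp add: alg_tensor_rel_def)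

lift_definition uminus_alg_tensor :: "('a, 'b) alg_tensor \<Rightarrow> ('a, 'b) alg_tensor"
  is "map (\<lambda>(a, b). (- a, b))"
proof -
  fix xs ys :: "('a \<times> 'b) list"
  have "bsum \<beta> (map (\<lambda>(a, b). (- a, b)) zs) = - bsum \<beta> zs" if "cbilinear \<beta>" for \<beta> :: "'a \<Rightarrow> 'b \<Rightarrow> complex" and zs
    by (induction zs) (auto simp: cbilinear_eqs[OF that])
  then show "alg_tensor_rel xs ys \<Longrightarrow> alg_tensor_rel (map (\<lambda>(a, b). (- a, b)) xs) (map (\<lambda>(a, b). (- a, b)) ys)"
    by (simp add: alg_tensor_rel_def)
qed

definition minus_alg_tensor :: "('a, 'b) alg_tensor \<Rightarrow> ('a, 'b) alg_tensor \<Rightarrow> ('a, 'b) alg_tensor"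
  where "x - y = x + - y" for x y :: "('a, 'b) alg_tensor"

lift_definition scaleC_alg_tensor :: "complex \<Rightarrow> ('a, 'b) alg_tensor \<Rightarrow> ('a, 'b) alg_tensor"
  is "\<lambda>c. map (\<lambda>(a, b). (c *\<^sub>C a, b))"
proof -
  fix c and xs ys :: "('a \<times> 'b) list"
  have "bsum \<beta> (map (\<lambda>(a, b). (c *\<^sub>C a, b)) zs) = c * bsum \<beta> zs" if "cbilinear \<beta>" for \<beta> :: "'a \<Rightarrow> 'b \<Rightarrow> complex" and zs
    by (induction zs) (auto simp: cbilinear_eqs[OF that] algebra_simps)
  then show "alg_tensor_rel xs ys \<Longrightarrow> alg_tensor_rel (map (\<lambda>(a, b). (c *\<^sub>C a, b)) xs) (map (\<lambda>(a, b). (c *\<^sub>C a, b)) ys)"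
    by (simp add: alg_tensor_rel_def)
qed

lift_definition star_alg_tensor :: "('a, 'b) alg_tensor \<Rightarrow> ('a, 'b) alg_tensor"
  is "map (\<lambda>(a, b). (star a, star b))"
proof -
  fix xs ys :: "('a \<times> 'b) list"
  assume *: "alg_tensor_rel xs ys"
  have eq: "bsum \<beta> (map (\<lambda>(a, b). (star a, star b)) zs) = cnj (bsum (\<lambda>a b. cnj (\<beta> (star a) (star b))) zs)" for \<beta> :: "'a \<Rightarrow> 'b \<Rightarrow> complex" and zs
    by (induction zs) auto
  have "cbilinear (\<lambda>a b. cnj (\<beta> (star a) (star b)))" if "cbilinear \<beta>" for \<beta> :: "'a \<Rightarrow> 'b \<Rightarrow> complex"
    by (rule cbilinearI) (simp_all add: cbilinear_eqs[OF that] star_add star_scaleC)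
  with * show "alg_tensor_rel (map (\<lambda>(a, b). (star a, star b)) xs) (map (\<lambda>(a, b). (star a, star b)) ys)"
    unfolding alg_tensor_rel_def eq by auto
qed

lift_definition times_alg_tensor :: "('a, 'b) alg_tensor \<Rightarrow> ('a, 'b) alg_tensor \<Rightarrow> ('a, 'b) alg_tensor"
  is "\<lambda>xs ys. concat (map (\<lambda>(a, b). map (\<lambda>(c, d). (a * c, b * d)) ys) xs)"
proof -
  fix xs xs' ys ys' :: "('a \<times> 'b) list"
  assume xs: "alg_tensor_rel xs xs'" and ys: "alg_tensor_rel ys ys'"
  have 1: "bsum \<beta> (map (\<lambda>(c, d). (a * c, b * d)) ys) = bsum (\<lambda>c d. \<beta> (a * c) (b * d)) ys" for \<beta> a b and ys :: "('a \<times> 'b) list"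
    by (induction ys) auto
  have eq: "bsum \<beta> (concat (map (\<lambda>(a, b). map (\<lambda>(c, d). (a * c, b * d)) ys) xs))
      = bsum (\<lambda>a b. bsum (\<lambda>c d. \<beta> (a * c) (b * d)) ys) xs" for \<beta> and xs ys :: "('a \<times> 'b) list"
    by (induction xs) (auto simp: 1)
  show "alg_tensor_rel (concat (map (\<lambda>(a, b). map (\<lambda>(c, d). (a * c, b * d)) ys) xs))
     (concat (map (\<lambda>(a, b). map (\<lambda>(c, d). (a * c, b * d)) ys') xs'))"
    unfolding alg_tensor_rel_def eq
  proof (intro allI impI)
    fix \<beta> :: "'a \<Rightarrow> 'b \<Rightarrow> complex"
    assume \<beta>: "cbilinear \<beta>"
    have "bsum (\<lambda>a b. bsum (\<lambda>c d. \<beta> (a * c) (b * d)) ys) xs = bsum (\<lambda>a b. bsum (\<lambda>c d. \<beta> (a * c) (b * d)) ys) xs'"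
      using xs cbilinear_bsum(1)[OF \<beta>] by (simp add: alg_tensor_rel_def)
    also have "\<dots> = bsum (\<lambda>c d. bsum (\<lambda>a b. \<beta> (a * c) (b * d)) xs') ys"
      by (rule bsum_swap)
    also have "\<dots> = bsum (\<lambda>c d. bsum (\<lambda>a b. \<beta> (a * c) (b * d)) xs') ys'"
      using ys cbilinear_bsum(2)[OF \<beta>] by (simp add: alg_tensor_rel_def)
    also have "\<dots> = bsum (\<lambda>a b. bsum (\<lambda>c d. \<beta> (a * c) (b * d)) ys') xs'"
      by (rule bsum_swap)
    finally show "bsum (\<lambda>a b. bsum (\<lambda>c d. \<beta> (a * c) (b * d)) ys) xs = bsum (\<lambda>a b. bsum (\<lambda>c d. \<beta> (a * c) (b * d)) ys') xs'" .
  qed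
qed

lemma alg_eval_ops:
  assumes "cbilinear \<beta>"
  shows "alg_eval \<beta> 0 = 0" "alg_eval \<beta> (x + y) = alg_eval \<beta> x + alg_eval \<beta> y"
    "alg_eval \<beta> 1 = \<beta> 1 1" "alg_eval \<beta> (- x) = - alg_eval \<beta> x"
    "alg_eval \<beta> (c *\<^sub>C x) = c * alg_eval \<beta> x"
    "alg_eval \<beta> (elem_tensor a b) = \<beta> a b"
    "alg_eval \<beta> (star x) = cnj (alg_eval (\<lambda>a b. cnj (\<beta> (star a) (star b))) x)"
    "alg_eval \<beta> (x * y) = alg_eval (\<lambda>a b. alg_eval (\<lambda>c d. \<beta> (a * c) (b * d)) y) x"
  subgoal using assms by transfer simp
  subgoal using assms by transfer simp
  subgoal using assms by transfer simp
  subgoal using assms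
  proof transfer
    fix \<beta> :: "'a \<Rightarrow> 'b \<Rightarrow> complex" and xs
    assume \<beta>: "cbilinear \<beta>"
    have "bsum \<beta> (map (\<lambda>(a, b). (- a, b)) xs) = - bsum \<beta> xs"
      by (induction xs) (auto simp: cbilinear_eqs[OF \<beta>])
    with \<beta> show "(if cbilinear \<beta> then bsum \<beta> (map (\<lambda>(a, b). (- a, b)) xs) else 0) = - (if cbilinear \<beta> then bsum \<beta> xs else 0)"
      by simp
  qed
  subgoal using assms
  proof transfer
    fix \<beta> :: "'a \<Rightarrow> 'b \<Rightarrow> complex" and c xs
    assume \<beta>: "cbilinear \<beta>"
    have "bsum \<beta> (map (\<lambda>(a, b). (c *\<^sub>C a, b)) xs) = c * bsum \<beta> xs"
      by (induction xs) (auto simp: cbilinear_eqs[OF \<beta>] algebra_simps)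
    with \<beta> show "(if cbilinear \<beta> then bsum \<beta> (map (\<lambda>(a, b). (c *\<^sub>C a, b)) xs) else 0) = c * (if cbilinear \<beta> then bsum \<beta> xs else 0)"
      by simp
  qed
  subgoal using assms by transfer simp
  subgoal using assms
  proof transfer
    fix \<beta> :: "'a \<Rightarrow> 'b \<Rightarrow> complex" and xs
    assume \<beta>: "cbilinear \<beta>"
    have "bsum \<beta> (map (\<lambda>(a, b). (star a, star b)) xs) = cnj (bsum (\<lambda>a b. cnj (\<beta> (star a) (star b))) xs)"
      by (induction xs) auto
    moreover have "cbilinear (\<lambda>a b. cnj (\<beta> (star a) (star b)))"
      by (rule cbilinearI) (simp_all add: cbilinear_eqs[OF \<beta>] star_add star_scaleC)
    ultimately show "(if cbilinear \<beta> then bsum \<beta> (map (\<lambda>(a, b). (star a, star b)) xs) else 0)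
        = cnj (if cbilinear (\<lambda>a b. cnj (\<beta> (star a) (star b))) then bsum (\<lambda>a b. cnj (\<beta> (star a) (star b))) xs else 0)"
      using \<beta> by simp
  qed
  subgoal using assms
  proof transfer
    fix \<beta> :: "'a \<Rightarrow> 'b \<Rightarrow> complex" and xs ys
    assume \<beta>: "cbilinear \<beta>"
    have 1: "bsum \<beta> (map (\<lambda>(c, d). (a * c, b * d)) ys) = bsum (\<lambda>c d. \<beta> (a * c) (b * d)) ys" for a b
      by (induction ys) auto
    have "bsum \<beta> (concat (map (\<lambda>(a, b). map (\<lambda>(c, d). (a * c, b * d)) ys) xs))
      = bsum (\<lambda>a b. bsum (\<lambda>c d. \<beta> (a * c) (b * d)) ys) xs"
      by (induction xs) (auto simp: 1)
    then show "(if cbilinear \<beta> then bsum \<beta> (concat (map (\<lambda>(a, b). map (\<lambda>(c, d). (a * c, b * d)) ys) xs)) else 0)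
      = (if cbilinear (\<lambda>a b. if cbilinear (\<lambda>c d. \<beta> (a * c) (b * d)) then bsum (\<lambda>c d. \<beta> (a * c) (b * d)) ys else 0)
         then bsum (\<lambda>a b. if cbilinear (\<lambda>c d. \<beta> (a * c) (b * d)) then bsum (\<lambda>c d. \<beta> (a * c) (b * d)) ys else 0) xs else 0)"
      using \<beta> by (simp add: cbilinear_mult cbilinear_bsum)
  qed
  done

lemma alg_eval_times_swap:
  assumes "cbilinear \<beta>"
  shows "alg_eval \<beta> (x * y) = alg_eval (\<lambda>c d. alg_eval (\<lambda>a b. \<beta> (a * c) (b * d)) x) y"
proof -
  have "alg_eval (\<lambda>a b. alg_eval (\<lambda>c d. \<beta> (a * c) (b * d)) y) x = alg_eval (\<lambda>c d. alg_eval (\<lambda>a b. \<beta> (a * c) (b * d)) x) y"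
    using assms
    by transfer (simp add: cbilinear_mult cbilinear_bsum, rule bsum_swap)
  with assms show ?thesis by (simp add: alg_eval_ops)
qed

lemma alg_eval_cong_add:
  assumes "cbilinear \<beta>" "cbilinear \<beta>'"
  shows "alg_eval (\<lambda>a b. \<beta> a b + \<beta>' a b) x = alg_eval \<beta> x + alg_eval \<beta>' x"
proof -
  have "cbilinear (\<lambda>a b. \<beta> a b + \<beta>' a b)"
    by (rule cbilinearI) (simp_all add: cbilinear_eqs[OF assms(1)] cbilinear_eqs[OF assms(2)] algebra_simps)
  with assms show ?thesis by transfer (simp add: bsum_add)
qed

lemma alg_eval_cmult:
  assumes "cbilinear \<beta>"
  shows "alg_eval (\<lambda>a b. c * \<beta> a b) x = c * alg_eval \<beta> x"
proof -
  have "cbilinear (\<lambda>a b. c * \<beta> a b)"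
    by (rule cbilinearI) (simp_all add: cbilinear_eqs[OF assms(1)] algebra_simps)
  with assms show ?thesis by transfer (simp add: bsum_cmult)
qed

lemma alg_tensor_induct_aux:
  assumes "P (0 :: ('a, 'b) alg_tensor)" "\<And>a b x. P x \<Longrightarrow> P (elem_tensor a b + x)"
  shows "P x"
proof -
  have "P (abs_alg_tensor xs)" for xs
  proof (induction xs)
    case Nil
    then show ?case using assms(1) by (simp add: zero_alg_tensor.abs_eq)
  next
    case (Cons p xs)
    have "abs_alg_tensor (p # xs) = elem_tensor (fst p) (snd p) + abs_alg_tensor xs"
      by (simp add: elem_tensor.abs_eq plus_alg_tensor.abs_eq)
    then show ?case using assms(2) Cons by simp
  qed
  then show ?thesis by (metis Quotient_abs_rep[OF Quotient_alg_tensor])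
qed

instance
proof
  fix x y z :: "('a, 'b) alg_tensor" and c d :: complex

  have sb: "cbilinear (\<lambda>a b. cnj (\<beta> (star a) (star b)))" if "cbilinear \<beta>" for \<beta> :: "'a \<Rightarrow> 'b \<Rightarrow> complex"
    by (rule cbilinearI) (simp_all add: cbilinear_eqs[OF that] star_add star_scaleC)
  have mb: "cbilinear (\<lambda>a b. alg_eval (\<lambda>c d. \<beta> (a * c) (b * d)) y)"
    if "cbilinear \<beta>" for \<beta> :: "'a \<Rightarrow> 'b \<Rightarrow> complex" and y
    by (rule cbilinearI)
      (simp_all add: cbilinear_eqs[OF that] cbilinear_mult[OF that] algebra_simps mult_scaleC_left mult_scaleC_right
        alg_eval_cong_add alg_eval_cmult)
  show "x - y = x + - y" by (rule minus_alg_tensor_def)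
  show "x + y + z = x + (y + z)" "x + y = y + x" "0 + x = x" "- x + x = 0"
    "c *\<^sub>C (x + y) = c *\<^sub>C x + c *\<^sub>C y" "(c + d) *\<^sub>C x = c *\<^sub>C x + d *\<^sub>C x"
    "c *\<^sub>C d *\<^sub>C x = (c * d) *\<^sub>C x" "1 *\<^sub>C x = x"
    by (rule alg_tensor_eqI, simp add: alg_eval_ops distrib_left distrib_right mult.assoc)+
  show "(x + y) * z = x * z + y * z" "(c *\<^sub>C x) * y = c *\<^sub>C (x * y)" "1 * x = x"
    by (rule alg_tensor_eqI, simp add: alg_eval_ops mb)+
  show "x * (y + z) = x * y + x * z"
  proof (rule alg_tensor_eqI)
    fix \<beta> :: "'a \<Rightarrow> 'b \<Rightarrow> complex"
    assume \<beta>: "cbilinear \<beta>"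
    show "alg_eval \<beta> (x * (y + z)) = alg_eval \<beta> (x * y + x * z)"
      by (simp add: alg_eval_ops \<beta> cbilinear_mult[OF \<beta>] alg_eval_cong_add[OF mb[OF \<beta>] mb[OF \<beta>]])
  qed
  show "x * (c *\<^sub>C y) = c *\<^sub>C (x * y)"
  proof (rule alg_tensor_eqI)
    fix \<beta> :: "'a \<Rightarrow> 'b \<Rightarrow> complex"
    assume \<beta>: "cbilinear \<beta>"
    show "alg_eval \<beta> (x * (c *\<^sub>C y)) = alg_eval \<beta> (c *\<^sub>C (x * y))"
      by (simp add: alg_eval_ops \<beta> cbilinear_mult[OF \<beta>] alg_eval_cmult[OF mb[OF \<beta>]])
  qed
  show "x * 1 = x"
  proof (rule alg_tensor_eqI)
    fix \<beta> :: "'a \<Rightarrow> 'b \<Rightarrow> complex"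
    assume \<beta>: "cbilinear \<beta>"
    show "alg_eval \<beta> (x * 1) = alg_eval \<beta> x"
      by (simp add: alg_eval_ops \<beta> cbilinear_mult[OF \<beta>])
  qed
  show "star (star x) = x"
  proof (rule alg_tensor_eqI)
    fix \<beta> :: "'a \<Rightarrow> 'b \<Rightarrow> complex"
    assume \<beta>: "cbilinear \<beta>"
    show "alg_eval \<beta> (star (star x)) = alg_eval \<beta> x"
      by (simp add: alg_eval_ops(7) \<beta> sb[OF \<beta>] star_star)
  qed
  show "star (x + y) = star x + star y" "star (c *\<^sub>C x) = cnj c *\<^sub>C star x"
  proof (rule_tac [!] alg_tensor_eqI)
    fix \<beta> :: "'a \<Rightarrow> 'b \<Rightarrow> complex"
    assume \<beta>: "cbilinear \<beta>"
    show "alg_eval \<beta> (star (x + y)) = alg_eval \<beta> (star x + star y)"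
      by (simp add: alg_eval_ops(2,7) \<beta> sb[OF \<beta>])
    show "alg_eval \<beta> (star (c *\<^sub>C x)) = alg_eval \<beta> (cnj c *\<^sub>C star x)"
      by (simp add: alg_eval_ops(5,7) \<beta> sb[OF \<beta>])
  qed
  show "x * y * z = x * (y * z)"
  proof (rule alg_tensor_eqI)
    fix \<beta> :: "'a \<Rightarrow> 'b \<Rightarrow> complex"
    assume \<beta>: "cbilinear \<beta>"
    have "alg_eval \<beta> (x * y * z)
        = alg_eval (\<lambda>a b. alg_eval (\<lambda>c d. alg_eval (\<lambda>e f. \<beta> (a * c * e) (b * d * f)) z) y) x"
      by (simp only: alg_eval_ops(8)[OF \<beta>] alg_eval_ops(8)[OF mb[OF \<beta>]])
    also have "\<dots> = alg_eval \<beta> (x * (y * z))"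
      by (simp only: alg_eval_ops(8)[OF \<beta>] alg_eval_ops(8)[OF cbilinear_mult(1)[OF \<beta>]] mult.assoc)
    finally show "alg_eval \<beta> (x * y * z) = alg_eval \<beta> (x * (y * z))" .
  qed
  show "star (x * y) = star y * star x"
  proof (rule alg_tensor_eqI)
    fix \<beta> :: "'a \<Rightarrow> 'b \<Rightarrow> complex"
    assume \<beta>: "cbilinear \<beta>"
    have "alg_eval \<beta> (star (x * y))
        = cnj (alg_eval (\<lambda>c d. alg_eval (\<lambda>a b. cnj (\<beta> (star c * star a) (star d * star b))) x) y)"
      by (simp only: alg_eval_ops(7)[OF \<beta>] alg_eval_times_swap[OF sb[OF \<beta>]] star_mult)
    also have "\<dots> = alg_eval \<beta> (star y * star x)"
      unfolding alg_eval_ops(8)[OF \<beta>] alg_eval_ops(7)[OF mb[OF \<beta>]]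
      by (simp only: alg_eval_ops(7)[OF cbilinear_mult(1)[OF \<beta>]] complex_cnj_cnj)
    finally show "alg_eval \<beta> (star (x * y)) = alg_eval \<beta> (star y * star x)" .
  qed
qed

end

definition positive_functional :: "('a::star_algebra \<Rightarrow> complex) \<Rightarrow> bool"
  where "positive_functional f \<longleftrightarrow> clinear f \<and> (\<forall>x. \<exists>r\<ge>0. f (star x * x) = complex_of_real r)"

lemma positive_functionalD:
  assumes "positive_functional f"
  shows "f (x + y) = f x + f y" "f (c *\<^sub>C x) = c * f x" "f (- x) = - f x" "f 0 = 0" "f (x - y) = f x - f y"
    "Im (f (star x * x)) = 0" "Re (f (star x * x)) \<ge> 0"
proof -
  have l: "clinear f" using assms by (simp add: positive_functional_def)
  show "f (x + y) = f x + f y" "f (c *\<^sub>C x) = c * f x" "f (- x) = - f x" "f 0 = 0" "f (x - y) = f x - f y"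
    using clinear_eqs[OF l] by simp_all
  obtain r where "r \<ge> 0" "f (star x * x) = complex_of_real r"
    using assms by (auto simp: positive_functional_def)
  then show "Im (f (star x * x)) = 0" "Re (f (star x * x)) \<ge> 0"
    by simp_all
qed

lemma positive_functional_real:
  "positive_functional f \<Longrightarrow> f (star x * x) = complex_of_real (Re (f (star x * x)))"
  using positive_functionalD(6)[of f x] by (simp add: complex_eq_iff)

lemma positive_functional_herm:
  assumes f: "positive_functional f"
  shows "f (star y * x) = cnj (f (star x * y))"
proof -
  note D = positive_functionalD[OF f]
  have 1: "Im (f (star (x + c *\<^sub>C y) * (x + c *\<^sub>C y))) = 0" for c by (rule D(6))
  have 2: "f (star (x + c *\<^sub>C y) * (x + c *\<^sub>C y))
     = f (star x * x) + c * f (star x * y) + cnj c * f (star y * x) + cnj c * (c * f (star y * y))" for c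
    by (simp add: star_add star_scaleC distrib_left distrib_right mult_scaleC_left mult_scaleC_right D(1,2) scaleC_scaleC)
  have "Im (f (star x * y)) + Im (f (star y * x)) = 0"
    using 1[of 1] unfolding 2 by (simp add: D(6))
  moreover have "Re (f (star x * y)) = Re (f (star y * x))"
    using 1[of \<i>] unfolding 2 by (simp add: D(6))
  ultimately show ?thesis by (simp add: complex_eq_iff)
qed

lemma positive_functional_expand:
  assumes f: "positive_functional f"
  shows "Re (f (star (x + c *\<^sub>C y) * (x + c *\<^sub>C y)))
     = Re (f (star x * x)) + 2 * Re (c * f (star x * y)) + (cmod c)\<^sup>2 * Re (f (star y * y))"
proof -
  note D = positive_functionalD[OF f]
  have "f (star (x + c *\<^sub>C y) * (x + c *\<^sub>C y))
     = f (star x * x) + c * f (star x * y) + cnj (c * f (star x * y)) + (cnj c * c) * f (star y * y)"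
    by (simp add: star_add star_scaleC distrib_left distrib_right mult_scaleC_left mult_scaleC_right D(1,2) scaleC_scaleC
        positive_functional_herm[OF f, of y x])
  also have "cnj c * c = complex_of_real ((cmod c)\<^sup>2)"
    by (metis complex_norm_square mult.commute of_real_power)
  finally show ?thesis by (simp only: plus_complex.sel Re_complex_of_real Im_complex_of_real times_complex.sel cnj.sel) simp
qed

lemma positive_functional_CS:
  assumes f: "positive_functional f"
  shows "(cmod (f (star x * y)))\<^sup>2 \<le> Re (f (star x * x)) * Re (f (star y * y))"
proof -
  note D = positive_functionalD[OF f]
  define z where "z = f (star x * y)"
  define X Y where "X = Re (f (star x * x))" and "Y = Re (f (star y * y))"
  have Y: "Y \<ge> 0" by (simp add: Y_def D(7))
  have ge: "X + 2 * Re (c * z) + (cmod c)\<^sup>2 * Y \<ge> 0" for c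
    using positive_functional_expand[OF f, of x c y] D(7)[of "x + c *\<^sub>C y"]
    by (simp add: X_def Y_def z_def)
  have "X - 2 * t * (cmod z)\<^sup>2 + t\<^sup>2 * (cmod z)\<^sup>2 * Y \<ge> 0" for t
  proof -
    have e: "complex_of_real (- t) * cnj z * z = complex_of_real (- t * (cmod z)\<^sup>2)"
      by (simp add: complex_norm_square mult.assoc mult.commute del: of_real_power)
    show ?thesis using ge[of "complex_of_real (- t) * cnj z"]
      unfolding e by (simp add: norm_mult power_mult_distrib)
  qed
  note t = this
  show ?thesis
  proof (cases "Y = 0")
    case True
    have "z = 0"
    proof (rule ccontr)
      assume "z \<noteq> 0"
      then show False using t[of "(X + 1) / (2 * (cmod z)\<^sup>2)"] True by (simp add: field_simps)
    qed
    then show ?thesis using True by (simp add: z_def Y_def)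
  next
    case False
    with Y have "Y > 0" by simp
    with t[of "1 / Y"] have "X - (cmod z)\<^sup>2 / Y \<ge> 0"
      by (simp add: power2_eq_square field_simps)
    with \<open>Y > 0\<close> have "(cmod z)\<^sup>2 \<le> X * Y" by (simp add: field_simps)
    then show ?thesis by (simp add: X_def Y_def z_def)
  qed
qed

definition gns_seminorm :: "('a::star_algebra \<Rightarrow> complex) \<Rightarrow> 'a \<Rightarrow> real"
  where "gns_seminorm f x = sqrt (Re (f (star x * x)))"

lemma gns_seminorm_nonneg: "positive_functional f \<Longrightarrow> gns_seminorm f x \<ge> 0"
  by (simp add: gns_seminorm_def positive_functionalD)

lemma gns_seminorm_sq: "positive_functional f \<Longrightarrow> (gns_seminorm f x)\<^sup>2 = Re (f (star x * x))"
  by (simp add: gns_seminorm_def positive_functionalD)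

lemma gns_seminorm_CS:
  assumes "positive_functional f"
  shows "cmod (f (star x * y)) \<le> gns_seminorm f x * gns_seminorm f y"
  using real_sqrt_le_mono[OF positive_functional_CS[OF assms, of x y]]
  by (simp add: gns_seminorm_def real_sqrt_mult)

lemma gns_seminorm_scaleC:
  assumes f: "positive_functional f"
  shows "gns_seminorm f (c *\<^sub>C x) = cmod c * gns_seminorm f x"
  using positive_functional_expand[OF f, of 0 c x]
  by (simp add: gns_seminorm_def real_sqrt_mult positive_functionalD[OF f] star_zero)

lemma gns_seminorm_zero: "positive_functional f \<Longrightarrow> gns_seminorm f 0 = 0"
  by (simp add: gns_seminorm_def positive_functionalD)

lemma gns_seminorm_triangle:
  assumes f: "positive_functional f"
  shows "gns_seminorm f (x + y) \<le> gns_seminorm f x + gns_seminorm f y"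
proof (rule power2_le_imp_le)
  have "(gns_seminorm f (x + y))\<^sup>2 = (gns_seminorm f x)\<^sup>2 + 2 * Re (f (star x * y)) + (gns_seminorm f y)\<^sup>2"
    using positive_functional_expand[OF f, of x 1 y]
    by (simp add: gns_seminorm_sq[OF f] scaleC_one)
  also have "Re (f (star x * y)) \<le> gns_seminorm f x * gns_seminorm f y"
    using gns_seminorm_CS[OF f, of x y] complex_Re_le_cmod[of "f (star x * y)"] by linarith
  finally show "(gns_seminorm f (x + y))\<^sup>2 \<le> (gns_seminorm f x + gns_seminorm f y)\<^sup>2"
    by (simp add: power2_sum)
qed (simp add: gns_seminorm_nonneg[OF f])

lemma positive_functional_self_adjoint_bound:
  fixes f :: "'a::cstar_algebra \<Rightarrow> complex"
  assumes f: "positive_functional f" and M: "\<And>x. cmod (f x) \<le> M * norm x" and y: "star y = y"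
  shows "cmod (f y) \<le> Re (f 1) * norm y"
proof (cases "Re (f 1) = 0 \<or> norm y = 0")
  case True
  have "(cmod (f y))\<^sup>2 \<le> Re (f 1) * Re (f (star y * y))"
    using positive_functional_CS[OF f, of 1 y] by (simp add: star_one)
  with True positive_functionalD(4)[OF f] show ?thesis by auto
next
  case False
  define F where "F = Re (f 1)"
  have F: "F > 0" using False positive_functionalD(7)[OF f, of 1] by (simp add: star_one F_def)
  have y0: "norm y > 0" using False by simp
  have pow: "norm (y ^ (2 ^ n)) \<le> norm y ^ (2 ^ n) \<and> star (y ^ (2 ^ n)) = y ^ (2 ^ n)" for n
  proof (induction n)
    case (Suc n)
    have e: "y ^ (2 ^ Suc n) = y ^ (2 ^ n) * y ^ (2 ^ n)"
      by (simp add: power_add[symmetric] mult_2)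
    have "norm (y ^ (2 ^ Suc n)) \<le> norm (y ^ (2 ^ n)) * norm (y ^ (2 ^ n))"
      unfolding e by (rule norm_mult_ineq)
    also have "\<dots> \<le> norm y ^ (2 ^ n) * norm y ^ (2 ^ n)"
      using Suc by (intro mult_mono) auto
    also have "\<dots> = norm y ^ (2 ^ Suc n)" by (simp add: power_add[symmetric] mult_2)
    finally show ?case unfolding e star_mult using Suc by simp
  qed (simp add: y)
  define b where "b = cmod (f y) / F"
  have b: "b ^ (2 ^ n) \<le> cmod (f (y ^ (2 ^ n))) / F" for n
  proof (induction n)
    case (Suc n)
    have e: "y ^ (2 ^ Suc n) = y ^ (2 ^ n) * y ^ (2 ^ n)"
      by (simp add: power_add[symmetric] mult_2)
    have "b ^ (2 ^ Suc n) = (b ^ (2 ^ n))\<^sup>2" by (simp add: power_mult[symmetric] mult.commute)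
    also have "\<dots> \<le> (cmod (f (y ^ (2 ^ n))) / F)\<^sup>2"
      using Suc F by (intro power_mono) (auto simp: b_def)
    also have "\<dots> \<le> F * Re (f (y ^ (2 ^ Suc n))) / F\<^sup>2"
      using positive_functional_CS[OF f, of 1 "y ^ (2 ^ n)"] pow[of n]
      by (simp add: e star_one F_def power_divide divide_right_mono del: power_Suc)
    also have "\<dots> = Re (f (y ^ (2 ^ Suc n))) / F" using F by (simp add: power2_eq_square)
    also have "\<dots> \<le> cmod (f (y ^ (2 ^ Suc n))) / F"
      using F complex_Re_le_cmod by (intro divide_right_mono) auto
    finally show ?case .
  qed (simp add: b_def)
  define q where "q = b / norm y"
  have q0: "q \<ge> 0" using F by (simp add: q_def b_def)
  have q: "q ^ (2 ^ n) \<le> M / F" for n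
  proof -
    have "b ^ (2 ^ n) \<le> M * norm y ^ (2 ^ n) / F"
    proof -
      have "M \<ge> 0" using order.trans[OF norm_ge_zero M[of y]] y0 by (simp add: zero_le_mult_iff)
      then have "cmod (f (y ^ (2 ^ n))) \<le> M * norm y ^ (2 ^ n)"
        using M[of "y ^ (2 ^ n)"] pow[of n] mult_left_mono by (meson order.trans)
      then show ?thesis using b[of n] F by (meson divide_right_mono less_imp_le order.trans)
    qed
    then show ?thesis using y0 by (simp add: q_def power_divide divide_le_eq mult.commute)
  qed
  have "q \<le> 1"
  proof (rule ccontr)
    assume "\<not> q \<le> 1"
    then have q1: "q > 1" by simp
    then obtain n where n: "M / F < q ^ n" using real_arch_pow by blast
    have "q ^ n \<le> q ^ (2 ^ n)" using q1 by (intro power_increasing) auto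
    with n q[of n] show False by simp
  qed
  then show ?thesis using y0 F by (simp add: q_def b_def F_def field_simps)
qed

lemma elem_tensor_ops:
  fixes a a' :: "'a::star_algebra" and b b' :: "'b::star_algebra"
  shows
  "elem_tensor (a + a') b = elem_tensor a b + elem_tensor a' b"
  "elem_tensor a (b + b') = elem_tensor a b + elem_tensor a b'"
  "elem_tensor (c *\<^sub>C a) b = c *\<^sub>C elem_tensor a b"
  "elem_tensor a (c *\<^sub>C b) = c *\<^sub>C elem_tensor a b"
  "elem_tensor a b * elem_tensor a' b' = elem_tensor (a * a') (b * b')"
  "star (elem_tensor a b) = elem_tensor (star a) (star b)"
  "elem_tensor 1 1 = (1 :: ('a, 'b) alg_tensor)"
proof -
  show "elem_tensor (a + a') b = elem_tensor a b + elem_tensor a' b"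
    "elem_tensor a (b + b') = elem_tensor a b + elem_tensor a b'"
    "elem_tensor (c *\<^sub>C a) b = c *\<^sub>C elem_tensor a b"
    "elem_tensor a (c *\<^sub>C b) = c *\<^sub>C elem_tensor a b"
    by (rule alg_tensor_eqI, simp add: alg_eval_ops cbilinear_eqs)+
  show "elem_tensor a b * elem_tensor a' b' = elem_tensor (a * a') (b * b')"
    by transfer (simp add: alg_tensor_rel_def)
  show "star (elem_tensor a b) = elem_tensor (star a) (star b)"
    by transfer (simp add: alg_tensor_rel_def)
  show "elem_tensor 1 1 = (1 :: ('a, 'b) alg_tensor)"
    by transfer (simp add: alg_tensor_rel_def)
qed

lemma elem_tensor_zero: "elem_tensor 0 b = 0"
  using elem_tensor_ops(3)[of 0 0 b] by (simp add: scaleC_zero_left)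

definition bounded_clinear :: "('a::cstar_algebra \<Rightarrow> 'b::cstar_algebra) \<Rightarrow> bool"
  where "bounded_clinear f \<longleftrightarrow> clinear f \<and> bounded_linear f"

definition state :: "('a::cstar_algebra \<Rightarrow> complex) \<Rightarrow> bool"
  where "state \<phi> \<longleftrightarrow> bounded_clinear \<phi> \<and> (\<forall>a. \<exists>r\<ge>0. \<phi> (star a * a) = complex_of_real r) \<and> \<phi> 1 = 1"

text \<open>The functional \<open>\<phi> \<otimes> \<psi>\<close> on the algebraic tensor product.\<close>

definition product_functional ::
    "('a::cstar_algebra \<Rightarrow> complex) \<Rightarrow> ('b::cstar_algebra \<Rightarrow> complex) \<Rightarrow> ('a, 'b) alg_tensor \<Rightarrow> complex"
  where "product_functional \<phi> \<psi> = alg_eval (\<lambda>a b. \<phi> a * \<psi> b)"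

lemma state_positive: "state \<phi> \<Longrightarrow> positive_functional \<phi>"
  by (simp add: state_def positive_functional_def bounded_clinear_def)

lemma state_cbilinear:
  assumes "state \<phi>" "state \<psi>"
  shows "cbilinear (\<lambda>a b. \<phi> a * \<psi> b)"
  by (rule cbilinearI)
    (simp_all add: positive_functionalD[OF state_positive[OF assms(1)]]
      positive_functionalD[OF state_positive[OF assms(2)]] algebra_simps)

lemma product_functional_ops:
  assumes "state \<phi>" "state \<psi>"
  shows "product_functional \<phi> \<psi> (x + y) = product_functional \<phi> \<psi> x + product_functional \<phi> \<psi> y"
    "product_functional \<phi> \<psi> (c *\<^sub>C x) = c * product_functional \<phi> \<psi> x"
    "product_functional \<phi> \<psi> (elem_tensor a b) = \<phi> a * \<psi> b"
    "product_functional \<phi> \<psi> 0 = 0"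
  by (simp_all add: product_functional_def alg_eval_ops[OF state_cbilinear[OF assms]])

abbreviation tensor_sum :: "('a::star_algebra \<times> 'b::star_algebra) list \<Rightarrow> ('a, 'b) alg_tensor"
  where "tensor_sum xs \<equiv> (\<Sum>(a, b)\<leftarrow>xs. elem_tensor a b)"

lemma ex_tensor_sum: "\<exists>xs. x = tensor_sum xs"
proof (induction x rule: alg_tensor_induct_aux)
  case 1
  show ?case by (rule exI[of _ "[]"]) simp
next
  case (2 a b x)
  then obtain xs where "x = tensor_sum xs" by blast
  then show ?case by (intro exI[of _ "(a, b) # xs"]) simp
qed

lemma product_functional_positive:
  assumes \<phi>: "state \<phi>" and \<psi>: "state \<psi>"
  shows "positive_functional (product_functional \<phi> \<psi>)"
proof -
  let ?W = "product_functional \<phi> \<psi>"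
  note W = product_functional_ops[OF \<phi> \<psi>]
  note P\<phi> = state_positive[OF \<phi>] and P\<psi> = state_positive[OF \<psi>]
  have main: "\<exists>r\<ge>0. ?W (star (tensor_sum xs) * tensor_sum xs) = complex_of_real r" for xs
  proof (induction "length xs" arbitrary: xs)
    case 0
    then show ?case by (auto simp: star_zero W)
  next
    case (Suc n)
    then obtain a b ys where xs: "xs = (a, b) # ys" and len: "length ys = n"
      by (cases xs) auto
    have split: ?case
      if eq: "tensor_sum xs = elem_tensor a' b + tensor_sum zs" and len: "length zs = n"
        and orth: "\<And>c d. (c, d) \<in> set zs \<Longrightarrow> \<psi> (star b * d) = 0" for a' zs
    proof -
      have o': "\<psi> (star d * b) = 0" if "(c, d) \<in> set zs" for c d
        using positive_functional_herm[OF P\<psi>, of d b] orth[OF that] by simp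
      have 1: "?W (star (elem_tensor a' b) * tensor_sum zs) = 0"
      proof -
        have "\<forall>(c, d)\<in>set us. \<psi> (star b * d) = 0 \<Longrightarrow> ?W (star (elem_tensor a' b) * tensor_sum us) = 0" for us
          by (induction us) (auto simp: W distrib_left elem_tensor_ops)
        then show ?thesis using orth by blast
      qed
      have 2: "?W (star (tensor_sum zs) * elem_tensor a' b) = 0"
      proof -
        have "\<forall>(c, d)\<in>set us. \<psi> (star d * b) = 0 \<Longrightarrow> ?W (star (tensor_sum us) * elem_tensor a' b) = 0" for us
          by (induction us) (auto simp: W distrib_right star_add star_zero elem_tensor_ops)
        then show ?thesis using o' by blast
      qed
      have "?W (star (tensor_sum xs) * tensor_sum xs)
          = ?W (star (elem_tensor a' b) * elem_tensor a' b) + ?W (star (tensor_sum zs) * tensor_sum zs)"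
        unfolding eq by (simp add: star_add distrib_left distrib_right W 1 2)
      also have "?W (star (elem_tensor a' b) * elem_tensor a' b)
          = complex_of_real (Re (\<phi> (star a' * a')) * Re (\<psi> (star b * b)))"
        using positive_functional_real[OF P\<phi>, of a'] positive_functional_real[OF P\<psi>, of b]
        by (simp add: elem_tensor_ops W)
      finally show ?thesis
        using Suc(1)[of zs] len positive_functionalD(7)[OF P\<phi>, of a'] positive_functionalD(7)[OF P\<psi>, of b]
        by (metis add_nonneg_nonneg mult_nonneg_nonneg of_real_add)
    qed
    show ?case
    proof (cases "\<psi> (star b * b) = 0")
      case True
      have "\<psi> (star b * d) = 0" for d
        using positive_functional_CS[OF P\<psi>, of b d] True by simp
      then show ?thesis using split[of a ys] xs len by simp
    next
      case False
      define l where "l d = \<psi> (star b * d) / \<psi> (star b * b)" for d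
      define zs where "zs = map (\<lambda>(c, d). (c, d - l d *\<^sub>C b)) ys"
      define a' where "a' = a + (\<Sum>(c, d)\<leftarrow>ys. l d *\<^sub>C c)"
      have "tensor_sum ys = elem_tensor (\<Sum>(c, d)\<leftarrow>ys. l d *\<^sub>C c) b + tensor_sum (map (\<lambda>(c, d). (c, d - l d *\<^sub>C b)) ys)"
      proof (induction ys)
        case Nil
        then show ?case by (simp add: elem_tensor_zero)
      next
        case (Cons p ys)
        obtain c d where p: "p = (c, d)" by (cases p)
        have "elem_tensor c d = elem_tensor c (d - l d *\<^sub>C b) + elem_tensor c (l d *\<^sub>C b)"
          by (simp flip: elem_tensor_ops(2))
        then show ?case using Cons by (simp add: p elem_tensor_ops algebra_simps)
      qed
      then have "tensor_sum xs = elem_tensor a' b + tensor_sum zs"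
        by (simp add: xs a'_def zs_def elem_tensor_ops algebra_simps)
      moreover have "\<psi> (star b * d) = 0" if "(c, d) \<in> set zs" for c d
        using that False
        by (auto simp: zs_def l_def right_diff_distrib positive_functionalD[OF P\<psi>] mult_scaleC_right)
      ultimately show ?thesis using split[of a' zs] len by (simp add: zs_def)
    qed
  qed
  then show ?thesis
    unfolding positive_functional_def clinear_def scaleC_complex_def using ex_tensor_sum W by metis
qed

lemma product_functional_bounded:
  assumes \<phi>: "state \<phi>" and \<psi>: "state \<psi>"
  shows "\<exists>M. \<forall>x. cmod (product_functional \<phi> \<psi> (u * elem_tensor x 1 * v)) \<le> M * norm x"
    "\<exists>M. \<forall>x. cmod (product_functional \<phi> \<psi> (u * elem_tensor 1 x * v)) \<le> M * norm x"
proof -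
  let ?W = "product_functional \<phi> \<psi>"
  note W = product_functional_ops[OF \<phi> \<psi>]
  have bl: "bounded_linear \<phi>" "bounded_linear \<psi>"
    using \<phi> \<psi> by (auto simp: state_def bounded_clinear_def)
  have "\<exists>M. \<forall>x. cmod (f (a * x * b)) \<le> M * norm x"
    if "bounded_linear f" for a b :: "'c::cstar_algebra" and f :: "'c \<Rightarrow> complex"
  proof -
    have "bounded_linear (\<lambda>x. f (a * x * b))"
      by (rule bounded_linear_compose[OF that
            bounded_linear_compose[OF bounded_linear_mult_left bounded_linear_mult_right]])
    then obtain K where "\<And>x. cmod (f (a * x * b)) \<le> norm x * K"
      using bounded_linear.bounded by blast
    then show ?thesis by (intro exI[of _ K]) (simp add: mult.commute)
  qed
  note bd = this
  have sum: "\<exists>M. \<forall>x. cmod (g x + h x) \<le> M * norm x"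
    if "\<exists>M. \<forall>x. cmod (g x) \<le> M * norm x" "\<exists>M. \<forall>x. cmod (h x) \<le> M * norm x"
    for g h :: "'c::cstar_algebra \<Rightarrow> complex"
  proof -
    from that obtain M N where "\<And>x. cmod (g x) \<le> M * norm x" "\<And>x. cmod (h x) \<le> N * norm x" by blast
    then have "cmod (g x + h x) \<le> (M + N) * norm x" for x
      using norm_triangle_ineq[of "g x" "h x"] by (smt (verit) distrib_right)
    then show ?thesis by blast
  qed
  have cm: "\<exists>M. \<forall>x. cmod (g x * k) \<le> M * norm x" "\<exists>M. \<forall>x. cmod (k * g x) \<le> M * norm x"
    if "\<exists>M. \<forall>x. cmod (g x) \<le> M * norm x" for g :: "'c::cstar_algebra \<Rightarrow> complex" and k
  proof -
    from that obtain M where "\<And>x. cmod (g x) \<le> M * norm x" by blast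
    then have "cmod (g x) * cmod k \<le> M * norm x * cmod k" for x by (intro mult_right_mono) auto
    then have "cmod (g x * k) \<le> (M * cmod k) * norm x" for x by (simp add: norm_mult mult_ac)
    then show "\<exists>M. \<forall>x. cmod (g x * k) \<le> M * norm x" "\<exists>M. \<forall>x. cmod (k * g x) \<le> M * norm x"
      by (auto simp: mult.commute[of k])
  qed
  show "\<exists>M. \<forall>x. cmod (?W (u * elem_tensor x 1 * v)) \<le> M * norm x"
  proof (induction u rule: alg_tensor_induct_aux)
    case 1
    show ?case by (auto simp: W intro!: exI[of _ 0])
  next
    case (2 a b u)
    have "\<exists>M. \<forall>x. cmod (?W (elem_tensor a b * elem_tensor x 1 * v)) \<le> M * norm x"
    proof (induction v rule: alg_tensor_induct_aux)
      case 1
      show ?case by (auto simp: W intro!: exI[of _ 0])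
    next
      case (2 c d v)
      have eq: "?W (elem_tensor a b * elem_tensor x 1 * (elem_tensor c d + v))
          = \<phi> (a * x * c) * \<psi> (b * d) + ?W (elem_tensor a b * elem_tensor x 1 * v)" for x
        by (simp add: distrib_left W elem_tensor_ops)
      show ?case
        unfolding eq by (rule sum[OF cm(1)[OF bd[OF bl(1)]] 2])
    qed
    from sum[OF this 2] show ?case by (simp add: distrib_right W)
  qed
  show "\<exists>M. \<forall>x. cmod (?W (u * elem_tensor 1 x * v)) \<le> M * norm x"
  proof (induction u rule: alg_tensor_induct_aux)
    case 1
    show ?case by (auto simp: W intro!: exI[of _ 0])
  next
    case (2 a b u)
    have "\<exists>M. \<forall>x. cmod (?W (elem_tensor a b * elem_tensor 1 x * v)) \<le> M * norm x"
    proof (induction v rule: alg_tensor_induct_aux)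
      case 1
      show ?case by (auto simp: W intro!: exI[of _ 0])
    next
      case (2 c d v)
      have eq: "?W (elem_tensor a b * elem_tensor 1 x * (elem_tensor c d + v))
          = \<phi> (a * c) * \<psi> (b * x * d) + ?W (elem_tensor a b * elem_tensor 1 x * v)" for x
        by (simp add: distrib_left W elem_tensor_ops)
      show ?case
        unfolding eq by (rule sum[OF cm(2)[OF bd[OF bl(2)]] 2])
    qed
    from sum[OF this 2] show ?case by (simp add: distrib_right W)
  qed
qed

lemma gns_seminorm_mult_aux:
  fixes e :: "'c::cstar_algebra \<Rightarrow> 'd::star_algebra"
  assumes W: "positive_functional W"
    and e: "\<And>x y. e (x + y) = e x + e y" "\<And>c x. e (c *\<^sub>C x) = c *\<^sub>C e x" "\<And>x y. e (x * y) = e x * e y"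
      "\<And>x. star (e x) = e (star x)" "e 1 = 1"
    and bd: "\<And>u v. \<exists>M. \<forall>x. cmod (W (u * e x * v)) \<le> M * norm x"
  shows "gns_seminorm W (e x * s) \<le> norm x * gns_seminorm W s"
proof -
  note D = positive_functionalD[OF W]
  let ?f = "\<lambda>x. W (star s * e x * s)"
  have sq: "?f (star x * x) = W (star (e x * s) * (e x * s))" for x
    by (simp add: e star_mult mult.assoc)
  have f: "positive_functional ?f"
    unfolding positive_functional_def
  proof (intro conjI allI)
    show "clinear ?f"
      by (simp add: clinear_def e D distrib_left distrib_right mult_scaleC_left mult_scaleC_right)
    show "\<exists>r\<ge>0. ?f (star x * x) = complex_of_real r" for x
      using sq positive_functional_real[OF W] D(7) by metis
  qed
  from bd[of "star s" s] obtain M where M: "\<And>x. cmod (?f x) \<le> M * norm x" by blast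
  have "Re (?f (star x * x)) \<le> cmod (?f (star x * x))" by (rule complex_Re_le_cmod)
  also have "\<dots> \<le> Re (?f 1) * norm (star x * x)"
    by (rule positive_functional_self_adjoint_bound[OF f M]) (simp add: star_mult star_star)
  finally have "(gns_seminorm W (e x * s))\<^sup>2 \<le> (norm x * gns_seminorm W s)\<^sup>2"
    unfolding sq power_mult_distrib gns_seminorm_sq[OF W]
    by (simp add: e cstar_identity mult.commute)
  then show ?thesis
    by (rule power2_le_imp_le) (simp add: gns_seminorm_nonneg[OF W])
qed

lemma gns_seminorm_left_mult_bounded:
  "\<exists>K\<ge>0. \<forall>\<phi> \<psi> s. state \<phi> \<longrightarrow> state \<psi> \<longrightarrow>
    gns_seminorm (product_functional \<phi> \<psi>) (t * s) \<le> K * gns_seminorm (product_functional \<phi> \<psi>) s"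
proof (induction t rule: alg_tensor_induct_aux)
  case 1
  show ?case by (auto simp: gns_seminorm_zero product_functional_positive intro!: exI[of _ 0])
next
  case (2 a b t)
  then obtain K where "K \<ge> 0" and K: "\<And>\<phi> \<psi> s. state \<phi> \<Longrightarrow> state \<psi> \<Longrightarrow>
    gns_seminorm (product_functional \<phi> \<psi>) (t * s) \<le> K * gns_seminorm (product_functional \<phi> \<psi>) s"
    by blast
  have "gns_seminorm (product_functional \<phi> \<psi>) ((elem_tensor a b + t) * s)
      \<le> (norm a * norm b + K) * gns_seminorm (product_functional \<phi> \<psi>) s"
    if st: "state \<phi>" "state \<psi>" for \<phi> \<psi> s
  proof -
    let ?p = "gns_seminorm (product_functional \<phi> \<psi>)"
    note pos = product_functional_positive[OF st]
    have "?p ((elem_tensor a b + t) * s) \<le> ?p (elem_tensor a 1 * (elem_tensor 1 b * s)) + ?p (t * s)"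
      using gns_seminorm_triangle[OF pos, of "elem_tensor a b * s" "t * s"]
      by (simp add: distrib_right elem_tensor_ops(5) flip: mult.assoc)
    also have "?p (elem_tensor a 1 * (elem_tensor 1 b * s)) \<le> norm a * ?p (elem_tensor 1 b * s)"
      by (rule gns_seminorm_mult_aux[OF pos])
        (auto simp: elem_tensor_ops star_one product_functional_bounded[OF st])
    also have "?p (elem_tensor 1 b * s) \<le> norm b * ?p s"
      by (rule gns_seminorm_mult_aux[OF pos])
        (auto simp: elem_tensor_ops star_one product_functional_bounded[OF st])
    finally have "?p ((elem_tensor a b + t) * s) \<le> norm a * (norm b * ?p s) + ?p (t * s)"
      by (simp add: mult_left_mono)
    also have "\<dots> \<le> (norm a * norm b + K) * ?p s"
      using K[OF st, of s] by (simp add: distrib_right mult.assoc)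
    finally show ?thesis .
  qed
  with \<open>K \<ge> 0\<close> show ?case by (intro exI[of _ "norm a * norm b + K"]) auto
qed

text \<open>The minimal (spatial) norm \<open>sup \<parallel>(\<pi>\<^sub>\<phi> \<otimes> \<pi>\<^sub>\<psi>) t\<parallel>\<close>, where \<open>\<phi>\<close>, \<open>\<psi>\<close> range over all
  states and \<open>\<pi>\<^sub>\<phi>\<close>, \<open>\<pi>\<^sub>\<psi>\<close> are their GNS representations; equivalently, the operator norm of \<open>t\<close> in the
  tensor product of the two universal representations. The GNS space of \<open>\<phi> \<otimes> \<psi>\<close> is the completed tensor product of
  those of \<open>\<phi>\<close> and \<open>\<psi>\<close>; it contains the classes of the algebraic tensors \<open>s\<close> as a dense subspace, with norm
  \<open>gns_seminorm (product_functional \<phi> \<psi>) s\<close> and with \<open>t\<close> acting by left multiplication.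
  Inserting 0 only matters when there are no states, i.e. when one of the algebras is zero.\<close>

definition min_norm :: "('a::cstar_algebra, 'b::cstar_algebra) alg_tensor \<Rightarrow> real"
  where "min_norm t = Sup (insert 0 {gns_seminorm (product_functional \<phi> \<psi>) (t * s) |\<phi> \<psi> s.
    state \<phi> \<and> state \<psi> \<and> gns_seminorm (product_functional \<phi> \<psi>) s \<le> 1})"

lemma min_norm_bdd:
  "bdd_above (insert 0 {gns_seminorm (product_functional \<phi> \<psi>) (t * s) |\<phi> \<psi> s.
    state \<phi> \<and> state \<psi> \<and> gns_seminorm (product_functional \<phi> \<psi>) s \<le> 1})"
proof -
  obtain K where "K \<ge> 0" and K: "\<And>\<phi> \<psi> s. state \<phi> \<Longrightarrow> state \<psi> \<Longrightarrow>
    gns_seminorm (product_functional \<phi> \<psi>) (t * s) \<le> K * gns_seminorm (product_functional \<phi> \<psi>) s"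
    using gns_seminorm_left_mult_bounded[of t] by blast
  have "gns_seminorm (product_functional \<phi> \<psi>) (t * s) \<le> K"
    if "state \<phi>" "state \<psi>" "gns_seminorm (product_functional \<phi> \<psi>) s \<le> 1" for \<phi> \<psi> s
    using K[OF that(1,2), of s] mult_left_mono[OF that(3) \<open>K \<ge> 0\<close>] by simp
  with \<open>K \<ge> 0\<close> show ?thesis by (intro bdd_aboveI[of _ K]) auto
qed

lemma min_norm_nonneg: "min_norm t \<ge> 0"
  unfolding min_norm_def by (rule cSup_upper[OF _ min_norm_bdd]) simp

lemma min_norm_bound:
  assumes st: "state \<phi>" "state \<psi>"
  shows "gns_seminorm (product_functional \<phi> \<psi>) (t * s) \<le> min_norm t * gns_seminorm (product_functional \<phi> \<psi>) s"
proof -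
  let ?p = "gns_seminorm (product_functional \<phi> \<psi>)"
  note pos = product_functional_positive[OF st]
  show ?thesis
  proof (cases "?p s = 0")
    case True
    obtain K where "?p (t * s) \<le> K * ?p s"
      using gns_seminorm_left_mult_bounded[of t] st by blast
    with True gns_seminorm_nonneg[OF pos, of "t * s"] show ?thesis by simp
  next
    case False
    then have p: "?p s > 0" using gns_seminorm_nonneg[OF pos, of s] by simp
    define s' where "s' = complex_of_real (1 / ?p s) *\<^sub>C s"
    have 1: "?p s' = 1" using p by (simp add: s'_def gns_seminorm_scaleC[OF pos] norm_divide)
    have 2: "?p (t * s') = ?p (t * s) / ?p s"
      using p by (simp add: s'_def gns_seminorm_scaleC[OF pos] norm_divide mult_scaleC_right)
    have "?p (t * s') \<le> min_norm t"
      unfolding min_norm_def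
      by (rule cSup_upper[OF insertI2 min_norm_bdd], rule CollectI,
          intro exI[of _ \<phi>] exI[of _ \<psi>] exI[of _ s']) (simp add: st 1)
    with p show ?thesis by (simp add: 2 divide_le_eq)
  qed
qed

lemma min_norm_leI:
  assumes "C \<ge> 0" "\<And>\<phi> \<psi> s. state \<phi> \<Longrightarrow> state \<psi> \<Longrightarrow>
    gns_seminorm (product_functional \<phi> \<psi>) (t * s) \<le> C * gns_seminorm (product_functional \<phi> \<psi>) s"
  shows "min_norm t \<le> C"
  unfolding min_norm_def
proof (rule cSup_least)
  fix x assume "x \<in> insert 0 {gns_seminorm (product_functional \<phi> \<psi>) (t * s) |\<phi> \<psi> s.
    state \<phi> \<and> state \<psi> \<and> gns_seminorm (product_functional \<phi> \<psi>) s \<le> 1}"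
  then show "x \<le> C"
  proof
    assume "x \<in> {gns_seminorm (product_functional \<phi> \<psi>) (t * s) |\<phi> \<psi> s.
      state \<phi> \<and> state \<psi> \<and> gns_seminorm (product_functional \<phi> \<psi>) s \<le> 1}"
    then obtain \<phi> \<psi> s where x: "x = gns_seminorm (product_functional \<phi> \<psi>) (t * s)" "state \<phi>" "state \<psi>"
        "gns_seminorm (product_functional \<phi> \<psi>) s \<le> 1" by blast
    show ?thesis using assms(2)[OF x(2,3), of s] mult_left_mono[OF x(4) assms(1)] x(1) by simp
  qed (use assms(1) in simp)
qed simp

lemma min_norm_zero: "min_norm 0 = 0"
  by (intro antisym min_norm_nonneg min_norm_leI) (simp_all add: gns_seminorm_zero product_functional_positive)

lemma min_norm_triangle: "min_norm (t + u) \<le> min_norm t + min_norm u"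
proof (rule min_norm_leI)
  fix \<phi> :: "'a \<Rightarrow> complex" and \<psi> :: "'b \<Rightarrow> complex" and s assume st: "state \<phi>" "state \<psi>"
  let ?p = "gns_seminorm (product_functional \<phi> \<psi>)"
  show "?p ((t + u) * s) \<le> (min_norm t + min_norm u) * ?p s"
    using gns_seminorm_triangle[OF product_functional_positive[OF st], of "t * s" "u * s"]
      min_norm_bound[OF st, of t s] min_norm_bound[OF st, of u s]
    by (simp add: distrib_right)
qed (simp add: min_norm_nonneg)

lemma min_norm_mult: "min_norm (t * u) \<le> min_norm t * min_norm u"
proof (rule min_norm_leI)
  fix \<phi> :: "'a \<Rightarrow> complex" and \<psi> :: "'b \<Rightarrow> complex" and s assume st: "state \<phi>" "state \<psi>"
  let ?p = "gns_seminorm (product_functional \<phi> \<psi>)"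
  have "?p (t * (u * s)) \<le> min_norm t * ?p (u * s)" by (rule min_norm_bound[OF st])
  also have "\<dots> \<le> min_norm t * (min_norm u * ?p s)"
    by (intro mult_left_mono min_norm_bound[OF st] min_norm_nonneg)
  finally show "?p (t * u * s) \<le> min_norm t * min_norm u * ?p s" by (simp add: mult.assoc)
qed (simp add: min_norm_nonneg)

lemma min_norm_scaleC: "min_norm (c *\<^sub>C t) = cmod c * min_norm t"
proof -
  have le: "min_norm (c *\<^sub>C t) \<le> cmod c * min_norm t" for c and t :: "('a, 'b) alg_tensor"
  proof (rule min_norm_leI)
    fix \<phi> :: "'a \<Rightarrow> complex" and \<psi> :: "'b \<Rightarrow> complex" and s assume st: "state \<phi>" "state \<psi>"
    let ?p = "gns_seminorm (product_functional \<phi> \<psi>)"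
    show "?p ((c *\<^sub>C t) * s) \<le> cmod c * min_norm t * ?p s"
      using mult_left_mono[OF min_norm_bound[OF st, of t s] norm_ge_zero[of c]]
      by (simp add: mult_scaleC_left gns_seminorm_scaleC product_functional_positive st mult.assoc)
  qed (simp add: min_norm_nonneg)
  show ?thesis
  proof (cases "c = 0")
    case False
    have "min_norm t \<le> cmod (inverse c) * min_norm (c *\<^sub>C t)"
      using le[of "inverse c" "c *\<^sub>C t"] False by (simp add: scaleC_scaleC scaleC_one)
    then have "cmod c * min_norm t \<le> min_norm (c *\<^sub>C t)"
      using False by (simp add: norm_inverse mult.commute[of "cmod c"] flip: divide_inverse_commute pos_le_divide_eq)
    with le[of c t] show ?thesis by simp
  qed (simp add: scaleC_zero_left min_norm_zero)
qed

lemma min_norm_minus: "min_norm (- t) = min_norm t"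
  using min_norm_scaleC[of "-1" t] by (simp add: scaleC_minus_one)

lemma min_norm_star_le: "min_norm (star t) \<le> min_norm t"
proof (rule min_norm_leI)
  fix \<phi> :: "'a \<Rightarrow> complex" and \<psi> :: "'b \<Rightarrow> complex" and s assume st: "state \<phi>" "state \<psi>"
  let ?W = "product_functional \<phi> \<psi>"
  let ?p = "gns_seminorm ?W"
  note pos = product_functional_positive[OF st]
  have "(?p (star t * s))\<^sup>2 = Re (?W (star s * (t * (star t * s))))"
    by (simp add: gns_seminorm_sq[OF pos] star_mult star_star mult.assoc)
  also have "\<dots> \<le> ?p s * ?p (t * (star t * s))"
    using complex_Re_le_cmod gns_seminorm_CS[OF pos] by (meson order.trans)
  also have "\<dots> \<le> ?p s * (min_norm t * ?p (star t * s))"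
    by (intro mult_left_mono min_norm_bound[OF st] gns_seminorm_nonneg[OF pos])
  finally have "?p (star t * s) * ?p (star t * s) \<le> (min_norm t * ?p s) * ?p (star t * s)"
    by (simp add: power2_eq_square mult_ac)
  then show "?p (star t * s) \<le> min_norm t * ?p s"
    using gns_seminorm_nonneg[OF pos, of "star t * s"] gns_seminorm_nonneg[OF pos, of s] min_norm_nonneg[of t]
    by (cases "?p (star t * s) = 0") auto
qed (simp add: min_norm_nonneg)

lemma min_norm_star: "min_norm (star t) = min_norm t"
  using min_norm_star_le[of t] min_norm_star_le[of "star t"] by (simp add: star_star)

lemma min_norm_cstar: "min_norm (star t * t) = (min_norm t)\<^sup>2"
proof (rule antisym)
  show "min_norm (star t * t) \<le> (min_norm t)\<^sup>2"
    using min_norm_mult[of "star t" t] by (simp add: min_norm_star power2_eq_square)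
  have "min_norm t \<le> sqrt (min_norm (star t * t))"
  proof (rule min_norm_leI)
    fix \<phi> :: "'a \<Rightarrow> complex" and \<psi> :: "'b \<Rightarrow> complex" and s assume st: "state \<phi>" "state \<psi>"
    let ?W = "product_functional \<phi> \<psi>"
    let ?p = "gns_seminorm ?W"
    note pos = product_functional_positive[OF st]
    have "(?p (t * s))\<^sup>2 = Re (?W (star s * ((star t * t) * s)))"
      by (simp add: gns_seminorm_sq[OF pos] star_mult mult.assoc)
    also have "\<dots> \<le> ?p s * ?p ((star t * t) * s)"
      using complex_Re_le_cmod gns_seminorm_CS[OF pos] by (meson order.trans)
    also have "\<dots> \<le> ?p s * (min_norm (star t * t) * ?p s)"
      by (intro mult_left_mono min_norm_bound[OF st] gns_seminorm_nonneg[OF pos])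
    also have "\<dots> = (sqrt (min_norm (star t * t)) * ?p s)\<^sup>2"
      by (simp add: power_mult_distrib min_norm_nonneg) (simp add: power2_eq_square mult_ac)
    finally show "?p (t * s) \<le> sqrt (min_norm (star t * t)) * ?p s"
      by (rule power2_le_imp_le) (simp add: min_norm_nonneg gns_seminorm_nonneg[OF pos])
  qed (simp add: min_norm_nonneg)
  then have "(min_norm t)\<^sup>2 \<le> (sqrt (min_norm (star t * t)))\<^sup>2"
    by (intro power_mono min_norm_nonneg)
  then show "(min_norm t)\<^sup>2 \<le> min_norm (star t * t)"
    by (simp add: min_norm_nonneg)
qed

lifting_update alg_tensor.lifting
lifting_forget alg_tensor.lifting

lemma min_norm_diff_commute: "min_norm (t - u) = min_norm (u - t)"
  using min_norm_minus[of "t - u"] by simp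

lemma min_norm_diff_triangle: "min_norm (t - v) \<le> min_norm (t - u) + min_norm (u - v)"
  using min_norm_triangle[of "t - u" "u - v"] by simp

lemma min_norm_abs_diff: "\<bar>min_norm t - min_norm u\<bar> \<le> min_norm (t - u)"
  using min_norm_triangle[of "t - u" u] min_norm_triangle[of "u - t" t] min_norm_diff_commute[of t u]
  by simp

text \<open>The minimal tensor product is the completion of the algebraic one in the minimal norm, built from Cauchy sequences.\<close>

definition min_Cauchy :: "(nat \<Rightarrow> ('a::cstar_algebra, 'b::cstar_algebra) alg_tensor) \<Rightarrow> bool"
  where "min_Cauchy X \<longleftrightarrow> (\<forall>e>0. \<exists>M. \<forall>m\<ge>M. \<forall>n\<ge>M. min_norm (X m - X n) < e)"

definition min_tensor_rel :: "(nat \<Rightarrow> ('a::cstar_algebra, 'b::cstar_algebra) alg_tensor) \<Rightarrow> (nat \<Rightarrow> ('a, 'b) alg_tensor) \<Rightarrow> bool"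
  where "min_tensor_rel X Y \<longleftrightarrow> min_Cauchy X \<and> min_Cauchy Y \<and> (\<lambda>n. min_norm (X n - Y n)) \<longlonglongrightarrow> 0"

lemma min_Cauchy_bounded:
  assumes "min_Cauchy X"
  shows "\<exists>B\<ge>0. \<forall>n. min_norm (X n) \<le> B"
proof -
  obtain M where M: "\<forall>m\<ge>M. \<forall>n\<ge>M. min_norm (X m - X n) < 1"
    using assms unfolding min_Cauchy_def by (meson zero_less_one)
  define B where "B = (\<Sum>k\<le>M. min_norm (X k)) + 1"
  have k: "min_norm (X k) \<le> B - 1" if "k \<le> M" for k
    unfolding B_def using that by (simp, intro member_le_sum) (auto simp: min_norm_nonneg)
  have "min_norm (X n) \<le> B" for n
  proof (cases "n \<le> M")
    case False
    then have "min_norm (X n - X M) < 1" using M by simp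
    then show ?thesis using min_norm_triangle[of "X n - X M" "X M"] k[of M] by simp
  qed (use k[of n] in simp)
  moreover have "B \<ge> 0" using k[of 0] min_norm_nonneg[of "X 0"] by linarith
  ultimately show ?thesis by blast
qed

lemma min_Cauchy_le:
  assumes X: "min_Cauchy X" and Y: "min_Cauchy Y" and C: "C \<ge> 0"
    and le: "\<And>m n. min_norm (Z m - Z n) \<le> C * min_norm (X m - X n) + C * min_norm (Y m - Y n)"
  shows "min_Cauchy Z"
  unfolding min_Cauchy_def
proof (intro allI impI)
  fix e :: real assume e: "e > 0"
  define d where "d = e / (2 * (C + 1))"
  have d: "d > 0" using e C by (simp add: d_def)
  obtain M1 where M1: "\<forall>m\<ge>M1. \<forall>n\<ge>M1. min_norm (X m - X n) < d"
    using X d unfolding min_Cauchy_def by meson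
  obtain M2 where M2: "\<forall>m\<ge>M2. \<forall>n\<ge>M2. min_norm (Y m - Y n) < d"
    using Y d unfolding min_Cauchy_def by meson
  have "min_norm (Z m - Z n) < e" if "m \<ge> max M1 M2" "n \<ge> max M1 M2" for m n
  proof -
    have "C * min_norm (X m - X n) \<le> C * d" "C * min_norm (Y m - Y n) \<le> C * d"
      by (rule mult_left_mono[OF less_imp_le C], use M1 M2 that in simp)+
    then have "min_norm (Z m - Z n) \<le> 2 * C * d" using le[of m n] by simp
    also have "\<dots> < 2 * (C + 1) * d" using d by simp
    also have "\<dots> = e" using C by (simp add: d_def)
    finally show ?thesis .
  qed
  then show "\<exists>M. \<forall>m\<ge>M. \<forall>n\<ge>M. min_norm (Z m - Z n) < e" by blast
qed

lemma min_Cauchy_const: "min_Cauchy (\<lambda>n. t)"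
  by (auto simp: min_Cauchy_def min_norm_zero)

lemma min_Cauchy_add:
  assumes "min_Cauchy X" "min_Cauchy Y" shows "min_Cauchy (\<lambda>n. X n + Y n)"
  by (rule min_Cauchy_le[OF assms, of 1]) (simp_all add: add_diff_add min_norm_triangle)

lemma min_Cauchy_scaleC:
  assumes "min_Cauchy X" shows "min_Cauchy (\<lambda>n. c *\<^sub>C X n)"
proof (rule min_Cauchy_le[OF assms min_Cauchy_const[of 0], of "cmod c"])
  fix m n
  have "c *\<^sub>C X m - c *\<^sub>C X n = c *\<^sub>C (X m - X n)"
    using scaleC_add_right[of c "X m - X n" "X n"] by (simp add: algebra_simps)
  then show "min_norm (c *\<^sub>C X m - c *\<^sub>C X n) \<le> cmod c * min_norm (X m - X n) + cmod c * min_norm (0 - 0)"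
    by (simp add: min_norm_scaleC min_norm_zero)
qed simp

lemma min_Cauchy_minus:
  assumes "min_Cauchy X" shows "min_Cauchy (\<lambda>n. - X n)"
  using min_Cauchy_scaleC[OF assms, of "-1"] by (simp add: scaleC_minus_one)

lemma min_Cauchy_diff:
  assumes "min_Cauchy X" "min_Cauchy Y" shows "min_Cauchy (\<lambda>n. X n - Y n)"
  using min_Cauchy_add[OF assms(1) min_Cauchy_minus[OF assms(2)]] by simp

lemma min_Cauchy_star:
  assumes "min_Cauchy X" shows "min_Cauchy (\<lambda>n. star (X n))"
  by (rule min_Cauchy_le[OF assms min_Cauchy_const[of 0], of 1])
    (simp_all add: min_norm_star min_norm_zero flip: star_diff)

lemma min_norm_mult_diff:
  "min_norm (x * y - x' * y') \<le> min_norm x * min_norm (y - y') + min_norm (x - x') * min_norm y'"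
proof -
  have "x * y - x' * y' = x * (y - y') + (x - x') * y'" by (simp add: algebra_simps)
  then show ?thesis
    using min_norm_triangle[of "x * (y - y')" "(x - x') * y'"] min_norm_mult[of x "y - y'"] min_norm_mult[of "x - x'" y']
    by simp
qed

lemma min_Cauchy_mult:
  assumes X: "min_Cauchy X" and Y: "min_Cauchy Y" shows "min_Cauchy (\<lambda>n. X n * Y n)"
proof -
  obtain B where B: "B \<ge> 0" "\<And>n. min_norm (X n) \<le> B" using min_Cauchy_bounded[OF X] by blast
  obtain D where D: "D \<ge> 0" "\<And>n. min_norm (Y n) \<le> D" using min_Cauchy_bounded[OF Y] by blast
  show ?thesis
  proof (rule min_Cauchy_le[OF X Y, of "B + D"])
    fix m n
    have "min_norm (X m * Y m - X n * Y n) \<le> min_norm (X m) * min_norm (Y m - Y n) + min_norm (X m - X n) * min_norm (Y n)"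
      by (rule min_norm_mult_diff)
    also have "\<dots> \<le> (B + D) * min_norm (Y m - Y n) + min_norm (X m - X n) * (B + D)"
      using B D by (intro add_mono mult_right_mono mult_left_mono min_norm_nonneg) (auto intro: add_increasing add_increasing2)
    finally show "min_norm (X m * Y m - X n * Y n) \<le> (B + D) * min_norm (X m - X n) + (B + D) * min_norm (Y m - Y n)"
      by (simp add: algebra_simps)
  qed (use B D in simp)
qed

lemma min_null_le:
  assumes "f \<longlonglongrightarrow> 0" "\<And>n. min_norm (Z n) \<le> f n"
  shows "(\<lambda>n. min_norm (Z n)) \<longlonglongrightarrow> 0"
  by (rule tendsto_sandwich[OF _ _ tendsto_const assms(1)]) (auto simp: min_norm_nonneg assms(2))

lemma min_tensor_rel_refl: "min_tensor_rel X X \<longleftrightarrow> min_Cauchy X"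
  by (simp add: min_tensor_rel_def min_norm_zero)

quotient_type (overloaded) ('a, 'b) min_tensor =
  "nat \<Rightarrow> ('a::cstar_algebra, 'b::cstar_algebra) alg_tensor" / partial: min_tensor_rel
proof (intro part_equivpI sympI transpI)
  show "\<exists>X :: nat \<Rightarrow> ('a, 'b) alg_tensor. min_tensor_rel X X"
    using min_Cauchy_const min_tensor_rel_refl by blast
  fix X Y Z :: "nat \<Rightarrow> ('a, 'b) alg_tensor"
  show "min_tensor_rel Y X" if "min_tensor_rel X Y"
    using that by (simp add: min_tensor_rel_def min_norm_diff_commute)
  show "min_tensor_rel X Z" if "min_tensor_rel X Y" "min_tensor_rel Y Z"
    using that min_null_le[OF tendsto_add_zero min_norm_diff_triangle, of X Y Z]
    by (simp add: min_tensor_rel_def)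
qed

lemma min_norm_convergent:
  assumes "min_Cauchy X"
  shows "convergent (\<lambda>n. min_norm (X n))"
proof (rule real_Cauchy_convergent, rule metric_CauchyI)
  fix e :: real assume "e > 0"
  then obtain M where "\<forall>m\<ge>M. \<forall>n\<ge>M. min_norm (X m - X n) < e"
    using assms unfolding min_Cauchy_def by meson
  then show "\<exists>M. \<forall>m\<ge>M. \<forall>n\<ge>M. dist (min_norm (X m)) (min_norm (X n)) < e"
    by (metis dist_real_def min_norm_abs_diff le_less_trans)
qed

lemma min_norm_lim:
  assumes "min_Cauchy X"
  shows "(\<lambda>n. min_norm (X n)) \<longlonglongrightarrow> lim (\<lambda>n. min_norm (X n))"
  using min_norm_convergent[OF assms] by (simp add: convergent_LIMSEQ_iff)

instantiation min_tensor :: (cstar_algebra, cstar_algebra) star_algebra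
begin

lift_definition zero_min_tensor :: "('a, 'b) min_tensor" is "\<lambda>n. 0"
  by (simp add: min_tensor_rel_refl min_Cauchy_const)

lift_definition one_min_tensor :: "('a, 'b) min_tensor" is "\<lambda>n. 1"
  by (simp add: min_tensor_rel_refl min_Cauchy_const)

lift_definition plus_min_tensor :: "('a, 'b) min_tensor \<Rightarrow> ('a, 'b) min_tensor \<Rightarrow> ('a, 'b) min_tensor"
  is "\<lambda>X Y n. X n + Y n"
  unfolding min_tensor_rel_def
  by (auto simp: min_Cauchy_add add_diff_add intro: min_null_le[OF tendsto_add_zero min_norm_triangle])

lift_definition uminus_min_tensor :: "('a, 'b) min_tensor \<Rightarrow> ('a, 'b) min_tensor"
  is "\<lambda>X n. - X n"
  unfolding min_tensor_rel_def
  by (auto simp: min_Cauchy_minus min_norm_diff_commute)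

lift_definition minus_min_tensor :: "('a, 'b) min_tensor \<Rightarrow> ('a, 'b) min_tensor \<Rightarrow> ('a, 'b) min_tensor"
  is "\<lambda>X Y n. X n - Y n"
proof -
  fix X X' Y Y' :: "nat \<Rightarrow> ('a, 'b) alg_tensor"
  assume *: "min_tensor_rel X X'" "min_tensor_rel Y Y'"
  have "min_norm (X n - Y n - (X' n - Y' n)) \<le> min_norm (X n - X' n) + min_norm (Y n - Y' n)" for n
    using min_norm_triangle[of "X n - X' n" "- (Y n - Y' n)"] by (simp only: min_norm_minus) (simp add: algebra_simps)
  with * show "min_tensor_rel (\<lambda>n. X n - Y n) (\<lambda>n. X' n - Y' n)"
    unfolding min_tensor_rel_def by (auto simp: min_Cauchy_diff intro: min_null_le[OF tendsto_add_zero])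
qed

lift_definition scaleC_min_tensor :: "complex \<Rightarrow> ('a, 'b) min_tensor \<Rightarrow> ('a, 'b) min_tensor"
  is "\<lambda>c X n. c *\<^sub>C X n"
proof -
  fix c and X Y :: "nat \<Rightarrow> ('a, 'b) alg_tensor"
  assume *: "min_tensor_rel X Y"
  have "c *\<^sub>C X n - c *\<^sub>C Y n = c *\<^sub>C (X n - Y n)" for n
    using scaleC_add_right[of c "X n - Y n" "Y n"] by (simp add: algebra_simps)
  with * show "min_tensor_rel (\<lambda>n. c *\<^sub>C X n) (\<lambda>n. c *\<^sub>C Y n)"
    unfolding min_tensor_rel_def by (auto simp: min_Cauchy_scaleC min_norm_scaleC intro!: tendsto_mult_right_zero)
qed

lift_definition star_min_tensor :: "('a, 'b) min_tensor \<Rightarrow> ('a, 'b) min_tensor"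
  is "\<lambda>X n. star (X n)"
  unfolding min_tensor_rel_def
  by (simp add: min_Cauchy_star min_norm_star flip: star_diff)

lift_definition times_min_tensor :: "('a, 'b) min_tensor \<Rightarrow> ('a, 'b) min_tensor \<Rightarrow> ('a, 'b) min_tensor"
  is "\<lambda>X Y n. X n * Y n"
proof -
  fix X X' Y Y' :: "nat \<Rightarrow> ('a, 'b) alg_tensor"
  assume *: "min_tensor_rel X X'" "min_tensor_rel Y Y'"
  then have c: "min_Cauchy X" "min_Cauchy X'" "min_Cauchy Y" "min_Cauchy Y'"
    by (auto simp: min_tensor_rel_def)
  obtain B where B: "B \<ge> 0" "\<And>n. min_norm (X n) \<le> B" using min_Cauchy_bounded[OF c(1)] by blast
  obtain D where D: "D \<ge> 0" "\<And>n. min_norm (Y' n) \<le> D" using min_Cauchy_bounded[OF c(4)] by blast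
  have "(\<lambda>n. B * min_norm (Y n - Y' n) + min_norm (X n - X' n) * D) \<longlonglongrightarrow> 0"
    using * by (auto simp: min_tensor_rel_def intro!: tendsto_add_zero tendsto_mult_right_zero tendsto_mult_left_zero)
  moreover have "min_norm (X n * Y n - X' n * Y' n) \<le> B * min_norm (Y n - Y' n) + min_norm (X n - X' n) * D" for n
    using B D by (intro order.trans[OF min_norm_mult_diff] add_mono mult_right_mono mult_left_mono min_norm_nonneg)
  ultimately show "min_tensor_rel (\<lambda>n. X n * Y n) (\<lambda>n. X' n * Y' n)"
    using c unfolding min_tensor_rel_def by (auto simp: min_Cauchy_mult intro: min_null_le)
qed

instance
proof
  fix x y z :: "('a, 'b) min_tensor" and c d :: complex
  note I = min_tensor_rel_refl min_Cauchy_const min_Cauchy_add min_Cauchy_mult min_Cauchy_minus min_Cauchy_scaleC min_Cauchy_star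
  show "x + y + z = x + (y + z)" by transfer (simp add: I add.assoc)
  show "x + y = y + x" by transfer (simp add: I add.commute)
  show "0 + x = x" by transfer (simp add: I)
  show "- x + x = 0" by transfer (simp add: I)
  show "x - y = x + - y" by transfer (simp add: I min_Cauchy_diff)
  show "c *\<^sub>C (x + y) = c *\<^sub>C x + c *\<^sub>C y" by transfer (simp add: I flip: scaleC_add_right)
  show "(c + d) *\<^sub>C x = c *\<^sub>C x + d *\<^sub>C x" by transfer (simp add: I flip: scaleC_add_left)
  show "c *\<^sub>C d *\<^sub>C x = (c * d) *\<^sub>C x" by transfer (simp add: I scaleC_scaleC)
  show "1 *\<^sub>C x = x" by transfer (simp add: I scaleC_one)
  show "(x + y) * z = x * z + y * z" by transfer (simp add: I flip: distrib_right)
  show "x * (y + z) = x * y + x * z" by transfer (simp add: I flip: distrib_left)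
  show "x * y * z = x * (y * z)" by transfer (simp add: I mult.assoc)
  show "1 * x = x" "x * 1 = x" by (transfer, simp add: I)+
  show "(c *\<^sub>C x) * y = c *\<^sub>C (x * y)" by transfer (simp add: I mult_scaleC_left)
  show "x * (c *\<^sub>C y) = c *\<^sub>C (x * y)" by transfer (simp add: I mult_scaleC_right)
  show "star (star x) = x" by transfer (simp add: I star_star)
  show "star (x + y) = star x + star y" by transfer (simp add: I star_add)
  show "star (c *\<^sub>C x) = cnj c *\<^sub>C star x" by transfer (simp add: I star_scaleC)
  show "star (x * y) = star y * star x" by transfer (simp add: I star_mult)
qed

end

lift_definition of_alg_tensor :: "('a::cstar_algebra, 'b::cstar_algebra) alg_tensor \<Rightarrow> ('a, 'b) min_tensor"
  is "\<lambda>t n. t"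
  by (simp add: min_tensor_rel_refl min_Cauchy_const)

lemma of_alg_tensor_diff: "of_alg_tensor (t - u) = of_alg_tensor t - of_alg_tensor u"
  by transfer (simp add: min_tensor_rel_refl min_Cauchy_const)

instantiation min_tensor :: (cstar_algebra, cstar_algebra) real_normed_algebra
begin

definition scaleR_min_tensor :: "real \<Rightarrow> ('a, 'b) min_tensor \<Rightarrow> ('a, 'b) min_tensor"
  where "r *\<^sub>R x = complex_of_real r *\<^sub>C x" for x :: "('a, 'b) min_tensor"

lift_definition norm_min_tensor :: "('a, 'b) min_tensor \<Rightarrow> real"
  is "\<lambda>X. lim (\<lambda>n. min_norm (X n))"
proof -
  fix X Y :: "nat \<Rightarrow> ('a, 'b) alg_tensor"
  assume "min_tensor_rel X Y"
  then have XY: "min_Cauchy X" "min_Cauchy Y" "(\<lambda>n. min_norm (X n - Y n)) \<longlonglongrightarrow> 0"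
    by (auto simp: min_tensor_rel_def)
  have "(\<lambda>n. min_norm (X n) - min_norm (Y n)) \<longlonglongrightarrow> 0"
    by (rule Lim_null_comparison[OF _ XY(3)]) (simp add: min_norm_abs_diff)
  from tendsto_add[OF this min_norm_lim[OF XY(2)]]
  show "lim (\<lambda>n. min_norm (X n)) = lim (\<lambda>n. min_norm (Y n))"
    by (simp add: limI)
qed

definition dist_min_tensor :: "('a, 'b) min_tensor \<Rightarrow> ('a, 'b) min_tensor \<Rightarrow> real"
  where "dist x y = norm (x - y)" for x y :: "('a, 'b) min_tensor"

definition sgn_min_tensor :: "('a, 'b) min_tensor \<Rightarrow> ('a, 'b) min_tensor"
  where "sgn x = inverse (norm x) *\<^sub>R x" for x :: "('a, 'b) min_tensor"

definition uniformity_min_tensor :: "(('a, 'b) min_tensor \<times> ('a, 'b) min_tensor) filter"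
  where "uniformity_min_tensor = (INF e\<in>{0<..}. principal {(x, y). dist x y < e})"

definition open_min_tensor :: "('a, 'b) min_tensor set \<Rightarrow> bool"
  where "open_min_tensor U \<longleftrightarrow> (\<forall>x\<in>U. \<forall>\<^sub>F (x', y) in uniformity. x' = x \<longrightarrow> y \<in> U)"

lemma norm_of_alg_tensor: "norm (of_alg_tensor t) = min_norm t"
  by transfer simp

lemma norm_min_tensor_ge_zero: "norm (x :: ('a, 'b) min_tensor) \<ge> 0"
  by transfer (metis LIMSEQ_le_const min_norm_lim min_norm_nonneg min_tensor_rel_refl)

lemma norm_min_tensor_triangle: "norm (x + y) \<le> norm x + norm (y :: ('a, 'b) min_tensor)"
proof transfer
  fix X Y :: "nat \<Rightarrow> ('a, 'b) alg_tensor"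
  assume "min_tensor_rel X X" "min_tensor_rel Y Y"
  then have XY: "min_Cauchy X" "min_Cauchy Y" by (simp_all add: min_tensor_rel_refl)
  show "lim (\<lambda>n. min_norm (X n + Y n)) \<le> lim (\<lambda>n. min_norm (X n)) + lim (\<lambda>n. min_norm (Y n))"
    by (rule LIMSEQ_le[OF min_norm_lim[OF min_Cauchy_add[OF XY]] tendsto_add[OF min_norm_lim[OF XY(1)] min_norm_lim[OF XY(2)]]])
      (auto simp: min_norm_triangle)
qed

lemma min_tensor_dense: "e > 0 \<Longrightarrow> \<exists>t. norm (x - of_alg_tensor t) < e"
proof transfer
  fix e :: real and X :: "nat \<Rightarrow> ('a, 'b) alg_tensor"
  assume e: "e > 0" and "min_tensor_rel X X"
  then have X: "min_Cauchy X" by (simp add: min_tensor_rel_refl)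
  then obtain M where M: "\<forall>m\<ge>M. \<forall>n\<ge>M. min_norm (X m - X n) < e / 2"
    using e unfolding min_Cauchy_def by (meson half_gt_zero)
  have "min_Cauchy (\<lambda>n. X n - X M)"
    by (rule min_Cauchy_diff[OF X min_Cauchy_const])
  from min_norm_lim[OF this] have "lim (\<lambda>n. min_norm (X n - X M)) \<le> e / 2"
    by (rule LIMSEQ_le_const2) (use M in \<open>auto intro!: exI[of _ M] less_imp_le\<close>)
  then show "\<exists>t. lim (\<lambda>n. min_norm (X n - t)) < e" using e by (intro exI[of _ "X M"]) simp
qed

instance
proof
  fix x y :: "('a, 'b) min_tensor" and r s :: real and U :: "('a, 'b) min_tensor set"
  show "dist x y = norm (x - y)" by (rule dist_min_tensor_def)
  show "sgn x = inverse (norm x) *\<^sub>R x" by (rule sgn_min_tensor_def)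
  show "uniformity = (INF e\<in>{0<..}. principal {(x :: ('a, 'b) min_tensor, y). dist x y < e})"
    by (rule uniformity_min_tensor_def)
  show "open U \<longleftrightarrow> (\<forall>x\<in>U. \<forall>\<^sub>F (x', y) in uniformity. x' = x \<longrightarrow> y \<in> U)"
    by (rule open_min_tensor_def)
  show "r *\<^sub>R (x + y) = r *\<^sub>R x + r *\<^sub>R y" "(r + s) *\<^sub>R x = r *\<^sub>R x + s *\<^sub>R x"
    "r *\<^sub>R s *\<^sub>R x = (r * s) *\<^sub>R x" "1 *\<^sub>R x = x"
    "r *\<^sub>R x * y = r *\<^sub>R (x * y)" "x * r *\<^sub>R y = r *\<^sub>R (x * y)"
    by (simp_all add: scaleR_min_tensor_def scaleC_add_right scaleC_add_left scaleC_scaleC scaleC_one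
        mult_scaleC_left mult_scaleC_right)
  show "norm x = 0 \<longleftrightarrow> x = 0"
  proof transfer
    fix X :: "nat \<Rightarrow> ('a, 'b) alg_tensor"
    assume "min_tensor_rel X X"
    then have X: "min_Cauchy X" by (simp add: min_tensor_rel_refl)
    show "lim (\<lambda>n. min_norm (X n)) = 0 \<longleftrightarrow> min_tensor_rel X (\<lambda>n. 0)"
      using min_norm_lim[OF X] X by (auto simp: min_tensor_rel_def min_Cauchy_const intro: limI)
  qed
  show "norm (x + y) \<le> norm x + norm y" by (rule norm_min_tensor_triangle)
  show "norm (r *\<^sub>R x) = \<bar>r\<bar> * norm x"
    unfolding scaleR_min_tensor_def
  proof transfer
    fix r and X :: "nat \<Rightarrow> ('a, 'b) alg_tensor"
    assume "min_tensor_rel X X"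
    then have X: "min_Cauchy X" by (simp add: min_tensor_rel_refl)
    show "lim (\<lambda>n. min_norm (complex_of_real r *\<^sub>C X n)) = \<bar>r\<bar> * lim (\<lambda>n. min_norm (X n))"
      using tendsto_mult_left[OF min_norm_lim[OF X], of "\<bar>r\<bar>"] by (simp add: min_norm_scaleC limI)
  qed
  show "norm (x * y) \<le> norm x * norm y"
  proof transfer
    fix X Y :: "nat \<Rightarrow> ('a, 'b) alg_tensor"
    assume "min_tensor_rel X X" "min_tensor_rel Y Y"
    then have XY: "min_Cauchy X" "min_Cauchy Y" by (simp_all add: min_tensor_rel_refl)
    show "lim (\<lambda>n. min_norm (X n * Y n)) \<le> lim (\<lambda>n. min_norm (X n)) * lim (\<lambda>n. min_norm (Y n))"
      by (rule LIMSEQ_le[OF min_norm_lim[OF min_Cauchy_mult[OF XY]] tendsto_mult[OF min_norm_lim[OF XY(1)] min_norm_lim[OF XY(2)]]])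
        (auto simp: min_norm_mult)
  qed
qed

end

instance min_tensor :: (cstar_algebra, cstar_algebra) cstar_algebra
proof
  fix x :: "('a, 'b) min_tensor" and r :: real
  show "complex_of_real r *\<^sub>C x = r *\<^sub>R x" by (simp add: scaleR_min_tensor_def)
  show "norm (star x * x) = (norm x)\<^sup>2"
  proof transfer
    fix X :: "nat \<Rightarrow> ('a, 'b) alg_tensor"
    assume "min_tensor_rel X X"
    then have X: "min_Cauchy X" by (simp add: min_tensor_rel_refl)
    show "lim (\<lambda>n. min_norm (star (X n) * X n)) = (lim (\<lambda>n. min_norm (X n)))\<^sup>2"
      using tendsto_power[OF min_norm_lim[OF X], of 2] by (simp add: min_norm_cstar limI)
  qed
next
  fix F :: "nat \<Rightarrow> ('a, 'b) min_tensor"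
  assume F: "Cauchy F"
  have "\<forall>k. \<exists>t. norm (F k - of_alg_tensor t) < 1 / real (Suc k)"
    by (intro allI min_tensor_dense) simp
  then obtain T where T: "\<And>k. norm (F k - of_alg_tensor (T k)) < 1 / real (Suc k)" by metis
  have FC: "\<exists>M. \<forall>m\<ge>M. \<forall>n\<ge>M. norm (F m - F n) < e" if "e > 0" for e
    using F that unfolding Cauchy_def dist_norm by blast
  have C: "min_Cauchy T"
    unfolding min_Cauchy_def
  proof (intro allI impI)
    fix e :: real assume e: "e > 0"
    obtain M where M: "\<forall>m\<ge>M. \<forall>n\<ge>M. norm (F m - F n) < e / 3" using FC[of "e / 3"] e by auto
    obtain K where K: "1 / real (Suc K) < e / 3" using nat_approx_posE[of "e / 3"] e by auto
    have small: "norm (F k - of_alg_tensor (T k)) < e / 3" if "k \<ge> K" for k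
    proof -
      have "1 / real (Suc k) \<le> 1 / real (Suc K)" using that by (simp add: frac_le)
      with T[of k] K show ?thesis by linarith
    qed
    have "min_norm (T m - T n) < e" if "m \<ge> max M K" "n \<ge> max M K" for m n
    proof -
      have "min_norm (T m - T n) = norm (of_alg_tensor (T m) - of_alg_tensor (T n))"
        by (simp add: norm_of_alg_tensor flip: of_alg_tensor_diff)
      also have "\<dots> \<le> norm (of_alg_tensor (T m) - F m) + (norm (F m - F n) + norm (F n - of_alg_tensor (T n)))"
        using norm_triangle_ineq[of "of_alg_tensor (T m) - F m" "F m - F n + (F n - of_alg_tensor (T n))"]
          norm_triangle_ineq[of "F m - F n" "F n - of_alg_tensor (T n)"] by simp
      also have "\<dots> < e / 3 + (e / 3 + e / 3)"
        using small[of m] small[of n] M that by (intro add_strict_mono) (auto simp: norm_minus_commute)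
      finally show ?thesis by simp
    qed
    then show "\<exists>M. \<forall>m\<ge>M. \<forall>n\<ge>M. min_norm (T m - T n) < e" by blast
  qed
  obtain L where L: "\<And>e. e > 0 \<Longrightarrow> \<exists>M. \<forall>k\<ge>M. norm (of_alg_tensor (T k) - L) < e"
  proof
    fix e :: real assume e: "e > 0"
    obtain M where M: "\<forall>m\<ge>M. \<forall>n\<ge>M. min_norm (T m - T n) < e / 2"
      using C e unfolding min_Cauchy_def by (meson half_gt_zero)
    have "norm (of_alg_tensor (T k) - abs_min_tensor T) < e" if k: "k \<ge> M" for k
    proof -
      have rel: "min_tensor_rel T T" "min_tensor_rel (\<lambda>n. T k) (\<lambda>n. T k)"
        using C by (simp_all add: min_tensor_rel_refl min_Cauchy_const)
      have c: "min_Cauchy (\<lambda>n. T k - T n)"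
        by (rule min_Cauchy_diff[OF min_Cauchy_const C])
      have "norm (of_alg_tensor (T k) - abs_min_tensor T) = lim (\<lambda>n. min_norm (T k - T n))"
        using rel c by (simp add: of_alg_tensor.abs_eq minus_min_tensor.abs_eq norm_min_tensor.abs_eq min_tensor_rel_refl)
      also have "\<dots> \<le> e / 2"
        by (rule LIMSEQ_le_const2[OF min_norm_lim[OF c]]) (use M k in \<open>auto intro!: exI[of _ M] less_imp_le\<close>)
      finally show ?thesis using e by simp
    qed
    then show "\<exists>M. \<forall>k\<ge>M. norm (of_alg_tensor (T k) - abs_min_tensor T) < e" by blast
  qed
  have "F \<longlonglongrightarrow> L"
  proof (rule metric_LIMSEQ_I)
    fix e :: real assume e: "e > 0"
    obtain M where M: "\<forall>k\<ge>M. norm (of_alg_tensor (T k) - L) < e / 2" using L[of "e / 2"] e by auto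
    obtain K where K: "1 / real (Suc K) < e / 2" using nat_approx_posE[of "e / 2"] e by auto
    have "dist (F k) L < e" if k: "k \<ge> max M K" for k
    proof -
      have "1 / real (Suc k) \<le> 1 / real (Suc K)" using k by (simp add: frac_le)
      then have "norm (F k - of_alg_tensor (T k)) < e / 2" using T[of k] K by linarith
      moreover have "norm (of_alg_tensor (T k) - L) < e / 2" using M k by simp
      ultimately show ?thesis
        using norm_triangle_ineq[of "F k - of_alg_tensor (T k)" "of_alg_tensor (T k) - L"]
        by (simp add: dist_norm)
    qed
    then show "\<exists>no. \<forall>n\<ge>no. dist (F n) L < e" by blast
  qed
  then show "convergent F" by (rule convergentI)
qed

lemma star_scaleR: "star (r *\<^sub>R x) = r *\<^sub>R star (x :: 'a::cstar_algebra)"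
  using star_scaleC[of "complex_of_real r" x] by (simp add: scaleC_of_real)

lemma bounded_linear_star: "bounded_linear (star :: 'a::cstar_algebra \<Rightarrow> 'a)"
  by (rule bounded_linear_intro[of _ 1]) (simp_all add: star_add star_scaleR norm_star)

lemma bounded_linear_scaleC: "bounded_linear (\<lambda>x :: 'a::cstar_algebra. c *\<^sub>C x)"
proof (rule bounded_linear_intro[of _ "cmod c"])
  fix r and x :: 'a
  show "c *\<^sub>C r *\<^sub>R x = r *\<^sub>R c *\<^sub>C x"
    by (simp add: scaleC_scaleC mult.commute flip: scaleC_of_real)
qed (simp_all add: scaleC_add_right norm_scaleC)

instantiation bcontfun :: (topological_space, cstar_algebra) star_algebra
begin

definition one_bcontfun :: "'a \<Rightarrow>\<^sub>C 'b" where "1 = const_bcontfun (1 :: 'b)"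

definition times_bcontfun :: "('a \<Rightarrow>\<^sub>C 'b) \<Rightarrow> ('a \<Rightarrow>\<^sub>C 'b) \<Rightarrow> 'a \<Rightarrow>\<^sub>C 'b"
  where "f * g = Bcontfun (\<lambda>x. f x * g x)" for f g :: "'a \<Rightarrow>\<^sub>C 'b"

definition scaleC_bcontfun :: "complex \<Rightarrow> ('a \<Rightarrow>\<^sub>C 'b) \<Rightarrow> 'a \<Rightarrow>\<^sub>C 'b"
  where "c *\<^sub>C f = Bcontfun (\<lambda>x. c *\<^sub>C f x)" for f :: "'a \<Rightarrow>\<^sub>C 'b"

definition star_bcontfun :: "('a \<Rightarrow>\<^sub>C 'b) \<Rightarrow> 'a \<Rightarrow>\<^sub>C 'b"
  where "star f = Bcontfun (\<lambda>x. star (f x))" for f :: "'a \<Rightarrow>\<^sub>C 'b"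

lemma one_bcontfun_apply: "(1 :: 'a \<Rightarrow>\<^sub>C 'b) x = 1"
  by (simp add: one_bcontfun_def)

lemma times_bcontfun_apply: "(f * g) x = f x * g x" for f g :: "'a \<Rightarrow>\<^sub>C 'b"
proof -
  have "(\<lambda>x. f x * g x) \<in> bcontfun"
    by (rule bcontfun_normI[of _ "norm f * norm g"])
      (auto intro!: continuous_intros order.trans[OF norm_mult_ineq] mult_mono norm_bounded)
  then show ?thesis by (simp add: times_bcontfun_def Bcontfun_inverse)
qed

lemma bounded_linear_bcontfun:
  fixes T :: "'c::real_normed_vector \<Rightarrow> 'd::real_normed_vector" and f :: "'e::topological_space \<Rightarrow>\<^sub>C 'c"
  assumes "bounded_linear T"
  shows "(\<lambda>x. T (f x)) \<in> bcontfun"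
proof -
  interpret bounded_linear T by fact
  obtain K where "K \<ge> 0" and K: "\<And>x. norm (T x) \<le> norm x * K" using nonneg_bounded by blast
  have "norm (T (f x)) \<le> norm f * K" for x
    using K[of "f x"] mult_right_mono[OF norm_bounded[of f x] \<open>K \<ge> 0\<close>] by linarith
  then show ?thesis by (intro bcontfun_normI continuous_on continuous_on_apply_bcontfun)
qed

lemma scaleC_bcontfun_apply: "(c *\<^sub>C f) x = c *\<^sub>C f x" for f :: "'a \<Rightarrow>\<^sub>C 'b"
  by (simp add: scaleC_bcontfun_def Bcontfun_inverse bounded_linear_bcontfun bounded_linear_scaleC)

lemma star_bcontfun_apply: "star f x = star (f x)" for f :: "'a \<Rightarrow>\<^sub>C 'b"
  by (simp add: star_bcontfun_def Bcontfun_inverse bounded_linear_bcontfun bounded_linear_star)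

instance
  by standard
    (rule bcontfun_eqI; simp add: one_bcontfun_apply times_bcontfun_apply scaleC_bcontfun_apply star_bcontfun_apply
      algebra_simps scaleC_add_right scaleC_add_left scaleC_scaleC scaleC_one mult_scaleC_left mult_scaleC_right
      star_star star_add star_scaleC star_mult)+

end

instance bcontfun :: (topological_space, cstar_algebra) real_normed_algebra
proof
  fix f g :: "'a \<Rightarrow>\<^sub>C 'b" and r :: real
  show "r *\<^sub>R f * g = r *\<^sub>R (f * g)" "f * r *\<^sub>R g = r *\<^sub>R (f * g)"
    by (rule bcontfun_eqI; simp add: times_bcontfun_apply)+
  show "norm (f * g) \<le> norm f * norm g"
    by (rule norm_bound)
      (auto simp: times_bcontfun_apply intro!: order.trans[OF norm_mult_ineq] mult_mono norm_bounded)
qed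

instance bcontfun :: (metric_space, cstar_algebra) cstar_algebra
proof
  fix f :: "'a \<Rightarrow>\<^sub>C 'b" and r :: real
  show "complex_of_real r *\<^sub>C f = r *\<^sub>R f"
    by (rule bcontfun_eqI) (simp add: scaleC_bcontfun_apply scaleC_of_real)
  show "norm (star f * f) = (norm f)\<^sup>2"
  proof (rule antisym)
    show "norm (star f * f) \<le> (norm f)\<^sup>2"
      by (rule norm_bound)
        (simp add: times_bcontfun_apply star_bcontfun_apply cstar_identity power_mono norm_bounded)
    have "norm (f x) \<le> sqrt (norm (star f * f))" for x
      using norm_bounded[of "star f * f" x]
      by (simp add: times_bcontfun_apply star_bcontfun_apply cstar_identity real_le_rsqrt)
    then have "(norm f)\<^sup>2 \<le> (sqrt (norm (star f * f)))\<^sup>2"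
      by (intro power_mono norm_bound) auto
    then show "(norm f)\<^sup>2 \<le> norm (star f * f)" by simp
  qed
qed

typedef unit_interval = "{0..1::real}" by force

instantiation unit_interval :: metric_space
begin

definition dist_unit_interval :: "unit_interval \<Rightarrow> unit_interval \<Rightarrow> real"
  where "dist s t = dist (Rep_unit_interval s) (Rep_unit_interval t)"

definition uniformity_unit_interval :: "(unit_interval \<times> unit_interval) filter"
  where "uniformity_unit_interval = (INF e\<in>{0<..}. principal {(s, t). dist s t < e})"

definition open_unit_interval :: "unit_interval set \<Rightarrow> bool"
  where "open_unit_interval U \<longleftrightarrow> (\<forall>s\<in>U. \<forall>\<^sub>F (s', t) in uniformity. s' = s \<longrightarrow> t \<in> U)"

instance
  by standard
    (simp_all add: dist_unit_interval_def Rep_unit_interval_inject uniformity_unit_interval_def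
      open_unit_interval_def dist_triangle2)

end

instantiation unit_interval :: zero_neq_one
begin

definition zero_unit_interval :: unit_interval where "0 = Abs_unit_interval 0"
definition one_unit_interval :: unit_interval where "1 = Abs_unit_interval 1"

instance
  by standard (simp add: zero_unit_interval_def one_unit_interval_def Abs_unit_interval_inject)

end

definition tensor :: "'a::cstar_algebra \<Rightarrow> 'b::cstar_algebra \<Rightarrow> ('a, 'b) min_tensor"  (infixl \<open>\<otimes>\<close> 70)
  where "a \<otimes> b = of_alg_tensor (elem_tensor a b)"

lemma of_alg_tensor_ops:
  "of_alg_tensor (t + u) = of_alg_tensor t + of_alg_tensor u"
  "of_alg_tensor (t * u) = of_alg_tensor t * of_alg_tensor u"
  "of_alg_tensor (c *\<^sub>C t) = c *\<^sub>C of_alg_tensor t"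
  "of_alg_tensor (star t) = star (of_alg_tensor t)"
  "of_alg_tensor 1 = 1" "of_alg_tensor 0 = 0"
  by (transfer, simp add: min_tensor_rel_refl min_Cauchy_const)+

lemma tensor_add_left: "(a + a') \<otimes> b = a \<otimes> b + a' \<otimes> b"
  and tensor_add_right: "a \<otimes> (b + b') = a \<otimes> b + a \<otimes> b'"
  and tensor_scaleC_left: "(c *\<^sub>C a) \<otimes> b = c *\<^sub>C (a \<otimes> b)"
  and tensor_scaleC_right: "a \<otimes> (c *\<^sub>C b) = c *\<^sub>C (a \<otimes> b)"
  and tensor_mult: "(a \<otimes> b) * (a' \<otimes> b') = (a * a') \<otimes> (b * b')"
  and star_tensor: "star (a \<otimes> b) = star a \<otimes> star b"
  and tensor_one: "1 \<otimes> 1 = 1"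
  by (simp_all add: tensor_def elem_tensor_ops flip: of_alg_tensor_ops)

lemma norm_tensor_le: "norm (a \<otimes> b) \<le> norm a * norm b"
  unfolding tensor_def norm_of_alg_tensor
proof (rule min_norm_leI)
  fix \<phi> :: "'a \<Rightarrow> complex" and \<psi> :: "'b \<Rightarrow> complex" and s
  assume st: "state \<phi>" "state \<psi>"
  let ?p = "gns_seminorm (product_functional \<phi> \<psi>)"
  note pos = product_functional_positive[OF st]
  have "elem_tensor a b * s = elem_tensor a 1 * (elem_tensor 1 b * s)"
    by (simp add: elem_tensor_ops flip: mult.assoc)
  moreover have "?p (elem_tensor a 1 * (elem_tensor 1 b * s)) \<le> norm a * ?p (elem_tensor 1 b * s)"
    by (rule gns_seminorm_mult_aux[OF pos])
      (auto simp: elem_tensor_ops star_one product_functional_bounded[OF st])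
  moreover have "?p (elem_tensor 1 b * s) \<le> norm b * ?p s"
    by (rule gns_seminorm_mult_aux[OF pos])
      (auto simp: elem_tensor_ops star_one product_functional_bounded[OF st])
  ultimately show "?p (elem_tensor a b * s) \<le> norm a * norm b * ?p s"
    by (smt (verit, best) mult.assoc mult_left_mono norm_ge_zero)
qed simp

text \<open>\<open>tensor_lift \<beta>\<close> is the bounded linear map determined by its values \<open>\<beta> a b\<close> on elementary tensors.
  It is unspecified if no such map exists; for the maps below it does.\<close>

definition tensor_lift ::
    "('a::cstar_algebra \<Rightarrow> 'b::cstar_algebra \<Rightarrow> 'c::cstar_algebra) \<Rightarrow> ('a, 'b) min_tensor \<Rightarrow> 'c"
  where "tensor_lift \<beta> = (THE T. bounded_clinear T \<and> (\<forall>a b. T (a \<otimes> b) = \<beta> a b))"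

lemma bounded_clinear_tensor_unique:
  assumes S: "bounded_clinear S" and T: "bounded_clinear T"
    and eq: "\<And>a b. S (a \<otimes> b) = T (a \<otimes> b)"
  shows "S = T"
proof
  fix x
  have lin: "clinear S" "clinear T" "bounded_linear S" "bounded_linear T"
    using S T by (auto simp: bounded_clinear_def)
  have alg: "S (of_alg_tensor t) = T (of_alg_tensor t)" for t
  proof (induction t rule: alg_tensor_induct_aux)
    case 1
    then show ?case by (simp add: of_alg_tensor_ops clinear_eqs(4)[OF lin(1)] clinear_eqs(4)[OF lin(2)])
  next
    case (2 a b t)
    then show ?case
      using eq[of a b] by (simp add: of_alg_tensor_ops tensor_def clinear_eqs(1)[OF lin(1)] clinear_eqs(1)[OF lin(2)])
  qed
  interpret D: bounded_linear "\<lambda>x. S x - T x" by (rule bounded_linear_sub[OF lin(3,4)])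
  obtain K where "K > 0" and K: "\<And>x. norm (S x - T x) \<le> norm x * K" using D.pos_bounded by blast
  have "norm (S x - T x) \<le> 0 + e" if e: "e > 0" for e
  proof -
    obtain t where t: "norm (x - of_alg_tensor t) < e / K"
      using min_tensor_dense[of "e / K" x] e \<open>K > 0\<close> by auto
    have "S x - T x = S (x - of_alg_tensor t) - T (x - of_alg_tensor t)"
      by (simp add: D.diff[of x "of_alg_tensor t"] alg)
    also have "norm \<dots> \<le> norm (x - of_alg_tensor t) * K" by (rule K)
    also have "\<dots> \<le> e" using t \<open>K > 0\<close> by (simp add: field_simps)
    finally show ?thesis by simp
  qed
  then have "norm (S x - T x) \<le> 0" by (rule field_le_epsilon)
  then show "S x = T x" by simp
qed

lemma tensor_lift_eq:
  assumes "bounded_clinear T" "\<And>a b. T (a \<otimes> b) = \<beta> a b"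
  shows "tensor_lift \<beta> = T"
  unfolding tensor_lift_def
  by (rule the_equality) (use assms in \<open>auto intro!: bounded_clinear_tensor_unique\<close>)

lemma bounded_linear_tensor_left: "bounded_linear (\<lambda>a. a \<otimes> b)"
  by (rule bounded_linear_intro[of _ "norm b"])
    (simp_all add: tensor_add_left tensor_scaleC_left norm_tensor_le flip: scaleC_of_real)

definition tensor_map ::
    "('a::cstar_algebra \<Rightarrow> 'c::cstar_algebra) \<Rightarrow> ('b::cstar_algebra \<Rightarrow> 'd::cstar_algebra)
      \<Rightarrow> ('a, 'b) min_tensor \<Rightarrow> ('c, 'd) min_tensor"
  where "tensor_map f g = tensor_lift (\<lambda>a b. f a \<otimes> g b)"

definition tensor_assoc ::
    "('a::cstar_algebra, ('b::cstar_algebra, 'c::cstar_algebra) min_tensor) min_tensor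
      \<Rightarrow> (('a, 'b) min_tensor, 'c) min_tensor"
  where "tensor_assoc = tensor_lift (\<lambda>a. tensor_lift (\<lambda>b c. (a \<otimes> b) \<otimes> c))"

text \<open>The canonical isomorphism of \<open>C([0,1],B) \<otimes> C\<close> with \<open>C([0,1],B \<otimes> C)\<close>.\<close>

definition path_tensor ::
    "(unit_interval \<Rightarrow>\<^sub>C 'b::cstar_algebra, 'c::cstar_algebra) min_tensor \<Rightarrow> (unit_interval \<Rightarrow>\<^sub>C ('b, 'c) min_tensor)"
  where "path_tensor = tensor_lift (\<lambda>f c. Bcontfun (\<lambda>t. apply_bcontfun f t \<otimes> c))"

lemma elem_path_apply: "apply_bcontfun (Bcontfun (\<lambda>t. apply_bcontfun f t \<otimes> c)) t = apply_bcontfun f t \<otimes> c"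
  by (subst Bcontfun_inverse[OF bounded_linear_bcontfun[OF bounded_linear_tensor_left]]) (rule refl)

definition star_hom :: "('a::star_algebra \<Rightarrow> 'b::star_algebra) \<Rightarrow> bool"
  where "star_hom f \<longleftrightarrow> clinear f \<and> (\<forall>x y. f (x * y) = f x * f y) \<and> (\<forall>x. f (star x) = star (f x)) \<and> f 1 = 1"

text \<open>The real span of the complex multiples is the complex span.\<close>

definition cls :: "'a::cstar_algebra set \<Rightarrow> 'a set"
  where "cls S = closure (span {c *\<^sub>C x |c x. x \<in> S})"

definition compact_quantum_group :: "('h::cstar_algebra \<Rightarrow> ('h, 'h) min_tensor) \<Rightarrow> bool"
  where "compact_quantum_group \<Delta> \<longleftrightarrow>
    star_hom \<Delta> \<and> inj \<Delta> \<and>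
    tensor_map \<Delta> id \<circ> \<Delta> = tensor_assoc \<circ> tensor_map id \<Delta> \<circ> \<Delta> \<and>
    cls {\<Delta> g * (1 \<otimes> h) |g h. True} = UNIV \<and>
    cls {(g \<otimes> 1) * \<Delta> h |g h. True} = UNIV"

definition action ::
    "('h::cstar_algebra \<Rightarrow> ('h, 'h) min_tensor) \<Rightarrow> ('a::cstar_algebra \<Rightarrow> ('a, 'h) min_tensor) \<Rightarrow> bool"
  where "action \<Delta> \<delta> \<longleftrightarrow>
    star_hom \<delta> \<and> inj \<delta> \<and>
    tensor_map \<delta> id \<circ> \<delta> = tensor_assoc \<circ> tensor_map id \<Delta> \<circ> \<delta> \<and>
    cls {\<delta> a * (1 \<otimes> h) |a h. True} = UNIV"

definition free_action ::
    "('h::cstar_algebra \<Rightarrow> ('h, 'h) min_tensor) \<Rightarrow> ('a::cstar_algebra \<Rightarrow> ('a, 'h) min_tensor) \<Rightarrow> bool"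
  where "free_action \<Delta> \<delta> \<longleftrightarrow> action \<Delta> \<delta> \<and> cls {(x \<otimes> 1) * \<delta> y |x y. True} = UNIV"

text \<open>Colinearity only; that \<open>f\<close> is a *-homomorphism is stated separately by \<^const>\<open>star_hom\<close>.\<close>

definition equivariant ::
    "('a::cstar_algebra \<Rightarrow> ('a, 'h::cstar_algebra) min_tensor) \<Rightarrow> ('b::cstar_algebra \<Rightarrow> ('b, 'h) min_tensor)
      \<Rightarrow> ('a \<Rightarrow> 'b) \<Rightarrow> bool"
  where "equivariant \<delta>\<^sub>A \<delta>\<^sub>B f \<longleftrightarrow> \<delta>\<^sub>B \<circ> f = tensor_map f id \<circ> \<delta>\<^sub>A"

text \<open>The cone and the join are given as C*-subalgebras of \<open>C([0,1],A)\<close> and \<open>C([0,1],A \<otimes> H)\<close>; a *-homomorphism into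
  one of them is a *-homomorphism into the ambient algebra with range in the subalgebra.\<close>

definition nc_cone :: "(unit_interval \<Rightarrow>\<^sub>C 'a::cstar_algebra) set"
  where "nc_cone = {f. apply_bcontfun f 0 \<in> range (\<lambda>c. c *\<^sub>C 1)}"

definition nc_join ::
    "('a::cstar_algebra \<Rightarrow> ('a, 'h::cstar_algebra) min_tensor) \<Rightarrow> (unit_interval \<Rightarrow>\<^sub>C ('a, 'h) min_tensor) set"
  where "nc_join \<delta> = {f. apply_bcontfun f 0 \<in> range (\<lambda>h. 1 \<otimes> h) \<and> apply_bcontfun f 1 \<in> range \<delta>}"

text \<open>The map \<open>f \<mapsto> (id \<otimes> \<Delta>) \<circ> f\<close>. It induces the coaction of the join through
  \<open>(A \<circledast> H) \<otimes> H \<subseteq> C([0,1],A \<otimes> H) \<otimes> H \<cong> C([0,1],A \<otimes> H \<otimes> H)\<close>; accordingly both sides of the colinearity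
  equation for maps into the join are compared in \<open>C([0,1],A \<otimes> H \<otimes> H)\<close>.\<close>

definition join_coaction ::
    "('h::cstar_algebra \<Rightarrow> ('h, 'h) min_tensor) \<Rightarrow> (unit_interval \<Rightarrow>\<^sub>C ('a::cstar_algebra, 'h) min_tensor)
      \<Rightarrow> (unit_interval \<Rightarrow>\<^sub>C (('a, 'h) min_tensor, 'h) min_tensor)"
  where "join_coaction \<Delta> f = Bcontfun (\<lambda>t. tensor_assoc (tensor_map id \<Delta> (f t)))"

definition join_equivariant ::
    "('h::cstar_algebra \<Rightarrow> ('h, 'h) min_tensor) \<Rightarrow> ('a::cstar_algebra \<Rightarrow> ('a, 'h) min_tensor)
      \<Rightarrow> ('a \<Rightarrow> (unit_interval \<Rightarrow>\<^sub>C ('a, 'h) min_tensor)) \<Rightarrow> bool"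
  where "join_equivariant \<Delta> \<delta> f \<longleftrightarrow> join_coaction \<Delta> \<circ> f = path_tensor \<circ> tensor_map f id \<circ> \<delta>"

definition character :: "('a::cstar_algebra \<Rightarrow> complex) \<Rightarrow> bool"
  where "character \<kappa> \<longleftrightarrow> star_hom \<kappa>"

definition convolution ::
    "('h::cstar_algebra \<Rightarrow> ('h, 'h) min_tensor) \<Rightarrow> ('h \<Rightarrow> complex) \<Rightarrow> ('h \<Rightarrow> complex) \<Rightarrow> 'h \<Rightarrow> complex"
  where "convolution \<Delta> \<kappa>\<^sub>1 \<kappa>\<^sub>2 = tensor_lift (\<lambda>g h. \<kappa>\<^sub>1 g * \<kappa>\<^sub>2 h) \<circ> \<Delta>"

text \<open>Uniquely determined if \<open>H\<close> admits a character, and unspecified otherwise.\<close>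

definition counit :: "('h::cstar_algebra \<Rightarrow> ('h, 'h) min_tensor) \<Rightarrow> 'h \<Rightarrow> complex"
  where "counit \<Delta> = (THE \<epsilon>. character \<epsilon> \<and>
    (\<forall>\<kappa>. character \<kappa> \<longrightarrow> convolution \<Delta> \<epsilon> \<kappa> = \<kappa> \<and> convolution \<Delta> \<kappa> \<epsilon> = \<kappa>))"

primrec convolution_power ::
    "('h::cstar_algebra \<Rightarrow> ('h, 'h) min_tensor) \<Rightarrow> ('h \<Rightarrow> complex) \<Rightarrow> nat \<Rightarrow> 'h \<Rightarrow> complex"
  where
    "convolution_power \<Delta> \<kappa> 0 = counit \<Delta>"
  | "convolution_power \<Delta> \<kappa> (Suc n) = convolution \<Delta> (convolution_power \<Delta> \<kappa> n) \<kappa>"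

end

theory Submission
  imports Defs "HOL-Homology.Simplices" "HOL-Number_Theory.Cong"
begin

text \<open>An equivariant map into the join yields a map into the cone by slicing with the counit, and \<open>\<gamma>\<close> yields conversely
  the map \<open>a \<mapsto> (\<gamma> \<otimes> id)(\<delta> a)\<close>. The counit is an idempotent of the compact cancellative semigroup of characters of \<open>H\<close>.

  A character \<open>\<kappa>\<close> of finite order acts on \<open>A\<close>, and so induces a cyclic action \<open>s\<close> on the space \<open>X\<close> of characters of \<open>A\<close>.
  Given \<open>\<gamma>\<close>, this space is nonempty because \<open>\<gamma>\<close> evaluated at 0 is a character, and \<open>x \<mapsto> x \<circ> ev\<^sub>1 \<circ> \<gamma>\<close> is an
  \<open>s\<close>-equivariant self-map of \<open>X\<close> that is homotopic to a constant. Since \<open>\<delta>\<close> is free, finitely many elements of \<open>A\<close>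
  separate the points of every \<open>s\<close>-orbit uniformly, which gives labels in a finite-dimensional join of cyclic groups.
  The self-map allows the construction of equivariant singular chains of all dimensions as in the bar resolution, and
  pairing them with cochains on the labels yields 1 modulo the order in every dimension, although it is 0 in high ones.\<close>

section \<open>Square roots and contractivity of *-homomorphisms\<close>

text \<open>The maps out of minimal tensor products in the statement are
  \<open>tensor_lift\<close>s, hence unspecified until their existence is proved. The obstacle is
  continuity for \<open>min_norm\<close>, a supremum over pairs of states: a homomorphism on
  algebraic tensors is controlled by testing it with states of its target, and the target must have
  enough of them. This is why positivity of \<open>star x * x\<close> and Hahn-Banach come into
  play; square roots obtained as fixed points of contractions take the place of spectral theory.

  In the topological half the chains satisfy \<partial>c_{d+1} = (s - 1) c_d for even d and
  \<partial>c_{d+1} = (1 + s + ... + s^(k-1)) c_d for odd d, the pattern of the periodic resolution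
  of the cyclic group of order k. The cochains satisfy the transposed relations modulo k, so the
  pairing passes from one dimension to the next. The labelling need not be continuous: it suffices
  that after subdivision the labels of the vertices of each simplex span a simplex of the
  join.\<close>

lemma scaleC_minus_left: "(- c) *\<^sub>C x = - (c *\<^sub>C (x :: 'a::star_algebra))"
  using scaleC_scaleC[of "-1" c x] unfolding scaleC_minus_one by simp

lemma scaleC_minus_right: "c *\<^sub>C (- x) = - (c *\<^sub>C (x :: 'a::star_algebra))"
  using scaleC_scaleC[of c "-1" x] unfolding scaleC_minus_one by (simp add: scaleC_minus_left)

lemma scaleC_diff_right: "c *\<^sub>C (x - y) = c *\<^sub>C x - c *\<^sub>C (y :: 'a::star_algebra)"
  using scaleC_add_right[of c x "- y"] by (simp add: scaleC_minus_right)

lemma norm_one_le: "norm (1 :: 'a::cstar_algebra) \<le> 1"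
proof -
  have "norm (1 :: 'a) * norm (1 :: 'a) = norm (star 1 * (1 :: 'a))"
    by (simp only: cstar_identity power2_eq_square)
  then have "norm (1 :: 'a) * norm (1 :: 'a) = norm (1 :: 'a)"
    by (simp only: star_one mult_1_left)
  then have "norm (1 :: 'a) = 0 \<or> norm (1 :: 'a) = 1"
    by (simp only: mult_cancel_left2)
  then show ?thesis by linarith
qed

lemma norm_scaleR_one_le: "norm (r *\<^sub>R (1 :: 'a::cstar_algebra)) \<le> \<bar>r\<bar>"
  using mult_left_mono[OF norm_one_le, of "\<bar>r\<bar>"] by simp

lemma continuous_on_star: "continuous_on S f \<Longrightarrow> continuous_on S (\<lambda>x. star (f x :: 'a::cstar_algebra))"
  by (rule bounded_linear.continuous_on[OF bounded_linear_star])

text \<open>If \<open>a\<close> and \<open>b\<close> are commuting self-adjoint elements, then \<open>a\<close> is the real part of \<open>u = a + i b\<close>, and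
  \<open>u\<^sup>* u = a\<^sup>2 + b\<^sup>2\<close>.\<close>

lemma norm_le_sum_squares:
  fixes a b :: "'a::cstar_algebra"
  assumes "star a = a" "star b = b" "a * b = b * a"
  shows "(norm a)\<^sup>2 \<le> norm (a * a + b * b)"
proof -
  define u where "u = a + \<i> *\<^sub>C b"
  have su: "star u = a - \<i> *\<^sub>C b"
    by (simp add: u_def star_add star_scaleC assms scaleC_minus_left)
  have ii: "\<i> *\<^sub>C \<i> *\<^sub>C x = - x" for x :: 'a
    by (simp add: scaleC_scaleC scaleC_minus_one)
  have uu: "star u * u = a * a + b * b"
    unfolding su
    by (simp add: u_def algebra_simps mult_scaleC_left mult_scaleC_right ii assms(3) scaleC_diff_right scaleC_add_right)
  have "a + a = u + star u" unfolding su by (simp add: u_def)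
  then have "norm (2 *\<^sub>R a) \<le> norm u + norm u"
    using norm_triangle_ineq[of u "star u"] by (simp add: norm_star scaleR_2)
  then have "norm a \<le> norm u" by simp
  then have "(norm a)\<^sup>2 \<le> (norm u)\<^sup>2" by (simp add: power_mono)
  also have "\<dots> = norm (a * a + b * b)" by (simp add: uu flip: cstar_identity)
  finally show ?thesis .
qed

text \<open>Writing the root as \<open>1 - b\<close> turns the equation into
  \<open>2 b = x + b * b\<close>, so \<open>b\<close> is a fixed point of a contraction.
  Self-adjointness and commutation with everything that commutes with \<open>x\<close> are closed
  conditions built into the domain \<open>S\<close>, so the fixed point inherits them. The last
  clause makes the root positive in the sense of \<open>cpos\<close> below.\<close>

lemma ex_sqrt_one_minus:
  fixes x :: "'a::cstar_algebra"
  assumes x: "star x = x" "norm x < 1"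
  shows "\<exists>k. star k = k \<and> k * k = 1 - x \<and> (\<forall>w. w * x = x * w \<longrightarrow> w * k = k * w) \<and> norm (1 - k) \<le> 1"
proof -
  \<comment> \<open>The smaller root of \<open>\<rho> = (norm x + \<rho>\<^sup>2) / 2\<close>: the
    ball of radius \<rho> is mapped into itself, and \<rho> is also the contraction factor on
    it.\<close>
  define \<rho> where "\<rho> = 1 - sqrt (1 - norm x)"
  have \<rho>: "0 \<le> \<rho>" "\<rho> < 1" using x(2) by (auto simp: \<rho>_def)
  have "(1 - \<rho>)\<^sup>2 = 1 - norm x" using x(2) by (simp add: \<rho>_def)
  then have \<rho>2: "(norm x + \<rho> * \<rho>) / 2 = \<rho>" by (simp add: power2_eq_square algebra_simps)
  define S where "S = {b. norm b \<le> \<rho> \<and> star b = b \<and> (\<forall>w. w * x = x * w \<longrightarrow> w * b = b * w)}"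
  define f where "f b = (1/2) *\<^sub>R (x + b * b)" for b
  have "S = {b. norm b \<le> \<rho>} \<inter> {b. star b = b} \<inter> (\<Inter>w\<in>{w. w * x = x * w}. {b. w * b = b * w})"
    by (auto simp: S_def)
  moreover have "closed \<dots>"
    by (intro closed_Int closed_INT ballI closed_Collect_le closed_Collect_eq continuous_intros continuous_on_star)
  ultimately have "complete S" by (simp add: complete_eq_closed)
  moreover have "S \<noteq> {}"
    using \<rho> by (auto simp: S_def star_zero intro!: exI[of _ 0])
  moreover have "f ` S \<subseteq> S"
  proof
    fix c assume "c \<in> f ` S"
    then obtain b where b: "norm b \<le> \<rho>" "star b = b" "\<And>w. w * x = x * w \<Longrightarrow> w * b = b * w" and c: "c = f b"
      by (auto simp: S_def)
    have "norm (b * b) \<le> \<rho> * \<rho>"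
      using norm_mult_ineq[of b b] mult_mono[OF b(1,1)] \<rho>(1) by simp
    then have "norm (f b) \<le> (norm x + \<rho> * \<rho>) / 2"
      using norm_triangle_ineq[of x "b * b"] by (simp add: f_def)
    moreover have "star (f b) = f b"
      by (simp add: f_def star_scaleR star_add star_mult b(2) x(1))
    moreover have "w * f b = f b * w" if "w * x = x * w" for w
    proof -
      have "w * (b * b) = (b * b) * w" using b(3)[OF that] by (metis mult.assoc)
      then show ?thesis using that by (simp add: f_def algebra_simps)
    qed
    ultimately show "c \<in> S" by (simp add: S_def c \<rho>2)
  qed
  moreover have "dist (f b) (f c) \<le> \<rho> * dist b c" if "b \<in> S" "c \<in> S" for b c
  proof -
    have nb: "norm b \<le> \<rho>" "norm c \<le> \<rho>" using that by (auto simp: S_def)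
    have e: "f b - f c = (1/2) *\<^sub>R (b * (b - c) + (b - c) * c)"
      by (simp add: f_def algebra_simps)
    have "norm (b * (b - c) + (b - c) * c) \<le> norm b * norm (b - c) + norm (b - c) * norm c"
      by (intro norm_triangle_le add_mono norm_mult_ineq)
    also have "\<dots> \<le> \<rho> * norm (b - c) + norm (b - c) * \<rho>"
      by (intro add_mono mult_right_mono mult_left_mono nb) auto
    finally show ?thesis by (simp add: dist_norm e)
  qed
  ultimately have "\<exists>!b. b \<in> S \<and> f b = b"
    using \<rho> by (intro Banach_fix[of S \<rho> f]) auto
  then obtain b where b: "b \<in> S" "f b = b" by blast
  show ?thesis
  proof (intro exI[of _ "1 - b"] conjI allI impI)
    show "star (1 - b) = 1 - b" using b(1) by (simp add: S_def star_diff star_one)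
    have "2 *\<^sub>R b = x + b * b" using b(2) by (metis f_def scaleR_half_double scaleR_2 scaleR_right_distrib)
    then have "b + b = x + b * b" by (simp add: scaleR_2)
    then show "(1 - b) * (1 - b) = 1 - x" by (simp add: algebra_simps)
    show "w * (1 - b) = (1 - b) * w" if "w * x = x * w" for w
      using b(1) that by (auto simp: S_def algebra_simps)
    show "norm (1 - (1 - b)) \<le> 1" using b(1) \<rho> by (simp add: S_def)
  qed
qed

lemma star_homD:
  assumes "star_hom f"
  shows "clinear f" "f (x * y) = f x * f y" "f (star x) = star (f x)" "f 1 = 1"
    "f (x + y) = f x + f y" "f (x - y) = f x - f y" "f (c *\<^sub>C x) = c *\<^sub>C f x" "f 0 = 0" "f (- x) = - f x"
  using assms clinear_eqs[of f] by (auto simp: star_hom_def)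

lemma clinear_scaleR:
  assumes "clinear (f :: 'a::cstar_algebra \<Rightarrow> 'b::cstar_algebra)"
  shows "f (r *\<^sub>R x) = r *\<^sub>R f x"
  using clinear_eqs(2)[OF assms, of "complex_of_real r" x] by (simp add: scaleC_of_real)

text \<open>After scaling to norm below 1, \<open>z * z + k * k = 1\<close> for a root
  \<open>k\<close> commuting with \<open>z\<close>. A homomorphism preserves this identity, and
  \<open>norm_le_sum_squares\<close> in the codomain turns it into the bound.\<close>

lemma norm_star_hom_self_adjoint_le:
  fixes f :: "'a::cstar_algebra \<Rightarrow> 'b::cstar_algebra"
  assumes f: "star_hom f" and y: "star y = y"
  shows "norm (f y) \<le> norm y"
proof (rule dense_ge)
  fix r assume r: "norm y < r"
  then have r0: "r > 0" using norm_ge_zero[of y] by linarith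
  define z where "z = (1 / r) *\<^sub>R y"
  have "norm z < 1" using r r0 by (simp add: z_def divide_less_eq)
  then have "norm z * norm z < 1 * 1" by (intro mult_strict_mono') auto
  then have nz: "norm (z * z) < 1" using norm_mult_ineq[of z z] by linarith
  have sz: "star z = z" by (simp add: z_def star_scaleR y)
  then have "star (z * z) = z * z" by (simp only: star_mult)
  from ex_sqrt_one_minus[OF this nz]
  obtain k where k: "star k = k" "k * k = 1 - z * z" "\<forall>w. w * (z * z) = (z * z) * w \<longrightarrow> w * k = k * w"
    by blast
  note F = star_homD[OF f]
  have "z * k = k * z" by (rule k(3)[rule_format]) (simp only: mult.assoc)
  then have "f z * f k = f k * f z" by (simp only: F(2)[symmetric])
  moreover have "star (f z) = f z" "star (f k) = f k" by (simp_all only: F(3)[symmetric] sz k(1))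
  ultimately have "(norm (f z))\<^sup>2 \<le> norm (f z * f z + f k * f k)"
    by (intro norm_le_sum_squares)
  also have "f z * f z + f k * f k = f (z * z + k * k)" by (simp add: F(2,5))
  also have "\<dots> = 1" by (simp add: k(2) F(4))
  finally have "(norm (f z))\<^sup>2 \<le> 1\<^sup>2" using norm_one_le[where 'a = 'b] by simp
  then have "norm (f z) \<le> 1" by (rule power2_le_imp_le) simp
  moreover have "f y = r *\<^sub>R f z"
    using r0 by (simp add: z_def clinear_scaleR[OF F(1)])
  ultimately show "norm (f y) \<le> r" using r0 by simp
qed

lemma norm_star_hom_le:
  fixes f :: "'a::cstar_algebra \<Rightarrow> 'b::cstar_algebra"
  assumes f: "star_hom f"
  shows "norm (f x) \<le> norm x"
proof -
  have "(norm (f x))\<^sup>2 = norm (f (star x * x))"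
    unfolding star_homD(2,3)[OF f] cstar_identity ..
  also have "\<dots> \<le> norm (star x * x)"
    by (rule norm_star_hom_self_adjoint_le[OF f]) (simp only: star_mult star_star)
  also have "\<dots> = (norm x)\<^sup>2" by (rule cstar_identity)
  finally show ?thesis by (rule power2_le_imp_le) simp
qed

lemma bounded_clinear_star_hom:
  fixes f :: "'a::cstar_algebra \<Rightarrow> 'b::cstar_algebra"
  assumes "star_hom f"
  shows "bounded_clinear f"
  unfolding bounded_clinear_def
proof
  show "bounded_linear f"
    by (rule bounded_linear_intro[of _ 1])
      (simp_all add: star_homD[OF assms] clinear_scaleR norm_star_hom_le assms)
qed (rule star_homD(1)[OF assms])

section \<open>Positive elements\<close>

text \<open>Positivity without the spectrum: for self-adjoint \<open>y\<close> the inequality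
  confines the spectrum to \<open>[0, 2 r]\<close>. In this form the triangle inequality shows that
  positive elements can be added.\<close>

definition cpos :: "'a::cstar_algebra \<Rightarrow> bool"
  where "cpos y \<longleftrightarrow> star y = y \<and> (\<exists>r. norm (r *\<^sub>R 1 - y) \<le> r)"

lemma cpos_star: "cpos y \<Longrightarrow> star y = y"
  by (simp add: cpos_def)

lemma cposI: "star y = y \<Longrightarrow> norm (r *\<^sub>R 1 - y) \<le> r \<Longrightarrow> cpos y"
  by (auto simp: cpos_def)

lemma star_scaleR_one: "star (r *\<^sub>R 1 :: 'a::cstar_algebra) = r *\<^sub>R 1"
  by (simp add: star_scaleR star_one)

lemma cpos_add:
  assumes "cpos x" "cpos y"
  shows "cpos (x + y)"
proof -
  obtain r s where rs: "norm (r *\<^sub>R 1 - x) \<le> r" "norm (s *\<^sub>R 1 - y) \<le> s"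
    using assms by (auto simp: cpos_def)
  have "(r + s) *\<^sub>R 1 - (x + y) = (r *\<^sub>R 1 - x) + (s *\<^sub>R 1 - y)"
    by (simp add: scaleR_left_distrib)
  then have "norm ((r + s) *\<^sub>R 1 - (x + y)) \<le> r + s"
    using norm_triangle_mono[OF rs] by (simp only:)
  moreover have "star (x + y) = x + y" using assms by (simp add: star_add cpos_star)
  ultimately show ?thesis by (intro cposI)
qed

lemma cpos_scaleR:
  assumes "cpos x" "c \<ge> 0"
  shows "cpos (c *\<^sub>R x)"
proof -
  obtain r where r: "norm (r *\<^sub>R 1 - x) \<le> r" using assms by (auto simp: cpos_def)
  have "(c * r) *\<^sub>R 1 - c *\<^sub>R x = c *\<^sub>R (r *\<^sub>R 1 - x)" by (simp add: scaleR_right_diff_distrib)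
  then have "norm ((c * r) *\<^sub>R 1 - c *\<^sub>R x) \<le> c * r"
    using mult_left_mono[OF r assms(2)] assms(2) by simp
  moreover have "star (c *\<^sub>R x) = c *\<^sub>R x" using assms by (simp add: star_scaleR cpos_star)
  ultimately show ?thesis by (intro cposI)
qed

lemma cpos_scaleR_one: "c \<ge> 0 \<Longrightarrow> cpos (c *\<^sub>R 1)"
  by (rule cposI[OF star_scaleR_one, of c]) simp

lemma cpos_add_scaleR_one: "cpos x \<Longrightarrow> c \<ge> 0 \<Longrightarrow> cpos (x + c *\<^sub>R 1)"
  by (intro cpos_add cpos_scaleR_one)

lemma norm_self_adjoint_add_cpos: "star y = y \<Longrightarrow> cpos (y + norm y *\<^sub>R 1)"
  by (rule cposI[of _ "norm y"]) (simp_all add: star_add star_scaleR_one norm_minus_commute)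

lemma cpos_norm_minus: "star y = y \<Longrightarrow> cpos (norm y *\<^sub>R 1 - y)"
  using norm_self_adjoint_add_cpos[of "- y"] by (simp add: star_minus)

lemma ex_sqrt_scaled:
  fixes y :: "'a::cstar_algebra"
  assumes y: "star y = y" "norm (r *\<^sub>R 1 - y) < r"
  shows "\<exists>k. cpos k \<and> k * k = y \<and> (\<forall>w. w * y = y * w \<longrightarrow> w * k = k * w)"
proof -
  have r: "r > 0" using y(2) norm_ge_zero[of "r *\<^sub>R 1 - y"] by linarith
  define x where "x = (1 / r) *\<^sub>R (r *\<^sub>R 1 - y)"
  have sx: "star x = x" by (simp add: x_def star_scaleR star_diff star_one y(1))
  have nx: "norm x < 1" using y(2) r by (simp add: x_def divide_less_eq)
  have e: "r *\<^sub>R (1 - x) = y" using r by (simp add: x_def scaleR_right_diff_distrib)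
  from ex_sqrt_one_minus[OF sx nx]
  obtain k where k: "star k = k" "k * k = 1 - x" "\<forall>w. w * x = x * w \<longrightarrow> w * k = k * w" "norm (1 - k) \<le> 1"
    by blast
  show ?thesis
  proof (intro exI[of _ "sqrt r *\<^sub>R k"] conjI allI impI)
    show "cpos (sqrt r *\<^sub>R k)"
      by (intro cpos_scaleR cposI[of k 1]) (use k(1,4) r in auto)
    show "(sqrt r *\<^sub>R k) * (sqrt r *\<^sub>R k) = y" using r by (simp add: k(2) e)
    show "w * (sqrt r *\<^sub>R k) = (sqrt r *\<^sub>R k) * w" if "w * y = y * w" for w
    proof -
      have "w * x = x * w" using that by (simp add: x_def right_diff_distrib left_diff_distrib)
      then have "w * k = k * w" by (rule k(3)[rule_format])
      then show ?thesis by simp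
    qed
  qed
qed

text \<open>The shift by \<open>e\<close> makes the inequality in \<open>cpos\<close> strict, as the
  contraction requires. Later proofs take roots of shifted elements and let \<open>e\<close> tend to
  0.\<close>

lemma ex_sqrt_cpos:
  fixes y :: "'a::cstar_algebra"
  assumes y: "cpos y" and e: "e > 0"
  shows "\<exists>k. cpos k \<and> k * k = y + e *\<^sub>R 1 \<and> (\<forall>w. w * y = y * w \<longrightarrow> w * k = k * w)"
proof -
  obtain r where r: "norm (r *\<^sub>R 1 - y) \<le> r" using y by (auto simp: cpos_def)
  have "(r + e) *\<^sub>R 1 - (y + e *\<^sub>R 1) = r *\<^sub>R 1 - y" by (simp add: scaleR_left_distrib)
  then have "norm ((r + e) *\<^sub>R 1 - (y + e *\<^sub>R 1)) \<le> r" using r by (simp only:)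
  then have "norm ((r + e) *\<^sub>R 1 - (y + e *\<^sub>R 1)) < r + e" using e by linarith
  moreover have "star (y + e *\<^sub>R 1) = y + e *\<^sub>R 1" by (simp add: star_add star_scaleR_one cpos_star[OF y])
  ultimately obtain k where k: "cpos k" "k * k = y + e *\<^sub>R 1" "\<forall>w. w * (y + e *\<^sub>R 1) = (y + e *\<^sub>R 1) * w \<longrightarrow> w * k = k * w"
    using ex_sqrt_scaled by blast
  have "w * k = k * w" if "w * y = y * w" for w
    by (rule k(3)[rule_format]) (simp add: distrib_left distrib_right that)
  with k(1,2) show ?thesis by blast
qed

lemma norm_le_commuting_sum:
  fixes a b :: "'a::cstar_algebra"
  assumes "star a = a" "star b = b" "a * b = b * a" "a * a + b * b = c *\<^sub>R 1"
  shows "norm (a * a) \<le> \<bar>c\<bar>"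
proof -
  have "norm (a * a) \<le> (norm a)\<^sup>2" using norm_mult_ineq[of a a] by (simp add: power2_eq_square)
  also have "\<dots> \<le> norm (a * a + b * b)" by (rule norm_le_sum_squares[OF assms(1-3)])
  also have "\<dots> \<le> \<bar>c\<bar>" unfolding assms(4) by (rule norm_scaleR_one_le)
  finally show ?thesis .
qed

text \<open>Let \<open>x\<close> be a multiple of \<open>h\<close> of norm below 1 and
  \<open>k\<close> the root of \<open>1 - x * x\<close>. The sum \<open>k * k + x * x = 1\<close>
  bounds \<open>k * k\<close>, and this is the inequality in \<open>cpos\<close> for
  \<open>x * x\<close> with radius 1.\<close>

lemma cpos_square:
  fixes h :: "'a::cstar_algebra"
  assumes h: "star h = h"
  shows "cpos (h * h)"
proof -
  define c where "c = norm h + 1"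
  have c: "c > norm h" "c > 0" by (auto simp: c_def add_nonneg_pos)
  define x where "x = (1 / c) *\<^sub>R h"
  have sx: "star x = x" by (simp add: x_def star_scaleR h)
  have "norm x < 1" using c by (simp add: x_def divide_less_eq)
  then have "norm x * norm x < 1 * 1" by (intro mult_strict_mono') auto
  then have nx: "norm (x * x) < 1" using norm_mult_ineq[of x x] by linarith
  have "star (x * x) = x * x" by (simp only: star_mult sx)
  from ex_sqrt_one_minus[OF this nx]
  obtain k where k: "star k = k" "k * k = 1 - x * x" "\<forall>w. w * (x * x) = (x * x) * w \<longrightarrow> w * k = k * w"
    by blast
  have "x * k = k * x" by (rule k(3)[rule_format]) (simp only: mult.assoc)
  then have "norm (k * k) \<le> \<bar>1\<bar>"
    by (intro norm_le_commuting_sum[of k x]) (simp_all add: k(1,2) sx)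
  then have "cpos (x * x)" by (intro cposI[of _ 1]) (simp_all add: k(2) star_mult sx)
  then have "cpos ((c * c) *\<^sub>R (x * x))" using c by (intro cpos_scaleR) auto
  then show ?thesis using c by (simp add: x_def)
qed

text \<open>After a shift by \<open>e\<close>, both \<open>y\<close> and \<open>r - y\<close> have
  square roots, and these commute because each root commutes with the commutant of its element. The
  squares of the roots add up to a scalar, which bounds each of them.\<close>

lemma norm_cpos_le:
  fixes y :: "'a::cstar_algebra"
  assumes y: "cpos y" "cpos (r *\<^sub>R 1 - y)"
  shows "norm y \<le> \<bar>r\<bar>"
proof (rule field_le_epsilon)
  fix e' :: real assume "e' > 0"
  define e where "e = e' / 3"
  have e: "e > 0" "3 * e = e'" using \<open>e' > 0\<close> by (auto simp: e_def)
  obtain k where k: "cpos k" "k * k = y + e *\<^sub>R 1" "\<forall>w. w * y = y * w \<longrightarrow> w * k = k * w"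
    using ex_sqrt_cpos[OF y(1) e(1)] by blast
  obtain l where l: "cpos l" "l * l = r *\<^sub>R 1 - y + e *\<^sub>R 1"
      "\<forall>w. w * (r *\<^sub>R 1 - y) = (r *\<^sub>R 1 - y) * w \<longrightarrow> w * l = l * w"
    using ex_sqrt_cpos[OF y(2) e(1)] by blast
  have "y * l = l * y"
    by (rule l(3)[rule_format]) (simp add: right_diff_distrib left_diff_distrib)
  then have "k * l = l * k" using k(3)[rule_format, of l] by (simp only:)
  moreover have "k * k + l * l = (r + 2 * e) *\<^sub>R 1"
    unfolding k(2) l(2) by (simp add: scaleR_left_distrib flip: scaleR_2)
  ultimately have "norm (k * k) \<le> \<bar>r + 2 * e\<bar>"
    using k(1) l(1) by (intro norm_le_commuting_sum[of k l]) (simp_all only: cpos_star)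
  then have "norm (y + e *\<^sub>R 1) \<le> \<bar>r\<bar> + 2 * e" using k(2) e by simp
  then have "norm y \<le> \<bar>r\<bar> + 2 * e + norm (e *\<^sub>R (1::'a))"
    using norm_triangle_ineq4[of "y + e *\<^sub>R 1" "e *\<^sub>R 1"] by simp
  also have "norm (e *\<^sub>R (1::'a)) \<le> e" using norm_scaleR_one_le[of e] e by simp
  finally show "norm y \<le> \<bar>r\<bar> + e'" using e by simp
qed

text \<open>Replacing the unknown radius by \<open>norm y\<close> exhibits positivity as a closed
  condition.\<close>

lemma cpos_iff_norm:
  "cpos y \<longleftrightarrow> star y = y \<and> norm (norm y *\<^sub>R 1 - y) \<le> norm y"
proof
  assume y: "cpos y"
  have "norm (norm y *\<^sub>R 1 - y) \<le> \<bar>norm y\<bar>"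
    by (rule norm_cpos_le) (use y cpos_norm_minus[OF cpos_star[OF y]] in simp_all)
  then show "star y = y \<and> norm (norm y *\<^sub>R 1 - y) \<le> norm y"
    using y by (simp add: cpos_star)
qed (auto simp: cpos_def)

lemma closed_cpos: "closed {y :: 'a::cstar_algebra. cpos y}"
proof -
  have "{y :: 'a. cpos y} = {y. star y = y} \<inter> {y. norm (norm y *\<^sub>R 1 - y) \<le> norm y}"
    by (auto simp: cpos_iff_norm)
  then show ?thesis
    by (simp only:) (intro closed_Int closed_Collect_eq closed_Collect_le continuous_intros continuous_on_star)
qed

lemma cpos_approx:
  assumes "\<And>e. e > 0 \<Longrightarrow> \<exists>x. cpos x \<and> norm (y - x) \<le> e"
  shows "cpos (y :: 'a::cstar_algebra)"
proof -
  have "y \<in> closure {y. cpos y}"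
    unfolding closure_approachable
  proof (intro allI impI)
    fix e :: real assume "e > 0"
    then obtain x where "cpos x" "norm (y - x) \<le> e / 2" using assms[of "e / 2"] by auto
    then show "\<exists>x\<in>{y. cpos y}. dist x y < e"
      using \<open>e > 0\<close> by (intro bexI[of _ x]) (auto simp: dist_norm norm_minus_commute)
  qed
  then show ?thesis unfolding closure_closed[OF closed_cpos] by simp
qed

lemma cpos_mult:
  fixes a b :: "'a::cstar_algebra"
  assumes a: "cpos a" and b: "cpos b" and ab: "a * b = b * a"
  shows "cpos (a * b)"
proof (rule cpos_approx)
  fix e' :: real assume e': "e' > 0"
  define C where "C = norm a + norm b + 1"
  have C: "C > 0" by (auto simp: C_def add_nonneg_pos)
  define e where "e = min 1 (e' / C)"
  have e: "e > 0" "e \<le> 1" "e * C \<le> e'"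
    using e' C by (auto simp: e_def min_def field_simps)
  obtain k where k: "cpos k" "k * k = a + e *\<^sub>R 1" "\<forall>w. w * a = a * w \<longrightarrow> w * k = k * w"
    using ex_sqrt_cpos[OF a e(1)] by blast
  obtain l where l: "cpos l" "l * l = b + e *\<^sub>R 1" "\<forall>w. w * b = b * w \<longrightarrow> w * l = l * w"
    using ex_sqrt_cpos[OF b e(1)] by blast
  have "b * k = k * b" by (rule k(3)[rule_format]) (simp only: ab)
  then have kl: "k * l = l * k" by (intro l(3)[rule_format]) (simp only:)
  then have "star (k * l) = k * l" by (simp only: star_mult cpos_star[OF k(1)] cpos_star[OF l(1)])
  then have "cpos ((k * l) * (k * l))" by (rule cpos_square)
  also have "(k * l) * (k * l) = (k * k) * (l * l)" using kl by (metis mult.assoc)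
  finally have 1: "cpos ((a + e *\<^sub>R 1) * (b + e *\<^sub>R 1))" by (simp only: k l)
  have "a * b - (a + e *\<^sub>R 1) * (b + e *\<^sub>R 1) = - (e *\<^sub>R (a + b + e *\<^sub>R 1))"
    by (simp add: algebra_simps)
  then have "norm (a * b - (a + e *\<^sub>R 1) * (b + e *\<^sub>R 1)) = e * norm (a + b + e *\<^sub>R 1)"
    using e by simp
  also have "\<dots> \<le> e * C"
  proof (rule mult_left_mono)
    have "norm (a + b + e *\<^sub>R 1) \<le> norm a + norm b + norm (e *\<^sub>R (1::'a))"
      by (intro norm_triangle_mono order.refl)
    also have "norm (e *\<^sub>R (1::'a)) \<le> 1" using norm_scaleR_one_le[of e, where 'a = 'a] e by linarith
    finally show "norm (a + b + e *\<^sub>R 1) \<le> C" by (simp add: C_def)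
  qed (use e in simp)
  finally show "\<exists>x. cpos x \<and> norm (a * b - x) \<le> e'"
    using 1 e by (intro exI[of _ "(a + e *\<^sub>R 1) * (b + e *\<^sub>R 1)"]) simp
qed

section \<open>Inverses, and the positivity of \<open>star x * x\<close>\<close>

definition two_sided_inverse :: "'a::cstar_algebra \<Rightarrow> 'a \<Rightarrow> bool"
  where "two_sided_inverse y z \<longleftrightarrow> z * y = 1 \<and> y * z = 1"

lemma two_sided_inverse_commute:
  assumes z: "two_sided_inverse y z" and w: "w * y = y * w"
  shows "w * z = z * w"
proof -
  have "w * z = z * y * w * z" using z by (simp add: two_sided_inverse_def)
  also have "\<dots> = z * w * (y * z)" by (simp only: w mult.assoc) (simp only: w flip: mult.assoc)
  finally show ?thesis using z by (simp add: two_sided_inverse_def)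
qed

text \<open>The Neumann series in the form of two fixed points: \<open>b = 1 + x * b\<close> is a
  right inverse, \<open>c = 1 + c * x\<close> a left inverse, and the two agree.\<close>

lemma ex_inverse_one_minus:
  fixes x :: "'a::cstar_algebra"
  assumes x: "norm x < 1"
  shows "\<exists>z. two_sided_inverse (1 - x) z"
proof -
  have "\<exists>!b. 1 + x * b = b"
  proof (rule banach_fix_type[of "norm x"])
    show "\<forall>b c. dist (1 + x * b) (1 + x * c) \<le> norm x * dist b c"
      by (simp add: dist_norm norm_mult_ineq flip: right_diff_distrib)
  qed (use x in auto)
  then obtain b where b: "1 + x * b = b" by blast
  have "\<exists>!b. 1 + b * x = b"
  proof (rule banach_fix_type[of "norm x"])
    show "\<forall>b c. dist (1 + b * x) (1 + c * x) \<le> norm x * dist b c"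
      by (simp add: dist_norm mult.commute[of "norm x"] norm_mult_ineq flip: left_diff_distrib)
  qed (use x in auto)
  then obtain c where c: "1 + c * x = c" by blast
  have 1: "(1 - x) * b = 1" by (simp add: left_diff_distrib) (metis add_diff_cancel_right' b)
  have 2: "c * (1 - x) = 1" by (simp add: right_diff_distrib) (metis add_diff_cancel_right' c)
  have "c = c * ((1 - x) * b)" by (simp add: 1)
  also have "\<dots> = b" by (simp add: 2 flip: mult.assoc)
  finally show ?thesis using 1 2 by (auto simp: two_sided_inverse_def)
qed

lemma ex_inverse_cpos_add:
  fixes y :: "'a::cstar_algebra"
  assumes y: "cpos y" and e: "e > 0"
  shows "\<exists>z. two_sided_inverse (y + e *\<^sub>R 1) z"
proof -
  obtain r where r: "norm (r *\<^sub>R 1 - y) \<le> r" using y by (auto simp: cpos_def)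
  have r0: "r \<ge> 0" using r norm_ge_zero[of "r *\<^sub>R 1 - y"] by linarith
  define x where "x = (1 / (r + e)) *\<^sub>R (r *\<^sub>R 1 - y)"
  have "norm x < 1" using r r0 e by (simp add: x_def divide_less_eq)
  then obtain z where z: "two_sided_inverse (1 - x) z" using ex_inverse_one_minus by blast
  have "(r + e) *\<^sub>R (1 - x) = (r + e) *\<^sub>R 1 - (r *\<^sub>R 1 - y)"
    using r0 e by (simp add: x_def scaleR_right_diff_distrib)
  then have e1: "y + e *\<^sub>R 1 = (r + e) *\<^sub>R (1 - x)" by (simp add: scaleR_left_distrib)
  have "two_sided_inverse (y + e *\<^sub>R 1) ((1 / (r + e)) *\<^sub>R z)"
    using z r0 e unfolding e1 two_sided_inverse_def by simp
  then show ?thesis by blast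
qed

text \<open>\<open>z = y * (z * z)\<close> is a product of commuting positive elements.\<close>

lemma cpos_inverse:
  assumes y: "cpos y" and z: "two_sided_inverse y z"
  shows "cpos z"
proof -
  have i: "z * y = 1" "y * z = 1" using z by (auto simp: two_sided_inverse_def)
  have "star z * y = star (y * z)" using cpos_star[OF y] by (simp only: star_mult)
  then have "star z * y * z = z" by (simp add: i star_one)
  then have sz: "star z = z" by (simp add: i mult.assoc)
  have "y * (z * z) = z * z * y" by (simp add: i mult.assoc) (simp add: i flip: mult.assoc)
  then have "cpos (y * (z * z))" by (rule cpos_mult[OF y cpos_square[OF sz]])
  then show ?thesis by (simp add: i flip: mult.assoc)
qed

lemma cpos_scaleR_oneD:
  assumes "cpos (c *\<^sub>R 1 :: 'a::nonzero_cstar_algebra)"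
  shows "c \<ge> 0"
proof -
  obtain r where "norm (r *\<^sub>R 1 - c *\<^sub>R (1 :: 'a)) \<le> r" using assms by (auto simp: cpos_def)
  then have "\<bar>r - c\<bar> \<le> r" by (simp flip: scaleR_left_diff_distrib)
  then show ?thesis by linarith
qed

text \<open>In spectral terms: no spectrum below \<open>-c\<close>. At the least
  \<open>m \<ge> c\<close> with \<open>y + m\<close> positive, if \<open>m > c\<close>, the inverse
  \<open>z\<close> of \<open>y + m\<close> would be positive, and so would
  \<open>(y + m) * (norm z - z) = norm z * (y + m) - 1\<close>; hence \<open>m\<close> could still
  be lowered, by \<open>1 / norm z\<close> or down to \<open>c\<close>.\<close>

lemma cpos_add_if_invertible:
  fixes y :: "'a::nonzero_cstar_algebra"
  assumes y: "star y = y" and c: "c \<ge> 0"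
    and inv: "\<And>e. e > c \<Longrightarrow> \<exists>z. two_sided_inverse (y + e *\<^sub>R 1) z"
  shows "cpos (y + c *\<^sub>R 1)"
proof -
  define L where "L = {e. e \<ge> c \<and> cpos (y + e *\<^sub>R 1)}"
  have mono: "cpos (y + e' *\<^sub>R 1)" if "cpos (y + e *\<^sub>R 1)" "e \<le> e'" for e e'
    using cpos_add_scaleR_one[OF that(1), of "e' - e"] that(2) by (simp add: scaleR_left_diff_distrib)
  have ne: "L \<noteq> {}"
    using mono[OF norm_self_adjoint_add_cpos[OF y], of "max c (norm y)"] by (auto simp: L_def intro!: exI[of _ "max c (norm y)"])
  have bdd: "bdd_below L" by (auto simp: L_def)
  have "closed L"
  proof -
    have "L = {c..} \<inter> (\<lambda>e. y + e *\<^sub>R 1) -` {y. cpos y}" by (auto simp: L_def)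
    then show ?thesis
      by (simp only:) (intro closed_Int closed_atLeast closed_vimage closed_cpos continuous_intros)
  qed
  then have m: "Inf L \<in> L" by (rule closed_contains_Inf[OF ne bdd])
  define m where "m = Inf L"
  have pm: "cpos (y + m *\<^sub>R 1)" "m \<ge> c" using m by (auto simp: L_def m_def)
  have "m \<le> c"
  proof (rule ccontr)
    assume "\<not> m \<le> c"
    then obtain z where z: "two_sided_inverse (y + m *\<^sub>R 1) z" using inv[of m] by auto
    have i: "z * (y + m *\<^sub>R 1) = 1" "(y + m *\<^sub>R 1) * z = 1" using z by (auto simp: two_sided_inverse_def)
    have cz: "cpos z" by (rule cpos_inverse[OF pm(1) z])
    define R where "R = norm z"
    have "z \<noteq> 0" using i by auto
    then have R: "R > 0" by (simp add: R_def)
    have "cpos ((y + m *\<^sub>R 1) * (R *\<^sub>R 1 - z))"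
    proof (rule cpos_mult[OF pm(1)])
      show "cpos (R *\<^sub>R 1 - z)" unfolding R_def by (rule cpos_norm_minus[OF cpos_star[OF cz]])
      show "(y + m *\<^sub>R 1) * (R *\<^sub>R 1 - z) = (R *\<^sub>R 1 - z) * (y + m *\<^sub>R 1)"
        unfolding right_diff_distrib left_diff_distrib i by simp
    qed
    then have "cpos ((1 / R) *\<^sub>R ((y + m *\<^sub>R 1) * (R *\<^sub>R 1 - z)))"
      by (rule cpos_scaleR) (use R in simp)
    also have "(1 / R) *\<^sub>R ((y + m *\<^sub>R 1) * (R *\<^sub>R 1 - z)) = y + (m - 1 / R) *\<^sub>R 1"
      unfolding right_diff_distrib i using R by (simp add: scaleR_right_diff_distrib scaleR_left_diff_distrib scaleR_right_distrib)
    finally have "cpos (y + max c (m - 1 / R) *\<^sub>R 1)" by (rule mono) simp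
    then have "max c (m - 1 / R) \<in> L" by (simp add: L_def)
    then have "m \<le> max c (m - 1 / R)" unfolding m_def by (rule cInf_lower[OF _ bdd])
    with \<open>\<not> m \<le> c\<close> R show False by (auto simp: max_def split: if_splits)
  qed
  with pm show ?thesis by simp
qed

text \<open>The nonzero spectra of \<open>v * w\<close> and \<open>w * v\<close> agree; the explicit
  inverse is \<open>(1 - w * z * v) / e\<close>.\<close>

lemma ex_inverse_swap:
  fixes w v :: "'a::cstar_algebra"
  assumes e: "e \<noteq> 0" and z: "two_sided_inverse (v * w + e *\<^sub>R 1) z"
  shows "\<exists>z. two_sided_inverse (w * v + e *\<^sub>R 1) z"
proof -
  have i: "z * (v * w + e *\<^sub>R 1) = 1" "(v * w + e *\<^sub>R 1) * z = 1" using z by (auto simp: two_sided_inverse_def)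
  have "(w * v + e *\<^sub>R 1) * (1 - w * z * v) = w * v + e *\<^sub>R 1 - w * ((v * w + e *\<^sub>R 1) * z) * v"
    by (simp add: algebra_simps)
  then have 1: "(w * v + e *\<^sub>R 1) * (1 - w * z * v) = e *\<^sub>R 1" by (simp add: i)
  have "(1 - w * z * v) * (w * v + e *\<^sub>R 1) = w * v + e *\<^sub>R 1 - w * (z * (v * w + e *\<^sub>R 1)) * v"
    by (simp add: algebra_simps)
  then have 2: "(1 - w * z * v) * (w * v + e *\<^sub>R 1) = e *\<^sub>R 1" by (simp add: i)
  have "two_sided_inverse (w * v + e *\<^sub>R 1) ((1 / e) *\<^sub>R (1 - w * z * v))"
    using e by (simp add: two_sided_inverse_def 1 2)
  then show ?thesis by blast
qed

text \<open>With \<open>a\<close> and \<open>b\<close> twice the real and the imaginary part of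
  \<open>w\<close>, the sum is \<open>(a * a + b * b) / 2\<close>.\<close>

lemma cpos_star_mult_add:
  fixes w :: "'a::cstar_algebra"
  shows "cpos (star w * w + w * star w)"
proof -
  define a where "a = w + star w"
  define b where "b = \<i> *\<^sub>C (star w - w)"
  have sa: "star a = a" by (simp add: a_def star_add star_star add.commute)
  have sb: "star b = b"
    by (simp add: b_def star_scaleC star_diff star_star scaleC_minus_left scaleC_diff_right)
  have ii: "\<i> *\<^sub>C \<i> *\<^sub>C x = - x" for x :: 'a
    by (simp add: scaleC_scaleC scaleC_minus_one)
  have "b * b = - ((star w - w) * (star w - w))"
    by (simp only: b_def mult_scaleC_left mult_scaleC_right ii)
  then have "a * a + b * b = 2 *\<^sub>R (star w * w + w * star w)"
    by (simp add: a_def algebra_simps scaleR_2)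
  then have "(1/2) *\<^sub>R (a * a + b * b) = star w * w + w * star w" by simp
  moreover have "cpos ((1/2) *\<^sub>R (a * a + b * b))"
    by (intro cpos_scaleR cpos_add cpos_square sa sb) simp
  ultimately show ?thesis by simp
qed

text \<open>If \<open>star w * w \<le> c\<close>, then \<open>w * star w \<ge> -c\<close>, since
  their sum is positive. Swapping the factors carries this lower bound, through invertibility, over
  to \<open>star w * w\<close>, which therefore lies between \<open>-c\<close> and \<open>c\<close>.
  The factor is 3 because a shift by \<open>c\<close> has to be undone.\<close>

lemma norm_le_if_star_mult_le:
  fixes w :: "'a::nonzero_cstar_algebra"
  assumes c: "c \<ge> 0" and w: "cpos (c *\<^sub>R 1 - star w * w)"
  shows "norm (star w * w) \<le> 3 * c"
proof -
  have "cpos ((star w * w + w * star w) + (c *\<^sub>R 1 - star w * w))"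
    by (intro cpos_add cpos_star_mult_add w)
  then have 1: "cpos (w * star w + c *\<^sub>R 1)" by (simp add: algebra_simps)
  have "\<exists>z. two_sided_inverse (star w * w + e *\<^sub>R 1) z" if e: "e > c" for e
  proof -
    obtain z where "two_sided_inverse ((w * star w + c *\<^sub>R 1) + (e - c) *\<^sub>R 1) z"
      using ex_inverse_cpos_add[OF 1, of "e - c"] e by auto
    then have "two_sided_inverse (w * star w + e *\<^sub>R 1) z" by (simp add: scaleR_left_diff_distrib)
    then show ?thesis using e c by (intro ex_inverse_swap) auto
  qed
  then have "cpos (star w * w + c *\<^sub>R 1)"
    by (intro cpos_add_if_invertible c) (simp_all only: star_mult star_star)
  moreover have "cpos ((2 * c) *\<^sub>R 1 - (star w * w + c *\<^sub>R 1))"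
  proof -
    have "(2 * c) *\<^sub>R 1 - (star w * w + c *\<^sub>R 1) = c *\<^sub>R 1 - star w * w"
      unfolding mult_2 scaleR_left_distrib by simp
    then show ?thesis using w by (simp only:)
  qed
  ultimately have "norm (star w * w + c *\<^sub>R 1) \<le> \<bar>2 * c\<bar>" by (rule norm_cpos_le)
  then have "norm (star w * w + c *\<^sub>R 1) \<le> 2 * c" using c by simp
  moreover have "norm (star w * w) \<le> norm (star w * w + c *\<^sub>R 1) + norm (c *\<^sub>R (1::'a))"
    using norm_triangle_ineq4[of "star w * w + c *\<^sub>R 1" "c *\<^sub>R 1"] by simp
  ultimately show ?thesis using c by simp
qed

text \<open>Kaplansky's argument. With \<open>k = \<surd>(y\<^sup>2 + e)\<close>, the element \<open>n = k - y\<close> approximates twice the negative part of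
  \<open>y = x\<^sup>* x\<close>, and \<open>w = x n\<close> satisfies \<open>w\<^sup>* w = n y n = (e n - n\<^sup>3) / 2\<close>, which is almost negative.\<close>

theorem cpos_star_mult:
  fixes x :: "'a::nonzero_cstar_algebra"
  shows "cpos (star x * x)"
proof (rule cpos_approx)
  fix e0 :: real assume e0: "e0 > 0"
  define y where "y = star x * x"
  \<comment> \<open>Chosen so that the final estimate, \<open>4 * e\<close> times the square of
    \<open>norm n\<close> as a bound for its fourth power, gives
    \<open>norm n \<le> e0\<close>.\<close>
  define e where "e = e0\<^sup>2 / 4"
  have e: "e > 0" "4 * e = e0\<^sup>2" using e0 by (auto simp: e_def)
  have sy: "star y = y" by (simp add: y_def star_mult star_star)
  obtain k where k: "cpos k" "k * k = y * y + e *\<^sub>R 1" "\<forall>w. w * (y * y) = (y * y) * w \<longrightarrow> w * k = k * w"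
    using ex_sqrt_cpos[OF cpos_square[OF sy] e(1)] by blast
  have yk: "y * k = k * y" by (rule k(3)[rule_format]) (simp only: mult.assoc)
  define n where "n = k - y"
  have sn: "star n = n" by (simp add: n_def star_diff sy cpos_star[OF k(1)])
  have kn: "k * n = n * k" by (simp add: n_def left_diff_distrib right_diff_distrib yk)
  obtain z where z: "two_sided_inverse (y * y + e *\<^sub>R 1) z"
    using ex_inverse_cpos_add[OF cpos_square[OF sy] e(1)] by blast
  have zi: "z * (k * k) = 1" "k * k * z = 1" using z by (simp_all add: two_sided_inverse_def k(2))
  have kz: "k * z = z * k"
    by (rule two_sided_inverse_commute[OF z]) (simp only: k(2)[symmetric] mult.assoc)
  define i where "i = k * z"
  have ki: "two_sided_inverse k i"
    unfolding two_sided_inverse_def i_def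
    using zi by (simp add: kz mult.assoc)
  have i: "i * k = 1" "k * i = 1" using ki by (auto simp: two_sided_inverse_def)
  have nn: "2 *\<^sub>R (k * n) = n * n + e *\<^sub>R 1"
  proof -
    have "2 *\<^sub>R (k * n) = k * k + (k * k) - 2 *\<^sub>R (k * y)"
      by (simp add: n_def algebra_simps scaleR_2)
    also have "\<dots> = k * k - k * y - y * k + y * y + e *\<^sub>R 1"
      by (subst (2) k(2)) (simp add: yk scaleR_2)
    also have "\<dots> = n * n + e *\<^sub>R 1" by (simp add: n_def algebra_simps)
    finally show ?thesis .
  qed
  \<comment> \<open>By \<open>nn\<close>, the element \<open>n\<close> is half the product of
    \<open>i\<close> and \<open>n * n + e\<close>, which are positive and commute; so
    \<open>n\<close> is positive as well.\<close>
  have "cpos (n * n + e *\<^sub>R 1)" by (intro cpos_add_scaleR_one cpos_square sn) (use e in simp)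
  moreover have "i * n = n * i" using two_sided_inverse_commute[OF ki kn[symmetric]] by simp
  then have "i * (n * n + e *\<^sub>R 1) = (n * n + e *\<^sub>R 1) * i"
    by (simp add: distrib_left distrib_right) (metis mult.assoc)
  ultimately have "cpos (i * (n * n + e *\<^sub>R 1))"
    by (intro cpos_mult cpos_inverse[OF k(1) ki])
  then have "cpos ((1/2) *\<^sub>R (i * (2 *\<^sub>R (k * n))))" by (intro cpos_scaleR) (simp_all add: nn)
  then have pn: "cpos n" by (simp add: i flip: mult.assoc)
  have yn: "y * n = n * y" by (simp add: n_def left_diff_distrib right_diff_distrib yk)
  define w where "w = x * n"
  have ww: "star w * w = n * y * n" by (simp add: w_def y_def star_mult sn mult.assoc)
  have knn: "2 *\<^sub>R (k * (n * n)) = n * n * n + e *\<^sub>R n"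
  proof -
    have "2 *\<^sub>R (k * (n * n)) = 2 *\<^sub>R (k * n) * n" by (simp add: mult.assoc)
    also have "\<dots> = n * n * n + e *\<^sub>R n" unfolding nn by (simp add: distrib_right)
    finally show ?thesis .
  qed
  have "n * y * n = y * (n * n)" by (simp add: mult.assoc flip: yn)
  also have "\<dots> = k * (n * n) - n * n * n" by (simp add: n_def left_diff_distrib mult.assoc)
  finally have "2 *\<^sub>R (star w * w) = 2 *\<^sub>R (k * (n * n)) - 2 *\<^sub>R (n * n * n)"
    by (simp add: ww scaleR_right_diff_distrib)
  then have w2: "2 *\<^sub>R (star w * w) = e *\<^sub>R n - n * n * n"
    unfolding knn by (simp add: scaleR_2)
  define c where "c = e * norm n / 2"
  have c: "c \<ge> 0" using e by (simp add: c_def)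
  have pn3: "cpos (n * (n * n))" by (intro cpos_mult pn cpos_square sn) (simp only: mult.assoc)
  have "cpos ((1/2) *\<^sub>R (e *\<^sub>R (norm n *\<^sub>R 1 - n) + n * (n * n)))"
    by (intro cpos_scaleR cpos_add pn3 cpos_norm_minus sn) (use e in simp_all)
  also have "(1/2) *\<^sub>R (e *\<^sub>R (norm n *\<^sub>R 1 - n) + n * (n * n)) = c *\<^sub>R 1 - (1/2) *\<^sub>R (2 *\<^sub>R (star w * w))"
    unfolding w2 by (simp add: c_def algebra_simps)
  finally have "norm (star w * w) \<le> 3 * c" by (intro norm_le_if_star_mult_le c) simp
  then have "norm (2 *\<^sub>R (star w * w)) \<le> 3 * (e * norm n)" by (simp add: c_def)
  moreover have "n * n * n = e *\<^sub>R n - 2 *\<^sub>R (star w * w)" unfolding w2 by simp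
  then have "norm (n * n * n) \<le> norm (e *\<^sub>R n) + norm (2 *\<^sub>R (star w * w))"
    using norm_triangle_ineq4[of "e *\<^sub>R n" "2 *\<^sub>R (star w * w)"] by (simp only:)
  moreover have "norm (e *\<^sub>R n) = e * norm n" using e by simp
  ultimately have n3: "norm (n * n * n) \<le> 4 * e * norm n" by linarith
  have nsq: "norm (m * m) = (norm m)\<^sup>2" if "star m = m" for m :: 'a
    using cstar_identity[of m] that by simp
  have "(norm n)\<^sup>2 * (norm n)\<^sup>2 = norm ((n * n) * (n * n))"
    using nsq[of "n * n"] nsq[OF sn] by (simp add: star_mult sn power2_eq_square)
  also have "(n * n) * (n * n) = n * n * n * n" by (simp only: mult.assoc)
  also have "norm (n * n * n * n) \<le> norm (n * n * n) * norm n" by (rule norm_mult_ineq)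
  also have "\<dots> \<le> 4 * e * norm n * norm n" by (intro mult_right_mono n3) simp
  finally have n4: "(norm n)\<^sup>2 * (norm n)\<^sup>2 \<le> e0\<^sup>2 * (norm n)\<^sup>2" by (simp add: e(2) power2_eq_square mult.assoc)
  have "(norm n)\<^sup>2 \<le> e0\<^sup>2"
  proof (cases "norm n = 0")
    case False
    then have "(norm n)\<^sup>2 > 0" by simp
    then show ?thesis using n4 mult_le_cancel_right_pos by blast
  qed simp
  then have "norm n \<le> e0" by (rule power2_le_imp_le) (use e0 in simp)
  then show "\<exists>k. cpos k \<and> norm (star x * x - k) \<le> e0"
    using k(1) by (intro exI[of _ k]) (simp add: n_def y_def norm_minus_commute)
qed

section \<open>States of C*-algebras\<close>

definition sublinear :: "('a::real_vector \<Rightarrow> real) \<Rightarrow> bool"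
  where "sublinear q \<longleftrightarrow> (\<forall>x y. q (x + y) \<le> q x + q y) \<and> (\<forall>r x. r \<ge> 0 \<longrightarrow> q (r *\<^sub>R x) = r * q x)"

lemma sublinearD:
  assumes "sublinear q"
  shows "q (x + y) \<le> q x + q y" "r \<ge> 0 \<Longrightarrow> q (r *\<^sub>R x) = r * q x" "q 0 = 0" "- q (- x) \<le> q x"
proof -
  show *: "q (x + y) \<le> q x + q y" "r \<ge> 0 \<Longrightarrow> q (r *\<^sub>R x) = r * q x" for x y r
    using assms by (auto simp: sublinear_def)
  show 0: "q 0 = 0" using *(2)[of 0 0] by simp
  show "- q (- x) \<le> q x" using *(1)[of x "- x"] 0 by simp
qed

lemma sublinearI:
  assumes "\<And>x y. q (x + y) \<le> q x + q y" "\<And>r x. r > 0 \<Longrightarrow> q (r *\<^sub>R x) \<le> r * q x" "q 0 = 0"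
  shows "sublinear q"
  unfolding sublinear_def
proof (intro conjI allI impI)
  fix r :: real and x assume r: "r \<ge> 0"
  show "q (r *\<^sub>R x) = r * q x"
  proof (cases "r = 0")
    case False
    then have "q ((1 / r) *\<^sub>R (r *\<^sub>R x)) \<le> (1 / r) * q (r *\<^sub>R x)" using r by (intro assms(2)) simp
    then have "r * q x \<le> q (r *\<^sub>R x)" using False r by (simp add: field_simps)
    moreover have "q (r *\<^sub>R x) \<le> r * q x" using False r by (intro assms(2)) simp
    ultimately show ?thesis by simp
  qed (simp add: assms(3))
qed (rule assms(1))

text \<open>Lowers \<open>q\<close> as far as possible subject to being at most \<open>- q y\<close> at \<open>- y\<close>.\<close>

definition sublinear_push :: "('a::real_vector \<Rightarrow> real) \<Rightarrow> 'a \<Rightarrow> 'a \<Rightarrow> real"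
  where "sublinear_push q y x = (INF t\<in>{0..}. q (x + t *\<^sub>R y) - t * q y)"

lemma sublinear_push:
  assumes q: "sublinear q"
  shows "sublinear (sublinear_push q y)" "sublinear_push q y x \<le> q x" "sublinear_push q y (- y) \<le> - q y"
proof -
  note D = sublinearD[OF q]
  \<comment> \<open>Keeps the infimum that defines the push finite.\<close>
  have lower: "- q (- x) \<le> q (x + t *\<^sub>R y) - t * q y" if "t \<ge> 0" for x t
    using D(1)[of "x + t *\<^sub>R y" "- x"] D(2)[OF that, of y] by simp
  have bdd: "bdd_below ((\<lambda>t. q (x + t *\<^sub>R y) - t * q y) ` {0..})" for x
    by (rule bdd_belowI[of _ "- q (- x)"]) (use lower in auto)
  have le: "sublinear_push q y x \<le> q (x + t *\<^sub>R y) - t * q y" if "t \<ge> 0" for x t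
    unfolding sublinear_push_def by (rule cINF_lower[OF bdd]) (use that in simp)
  have ge: "b \<le> sublinear_push q y x" if "\<And>t. t \<ge> 0 \<Longrightarrow> b \<le> q (x + t *\<^sub>R y) - t * q y" for b x
    unfolding sublinear_push_def by (rule cINF_greatest) (use that in auto)
  show "sublinear_push q y x \<le> q x" for x using le[of 0 x] by simp
  show "sublinear_push q y (- y) \<le> - q y" using le[of 1 "- y"] by (simp add: D(3))
  show "sublinear (sublinear_push q y)"
  proof (rule sublinearI)
    fix u v
    have "sublinear_push q y (u + v) - (q (v + s *\<^sub>R y) - s * q y) \<le> sublinear_push q y u" if s: "s \<ge> 0" for s
    proof (rule ge)
      fix t :: real assume t: "t \<ge> 0"
      have "u + v + (t + s) *\<^sub>R y = (u + t *\<^sub>R y) + (v + s *\<^sub>R y)" by (simp add: scaleR_left_distrib)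
      then have "q (u + v + (t + s) *\<^sub>R y) \<le> q (u + t *\<^sub>R y) + q (v + s *\<^sub>R y)"
        using D(1)[of "u + t *\<^sub>R y" "v + s *\<^sub>R y"] by (simp only:)
      then show "sublinear_push q y (u + v) - (q (v + s *\<^sub>R y) - s * q y) \<le> q (u + t *\<^sub>R y) - t * q y"
        using le[of "t + s" "u + v"] s t by (simp add: distrib_right)
    qed
    then have "sublinear_push q y (u + v) - sublinear_push q y u \<le> sublinear_push q y v"
      by (intro ge) (simp add: algebra_simps)
    then show "sublinear_push q y (u + v) \<le> sublinear_push q y u + sublinear_push q y v" by simp
  next
    fix r :: real and u assume r: "r > 0"
    have "sublinear_push q y (r *\<^sub>R u) / r \<le> sublinear_push q y u"
    proof (rule ge)
      fix t :: real assume t: "t \<ge> 0"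
      have "sublinear_push q y (r *\<^sub>R u) \<le> q (r *\<^sub>R u + (r * t) *\<^sub>R y) - (r * t) * q y"
        using r t by (intro le) simp
      also have "q (r *\<^sub>R u + (r * t) *\<^sub>R y) = r * q (u + t *\<^sub>R y)"
        using D(2)[of r "u + t *\<^sub>R y"] r by (simp add: scaleR_right_distrib)
      finally show "sublinear_push q y (r *\<^sub>R u) / r \<le> q (u + t *\<^sub>R y) - t * q y"
        using r by (simp add: field_simps)
    qed
    then show "sublinear_push q y (r *\<^sub>R u) \<le> r * sublinear_push q y u"
      using r by (simp add: field_simps)
  next
    have "sublinear_push q y 0 \<le> 0" using le[of 0 0] by (simp add: D(3))
    moreover have "0 \<le> sublinear_push q y 0" by (rule ge) (use D(2) in simp)
    ultimately show "sublinear_push q y 0 = 0" by simp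
  qed
qed

text \<open>An infimum of sublinear functionals need not be subadditive. Along a chain it is,
  because the values of two members \<open>p\<close> and \<open>p'\<close> are both bounded below by
  those of the smaller one.\<close>

lemma sublinear_INF_chain:
  assumes C: "C \<noteq> {}" "\<And>p. p \<in> C \<Longrightarrow> sublinear p" "\<And>p. p \<in> C \<Longrightarrow> p \<le> q"
    and chain: "\<And>p p'. p \<in> C \<Longrightarrow> p' \<in> C \<Longrightarrow> p \<le> p' \<or> p' \<le> p"
  shows "sublinear (\<lambda>x. INF p\<in>C. p x)" "\<And>p x. p \<in> C \<Longrightarrow> (INF p\<in>C. p x) \<le> p x"
proof -
  have bdd: "bdd_below ((\<lambda>p. p x) ` C)" for x
  proof (rule bdd_belowI)
    fix r assume "r \<in> (\<lambda>p. p x) ` C"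
    then obtain p where "p \<in> C" "r = p x" by blast
    then show "- q (- x) \<le> r"
      using sublinearD(4)[OF C(2), of p x] C(3)[of p] by (auto simp: le_fun_def dest!: spec[of _ "- x"])
  qed
  show le: "(INF p\<in>C. p x) \<le> p x" if "p \<in> C" for p x
    by (rule cINF_lower[OF bdd that])
  have ge: "b \<le> (INF p\<in>C. p x)" if "\<And>p. p \<in> C \<Longrightarrow> b \<le> p x" for b x
    by (rule cINF_greatest[OF C(1)]) (rule that)
  show "sublinear (\<lambda>x. INF p\<in>C. p x)"
  proof (rule sublinearI)
    fix u v
    have "(INF p\<in>C. p (u + v)) \<le> p u + p' v" if p: "p \<in> C" "p' \<in> C" for p p'
    proof -
      obtain p'' where p'': "p'' \<in> C" "p'' \<le> p" "p'' \<le> p'" using chain[OF p] p by blast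
      have "(INF p\<in>C. p (u + v)) \<le> p'' u + p'' v"
        using le[OF p''(1)] sublinearD(1)[OF C(2)[OF p''(1)]] by (rule order.trans)
      also have "\<dots> \<le> p u + p' v" using p''(2,3) by (intro add_mono) (auto simp: le_fun_def)
      finally show ?thesis .
    qed
    then have "(INF p\<in>C. p (u + v)) - p' v \<le> (INF p\<in>C. p u)" if "p' \<in> C" for p'
      using that by (intro ge) (simp add: algebra_simps)
    then have "(INF p\<in>C. p (u + v)) - (INF p\<in>C. p u) \<le> (INF p\<in>C. p v)"
      by (intro ge) (simp add: algebra_simps)
    then show "(INF p\<in>C. p (u + v)) \<le> (INF p\<in>C. p u) + (INF p\<in>C. p v)" by simp
  next
    fix r :: real and u assume r: "r > 0"
    have "(INF p\<in>C. p (r *\<^sub>R u)) / r \<le> (INF p\<in>C. p u)"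
    proof (rule ge)
      fix p assume p: "p \<in> C"
      show "(INF p\<in>C. p (r *\<^sub>R u)) / r \<le> p u"
        using le[OF p, of "r *\<^sub>R u"] sublinearD(2)[OF C(2)[OF p], of r u] r by (simp add: field_simps)
    qed
    then show "(INF p\<in>C. p (r *\<^sub>R u)) \<le> r * (INF p\<in>C. p u)" using r by (simp add: field_simps)
  next
    have "(\<lambda>p. p 0) ` C = {0}" using C(1) sublinearD(3)[OF C(2)] by force
    then show "(INF p\<in>C. p 0) = 0" by simp
  qed
qed

text \<open>A minimal sublinear functional is linear.\<close>

theorem hahn_banach_sublinear:
  fixes q :: "'a::real_vector \<Rightarrow> real"
  assumes q: "sublinear q"
  shows "\<exists>f. linear f \<and> (\<forall>x. f x \<le> q x) \<and> f y = q y"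
proof -
  \<comment> \<open>Starting from the push instead of \<open>q\<close> secures
    \<open>f y = q y\<close>: whatever lies below it is at most \<open>- q y\<close> at
    \<open>- y\<close>.\<close>
  let ?q = "sublinear_push q y"
  define A where "A = {p. sublinear p \<and> p \<le> ?q}"
  have po: "partial_order_on A (relation_of (\<lambda>p p'. p' \<le> p) A)"
    by (rule partial_order_on_relation_ofI) auto
  have "\<exists>u\<in>A. \<forall>p\<in>C. u \<le> p" if C: "C \<in> Chains (relation_of (\<lambda>p p'. p' \<le> p) A)" for C
  proof (cases "C = {}")
    case True
    then show ?thesis using sublinear_push(1)[OF q, of y] by (auto simp: A_def)
  next
    case False
    have CA: "C \<subseteq> A" using C by (auto simp: Chains_def relation_of_def)
    have 1: "p \<le> p' \<or> p' \<le> p" if "p \<in> C" "p' \<in> C" for p p'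
      using C that by (auto simp: Chains_def relation_of_def)
    have s: "sublinear p" "p \<le> ?q" if "p \<in> C" for p using CA that by (auto simp: A_def)
    have inf1: "sublinear (\<lambda>x. INF p\<in>C. p x)" by (rule sublinear_INF_chain(1)[OF False s 1])
    have inf2: "(INF p\<in>C. p x) \<le> p x" if "p \<in> C" for p x
      by (rule sublinear_INF_chain(2)[OF False s 1 that])
    obtain p0 where p0: "p0 \<in> C" using False by blast
    have "(\<lambda>x. INF p\<in>C. p x) \<le> ?q"
      by (rule le_funI) (rule order.trans[OF inf2[OF p0] le_funD[OF s(2)[OF p0]]])
    then show ?thesis
      using inf1 inf2 by (intro bexI[of _ "\<lambda>x. INF p\<in>C. p x"]) (auto simp: A_def le_fun_def)
  qed
  from predicate_Zorn[OF po this]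
  obtain p where p: "p \<in> A" "\<And>p'. p' \<in> A \<Longrightarrow> p' \<le> p \<Longrightarrow> p' = p" by blast
  have sp: "sublinear p" "p \<le> ?q" using p(1) by (auto simp: A_def)
  \<comment> \<open>By minimality, pushing \<open>p\<close> at any \<open>x\<close> does not change
    it, and a push at \<open>x\<close> is at most \<open>- p x\<close> at
    \<open>- x\<close>.\<close>
  have neg: "p (- x) = - p x" for x
  proof -
    have "sublinear_push p x \<le> p" using sublinear_push(2)[OF sp(1)] by (simp add: le_fun_def)
    moreover from this have "sublinear_push p x \<in> A"
      using sublinear_push(1)[OF sp(1)] sp(2) by (auto simp: A_def)
    ultimately have "sublinear_push p x = p" using p(2) by blast
    then have "p (- x) \<le> - p x" using sublinear_push(3)[OF sp(1), of x] by simp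
    then show ?thesis using sublinearD(4)[OF sp(1), of x] by simp
  qed
  have add: "p (u + v) = p u + p v" for u v
    using sublinearD(1)[OF sp(1), of u v] sublinearD(1)[OF sp(1), of "u + v" "- v"] by (simp add: neg)
  have "linear p"
  proof (rule linearI)
    show "p (r *\<^sub>R x) = r *\<^sub>R p x" for r x
    proof (cases "r \<ge> 0")
      case True
      then show ?thesis using sublinearD(2)[OF sp(1)] by simp
    next
      case False
      then show ?thesis
        using sublinearD(2)[OF sp(1), of "- r" x] neg[of "r *\<^sub>R x"] by simp
    qed
  qed (rule add)
  moreover have "p x \<le> q x" for x
    using sp(2) sublinear_push(2)[OF q, of y x] by (meson le_fun_def order.trans)
  moreover have "p (- y) \<le> - q y"
    using sp(2) sublinear_push(3)[OF q, of y] by (meson le_fun_def order.trans)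
  then have "p y = q y" using neg[of y] \<open>p y \<le> q y\<close> by simp
  ultimately show ?thesis by blast
qed

section \<open>States attaining the norm\<close>

lemma scaleR_scaleC: "r *\<^sub>R c *\<^sub>C x = c *\<^sub>C r *\<^sub>R (x :: 'a::cstar_algebra)"
  by (simp add: scaleC_scaleC mult.commute flip: scaleC_of_real)

text \<open>\<open>q x\<close> is the infimum of the scalars above the real part \<open>R x\<close>
  in the order given by \<open>cpos\<close>. A linear functional below \<open>q\<close> is
  automatically positive, vanishes on skew-adjoint elements and sends 1 to 1. At
  \<open>star a * a\<close> the value of \<open>q\<close> is the square of the norm, because this
  element is positive.\<close>

theorem ex_state_norm:
  fixes a :: "'a::nonzero_cstar_algebra"
  shows "\<exists>\<phi>. state \<phi> \<and> \<phi> (star a * a) = complex_of_real ((norm a)\<^sup>2)"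
proof -
  define R where "R x = (1/2) *\<^sub>R (x + star x)" for x :: 'a
  have R: "R (x + y) = R x + R y" "R (c *\<^sub>R x) = c *\<^sub>R R x" "star (R x) = R x" "R (- x) = - R x" for x y c
    by (simp_all add: R_def star_add star_scaleR star_star star_minus algebra_simps)
  have R_id: "R x = x" if "star x = x" for x using that by (simp add: R_def flip: scaleR_2)
  have R_norm: "norm (R x) \<le> norm x" for x
    using norm_triangle_ineq[of x "star x"] by (simp add: R_def norm_star)
  define Q where "Q x = {r. cpos (r *\<^sub>R 1 - R x)}" for x
  define q where "q x = Inf (Q x)" for x
  have low: "- norm x \<le> r" if "r \<in> Q x" for r x
  proof -
    have "cpos ((r *\<^sub>R 1 - R x) + (R x + norm (R x) *\<^sub>R 1))"
      using that by (intro cpos_add norm_self_adjoint_add_cpos R(3)) (simp add: Q_def)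
    then have "cpos ((r + norm (R x)) *\<^sub>R (1 :: 'a))" by (simp add: algebra_simps)
    from cpos_scaleR_oneD[OF this] show ?thesis using R_norm[of x] by linarith
  qed
  have bdd: "bdd_below (Q x)" for x by (rule bdd_belowI[OF low])
  have mem: "norm (R x) \<in> Q x" for x unfolding Q_def by (simp add: cpos_norm_minus R(3))
  have ne: "Q x \<noteq> {}" for x using mem by blast
  have le: "q x \<le> r" if "cpos (r *\<^sub>R 1 - R x)" for r x
    unfolding q_def by (rule cInf_lower[OF _ bdd]) (simp add: Q_def that)
  have ge: "b \<le> q x" if "\<And>r. cpos (r *\<^sub>R 1 - R x) \<Longrightarrow> b \<le> r" for b x
    unfolding q_def by (rule cInf_greatest[OF ne]) (use that in \<open>simp add: Q_def\<close>)
  have q: "sublinear q"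
  proof (rule sublinearI)
    fix x y
    have "q (x + y) - s \<le> q x" if s: "cpos (s *\<^sub>R 1 - R y)" for s
    proof (rule ge)
      fix r assume "cpos (r *\<^sub>R 1 - R x)"
      from cpos_add[OF this s] have "cpos ((r + s) *\<^sub>R 1 - R (x + y))" by (simp add: R algebra_simps)
      from le[OF this] show "q (x + y) - s \<le> r" by simp
    qed
    then have "q (x + y) - q x \<le> q y" by (intro ge) (simp add: algebra_simps)
    then show "q (x + y) \<le> q x + q y" by simp
  next
    fix r :: real and x assume r: "r > 0"
    have "q (r *\<^sub>R x) / r \<le> q x"
    proof (rule ge)
      fix s assume "cpos (s *\<^sub>R 1 - R x)"
      from cpos_scaleR[OF this, of r] have "cpos ((r * s) *\<^sub>R 1 - R (r *\<^sub>R x))"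
        using r by (simp add: R scaleR_right_diff_distrib)
      from le[OF this] show "q (r *\<^sub>R x) / r \<le> s" using r by (simp add: field_simps)
    qed
    then show "q (r *\<^sub>R x) \<le> r * q x" using r by (simp add: field_simps)
  next
    have R0: "R 0 = 0" by (simp add: R_def star_zero)
    have "q 0 \<le> 0" by (rule le) (use cpos_scaleR_one[of 0] R0 in simp)
    moreover have "0 \<le> q 0" by (rule ge) (use cpos_scaleR_oneD R0 in auto)
    ultimately show "q 0 = 0" by simp
  qed
  have qa: "q (star a * a) = (norm a)\<^sup>2"
  proof (rule antisym)
    have Ra: "R (star a * a) = star a * a" by (simp add: R_id star_mult star_star)
    show "q (star a * a) \<le> (norm a)\<^sup>2"
      by (rule le) (use cpos_norm_minus[of "star a * a"] in \<open>simp add: Ra star_mult star_star cstar_identity\<close>)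
    show "(norm a)\<^sup>2 \<le> q (star a * a)"
    proof (rule ge)
      fix r assume r: "cpos (r *\<^sub>R 1 - R (star a * a))"
      have "cpos (r *\<^sub>R 1 - star a * a + star a * a)"
        by (rule cpos_add[OF _ cpos_star_mult]) (use r Ra in simp)
      then have "r \<ge> 0" by (simp add: cpos_scaleR_oneD)
      moreover have "norm (star a * a) \<le> \<bar>r\<bar>"
        by (rule norm_cpos_le[OF cpos_star_mult]) (use r Ra in simp)
      ultimately show "(norm a)\<^sup>2 \<le> r" by (simp add: cstar_identity)
    qed
  qed
  obtain f where f: "linear f" "\<And>x. f x \<le> q x" "f (star a * a) = q (star a * a)"
    using hahn_banach_sublinear[OF q, of "star a * a"] by blast
  note fl = linear_add[OF f(1)] linear_scale[OF f(1)] linear_neg[OF f(1)] linear_diff[OF f(1)]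
  have f1: "f x \<le> norm x" for x
    using f(2)[of x] le[of "norm (R x)" x] mem[of x] R_norm[of x] by (simp add: Q_def)
  have fpos: "f x \<ge> 0" if "cpos x" for x
  proof -
    have "q (- x) \<le> 0" by (rule le) (use that R_id[OF cpos_star[OF that]] in \<open>simp add: R(4)\<close>)
    then show ?thesis using f(2)[of "- x"] by (simp add: fl)
  qed
  have fanti: "f x = 0" if "star x = - x" for x
  proof -
    have "f y \<le> 0" if "star y = - y" for y
    proof -
      have "R y = 0" using that by (simp add: R_def)
      then have "q y \<le> 0" by (intro le) (use cpos_scaleR_one[of 0] in simp)
      then show ?thesis using f(2)[of y] by simp
    qed
    from this[of x] this[of "- x"] show ?thesis using that by (simp add: star_minus fl)
  qed
  have fone: "f 1 = 1"
  proof -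
    have "q (- 1) \<le> - 1" by (rule le) (use cpos_scaleR_one[of 0] R_id[of 1] in \<open>simp add: R(4) star_one\<close>)
    then have "f 1 \<ge> 1" using f(2)[of "- 1"] by (simp add: fl)
    moreover have "f 1 \<le> 1" using f1[of 1] by simp
    ultimately show ?thesis by simp
  qed
  \<comment> \<open>The usual complexification of a real functional. Since \<open>f\<close> vanishes
    on skew-adjoint elements, it agrees with \<open>f\<close> on the elements
    \<open>star x * x\<close>.\<close>
  define \<phi> where "\<phi> x = Complex (f x) (- f (\<i> *\<^sub>C x))" for x
  have ii: "\<i> *\<^sub>C \<i> *\<^sub>C x = - x" for x :: 'a
    by (simp add: scaleC_scaleC scaleC_minus_one)
  have cdec: "c *\<^sub>C x = Re c *\<^sub>R x + Im c *\<^sub>R \<i> *\<^sub>C x" for c and x :: 'a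
  proof -
    have "c *\<^sub>C x = (complex_of_real (Re c) + complex_of_real (Im c) * \<i>) *\<^sub>C x"
      by (metis complex_eq mult.commute)
    then show ?thesis by (simp only: scaleC_add_left scaleC_of_real flip: scaleC_scaleC)
  qed
  have lin: "clinear \<phi>"
    unfolding clinear_def
  proof (intro conjI allI)
    show "\<phi> (x + y) = \<phi> x + \<phi> y" for x y by (simp add: \<phi>_def scaleC_add_right fl complex_eq_iff)
    show "\<phi> (c *\<^sub>C x) = c *\<^sub>C \<phi> x" for c x
    proof -
      have 1: "f (c *\<^sub>C x) = Re c * f x + Im c * f (\<i> *\<^sub>C x)" by (subst cdec) (simp add: fl)
      have "\<i> *\<^sub>C c *\<^sub>C x = Re c *\<^sub>R \<i> *\<^sub>C x - Im c *\<^sub>R x"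
        by (subst cdec) (simp add: scaleC_add_right ii flip: scaleR_scaleC)
      then have 2: "f (\<i> *\<^sub>C c *\<^sub>C x) = Re c * f (\<i> *\<^sub>C x) - Im c * f x" by (simp add: fl)
      show ?thesis by (simp add: \<phi>_def 1 2 complex_eq_iff algebra_simps)
    qed
  qed
  have pos: "\<phi> (star x * x) = complex_of_real (f (star x * x))" for x
  proof -
    have "f (\<i> *\<^sub>C (star x * x)) = 0"
      by (rule fanti) (simp add: star_scaleC star_mult star_star scaleC_minus_left)
    then show ?thesis by (simp add: \<phi>_def complex_eq_iff)
  qed
  have "bounded_linear \<phi>"
  proof (rule bounded_linear_intro[of _ 2])
    show "\<phi> (x + y) = \<phi> x + \<phi> y" for x y using lin by (simp add: clinear_eqs)
    show "\<phi> (r *\<^sub>R x) = r *\<^sub>R \<phi> x" for r x by (rule clinear_scaleR[OF lin])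
    have fn: "\<bar>f x\<bar> \<le> norm x" for x using f1[of x] f1[of "- x"] by (simp add: fl)
    show "norm (\<phi> x) \<le> norm x * 2" for x
      using cmod_le[of "\<phi> x"] fn[of x] fn[of "\<i> *\<^sub>C x"] by (simp add: \<phi>_def norm_scaleC)
  qed
  then have "state \<phi>"
    unfolding state_def bounded_clinear_def
    using lin pos fpos[OF cpos_star_mult] pos[of 1] fone by (auto simp: star_one)
  moreover have "\<phi> (star a * a) = complex_of_real ((norm a)\<^sup>2)" by (simp only: pos f(3) qa)
  ultimately show ?thesis by blast
qed

lemma stateD:
  assumes "state \<phi>"
  shows "bounded_clinear \<phi>" "clinear \<phi>" "bounded_linear \<phi>" "\<phi> 1 = 1" "positive_functional \<phi>"
  using assms state_positive[OF assms] by (auto simp: state_def bounded_clinear_def)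

lemma state_star_mult_le:
  assumes "state \<phi>" "star y = y"
  shows "cmod (\<phi> y) \<le> norm y"
proof -
  interpret bounded_linear \<phi> by (rule stateD(3)[OF assms(1)])
  obtain K where K: "\<And>x. norm (\<phi> x) \<le> norm x * K" using bounded by blast
  have "cmod (\<phi> y) \<le> Re (\<phi> 1) * norm y"
    by (rule positive_functional_self_adjoint_bound[OF stateD(5)[OF assms(1)] _ assms(2)])
      (subst mult.commute, rule K)
  then show ?thesis by (simp add: stateD(4)[OF assms(1)])
qed

lemma state_gns_seminorm_mult:
  assumes "state \<phi>"
  shows "gns_seminorm \<phi> (x * s) \<le> norm x * gns_seminorm \<phi> s"
proof (rule gns_seminorm_mult_aux[OF stateD(5)[OF assms], where e = "\<lambda>x. x"])
  fix u v
  have "bounded_linear (\<lambda>x. \<phi> (u * x * v))"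
    by (rule bounded_linear_compose[OF stateD(3)[OF assms]
          bounded_linear_compose[OF bounded_linear_mult_left bounded_linear_mult_right]])
  then obtain K where "\<And>x. norm (\<phi> (u * x * v)) \<le> norm x * K" using bounded_linear.bounded by blast
  then show "\<exists>M. \<forall>x. cmod (\<phi> (u * x * v)) \<le> M * norm x" by (auto simp: mult.commute)
qed auto

lemma bounded_clinear_compose:
  "bounded_clinear f \<Longrightarrow> bounded_clinear g \<Longrightarrow> bounded_clinear (\<lambda>x. f (g x))"
  by (simp add: bounded_clinear_def clinear_def bounded_linear_compose)

lemma clinear_compose: "clinear f \<Longrightarrow> clinear g \<Longrightarrow> clinear (\<lambda>x. f (g x))"
  by (simp add: clinear_def)

lemma clinear_mult_left: "clinear (\<lambda>x. u * x)"
  and clinear_mult_right: "clinear (\<lambda>x. x * u)"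
  by (simp_all add: clinear_def distrib_left distrib_right mult_scaleC_left mult_scaleC_right)

lemma bounded_clinear_mult_left: "bounded_clinear (\<lambda>x. u * x)"
  and bounded_clinear_mult_right: "bounded_clinear (\<lambda>x. x * u)"
  by (simp_all add: bounded_clinear_def clinear_mult_left clinear_mult_right bounded_linear_mult_left
      bounded_linear_mult_right)

lemma bounded_clinear_cmult: "bounded_clinear f \<Longrightarrow> bounded_clinear (\<lambda>x. (c :: complex) * f x)"
  by (rule bounded_clinear_compose[OF bounded_clinear_mult_left])

lemma bounded_clinear_add:
  "bounded_clinear f \<Longrightarrow> bounded_clinear g \<Longrightarrow> bounded_clinear (\<lambda>x. f x + g x)"
  by (simp add: bounded_clinear_def clinear_def bounded_linear_add scaleC_add_right)

lemma bounded_clinear_zero: "bounded_clinear (\<lambda>x. 0)"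
  by (simp add: bounded_clinear_def clinear_def bounded_linear_zero scaleC_zero_right)

lemma state_star_hom_comp:
  assumes "state \<phi>" "star_hom f"
  shows "state (\<lambda>x. \<phi> (f x))"
  unfolding state_def
proof (intro conjI allI)
  show "bounded_clinear (\<lambda>x. \<phi> (f x))"
    by (rule bounded_clinear_compose[OF stateD(1)[OF assms(1)] bounded_clinear_star_hom[OF assms(2)]])
  show "\<exists>r\<ge>0. \<phi> (f (star a * a)) = complex_of_real r" for a
    using assms(1) by (simp only: star_homD(2,3)[OF assms(2)] state_def)
  show "\<phi> (f 1) = 1" by (simp only: star_homD(4)[OF assms(2)] stateD(4)[OF assms(1)])
qed

lemma state_star_hom_complex:
  assumes "star_hom (\<kappa> :: 'a::cstar_algebra \<Rightarrow> complex)"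
  shows "state \<kappa>"
  unfolding state_def
proof (intro conjI allI)
  show "\<exists>r\<ge>0. \<kappa> (star a * a) = complex_of_real r" for a
    by (intro exI[of _ "(cmod (\<kappa> a))\<^sup>2"])
      (simp add: star_homD[OF assms] mult.commute[of "cnj _"] complex_norm_square del: of_real_power)
qed (use bounded_clinear_star_hom[OF assms] star_homD(4)[OF assms] in auto)

section \<open>Vector states and polarization\<close>

definition vector_state :: "('a::cstar_algebra \<Rightarrow> complex) \<Rightarrow> 'a \<Rightarrow> 'a \<Rightarrow> complex"
  where "vector_state \<phi> v x = \<phi> (star v * x * v) / \<phi> (star v * v)"

lemma state_vector_state:
  assumes \<phi>: "state \<phi>" and v: "\<phi> (star v * v) \<noteq> 0"
  shows "state (vector_state \<phi> v)"
proof -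
  note D = positive_functionalD[OF stateD(5)[OF \<phi>]]
  have "vector_state \<phi> v = (\<lambda>x. (1 / \<phi> (star v * v)) * \<phi> (star v * (x * v)))"
    by (rule ext) (simp add: vector_state_def mult.assoc)
  moreover have "bounded_clinear (\<lambda>x. (1 / \<phi> (star v * v)) * \<phi> (star v * (x * v)))"
    by (intro bounded_clinear_cmult bounded_clinear_compose[OF stateD(1)[OF \<phi>]]
        bounded_clinear_compose[OF bounded_clinear_mult_left bounded_clinear_mult_right])
  ultimately have "bounded_clinear (vector_state \<phi> v)" by (simp only:)
  moreover have "\<exists>r\<ge>0. vector_state \<phi> v (star a * a) = complex_of_real r" for a
  proof -
    have "vector_state \<phi> v (star a * a) = \<phi> (star (a * v) * (a * v)) / \<phi> (star v * v)"
      by (simp add: vector_state_def star_mult mult.assoc)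
    also have "\<dots> = complex_of_real (Re (\<phi> (star (a * v) * (a * v))) / Re (\<phi> (star v * v)))"
      using positive_functional_real[OF stateD(5)[OF \<phi>]] by (metis of_real_divide)
    finally show ?thesis using D(7) by (metis divide_nonneg_nonneg)
  qed
  moreover have "vector_state \<phi> v 1 = 1" using v by (simp add: vector_state_def)
  ultimately show ?thesis by (simp add: state_def)
qed

inductive state_span :: "('a::cstar_algebra \<Rightarrow> complex) \<Rightarrow> bool"
  where
    zero: "state_span (\<lambda>x. 0)"
  | step: "state_span f \<Longrightarrow> state \<phi> \<Longrightarrow> state_span (\<lambda>x. f x + c * \<phi> x)"

lemma state_span_state: "state \<phi> \<Longrightarrow> state_span (\<lambda>x. c * \<phi> x)"
  using state_span.step[OF state_span.zero, of \<phi> c] by simp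

lemma state_span_add:
  assumes "state_span f" "state_span g"
  shows "state_span (\<lambda>x. f x + g x)"
  using assms(2)
proof (induction rule: state_span.induct)
  case (step g \<phi> c)
  from state_span.step[OF step(3,2), of c] show ?case by (simp add: add.assoc)
qed (simp add: assms(1))

lemma state_span_cmult:
  assumes "state_span f"
  shows "state_span (\<lambda>x. c * f x)"
  using assms
proof (induction rule: state_span.induct)
  case (step g \<phi> d)
  from state_span.step[OF step(3,2), of "c * d"] show ?case by (simp add: distrib_left mult.assoc)
qed (simp add: state_span.zero)

lemma bounded_clinear_state_span:
  assumes "state_span f"
  shows "bounded_clinear f"
  using assms
proof (induction rule: state_span.induct)
  case (step f \<phi> c)
  show ?case by (rule bounded_clinear_add[OF step(3) bounded_clinear_cmult[OF stateD(1)[OF step(2)]]])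
qed (rule bounded_clinear_zero)

text \<open>Up to a factor this is a vector state. If \<open>\<phi> (star v * v) = 0\<close>, no
  normalization is possible, but then Cauchy-Schwarz makes the functional 0.\<close>

lemma state_span_diagonal:
  assumes \<phi>: "state \<phi>"
  shows "state_span (\<lambda>x. \<phi> (star v * x * v))"
proof (cases "\<phi> (star v * v) = 0")
  case True
  have "\<phi> (star v * (x * v)) = 0" for x
    using positive_functional_CS[OF stateD(5)[OF \<phi>], of v "x * v"] True by simp
  then show ?thesis by (simp add: mult.assoc state_span.zero)
next
  case False
  have "(\<lambda>x. \<phi> (star v * x * v)) = (\<lambda>x. \<phi> (star v * v) * vector_state \<phi> v x)"
    using False by (intro ext) (simp add: vector_state_def)
  then show ?thesis by (simp add: state_span_state[OF state_vector_state[OF \<phi> False]])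
qed

text \<open>Polarization.\<close>

lemma state_span_coefficient:
  assumes \<phi>: "state \<phi>"
  shows "state_span (\<lambda>x. \<phi> (star v * x * w))"
proof -
  let ?q = "\<lambda>c x. \<phi> (star (v + c *\<^sub>C w) * x * (v + c *\<^sub>C w))"
  note D = positive_functionalD[OF stateD(5)[OF \<phi>]]
  have q: "?q c x = \<phi> (star v * x * v) + c * \<phi> (star v * x * w) + cnj c * \<phi> (star w * x * v)
      + cnj c * c * \<phi> (star w * x * w)" for c x
    by (simp add: star_add star_scaleC distrib_left distrib_right mult_scaleC_left mult_scaleC_right D(1,2) scaleC_scaleC
        mult.assoc)
  have "(1/4) * ?q 1 x + ((-1/4) * ?q (-1) x + ((-\<i>/4) * ?q \<i> x + (\<i>/4) * ?q (-\<i>) x)) = \<phi> (star v * x * w)" for x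
    unfolding q by (simp add: algebra_simps)
  moreover have "state_span (\<lambda>x. (1/4) * ?q 1 x + ((-1/4) * ?q (-1) x + ((-\<i>/4) * ?q \<i> x + (\<i>/4) * ?q (-\<i>) x)))"
    by (intro state_span_add state_span_cmult state_span_diagonal \<phi>)
  ultimately show ?thesis by simp
qed

section \<open>Homomorphisms of minimal tensor products\<close>

inductive product_span :: "('a::cstar_algebra \<Rightarrow> 'b::cstar_algebra \<Rightarrow> complex) \<Rightarrow> bool"
  where
    zero: "product_span (\<lambda>a b. 0)"
  | step: "product_span \<beta> \<Longrightarrow> state \<phi> \<Longrightarrow> state \<psi> \<Longrightarrow> product_span (\<lambda>a b. \<beta> a b + c * (\<phi> a * \<psi> b))"

lemma product_span_add:
  assumes "product_span \<beta>" "product_span \<gamma>"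
  shows "product_span (\<lambda>a b. \<beta> a b + \<gamma> a b)"
  using assms(2)
proof (induction rule: product_span.induct)
  case (step g \<phi> \<psi> c)
  from product_span.step[OF step(4,2,3), of c] show ?case by (simp add: add.assoc)
qed (simp add: assms(1))

lemma product_span_cmult:
  assumes "product_span \<beta>"
  shows "product_span (\<lambda>a b. c * \<beta> a b)"
  using assms
proof (induction rule: product_span.induct)
  case (step g \<phi> \<psi> d)
  from product_span.step[OF step(4,2,3), of "c * d"] show ?case by (simp add: distrib_left mult.assoc)
qed (simp add: product_span.zero)

lemma product_span_mult:
  assumes "state_span f" "state_span g"
  shows "product_span (\<lambda>a b. f a * g b)"
  using assms(1)
proof (induction rule: state_span.induct)
  case (step f \<phi> c)
  have "product_span (\<lambda>a b. \<phi> a * g b)"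
    using assms(2)
  proof (induction rule: state_span.induct)
    case (step g \<psi> d)
    from product_span.step[OF step(3) \<open>state \<phi>\<close> step(2), of d]
    show ?case by (simp add: distrib_left mult_ac)
  qed (simp add: product_span.zero)
  from product_span_add[OF step(3) product_span_cmult[OF this, of c]]
  show ?case by (simp add: distrib_right mult.assoc)
qed (simp add: product_span.zero)

definition min_bounded :: "('a::cstar_algebra \<Rightarrow> 'b::cstar_algebra \<Rightarrow> complex) \<Rightarrow> bool"
  where "min_bounded \<beta> \<longleftrightarrow> (\<exists>M. \<forall>xs. cmod (bsum \<beta> xs) \<le> M * min_norm (tensor_sum xs))"

lemma bsum_product_functional:
  assumes "state \<phi>" "state \<psi>"
  shows "bsum (\<lambda>a b. \<phi> a * \<psi> b) xs = product_functional \<phi> \<psi> (tensor_sum xs)"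
  by (induction xs) (auto simp: product_functional_ops[OF assms])

lemma product_functional_one: "state \<phi> \<Longrightarrow> state \<psi> \<Longrightarrow> product_functional \<phi> \<psi> 1 = 1"
  by (simp add: product_functional_ops stateD(4) flip: elem_tensor_ops(7))

text \<open>The functional is the coefficient of the unit vector 1 in its own GNS space.\<close>

lemma product_functional_le:
  assumes "state \<phi>" "state \<psi>"
  shows "cmod (product_functional \<phi> \<psi> t) \<le> min_norm t"
proof -
  let ?p = "gns_seminorm (product_functional \<phi> \<psi>)"
  have p1: "?p 1 = 1" by (simp add: gns_seminorm_def star_one product_functional_one assms)
  have "cmod (product_functional \<phi> \<psi> (star 1 * t)) \<le> ?p 1 * ?p t"
    by (rule gns_seminorm_CS[OF product_functional_positive[OF assms]])
  also have "\<dots> \<le> min_norm t" using min_norm_bound[OF assms, of t 1] by (simp add: p1)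
  finally show ?thesis by (simp add: star_one)
qed

lemma min_bounded_product_span:
  assumes "product_span \<beta>"
  shows "min_bounded \<beta>"
  using assms
proof (induction rule: product_span.induct)
  case zero
  have "bsum (\<lambda>a b. 0) xs = 0" for xs :: "('a \<times> 'b) list" by (induction xs) auto
  then show ?case unfolding min_bounded_def by (auto intro!: exI[of _ 0])
next
  case (step \<beta> \<phi> \<psi> c)
  then obtain M where M: "\<And>xs. cmod (bsum \<beta> xs) \<le> M * min_norm (tensor_sum xs)"
    by (auto simp: min_bounded_def)
  show ?case
    unfolding min_bounded_def
  proof (intro exI[of _ "M + cmod c"] allI)
    fix xs
    have "cmod (bsum (\<lambda>a b. \<beta> a b + c * (\<phi> a * \<psi> b)) xs)
        \<le> cmod (bsum \<beta> xs) + cmod c * cmod (product_functional \<phi> \<psi> (tensor_sum xs))"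
      unfolding bsum_add bsum_cmult bsum_product_functional[OF step(2,3)] norm_mult[symmetric]
      by (rule norm_triangle_ineq)
    also have "\<dots> \<le> M * min_norm (tensor_sum xs) + cmod c * min_norm (tensor_sum xs)"
      by (intro add_mono mult_left_mono M product_functional_le step) simp
    finally show "cmod (bsum (\<lambda>a b. \<beta> a b + c * (\<phi> a * \<psi> b)) xs) \<le> (M + cmod c) * min_norm (tensor_sum xs)"
      by (simp add: distrib_right)
  qed
qed

lemma bsum_clinear: "clinear f \<Longrightarrow> bsum (\<lambda>a b. f (\<beta> a b)) xs = f (\<Sum>(a, b)\<leftarrow>xs. \<beta> a b)"
  by (induction xs) (auto simp: clinear_eqs)

lemma min_tensor_closed_induct:
  assumes "closed {x. P x}" "\<And>t. P (of_alg_tensor t)"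
  shows "P x"
proof -
  have "x \<in> closure (range of_alg_tensor)"
    unfolding closure_approachable
  proof (intro allI impI)
    fix e :: real assume "e > 0"
    then obtain t where "norm (x - of_alg_tensor t) < e" using min_tensor_dense by blast
    then show "\<exists>y\<in>range of_alg_tensor. dist y x < e" by (auto simp: dist_norm norm_minus_commute)
  qed
  moreover have "closure (range of_alg_tensor) \<subseteq> {x. P x}"
    by (rule closure_minimal) (use assms in auto)
  ultimately show ?thesis by blast
qed

lemma bounded_clinear_continuous_on: "bounded_clinear f \<Longrightarrow> continuous_on S g \<Longrightarrow> continuous_on S (\<lambda>x. f (g x))"
  by (simp add: bounded_clinear_def bounded_linear.continuous_on)

lemma continuous_on_scaleC:
  "continuous_on S f \<Longrightarrow> continuous_on S (\<lambda>x. c *\<^sub>C (f x :: 'a::cstar_algebra))"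
  by (rule bounded_linear.continuous_on[OF bounded_linear_scaleC])

text \<open>The norm bound makes the value on the image of the algebraic tensors independent of the
  chosen preimage. It also gives uniform continuity, hence an extension to the closure, to which all
  identities pass by density.\<close>

theorem ex_min_tensor_extension:
  fixes T :: "('a::cstar_algebra, 'b::cstar_algebra) alg_tensor \<Rightarrow> 'c::cstar_algebra"
  assumes T: "clinear T" and K: "\<And>t. norm (T t) \<le> K * min_norm t"
  shows "\<exists>T'. bounded_clinear T' \<and> (\<forall>t. T' (of_alg_tensor t) = T t)"
proof -
  note L = clinear_eqs[OF T]
  have K0: "norm (T t) \<le> \<bar>K\<bar> * norm (of_alg_tensor t)" for t
    unfolding norm_of_alg_tensor by (rule order.trans[OF K mult_right_mono[OF abs_ge_self min_norm_nonneg]])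
  define f where "f x = T (SOME t. of_alg_tensor t = x)" for x
  have f: "f (of_alg_tensor t) = T t" for t
  proof -
    define u where "u = (SOME u. of_alg_tensor u = of_alg_tensor t)"
    have "of_alg_tensor u = of_alg_tensor t" unfolding u_def by (rule someI) (rule refl)
    then have "norm (T (u - t)) \<le> 0" using K0[of "u - t"] by (simp add: of_alg_tensor_diff)
    then show ?thesis by (simp add: f_def L flip: u_def)
  qed
  have lip: "dist (f x) (f y) \<le> \<bar>K\<bar> * dist x y" if "x \<in> range of_alg_tensor" "y \<in> range of_alg_tensor" for x y
  proof -
    from that obtain t u where "x = of_alg_tensor t" "y = of_alg_tensor u" by blast
    then show ?thesis using K0[of "t - u"] by (simp add: f dist_norm L of_alg_tensor_diff)
  qed
  have "uniformly_continuous_on (range of_alg_tensor) f"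
    unfolding uniformly_continuous_on_def
  proof (intro allI impI)
    fix e :: real assume e: "e > 0"
    show "\<exists>d>0. \<forall>x\<in>range of_alg_tensor. \<forall>x'\<in>range of_alg_tensor. dist x' x < d \<longrightarrow> dist (f x') (f x) < e"
    proof (intro exI[of _ "e / (\<bar>K\<bar> + 1)"] conjI ballI impI)
      fix x x' :: "('a, 'b) min_tensor"
      assume x: "x \<in> range of_alg_tensor" "x' \<in> range of_alg_tensor" "dist x' x < e / (\<bar>K\<bar> + 1)"
      have "dist (f x') (f x) \<le> \<bar>K\<bar> * dist x' x" by (rule lip[OF x(2,1)])
      also have "\<dots> \<le> (\<bar>K\<bar> + 1) * dist x' x" by (simp add: distrib_right)
      also have "\<dots> < e" using x(3) by (simp add: field_simps)
      finally show "dist (f x') (f x) < e" .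
    qed (use e in simp)
  qed
  then obtain g where g: "uniformly_continuous_on (closure (range of_alg_tensor)) g"
      "\<And>x. x \<in> range of_alg_tensor \<Longrightarrow> f x = g x"
    by (rule uniformly_continuous_on_extension_on_closure) blast
  have "x \<in> closure (range of_alg_tensor)" for x :: "('a, 'b) min_tensor"
    by (rule min_tensor_closed_induct) (auto intro: closure_subset[THEN subsetD])
  then have "closure (range of_alg_tensor) = (UNIV :: ('a, 'b) min_tensor set)" by blast
  with g(1) have cont: "continuous_on UNIV g" using uniformly_continuous_imp_continuous by fastforce
  have gT: "g (of_alg_tensor t) = T t" for t using g(2)[of "of_alg_tensor t"] f by simp
  have cg: "continuous_on UNIV (\<lambda>x. g (h x))" if "continuous_on UNIV h" for h :: "('a, 'b) min_tensor \<Rightarrow> ('a, 'b) min_tensor"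
    using continuous_on_compose[OF that continuous_on_subset[OF cont]] by (simp add: o_def)
  have add0: "g (of_alg_tensor t + y) = g (of_alg_tensor t) + g y" for t y
    by (rule min_tensor_closed_induct[where P = "\<lambda>y. g (of_alg_tensor t + y) = g (of_alg_tensor t) + g y"])
      (intro closed_Collect_eq continuous_intros cg cont, simp add: gT L flip: of_alg_tensor_ops)
  have add: "g (x + y) = g x + g y" for x y
    by (rule min_tensor_closed_induct[where P = "\<lambda>x. g (x + y) = g x + g y"])
      (intro closed_Collect_eq continuous_intros cg cont, rule add0)
  have scale: "g (c *\<^sub>C x) = c *\<^sub>C g x" for c x
    by (rule min_tensor_closed_induct[where P = "\<lambda>x. g (c *\<^sub>C x) = c *\<^sub>C g x"])
      (intro closed_Collect_eq continuous_on_scaleC cg cont continuous_on_id, simp add: gT L flip: of_alg_tensor_ops)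
  have bd: "norm (g x) \<le> \<bar>K\<bar> * norm x" for x
    by (rule min_tensor_closed_induct[where P = "\<lambda>x. norm (g x) \<le> \<bar>K\<bar> * norm x"])
      (intro closed_Collect_le continuous_intros cont, simp add: gT K0)
  have "clinear g" by (simp add: clinear_def add scale)
  moreover have "bounded_linear g"
    by (rule bounded_linear_intro[of _ "\<bar>K\<bar>"])
      (simp_all add: add clinear_scaleR[OF \<open>clinear g\<close>] bd mult.commute[of _ "\<bar>K\<bar>"])
  ultimately have "bounded_clinear g" by (simp add: bounded_clinear_def)
  with gT show ?thesis by blast
qed

section \<open>Norming families and homomorphisms out of the minimal tensor product\<close>

definition norming :: "('a::cstar_algebra \<Rightarrow> complex) set \<Rightarrow> bool"
  where "norming S \<longleftrightarrow> (\<forall>\<phi>\<in>S. state \<phi>) \<and>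
    (\<forall>x C. C \<ge> 0 \<longrightarrow> (\<forall>\<phi>\<in>S. Re (\<phi> (star x * x)) \<le> C\<^sup>2) \<longrightarrow> norm x \<le> C)"

lemma norming_states: "norming {\<phi> :: 'a::nonzero_cstar_algebra \<Rightarrow> complex. state \<phi>}"
  unfolding norming_def
proof (intro conjI allI impI)
  fix x :: 'a and C :: real
  assume C: "C \<ge> 0" "\<forall>\<phi>\<in>{\<phi>. state \<phi>}. Re (\<phi> (star x * x)) \<le> C\<^sup>2"
  obtain \<phi> where "state \<phi>" "\<phi> (star x * x) = complex_of_real ((norm x)\<^sup>2)" using ex_state_norm by blast
  with C(2) have "(norm x)\<^sup>2 \<le> C\<^sup>2" by force
  then show "norm x \<le> C" by (rule power2_le_imp_le) (rule C(1))
qed simp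

lemma norming_eqI:
  assumes "norming S" "\<And>\<phi> u. \<phi> \<in> S \<Longrightarrow> \<phi> (u * x) = \<phi> (u * y)"
  shows "x = (y :: 'a::cstar_algebra)"
proof -
  have "Re (\<phi> (star (x - y) * (x - y))) \<le> 0\<^sup>2" if "\<phi> \<in> S" for \<phi>
  proof -
    have "clinear \<phi>" using assms(1) that by (auto simp: norming_def stateD)
    then have "\<phi> (star (x - y) * (x - y)) = \<phi> (star (x - y) * x) - \<phi> (star (x - y) * y)"
      by (simp only: right_diff_distrib clinear_eqs(5))
    then show ?thesis using assms(2)[OF that, of "star (x - y)"] by (simp only:) simp
  qed
  then have "norm (x - y) \<le> 0" using assms(1) unfolding norming_def by blast
  then show ?thesis by simp
qed

text \<open>Linear maps on the algebraic tensor product need functionals separating the points of the codomain, because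
  the tensors are identified by scalar-valued bilinear forms.\<close>

lemma ex_alg_tensor_lift:
  fixes B :: "'a::star_algebra \<Rightarrow> 'b::star_algebra \<Rightarrow> 'c::cstar_algebra" and S :: "('c \<Rightarrow> complex) set"
  assumes S: "norming S" and B: "\<And>a. clinear (B a)" "\<And>b. clinear (\<lambda>a. B a b)"
  shows "\<exists>T. clinear T \<and> (\<forall>a b. T (elem_tensor a b) = B a b)"
proof -
  define s where "s xs = (\<Sum>(a, b)\<leftarrow>xs. B a b)" for xs
  define T where "T t = s (SOME xs. t = tensor_sum xs)" for t
  have "s xs = s ys" if eq: "tensor_sum xs = tensor_sum ys" for xs ys
  proof (rule norming_eqI[OF S])
    fix \<phi> u assume "\<phi> \<in> S"
    then have \<phi>: "clinear \<phi>" using S by (auto simp: norming_def stateD)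
    have lin: "clinear (\<lambda>x. \<phi> (u * x))" by (rule clinear_compose[OF \<phi> clinear_mult_left])
    have cb: "cbilinear (\<lambda>a b. \<phi> (u * B a b))"
      unfolding cbilinear_def using clinear_compose[OF lin B(1)] clinear_compose[OF lin B(2)] by blast
    have "\<phi> (u * s zs) = alg_eval (\<lambda>a b. \<phi> (u * B a b)) (tensor_sum zs)" for zs
      by (induction zs) (auto simp: s_def clinear_eqs[OF lin] clinear_eqs(4)[OF \<phi>] alg_eval_ops[OF cb])
    then show "\<phi> (u * s xs) = \<phi> (u * s ys)" by (simp only: eq)
  qed
  then have T: "T (tensor_sum xs) = s xs" for xs
    unfolding T_def by (metis (mono_tags, lifting) someI_ex)
  have "clinear T"
    unfolding clinear_def
  proof (intro conjI allI)
    fix t u :: "('a, 'b) alg_tensor" and c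
    obtain xs where xs: "t = tensor_sum xs" using ex_tensor_sum by blast
    obtain ys where ys: "u = tensor_sum ys" using ex_tensor_sum by blast
    have "t + u = tensor_sum (xs @ ys)" by (simp add: xs ys)
    then show "T (t + u) = T t + T u" unfolding xs ys by (simp only: T) (simp add: s_def)
    have "c *\<^sub>C tensor_sum xs = tensor_sum (map (\<lambda>(a, b). (c *\<^sub>C a, b)) xs)"
      by (induction xs) (auto simp: elem_tensor_ops scaleC_zero_right scaleC_add_right)
    moreover have "s (map (\<lambda>(a, b). (c *\<^sub>C a, b)) xs) = c *\<^sub>C s xs"
      by (induction xs) (auto simp: s_def clinear_eqs(2)[OF B(2)] scaleC_zero_right scaleC_add_right)
    ultimately show "T (c *\<^sub>C t) = c *\<^sub>C T t" unfolding xs by (simp only: T)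
  qed
  moreover have "T (elem_tensor a b) = B a b" for a b
    using T[of "[(a, b)]"] by (simp add: s_def)
  ultimately show ?thesis by blast
qed

lemma star_hom_alg_tensorI:
  fixes T :: "('a::star_algebra, 'b::star_algebra) alg_tensor \<Rightarrow> 'c::star_algebra"
  assumes T: "clinear T" "\<And>a b. T (elem_tensor a b) = i a * j b"
    and hom: "star_hom i" "star_hom j" and comm: "\<And>a b. i a * j b = j b * i a"
  shows "star_hom T"
  unfolding star_hom_def
proof (intro conjI allI)
  note I = star_homD[OF hom(1)] and J = star_homD[OF hom(2)]
  note L = clinear_eqs[OF T(1)]
  have 1: "T (elem_tensor a b * t) = T (elem_tensor a b) * T t" for a b t
  proof (induction t rule: alg_tensor_induct_aux)
    case (2 c d t)
    have "T (elem_tensor a b * elem_tensor c d) = T (elem_tensor a b) * T (elem_tensor c d)"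
      unfolding elem_tensor_ops T(2) I(2) J(2) by (metis comm mult.assoc)
    with 2 show ?case by (simp add: distrib_left L)
  qed (simp add: L)
  show "T (s * t) = T s * T t" for s t
    by (induction s rule: alg_tensor_induct_aux) (simp_all add: L 1 distrib_right)
  show "T (star t) = star (T t)" for t
  proof (induction t rule: alg_tensor_induct_aux)
    case (2 c d t)
    have "T (star (elem_tensor c d)) = star (T (elem_tensor c d))"
      by (simp only: elem_tensor_ops T(2) star_mult I(3)[symmetric] J(3)[symmetric] comm)
    with 2 show ?case by (simp add: star_add L)
  qed (simp add: L star_zero)
  show "T 1 = 1" unfolding elem_tensor_ops(7)[symmetric] T(2) I(4) J(4) by simp
qed (rule T(1))

lemma closed_nonneg_complex: "closed {z. \<exists>r\<ge>0. z = complex_of_real r}"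
proof -
  have "{z. \<exists>r\<ge>0. z = complex_of_real r} = {z. Im z = 0} \<inter> {z. Re z \<ge> 0}"
    by (auto simp: complex_eq_iff)
  then show ?thesis
    by (simp only:) (intro closed_Int closed_Collect_eq closed_Collect_le continuous_intros)
qed

lemma state_extension:
  fixes F :: "('a::cstar_algebra, 'b::cstar_algebra) alg_tensor \<Rightarrow> complex"
  assumes F: "positive_functional F" "F 1 = 1" and M: "\<And>t. cmod (F t) \<le> M * min_norm t"
  shows "\<exists>F'. state F' \<and> (\<forall>t. F' (of_alg_tensor t) = F t)"
proof -
  have "clinear F" using F(1) by (simp add: positive_functional_def)
  from ex_min_tensor_extension[OF this M]
  obtain F' where F': "bounded_clinear F'" "\<And>t. F' (of_alg_tensor t) = F t" by blast
  have cont: "continuous_on UNIV (\<lambda>x :: ('a, 'b) min_tensor. F' (star x * x))"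
    by (intro bounded_clinear_continuous_on[OF F'(1)] continuous_intros continuous_on_star)
  have "\<exists>r\<ge>0. F' (star x * x) = complex_of_real r" for x
  proof (rule min_tensor_closed_induct[where P = "\<lambda>x. \<exists>r\<ge>0. F' (star x * x) = complex_of_real r"])
    have "{x. \<exists>r\<ge>0. F' (star x * x) = complex_of_real r} = (\<lambda>x. F' (star x * x)) -` {z. \<exists>r\<ge>0. z = complex_of_real r}"
      by auto
    then show "closed {x. \<exists>r\<ge>0. F' (star x * x) = complex_of_real r}"
      by (simp only:) (intro closed_vimage closed_nonneg_complex cont)
    show "\<exists>r\<ge>0. F' (star (of_alg_tensor t) * of_alg_tensor t) = complex_of_real r" for t
      unfolding of_alg_tensor_ops[symmetric] F'(2) using F(1) by (simp add: positive_functional_def)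
  qed
  moreover have "F' 1 = 1" using F'(2)[of 1] F(2) by (simp only: of_alg_tensor_ops)
  ultimately show ?thesis using F' by (auto simp: state_def)
qed

text \<open>For \<phi> in \<open>S\<close> the composition of \<phi> with \<open>T\<close> is
  bounded by some unknown constant, which suffices to extend it to a state of the completion. A
  state is contractive on self-adjoint elements, so the constant disappears, and evaluation at
  \<open>star t * t\<close> bounds the norm of \<open>T t\<close>.\<close>

theorem norm_star_hom_alg_tensor_le:
  fixes T :: "('a::cstar_algebra, 'b::cstar_algebra) alg_tensor \<Rightarrow> 'c::cstar_algebra" and S :: "('c \<Rightarrow> complex) set"
  assumes T: "star_hom T" and S: "norming S"
    and bd: "\<And>\<phi>. \<phi> \<in> S \<Longrightarrow> min_bounded (\<lambda>a b. \<phi> (T (elem_tensor a b)))"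
  shows "norm (T t) \<le> min_norm t"
proof -
  note H = star_homD[OF T]
  have "Re (\<phi> (star (T t) * T t)) \<le> (min_norm t)\<^sup>2" if \<phi>S: "\<phi> \<in> S" for \<phi>
  proof -
    have \<phi>: "state \<phi>" using S \<phi>S by (auto simp: norming_def)
    let ?F = "\<lambda>t. \<phi> (T t)"
    have lin: "clinear ?F" by (rule clinear_compose[OF stateD(2)[OF \<phi>] H(1)])
    obtain M where M: "\<And>xs. cmod (bsum (\<lambda>a b. \<phi> (T (elem_tensor a b))) xs) \<le> M * min_norm (tensor_sum xs)"
      using bd[OF \<phi>S] unfolding min_bounded_def by blast
    have "bsum (\<lambda>a b. ?F (elem_tensor a b)) xs = ?F (tensor_sum xs)" for xs
      by (rule bsum_clinear[OF lin])
    then have M: "cmod (?F t) \<le> M * min_norm t" for t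
      using M ex_tensor_sum[of t] by metis
    have "positive_functional ?F"
      unfolding positive_functional_def
    proof (intro conjI allI lin)
      show "\<exists>r\<ge>0. \<phi> (T (star x * x)) = complex_of_real r" for x
        using \<phi> by (simp only: H(2,3) state_def)
    qed
    moreover have "?F 1 = 1" by (simp only: H(4) stateD(4)[OF \<phi>])
    ultimately obtain F' where F': "state F'" "\<And>t. F' (of_alg_tensor t) = ?F t"
      using state_extension[OF _ _ M] by blast
    have "Re (\<phi> (star (T t) * T t)) = Re (F' (of_alg_tensor (star t * t)))"
      by (simp only: F'(2) H(2,3))
    also have "\<dots> \<le> cmod (F' (of_alg_tensor (star t * t)))" by (rule complex_Re_le_cmod)
    also have "\<dots> \<le> norm (of_alg_tensor (star t * t))"
      by (rule state_star_mult_le[OF F'(1)]) (simp add: star_mult star_star flip: of_alg_tensor_ops)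
    also have "\<dots> = (min_norm t)\<^sup>2" by (simp only: norm_of_alg_tensor min_norm_cstar)
    finally show ?thesis .
  qed
  then show ?thesis using S min_norm_nonneg[of t] unfolding norming_def by blast
qed

text \<open>The source of \<open>tensor_map\<close>, of the slices and of
  \<open>tensor_assoc\<close>. In each application the work lies in choosing a norming family on the
  target whose members become visibly bounded when composed with \<open>i a * j b\<close>.\<close>

theorem ex_tensor_hom:
  fixes i :: "'a::cstar_algebra \<Rightarrow> 'c::cstar_algebra" and j :: "'b::cstar_algebra \<Rightarrow> 'c"
    and S :: "('c \<Rightarrow> complex) set"
  assumes hom: "star_hom i" "star_hom j" and comm: "\<And>a b. i a * j b = j b * i a"
    and S: "norming S" "\<And>\<phi>. \<phi> \<in> S \<Longrightarrow> min_bounded (\<lambda>a b. \<phi> (i a * j b))"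
  shows "\<exists>T. star_hom T \<and> (\<forall>a b. T (a \<otimes> b) = i a * j b)"
proof -
  have "clinear (\<lambda>b. i a * j b)" "clinear (\<lambda>a. i a * j b)" for a b
    by (rule clinear_compose[OF clinear_mult_left star_homD(1)[OF hom(2)]],
        rule clinear_compose[OF clinear_mult_right star_homD(1)[OF hom(1)]])
  from ex_alg_tensor_lift[OF S(1) this]
  obtain T where T: "clinear T" "\<And>a b. T (elem_tensor a b) = i a * j b" by blast
  have TH: "star_hom T" by (rule star_hom_alg_tensorI[OF T hom comm])
  have "norm (T t) \<le> 1 * min_norm t" for t
    using norm_star_hom_alg_tensor_le[OF TH S(1)] S(2) by (simp add: T(2))
  from ex_min_tensor_extension[OF T(1) this]
  obtain T' where T': "bounded_clinear T'" "\<And>t. T' (of_alg_tensor t) = T t" by blast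
  note H = star_homD[OF TH]
  have cont: "continuous_on UNIV (\<lambda>x. T' (h x))" if "continuous_on UNIV h" for h :: "('a, 'b) min_tensor \<Rightarrow> _"
    by (rule bounded_clinear_continuous_on[OF T'(1) that])
  have m0: "T' (of_alg_tensor t * y) = T' (of_alg_tensor t) * T' y" for t y
    by (rule min_tensor_closed_induct[where P = "\<lambda>y. T' (of_alg_tensor t * y) = T' (of_alg_tensor t) * T' y"])
      (intro closed_Collect_eq continuous_intros cont, simp add: T'(2) H(2) flip: of_alg_tensor_ops)
  have "T' (x * y) = T' x * T' y" for x y
    by (rule min_tensor_closed_induct[where P = "\<lambda>x. T' (x * y) = T' x * T' y"])
      (intro closed_Collect_eq continuous_intros cont, rule m0)
  moreover have "T' (star x) = star (T' x)" for x
    by (rule min_tensor_closed_induct[where P = "\<lambda>x. T' (star x) = star (T' x)"])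
      (intro closed_Collect_eq continuous_on_star cont continuous_on_id, simp add: T'(2) H(3) flip: of_alg_tensor_ops)
  moreover have "T' 1 = 1" using T'(2)[of 1] by (simp add: of_alg_tensor_ops H(4))
  ultimately have "star_hom T'" using T'(1) by (simp add: star_hom_def bounded_clinear_def)
  moreover have "T' (a \<otimes> b) = i a * j b" for a b by (simp add: tensor_def T'(2) T(2))
  ultimately show ?thesis by blast
qed

section \<open>Families of states that compute the minimal norm\<close>

definition tensor_state :: "('a::cstar_algebra \<Rightarrow> complex) \<Rightarrow> ('b::cstar_algebra \<Rightarrow> complex) \<Rightarrow> ('a, 'b) min_tensor \<Rightarrow> complex"
  where "tensor_state \<phi> \<psi> = tensor_lift (\<lambda>a b. \<phi> a * \<psi> b)"

lemma tensor_state: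
  assumes st: "state \<phi>" "state \<psi>"
  shows "state (tensor_state \<phi> \<psi>)" "tensor_state \<phi> \<psi> (of_alg_tensor t) = product_functional \<phi> \<psi> t"
    "tensor_state \<phi> \<psi> (a \<otimes> b) = \<phi> a * \<psi> b"
proof -
  have le: "cmod (product_functional \<phi> \<psi> t) \<le> 1 * min_norm t" for t
    using product_functional_le[OF st] by simp
  from state_extension[OF product_functional_positive[OF st] product_functional_one[OF st] le]
  obtain F where F: "state F" "\<And>t. F (of_alg_tensor t) = product_functional \<phi> \<psi> t" by blast
  have "F (a \<otimes> b) = \<phi> a * \<psi> b" for a b by (simp add: tensor_def F(2) product_functional_ops[OF st])
  then have "tensor_state \<phi> \<psi> = F"
    unfolding tensor_state_def by (rule tensor_lift_eq[OF stateD(1)[OF F(1)]])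
  with F \<open>\<And>b a. F (a \<otimes> b) = \<phi> a * \<psi> b\<close>
  show "state (tensor_state \<phi> \<psi>)" "tensor_state \<phi> \<psi> (of_alg_tensor t) = product_functional \<phi> \<psi> t"
    "tensor_state \<phi> \<psi> (a \<otimes> b) = \<phi> a * \<psi> b" by simp_all
qed

text \<open>By Hahn-Banach this says that the convex hull of \<open>S\<close> is dense in the state
  space for pointwise convergence.\<close>

definition state_determining :: "('a::cstar_algebra \<Rightarrow> complex) set \<Rightarrow> bool"
  where "state_determining S \<longleftrightarrow> (\<forall>\<phi>\<in>S. state \<phi>) \<and>
    (\<forall>\<psi> d. state \<psi> \<longrightarrow> star d = d \<longrightarrow> (\<forall>\<phi>\<in>S. Re (\<phi> d) \<ge> 0) \<longrightarrow> Re (\<psi> d) \<ge> 0)"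

lemma state_determining_states: "state_determining {\<phi>. state \<phi>}"
  by (auto simp: state_determining_def)

text \<open>A lower bound 0 for \<open>d\<close> on \<open>S\<close> is an upper bound
  \<open>r\<close> for \<open>r - d = k * k\<close>. A norming family turns it into
  \<open>norm (r - d) \<le> r\<close>, and then no state can be negative at
  \<open>d\<close>.\<close>

lemma norming_imp_state_determining:
  fixes S :: "('a::cstar_algebra \<Rightarrow> complex) set"
  assumes S: "norming S"
  shows "state_determining S"
  unfolding state_determining_def
proof (intro conjI allI impI)
  show "\<forall>\<phi>\<in>S. state \<phi>" using S by (simp add: norming_def)
  fix \<psi> :: "'a \<Rightarrow> complex" and d
  assume \<psi>: "state \<psi>" and d: "star d = d" and pos: "\<forall>\<phi>\<in>S. Re (\<phi> d) \<ge> 0"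
  \<comment> \<open>Strictly larger than \<open>norm d\<close>, so that \<open>r - d\<close> has a
    square root.\<close>
  define r where "r = norm d + 1"
  have r: "r > norm d" "r > 0" by (auto simp: r_def add_nonneg_pos)
  have f1: "\<phi> (r *\<^sub>R 1 - d) = complex_of_real r - \<phi> d" if "state \<phi>" for \<phi>
    using stateD[OF that] by (simp add: clinear_eqs clinear_scaleR scaleR_conv_of_real)
  have se: "star (r *\<^sub>R 1 - d) = r *\<^sub>R 1 - d" by (simp add: star_diff star_scaleR_one d)
  moreover have "norm (r *\<^sub>R 1 - (r *\<^sub>R 1 - d)) < r" using r by simp
  ultimately obtain k where k: "cpos k" "k * k = r *\<^sub>R 1 - d" using ex_sqrt_scaled by blast
  have "Re (\<phi> (star k * k)) \<le> (sqrt r)\<^sup>2" if "\<phi> \<in> S" for \<phi>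
  proof -
    have "state \<phi>" using S that by (auto simp: norming_def)
    then have "Re (\<phi> (star k * k)) = r - Re (\<phi> d)"
      by (simp add: cpos_star[OF k(1)] k(2) f1)
    then show ?thesis using pos that r by simp
  qed
  then have "norm k \<le> sqrt r" using S r unfolding norming_def by (meson less_imp_le real_sqrt_ge_zero)
  then have "(norm k)\<^sup>2 \<le> r" using r by (metis less_imp_le norm_ge_zero power_mono real_sqrt_pow2)
  then have "norm (r *\<^sub>R 1 - d) \<le> r"
    using cstar_identity[of k] by (simp add: cpos_star[OF k(1)] k(2))
  then have "cmod (complex_of_real r - \<psi> d) \<le> r"
    using state_star_mult_le[OF \<psi> se] f1[OF \<psi>] by simp
  then show "Re (\<psi> d) \<ge> 0"
    using abs_Re_le_cmod[of "complex_of_real r - \<psi> d"] by simp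
qed

lemma continuous_on_gns_seminorm:
  assumes "state \<phi>" "continuous_on S g"
  shows "continuous_on S (\<lambda>x. gns_seminorm \<phi> (g x))"
  unfolding gns_seminorm_def
  by (intro continuous_intros bounded_clinear_continuous_on[OF stateD(1)[OF assms(1)]] continuous_on_star assms(2))

lemma gns_seminorm_of_alg_tensor:
  assumes "state \<phi>" "state \<psi>"
  shows "gns_seminorm (tensor_state \<phi> \<psi>) (of_alg_tensor t) = gns_seminorm (product_functional \<phi> \<psi>) t"
  unfolding gns_seminorm_def by (simp add: tensor_state(2)[OF assms] flip: of_alg_tensor_ops)

text \<open>The vectors are restricted to a set \<open>V\<close> so that they can be chosen with
  computable coefficients, for instance as algebraic tensors; density of \<open>V\<close> is enough
  for the norm.\<close>

definition tensor_vector_states ::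
    "('a::cstar_algebra \<Rightarrow> complex) set \<Rightarrow> ('a, 'b::cstar_algebra) min_tensor set \<Rightarrow> (('a, 'b) min_tensor \<Rightarrow> complex) set"
  where "tensor_vector_states F V = {vector_state (tensor_state \<phi> \<psi>) v |\<phi> \<psi> v. \<phi> \<in> F \<and> state \<psi> \<and> v \<in> V \<and>
    tensor_state \<phi> \<psi> (star v * v) \<noteq> 0}"

text \<open>The minimal norm is computed by any family of states determining positivity on the left factor. The
  point of the proof is that the slice of a tensor by a state of the right factor is an element of the left factor.\<close>

theorem norming_tensor_vector_states:
  fixes F :: "('a::cstar_algebra \<Rightarrow> complex) set" and V :: "('a, 'b::cstar_algebra) min_tensor set"
  assumes F: "state_determining F" and V: "closure V = UNIV"
  shows "norming (tensor_vector_states F V)"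
  unfolding norming_def
proof (intro conjI allI impI)
  have st: "state \<phi>" if "\<phi> \<in> F" for \<phi> using F that by (simp add: state_determining_def)
  show "\<forall>\<phi>\<in>tensor_vector_states F V. state \<phi>"
    using st by (auto simp: tensor_vector_states_def intro!: state_vector_state tensor_state)
  fix e :: "('a, 'b) min_tensor" and C :: real
  assume C: "C \<ge> 0" and le: "\<forall>\<phi>\<in>tensor_vector_states F V. Re (\<phi> (star e * e)) \<le> C\<^sup>2"
  have e: "gns_seminorm (tensor_state \<phi> \<psi>) (e * s) \<le> C * gns_seminorm (tensor_state \<phi> \<psi>) s"
    if \<phi>: "\<phi> \<in> F" and \<psi>: "state \<psi>" for \<phi> \<psi> s
  proof -
    let ?W = "tensor_state \<phi> \<psi>"
    have W: "state ?W" by (rule tensor_state(1)[OF st[OF \<phi>] \<psi>])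
    note P = stateD(5)[OF W]
    have V1: "gns_seminorm ?W (e * v) \<le> C * gns_seminorm ?W v" if v: "v \<in> V" for v
    proof (cases "?W (star v * v) = 0")
      case True
      then have "gns_seminorm ?W v = 0" by (simp add: gns_seminorm_def)
      then show ?thesis using state_gns_seminorm_mult[OF W, of e v] by simp
    next
      case False
      then have "vector_state ?W v \<in> tensor_vector_states F V"
        using \<phi> \<psi> v by (auto simp: tensor_vector_states_def)
      then have 1: "Re (vector_state ?W v (star e * e)) \<le> C\<^sup>2" using le by blast
      have r: "?W (star v * v) = complex_of_real (Re (?W (star v * v)))"
        by (rule positive_functional_real[OF P])
      have pos: "Re (?W (star v * v)) > 0"
        using False r positive_functionalD(7)[OF P, of v] by (metis less_eq_real_def of_real_0)
      have "Re (vector_state ?W v (star e * e)) = Re (?W (star (e * v) * (e * v))) / Re (?W (star v * v))"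
        unfolding vector_state_def by (subst r) (simp add: star_mult mult.assoc)
      with 1 pos have "Re (?W (star (e * v) * (e * v))) \<le> C\<^sup>2 * Re (?W (star v * v))"
        by (simp add: divide_le_eq)
      then have "(gns_seminorm ?W (e * v))\<^sup>2 \<le> (C * gns_seminorm ?W v)\<^sup>2"
        unfolding power_mult_distrib gns_seminorm_sq[OF P] .
      then show ?thesis
        by (rule power2_le_imp_le) (simp add: C gns_seminorm_nonneg[OF P])
    qed
    have "closed {s. gns_seminorm ?W (e * s) \<le> C * gns_seminorm ?W s}"
      by (intro closed_Collect_le continuous_intros continuous_on_gns_seminorm[OF W])
    then have "closure V \<subseteq> {s. gns_seminorm ?W (e * s) \<le> C * gns_seminorm ?W s}"
      using V1 by (intro closure_minimal) auto
    then show ?thesis using V by auto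
  qed
  show "norm e \<le> C"
  proof (rule field_le_epsilon)
    fix \<epsilon> :: real assume \<epsilon>: "\<epsilon> > 0"
    \<comment> \<open>One \<eta> is lost in passing from \<open>e\<close> to the algebraic tensor
      \<open>t\<close>, the other in returning.\<close>
    define \<eta> where "\<eta> = \<epsilon> / 2"
    have \<eta>: "\<eta> > 0" "\<eta> + \<eta> = \<epsilon>" using \<epsilon> by (auto simp: \<eta>_def)
    obtain t where t: "norm (e - of_alg_tensor t) < \<eta>" using min_tensor_dense[OF \<eta>(1)] by blast
    define K where "K = C + \<eta>"
    have K: "K \<ge> 0" using C \<eta> by (simp add: K_def)
    have alg: "gns_seminorm (product_functional \<phi> \<psi>) (t * s) \<le> K * gns_seminorm (product_functional \<phi> \<psi>) s"
      if \<phi>: "\<phi> \<in> F" and \<psi>: "state \<psi>" for \<phi> \<psi> s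
    proof -
      let ?W = "tensor_state \<phi> \<psi>" and ?t = "of_alg_tensor t" and ?s = "of_alg_tensor s"
      have W: "state ?W" by (rule tensor_state(1)[OF st[OF \<phi>] \<psi>])
      have "gns_seminorm ?W (e * ?s + (?t - e) * ?s) \<le> gns_seminorm ?W (e * ?s) + gns_seminorm ?W ((?t - e) * ?s)"
        by (rule gns_seminorm_triangle[OF stateD(5)[OF W]])
      also have "\<dots> \<le> C * gns_seminorm ?W ?s + norm (?t - e) * gns_seminorm ?W ?s"
        by (intro add_mono e[OF \<phi> \<psi>] state_gns_seminorm_mult[OF W])
      also have "\<dots> \<le> C * gns_seminorm ?W ?s + \<eta> * gns_seminorm ?W ?s"
        using t by (intro add_left_mono mult_right_mono gns_seminorm_nonneg[OF stateD(5)[OF W]])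
          (simp add: norm_minus_commute)
      also have "\<dots> = K * gns_seminorm ?W ?s" by (simp add: K_def distrib_right)
      also have "e * ?s + (?t - e) * ?s = of_alg_tensor (t * s)" by (simp add: left_diff_distrib of_alg_tensor_ops)
      finally show ?thesis by (simp only: gns_seminorm_of_alg_tensor[OF st[OF \<phi>] \<psi>])
    qed
    have "min_norm t \<le> K"
    proof (rule min_norm_leI[OF K])
      fix \<phi> :: "'a \<Rightarrow> complex" and \<psi> :: "'b \<Rightarrow> complex" and s
      assume \<phi>: "state \<phi>" and \<psi>: "state \<psi>"
      \<comment> \<open>The inequality sought for states \<omega> and \<psi> says that the product
        functional is nonnegative at \<open>h\<close>. With \<psi> fixed it concerns only the slice
        \<open>d0\<close> of \<open>h\<close>, where one can pass from \<open>F\<close> to all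
        states \<omega>.\<close>
      define h where "h = complex_of_real (K\<^sup>2) *\<^sub>C (star s * s) - star (t * s) * (t * s)"
      obtain xs where xs: "h = tensor_sum xs" using ex_tensor_sum by blast
      define d0 where "d0 = (\<Sum>(a, b)\<leftarrow>xs. \<psi> b *\<^sub>C a)"
      \<comment> \<open>\<open>state_determining\<close> speaks of self-adjoint elements; taking the
        real part of \<open>d0\<close> leaves the real parts of its values under states
        unchanged.\<close>
      define d where "d = (1/2) *\<^sub>R (d0 + star d0)"
      have sd: "star d = d" by (simp add: d_def star_scaleR star_add star_star add.commute)
      have slice: "Re (\<omega> d) = K\<^sup>2 * (gns_seminorm (product_functional \<omega> \<psi>) s)\<^sup>2 - (gns_seminorm (product_functional \<omega> \<psi>) (t * s))\<^sup>2"
        if \<omega>: "state \<omega>" for \<omega>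
      proof -
        note D = positive_functionalD[OF stateD(5)[OF \<omega>]]
        have "\<omega> (star d0) = cnj (\<omega> d0)"
          using positive_functional_herm[OF stateD(5)[OF \<omega>], of d0 1] by (simp add: star_one)
        then have "Re (\<omega> d) = Re (\<omega> d0)"
          unfolding d_def clinear_scaleR[OF stateD(2)[OF \<omega>]] by (simp add: D)
        moreover have "\<omega> d0 = product_functional \<omega> \<psi> h"
          unfolding xs d0_def bsum_product_functional[OF \<omega> \<psi>, symmetric]
          by (induction xs) (auto simp: D mult.commute)
        moreover have "Re (product_functional \<omega> \<psi> h)
            = K\<^sup>2 * Re (product_functional \<omega> \<psi> (star s * s)) - Re (product_functional \<omega> \<psi> (star (t * s) * (t * s)))"
          unfolding h_def by (simp add: positive_functionalD[OF product_functional_positive[OF \<omega> \<psi>]])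
        ultimately show ?thesis by (simp add: gns_seminorm_sq[OF product_functional_positive[OF \<omega> \<psi>]])
      qed
      have "Re (\<omega> d) \<ge> 0" if "\<omega> \<in> F" for \<omega>
        using power_mono[OF alg[OF that \<psi>, of s], of 2] gns_seminorm_nonneg[OF product_functional_positive[OF st[OF that] \<psi>]]
        by (simp add: slice[OF st[OF that]] power_mult_distrib)
      then have "Re (\<phi> d) \<ge> 0" using F \<phi> sd unfolding state_determining_def by blast
      then have "(gns_seminorm (product_functional \<phi> \<psi>) (t * s))\<^sup>2 \<le> (K * gns_seminorm (product_functional \<phi> \<psi>) s)\<^sup>2"
        by (simp add: slice[OF \<phi>] power_mult_distrib)
      then show "gns_seminorm (product_functional \<phi> \<psi>) (t * s) \<le> K * gns_seminorm (product_functional \<phi> \<psi>) s"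
        by (rule power2_le_imp_le) (simp add: K gns_seminorm_nonneg[OF product_functional_positive[OF \<phi> \<psi>]])
    qed
    then have "norm e \<le> K + \<eta>"
      using t norm_triangle_ineq[of "e - of_alg_tensor t" "of_alg_tensor t"] by (simp add: norm_of_alg_tensor)
    then show "norm e \<le> C + \<epsilon>" using \<eta> by (simp add: K_def)
  qed
qed

section \<open>Functoriality, slices and associativity\<close>

lemma closure_range_of_alg_tensor: "closure (range of_alg_tensor) = UNIV"
proof -
  have "x \<in> closure (range of_alg_tensor)" for x
    by (rule min_tensor_closed_induct) (auto intro: closure_subset[THEN subsetD])
  then show ?thesis by blast
qed

lemma star_hom_id: "star_hom id"
  by (simp add: star_hom_def clinear_def)

lemma star_hom_ident: "star_hom (\<lambda>x. x)"
  by (simp add: star_hom_def clinear_def)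

lemma star_hom_comp: "star_hom f \<Longrightarrow> star_hom g \<Longrightarrow> star_hom (\<lambda>x. f (g x))"
  by (simp add: star_hom_def clinear_def)

lemma star_hom_tensor_left: "star_hom (\<lambda>a. a \<otimes> 1)"
  by (simp add: star_hom_def clinear_def tensor_add_left tensor_scaleC_left tensor_mult star_tensor tensor_one star_one)

lemma star_hom_tensor_right: "star_hom (\<lambda>b. 1 \<otimes> b)"
  by (simp add: star_hom_def clinear_def tensor_add_right tensor_scaleC_right tensor_mult star_tensor tensor_one star_one)

text \<open>Expanding \<open>s\<close> and \<open>u\<close> into elementary tensors leaves products
  of the coefficients treated by polarization, and composition with a homomorphism keeps these
  combinations of states.\<close>

lemma product_span_coefficient:
  fixes f :: "'a::cstar_algebra \<Rightarrow> 'c::cstar_algebra" and g :: "'b::cstar_algebra \<Rightarrow> 'd::cstar_algebra"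
  assumes st: "state \<phi>" "state \<psi>" and hom: "star_hom f" "star_hom g"
  shows "product_span (\<lambda>a b. product_functional \<phi> \<psi> (star s * elem_tensor (f a) (g b) * u))"
proof -
  note P = product_functional_ops[OF st]
  have 1: "product_span (\<lambda>a b. product_functional \<phi> \<psi> (star (elem_tensor x y) * elem_tensor (f a) (g b) * u))" for x y
  proof (induction u rule: alg_tensor_induct_aux)
    case 1
    show ?case by (simp add: P product_span.zero)
  next
    case (2 c d u)
    have sp: "state_span (\<lambda>a. \<phi> (star x * f a * c))" "state_span (\<lambda>b. \<psi> (star y * g b * d))"
    proof -
      have "state_span (\<lambda>a. h (F a))" if "state_span h" "star_hom F"
        for h :: "'e::cstar_algebra \<Rightarrow> complex" and F :: "'f::cstar_algebra \<Rightarrow> 'e"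
        using that(1)
      proof (induction rule: state_span.induct)
        case (step h \<omega> k)
        show ?case by (rule state_span.step[OF step(3) state_star_hom_comp[OF step(2) that(2)]])
      qed (rule state_span.zero)
      from this[OF state_span_coefficient[OF st(1)] hom(1)] this[OF state_span_coefficient[OF st(2)] hom(2)]
      show "state_span (\<lambda>a. \<phi> (star x * f a * c))" "state_span (\<lambda>b. \<psi> (star y * g b * d))" .
    qed
    from product_span_add[OF product_span_mult[OF sp] 2]
    show ?case by (simp add: distrib_left P elem_tensor_ops)
  qed
  show ?thesis
  proof (induction s rule: alg_tensor_induct_aux)
    case 1
    show ?case by (simp add: P product_span.zero star_zero)
  next
    case (2 x y s)
    from product_span_add[OF 1 2] show ?case by (simp add: star_add distrib_right P)
  qed
qed

lemma vector_state_of_alg_tensor: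
  assumes "state \<phi>" "state \<psi>"
  shows "vector_state (tensor_state \<phi> \<psi>) (of_alg_tensor s) (of_alg_tensor t)
    = (1 / product_functional \<phi> \<psi> (star s * s)) * product_functional \<phi> \<psi> (star s * t * s)"
  unfolding vector_state_def by (simp add: tensor_state(2)[OF assms] flip: of_alg_tensor_ops)

text \<open>Tested on vector states given by algebraic tensors, the candidate has coefficients in
  \<open>product_span\<close>, so \<open>ex_tensor_hom\<close> applies to the two commuting
  legs.\<close>

theorem tensor_map:
  fixes f :: "'a::cstar_algebra \<Rightarrow> 'c::cstar_algebra" and g :: "'b::cstar_algebra \<Rightarrow> 'd::cstar_algebra"
  assumes hom: "star_hom f" "star_hom g"
  shows "star_hom (tensor_map f g)" "tensor_map f g (a \<otimes> b) = f a \<otimes> g b"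
proof -
  let ?N = "tensor_vector_states {\<phi> :: 'c \<Rightarrow> complex. state \<phi>} (range of_alg_tensor) :: (('c, 'd) min_tensor \<Rightarrow> complex) set"
  have N: "norming ?N"
    by (rule norming_tensor_vector_states[OF state_determining_states closure_range_of_alg_tensor])
  have bd: "min_bounded (\<lambda>a b. \<phi> ((f a \<otimes> 1) * (1 \<otimes> g b)))" if "\<phi> \<in> ?N" for \<phi>
  proof -
    from that obtain \<omega> \<psi> s where st: "state \<omega>" "state \<psi>"
        and \<phi>: "\<phi> = vector_state (tensor_state \<omega> \<psi>) (of_alg_tensor s)"
      by (auto simp: tensor_vector_states_def)
    have "\<phi> ((f a \<otimes> 1) * (1 \<otimes> g b)) = (1 / product_functional \<omega> \<psi> (star s * s))
        * product_functional \<omega> \<psi> (star s * elem_tensor (f a) (g b) * s)" for a b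
      unfolding \<phi> tensor_mult by (simp add: tensor_def vector_state_of_alg_tensor[OF st])
    then show ?thesis
      using min_bounded_product_span[OF product_span_cmult[OF product_span_coefficient[OF st hom]]] by (simp only:)
  qed
  obtain T where T: "star_hom T" "\<And>a b. T (a \<otimes> b) = (f a \<otimes> 1) * (1 \<otimes> g b)"
    using ex_tensor_hom[OF star_hom_comp[OF star_hom_tensor_left hom(1)] star_hom_comp[OF star_hom_tensor_right hom(2)] _ N bd]
    by (auto simp: tensor_mult)
  have T2: "T (a \<otimes> b) = f a \<otimes> g b" for a b by (simp add: T(2) tensor_mult)
  have "tensor_map f g = T"
    unfolding tensor_map_def by (rule tensor_lift_eq[OF bounded_clinear_star_hom[OF T(1)] T2])
  with T(1) T2 show "star_hom (tensor_map f g)" "tensor_map f g (a \<otimes> b) = f a \<otimes> g b" by simp_all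
qed

lemma star_hom_tensor_eqI:
  fixes S T :: "('a::cstar_algebra, 'b::cstar_algebra) min_tensor \<Rightarrow> 'c::cstar_algebra"
  assumes "star_hom S" "star_hom T" "\<And>a b. S (a \<otimes> b) = T (a \<otimes> b)"
  shows "S x = T x"
  using bounded_clinear_tensor_unique[OF assms(1,2)[THEN bounded_clinear_star_hom] assms(3)] by (rule fun_cong)

lemma tensor_map_comp:
  assumes "star_hom f" "star_hom g" "star_hom f'" "star_hom g'"
  shows "tensor_map f g (tensor_map f' g' x) = tensor_map (\<lambda>x. f (f' x)) (\<lambda>x. g (g' x)) x"
  by (rule star_hom_tensor_eqI[of "\<lambda>x. tensor_map f g (tensor_map f' g' x)"])
    (simp_all add: star_hom_comp tensor_map assms)

definition slice_right :: "('b::cstar_algebra \<Rightarrow> complex) \<Rightarrow> ('a::cstar_algebra, 'b) min_tensor \<Rightarrow> 'a"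
  where "slice_right \<kappa> = tensor_lift (\<lambda>a b. \<kappa> b *\<^sub>C a)"

definition slice_left :: "('a::cstar_algebra \<Rightarrow> complex) \<Rightarrow> ('a, 'b::cstar_algebra) min_tensor \<Rightarrow> 'b"
  where "slice_left \<kappa> = tensor_lift (\<lambda>a b. \<kappa> a *\<^sub>C b)"

lemma star_hom_scalar: "star_hom \<kappa> \<Longrightarrow> star_hom (\<lambda>b. \<kappa> b *\<^sub>C (1 :: 'a::star_algebra))"
  by (simp add: star_hom_def clinear_def scaleC_add_left scaleC_scaleC scaleC_one mult_scaleC_left mult_scaleC_right
      star_scaleC star_one mult.commute)

text \<open>Slicing by a character, unlike slicing by a general state, is multiplicative: the second
  leg is \<open>\<kappa> b *\<^sub>C 1\<close>, which is central.\<close>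

lemma slice_right:
  fixes \<kappa> :: "'b::cstar_algebra \<Rightarrow> complex"
  assumes \<kappa>: "star_hom \<kappa>"
  shows "star_hom (slice_right \<kappa> :: ('a::nonzero_cstar_algebra, 'b) min_tensor \<Rightarrow> 'a)"
    "slice_right \<kappa> ((a :: 'a) \<otimes> b) = \<kappa> b *\<^sub>C a"
proof -
  let ?N = "{\<phi> :: 'a \<Rightarrow> complex. state \<phi>}"
  have bd: "min_bounded (\<lambda>a b. \<phi> (a * (\<kappa> b *\<^sub>C 1)))" if "\<phi> \<in> ?N" for \<phi>
  proof -
    have \<phi>: "state \<phi>" using that by simp
    have "\<phi> (a * (\<kappa> b *\<^sub>C 1)) = 1 * \<phi> a * \<kappa> b" for a b
      using positive_functionalD(2)[OF stateD(5)[OF \<phi>]] by (simp add: mult_scaleC_right)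
    moreover have "product_span (\<lambda>a b. 1 * \<phi> a * \<kappa> b)"
      using product_span_mult[OF state_span_state[OF \<phi>, of 1] state_span_state[OF state_star_hom_complex[OF \<kappa>], of 1]] by simp
    ultimately show ?thesis using min_bounded_product_span by (simp only:)
  qed
  obtain T where T: "star_hom T" "\<And>a b. T ((a :: 'a) \<otimes> b) = a * (\<kappa> b *\<^sub>C 1)"
    using ex_tensor_hom[OF star_hom_ident star_hom_scalar[OF \<kappa>] _ norming_states bd]
    by (auto simp: mult_scaleC_left mult_scaleC_right)
  have T2: "T (a \<otimes> b) = \<kappa> b *\<^sub>C a" for a b by (simp add: T(2) mult_scaleC_right)
  have "slice_right \<kappa> = T"
    unfolding slice_right_def by (rule tensor_lift_eq[OF bounded_clinear_star_hom[OF T(1)] T2])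
  with T(1) T2 show "star_hom (slice_right \<kappa> :: ('a, 'b) min_tensor \<Rightarrow> 'a)" "slice_right \<kappa> (a \<otimes> b) = \<kappa> b *\<^sub>C a"
    by simp_all
qed

lemma slice_left:
  fixes \<kappa> :: "'a::cstar_algebra \<Rightarrow> complex"
  assumes \<kappa>: "star_hom \<kappa>"
  shows "star_hom (slice_left \<kappa> :: ('a, 'b::nonzero_cstar_algebra) min_tensor \<Rightarrow> 'b)"
    "slice_left \<kappa> (a \<otimes> (b :: 'b)) = \<kappa> a *\<^sub>C b"
proof -
  let ?N = "{\<phi> :: 'b \<Rightarrow> complex. state \<phi>}"
  have bd: "min_bounded (\<lambda>a b. \<phi> ((\<kappa> a *\<^sub>C 1) * b))" if "\<phi> \<in> ?N" for \<phi>
  proof -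
    have \<phi>: "state \<phi>" using that by simp
    have "\<phi> ((\<kappa> a *\<^sub>C 1) * b) = 1 * \<kappa> a * \<phi> b" for a b
      using positive_functionalD(2)[OF stateD(5)[OF \<phi>]] by (simp add: mult_scaleC_left)
    moreover have "product_span (\<lambda>a b. 1 * \<kappa> a * \<phi> b)"
      using product_span_mult[OF state_span_state[OF state_star_hom_complex[OF \<kappa>], of 1] state_span_state[OF \<phi>, of 1]] by simp
    ultimately show ?thesis using min_bounded_product_span by (simp only:)
  qed
  obtain T where T: "star_hom T" "\<And>a b. T (a \<otimes> (b :: 'b)) = (\<kappa> a *\<^sub>C 1) * b"
    using ex_tensor_hom[OF star_hom_scalar[OF \<kappa>] star_hom_ident _ norming_states bd]
    by (auto simp: mult_scaleC_left mult_scaleC_right)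
  have T2: "T (a \<otimes> b) = \<kappa> a *\<^sub>C b" for a b by (simp add: T(2) mult_scaleC_left)
  have "slice_left \<kappa> = T"
    unfolding slice_left_def by (rule tensor_lift_eq[OF bounded_clinear_star_hom[OF T(1)] T2])
  with T(1) T2 show "star_hom (slice_left \<kappa> :: ('a, 'b) min_tensor \<Rightarrow> 'b)" "slice_left \<kappa> (a \<otimes> b) = \<kappa> a *\<^sub>C b"
    by simp_all
qed

lemma tensor_lift_characters:
  fixes \<kappa> :: "'a::nonzero_cstar_algebra \<Rightarrow> complex" and \<mu> :: "'b::cstar_algebra \<Rightarrow> complex"
  assumes "star_hom \<kappa>" "star_hom \<mu>"
  shows "tensor_lift (\<lambda>a b. \<kappa> a * \<mu> b) = (\<lambda>x. \<kappa> (slice_right \<mu> x))"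
  by (rule tensor_lift_eq[OF bounded_clinear_star_hom[OF star_hom_comp[OF assms(1) slice_right(1)[OF assms(2)]]]])
    (simp add: slice_right(2)[OF assms(2)] star_homD[OF assms(1)])

lemma ex_state_span_tensor:
  assumes "state \<phi>" "state_span g"
  shows "\<exists>\<xi>. state_span \<xi> \<and> (\<forall>b c. \<xi> (b \<otimes> c) = \<phi> b * g c)"
  using assms(2)
proof (induction rule: state_span.induct)
  case zero
  show ?case by (rule exI[of _ "\<lambda>x. 0"]) (simp add: state_span.zero)
next
  case (step g \<psi> k)
  then obtain \<xi> where \<xi>: "state_span \<xi>" "\<And>b c. \<xi> (b \<otimes> c) = \<phi> b * g c" by blast
  show ?case
    by (rule exI[of _ "\<lambda>x. \<xi> x + k * tensor_state \<phi> \<psi> x"])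
      (simp add: state_span.step[OF \<xi>(1) tensor_state(1)[OF assms(1) step(2)]] \<xi>(2) tensor_state(3)[OF assms(1) step(2)]
        distrib_left)
qed

text \<open>Regroups sums of \<open>\<phi> a * \<psi> b * g c\<close> as forms in \<open>a\<close>
  and \<open>b \<otimes> c\<close>. Boundedness in the second variable is recorded because it makes
  such a form determined by elementary tensors.\<close>

lemma ex_product_span_tensor:
  assumes "product_span \<beta>" "state_span g"
  shows "\<exists>\<gamma>. product_span \<gamma> \<and> (\<forall>a b c. \<gamma> a (b \<otimes> c) = \<beta> a b * g c) \<and> (\<forall>a. bounded_clinear (\<gamma> a))"
  using assms(1)
proof (induction rule: product_span.induct)
  case zero
  show ?case by (rule exI[of _ "\<lambda>a x. 0"]) (simp add: product_span.zero bounded_clinear_zero)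
next
  case (step \<beta> \<phi> \<psi> k)
  then obtain \<gamma> where \<gamma>: "product_span \<gamma>" "\<And>a b c. \<gamma> a (b \<otimes> c) = \<beta> a b * g c" "\<And>a. bounded_clinear (\<gamma> a)" by blast
  obtain \<xi> where \<xi>: "state_span \<xi>" "\<And>b c. \<xi> (b \<otimes> c) = \<psi> b * g c"
    using ex_state_span_tensor[OF step(3) assms(2)] by blast
  show ?case
  proof (rule exI[of _ "\<lambda>a x. \<gamma> a x + k * (\<phi> a * \<xi> x)"], intro conjI allI)
    have "product_span (\<lambda>a x. (1 * \<phi> a) * \<xi> x)" by (rule product_span_mult[OF state_span_state[OF step(2)] \<xi>(1)])
    then show "product_span (\<lambda>a x. \<gamma> a x + k * (\<phi> a * \<xi> x))"
      using product_span_add[OF \<gamma>(1) product_span_cmult[of _ k]] by simp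
    show "\<gamma> a (b \<otimes> c) + k * (\<phi> a * \<xi> (b \<otimes> c)) = (\<beta> a b + k * (\<phi> a * \<psi> b)) * g c" for a b c
      by (simp add: \<gamma>(2) \<xi>(2) distrib_right)
    show "bounded_clinear (\<lambda>x. \<gamma> a x + k * (\<phi> a * \<xi> x))" for a
      by (intro bounded_clinear_add bounded_clinear_cmult \<gamma>(3) bounded_clinear_state_span[OF \<xi>(1)])
  qed
qed

lemma min_bounded_add: "min_bounded \<beta> \<Longrightarrow> min_bounded \<gamma> \<Longrightarrow> min_bounded (\<lambda>a b. \<beta> a b + \<gamma> a b)"
  unfolding min_bounded_def
proof (elim exE)
  fix M N
  assume "\<forall>xs. cmod (bsum \<beta> xs) \<le> M * min_norm (tensor_sum xs)" "\<forall>xs. cmod (bsum \<gamma> xs) \<le> N * min_norm (tensor_sum xs)"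
  then have "cmod (bsum (\<lambda>a b. \<beta> a b + \<gamma> a b) xs) \<le> (M + N) * min_norm (tensor_sum xs)" for xs
    unfolding bsum_add distrib_right by (intro norm_triangle_mono) auto
  then show "\<exists>M. \<forall>xs. cmod (bsum (\<lambda>a b. \<beta> a b + \<gamma> a b) xs) \<le> M * min_norm (tensor_sum xs)" by blast
qed

lemma min_bounded_cmult:
  assumes "min_bounded \<beta>"
  shows "min_bounded (\<lambda>a b. c * \<beta> a b)"
proof -
  obtain M where M: "\<And>xs. cmod (bsum \<beta> xs) \<le> M * min_norm (tensor_sum xs)"
    using assms by (auto simp: min_bounded_def)
  have "cmod (bsum (\<lambda>a b. c * \<beta> a b) xs) \<le> (cmod c * M) * min_norm (tensor_sum xs)" for xs
    using mult_left_mono[OF M, of "cmod c"] by (simp add: bsum_cmult norm_mult mult.assoc)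
  then show ?thesis unfolding min_bounded_def by blast
qed

text \<open>The functionals testing \<open>(A \<otimes> B) \<otimes> C\<close> may be taken to be combinations of product states of \<open>A\<close>, \<open>B\<close>, \<open>C\<close>, and
  those are visibly bounded on \<open>A \<otimes> (B \<otimes> C)\<close>.\<close>

theorem tensor_assoc:
  fixes a :: "'a::cstar_algebra" and b :: "'b::cstar_algebra" and c :: "'c::cstar_algebra"
  shows "star_hom (tensor_assoc :: ('a, ('b, 'c) min_tensor) min_tensor \<Rightarrow> (('a, 'b) min_tensor, 'c) min_tensor)"
    "tensor_assoc (a \<otimes> (b \<otimes> c)) = (a \<otimes> b) \<otimes> c"
proof -
  let ?F = "tensor_vector_states {\<phi> :: 'a \<Rightarrow> complex. state \<phi>} (range of_alg_tensor) :: (('a, 'b) min_tensor \<Rightarrow> complex) set"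
  \<comment> \<open>Against these vectors the coefficients of
    \<open>(a \<otimes> b) \<otimes> c\<close> split into coefficients on the three factors.\<close>
  define V :: "(('a, 'b) min_tensor, 'c) min_tensor set"
    where "V = range (\<lambda>L. \<Sum>(u, c)\<leftarrow>L. of_alg_tensor u \<otimes> c)"
  have F: "state_determining ?F"
    by (intro norming_imp_state_determining norming_tensor_vector_states state_determining_states
        closure_range_of_alg_tensor)
  have V_add: "x + y \<in> closure V" if "x \<in> closure V" "y \<in> closure V" for x y
  proof -
    obtain f g where fg: "\<And>n. f n \<in> V" "f \<longlonglongrightarrow> x" "\<And>n. g n \<in> V" "g \<longlonglongrightarrow> y"
      using \<open>x \<in> closure V\<close> \<open>y \<in> closure V\<close> unfolding closure_sequential by blast
    have "f n + g n \<in> V" for n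
    proof -
      obtain L L' where "f n = (\<Sum>(u, c)\<leftarrow>L. of_alg_tensor u \<otimes> c)" "g n = (\<Sum>(u, c)\<leftarrow>L'. of_alg_tensor u \<otimes> c)"
        using fg(1,3) unfolding V_def by blast
      then have "f n + g n = (\<Sum>(u, c)\<leftarrow>L @ L'. of_alg_tensor u \<otimes> c)" by simp
      then show ?thesis unfolding V_def by blast
    qed
    then show ?thesis
      using tendsto_add[OF fg(2,4)] unfolding closure_sequential by (intro exI[of _ "\<lambda>n. f n + g n"]) simp
  qed
  have "(\<Sum>(u, c)\<leftarrow>[]. of_alg_tensor u \<otimes> c) \<in> V" unfolding V_def by blast
  then have V_0: "0 \<in> closure V" using closure_subset by auto
  have V_elem: "x \<otimes> c \<in> closure V" for x c
  proof (rule min_tensor_closed_induct[where P = "\<lambda>x. x \<otimes> c \<in> closure V"])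
    have "continuous_on UNIV (\<lambda>x. x \<otimes> c)"
      by (rule bounded_linear.continuous_on[OF bounded_linear_tensor_left continuous_on_id])
    then have "closed ((\<lambda>x. x \<otimes> c) -` closure V)" by (intro closed_vimage closed_closure)
    then show "closed {x. x \<otimes> c \<in> closure V}" by (simp add: vimage_def)
    have "(\<Sum>(u, c)\<leftarrow>[(t, c)]. of_alg_tensor u \<otimes> c) \<in> V" for t unfolding V_def by blast
    then show "of_alg_tensor t \<otimes> c \<in> closure V" for t using closure_subset by auto
  qed
  have "of_alg_tensor t \<in> closure V" for t
  proof (induction t rule: alg_tensor_induct_aux)
    case (2 x c t)
    then show ?case using V_add[OF V_elem] by (simp add: of_alg_tensor_ops tensor_def)
  qed (simp add: of_alg_tensor_ops V_0)
  then have "x \<in> closure V" for x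
    by (rule min_tensor_closed_induct[where P = "\<lambda>x. x \<in> closure V", rotated]) simp
  then have V: "closure V = UNIV" by blast
  let ?N = "tensor_vector_states ?F V"
  have N: "norming ?N" by (rule norming_tensor_vector_states[OF F V])
  define i :: "'a \<Rightarrow> (('a, 'b) min_tensor, 'c) min_tensor" where "i a = (a \<otimes> 1) \<otimes> 1" for a
  define j :: "('b, 'c) min_tensor \<Rightarrow> (('a, 'b) min_tensor, 'c) min_tensor" where "j = tensor_map (\<lambda>b. 1 \<otimes> b) id"
  have hom: "star_hom i" "star_hom j"
    unfolding i_def j_def
    by (rule star_hom_comp[OF star_hom_tensor_left star_hom_tensor_left], rule tensor_map(1)[OF star_hom_tensor_right star_hom_id])
  have j: "j (b \<otimes> c) = (1 \<otimes> b) \<otimes> c" for b c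
    by (simp add: j_def tensor_map(2)[OF star_hom_tensor_right star_hom_id])
  have ij: "i a * j (b \<otimes> c) = (a \<otimes> b) \<otimes> c" for a b c by (simp add: i_def j tensor_mult)
  have jb: "bounded_clinear j" by (rule bounded_clinear_star_hom[OF hom(2)])
  have comm: "i a * j y = j y * i a" for a y
    by (rule fun_cong[OF bounded_clinear_tensor_unique[of "\<lambda>y. i a * j y" "\<lambda>y. j y * i a"]])
      (auto intro: bounded_clinear_compose[OF bounded_clinear_mult_left jb] bounded_clinear_compose[OF bounded_clinear_mult_right jb]
        simp: i_def j tensor_mult)
  have bd: "min_bounded (\<lambda>a y. \<phi> (i a * j y))" if "\<phi> \<in> ?N" for \<phi>
  proof -
    from that obtain \<omega> \<psi> L where \<omega>: "\<omega> \<in> ?F" and \<psi>: "state \<psi>"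
        and \<phi>: "\<phi> = vector_state (tensor_state \<omega> \<psi>) (\<Sum>(u, c)\<leftarrow>L. of_alg_tensor u \<otimes> c)"
      by (auto simp: tensor_vector_states_def[of ?F] V_def)
    have "state \<omega>" using F \<omega> by (auto simp: state_determining_def)
    define W where "W = tensor_state \<omega> \<psi>"
    have W: "state W" "\<And>x c. W (x \<otimes> c) = \<omega> x * \<psi> c"
      using tensor_state[OF \<open>state \<omega>\<close> \<psi>] by (simp_all add: W_def)
    note WL = positive_functionalD[OF stateD(5)[OF W(1)]]
    from \<omega> obtain \<phi>1 \<phi>2 v where st: "state \<phi>1" "state \<phi>2"
        and \<omega>v: "\<omega> = vector_state (tensor_state \<phi>1 \<phi>2) (of_alg_tensor v)"
      by (auto simp: tensor_vector_states_def)
    define k where "k = 1 / product_functional \<phi>1 \<phi>2 (star v * v)"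
    have 1: "min_bounded (\<lambda>a y. W (star (of_alg_tensor u \<otimes> c) * (i a * j y) * (of_alg_tensor u' \<otimes> c')))" for u u' c c'
    proof -
      define \<beta> where "\<beta> a b = k * product_functional \<phi>1 \<phi>2 (star (u * v) * elem_tensor a b * (u' * v))" for a b
      define g where "g y = \<psi> (star c * y * c')" for y
      have \<beta>: "product_span \<beta>"
        unfolding \<beta>_def using product_span_cmult[OF product_span_coefficient[OF st star_hom_ident star_hom_ident]] by simp
      have g: "state_span g" unfolding g_def by (rule state_span_coefficient[OF \<psi>])
      obtain \<gamma> where \<gamma>: "product_span \<gamma>" "\<And>a b c. \<gamma> a (b \<otimes> c) = \<beta> a b * g c" "\<And>a. bounded_clinear (\<gamma> a)"
        using ex_product_span_tensor[OF \<beta> g] by blast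
      have "W (star (of_alg_tensor u \<otimes> c) * (i a * j y) * (of_alg_tensor u' \<otimes> c')) = \<gamma> a y" for a y
      proof (rule fun_cong[OF bounded_clinear_tensor_unique[OF _ \<gamma>(3)]])
        show "bounded_clinear (\<lambda>y. W (star (of_alg_tensor u \<otimes> c) * (i a * j y) * (of_alg_tensor u' \<otimes> c')))"
          by (intro bounded_clinear_compose[OF stateD(1)[OF W(1)]] bounded_clinear_compose[OF bounded_clinear_mult_right]
              bounded_clinear_compose[OF bounded_clinear_mult_left] jb)
        fix b c0
        have "W (star (of_alg_tensor u \<otimes> c) * (i a * j (b \<otimes> c0)) * (of_alg_tensor u' \<otimes> c'))
            = \<omega> (of_alg_tensor (star u * elem_tensor a b * u')) * g c0"
          unfolding ij star_tensor tensor_mult W(2) g_def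
          by (simp add: of_alg_tensor_ops tensor_def)
        also have "\<omega> (of_alg_tensor (star u * elem_tensor a b * u')) = \<beta> a b"
          unfolding \<omega>v vector_state_of_alg_tensor[OF st] \<beta>_def k_def by (simp add: star_mult mult.assoc)
        finally show "W (star (of_alg_tensor u \<otimes> c) * (i a * j (b \<otimes> c0)) * (of_alg_tensor u' \<otimes> c')) = \<gamma> a (b \<otimes> c0)"
          by (simp only: \<gamma>(2))
      qed
      then show ?thesis using min_bounded_product_span[OF \<gamma>(1)] by (simp only:)
    qed
    let ?s = "\<lambda>L. (\<Sum>(u, c)\<leftarrow>L. of_alg_tensor u \<otimes> c)"
    have zero: "min_bounded (\<lambda>(a :: 'a) (y :: ('b, 'c) min_tensor). 0)"
      by (rule min_bounded_product_span[OF product_span.zero])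
    have 2: "min_bounded (\<lambda>a y. W (star (of_alg_tensor u \<otimes> c) * (i a * j y) * ?s L))" for u c L
    proof (induction L)
      case (Cons p L)
      obtain u' c' where p: "p = (u', c')" by (cases p)
      from min_bounded_add[OF 1 Cons] show ?case by (simp add: p distrib_left WL)
    qed (simp add: WL zero)
    have 3: "min_bounded (\<lambda>a y. W (star (?s L) * (i a * j y) * ?s L'))" for L L'
    proof (induction L)
      case (Cons p L)
      obtain u c where p: "p = (u, c)" by (cases p)
      from min_bounded_add[OF 2 Cons] show ?case by (simp add: p star_add distrib_right WL)
    qed (simp add: star_zero WL zero)
    have "\<phi> x = (1 / W (star (?s L) * ?s L)) * W (star (?s L) * x * ?s L)" for x
      by (simp add: \<phi> vector_state_def W_def)
    then show ?thesis using min_bounded_cmult[OF 3] by (simp only:)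
  qed
  obtain T where T: "star_hom T" "\<And>a y. T (a \<otimes> y) = i a * j y"
    using ex_tensor_hom[OF hom comm N bd] by blast
  have "tensor_lift (\<lambda>b c. (a \<otimes> b) \<otimes> c) = (\<lambda>y. i a * j y)" for a
    by (rule tensor_lift_eq[OF bounded_clinear_compose[OF bounded_clinear_mult_left jb] ij])
  then have eq: "tensor_assoc = T"
    unfolding tensor_assoc_def by (intro tensor_lift_eq[OF bounded_clinear_star_hom[OF T(1)]]) (simp add: T(2))
  show "star_hom (tensor_assoc :: ('a, ('b, 'c) min_tensor) min_tensor \<Rightarrow> (('a, 'b) min_tensor, 'c) min_tensor)"
    unfolding eq by (rule T(1))
  show "tensor_assoc (a \<otimes> (b \<otimes> c)) = (a \<otimes> b) \<otimes> c"
    unfolding eq T(2) by (rule ij)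
qed

section \<open>Paths with values in tensor products, and density arguments\<close>

lemma bcontfun_star_homI:
  fixes g :: "'a::star_algebra \<Rightarrow> ('t::metric_space \<Rightarrow>\<^sub>C 'b::cstar_algebra)"
  assumes "\<And>t. star_hom (\<lambda>x. apply_bcontfun (g x) t)"
  shows "star_hom g"
  unfolding star_hom_def clinear_def
  by (intro conjI allI bcontfun_eqI)
    (simp_all add: star_homD[OF assms] scaleC_bcontfun_apply times_bcontfun_apply star_bcontfun_apply one_bcontfun_apply)

lemma star_hom_apply_bcontfun: "star_hom (\<lambda>f :: 't::metric_space \<Rightarrow>\<^sub>C 'b::cstar_algebra. apply_bcontfun f t)"
  by (simp add: star_hom_def clinear_def scaleC_bcontfun_apply times_bcontfun_apply star_bcontfun_apply one_bcontfun_apply)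

lemma star_hom_apply_bcontfun_comp:
  "star_hom g \<Longrightarrow> star_hom (\<lambda>x. apply_bcontfun (g x) t)"
  for g :: "'a::star_algebra \<Rightarrow> ('t::metric_space \<Rightarrow>\<^sub>C 'b::cstar_algebra)"
  by (rule star_hom_comp[OF star_hom_apply_bcontfun])

text \<open>Continuity in \<open>t\<close> of the right-hand side is clear for algebraic tensors and
  passes to uniform limits, since the evaluations are contractive for all \<open>t\<close> alike.
  The resulting path has the values on elementary tensors that determine
  \<open>path_tensor\<close>.\<close>

lemma path_tensor:
  fixes x :: "(unit_interval \<Rightarrow>\<^sub>C 'b::cstar_algebra, 'c::cstar_algebra) min_tensor"
  shows "apply_bcontfun (path_tensor x) t = tensor_map (\<lambda>f. apply_bcontfun f t) id x"
proof -
  let ?E = "\<lambda>t. tensor_map (\<lambda>f :: unit_interval \<Rightarrow>\<^sub>C 'b. apply_bcontfun f t) (id :: 'c \<Rightarrow> 'c)"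
  have hom: "star_hom (?E t)" for t by (rule tensor_map(1)[OF star_hom_apply_bcontfun star_hom_id])
  have E: "?E t (f \<otimes> c) = apply_bcontfun f t \<otimes> c" for t f c
    by (simp add: tensor_map(2)[OF star_hom_apply_bcontfun star_hom_id])
  have alg: "continuous_on UNIV (\<lambda>t. ?E t (of_alg_tensor u))" for u
  proof (induction u rule: alg_tensor_induct_aux)
    case 1
    show ?case by (simp only: of_alg_tensor_ops star_homD(8)[OF hom] continuous_on_const)
  next
    case (2 f c u)
    have "continuous_on UNIV (\<lambda>t. apply_bcontfun f t \<otimes> c)"
      by (rule bounded_linear.continuous_on[OF bounded_linear_tensor_left continuous_on_apply_bcontfun])
    then have "continuous_on UNIV (\<lambda>t. ?E t (of_alg_tensor (elem_tensor f c)))" by (simp only: E flip: tensor_def)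
    from continuous_on_add[OF this 2] show ?case by (simp only: of_alg_tensor_ops star_homD(5)[OF hom])
  qed
  have cont: "continuous_on UNIV (\<lambda>t. ?E t x)" for x
  proof -
    have "\<exists>u. norm (x - of_alg_tensor u) < 1 / real (Suc n)" for n by (rule min_tensor_dense) simp
    then obtain u where u: "\<And>n. norm (x - of_alg_tensor (u n)) < 1 / real (Suc n)" by metis
    have "uniform_limit UNIV (\<lambda>n t. ?E t (of_alg_tensor (u n))) (\<lambda>t. ?E t x) sequentially"
      unfolding uniform_limit_iff
    proof (intro allI impI)
      fix e :: real assume "e > 0"
      then obtain N where N: "1 / real (Suc N) < e" using nat_approx_posE by blast
      have "dist (?E t (of_alg_tensor (u n))) (?E t x) < e" if "n \<ge> N" for n t
      proof -
        have "dist (?E t (of_alg_tensor (u n))) (?E t x) = norm (?E t (of_alg_tensor (u n) - x))"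
          by (simp add: dist_norm star_homD[OF hom])
        also have "\<dots> \<le> norm (of_alg_tensor (u n) - x)" by (rule norm_star_hom_le[OF hom])
        also have "\<dots> < 1 / real (Suc n)" using u[of n] by (simp add: norm_minus_commute)
        also have "\<dots> \<le> 1 / real (Suc N)" using that by (simp add: frac_le)
        finally show ?thesis using N by simp
      qed
      then show "\<forall>\<^sub>F n in sequentially. \<forall>t\<in>UNIV. dist (?E t (of_alg_tensor (u n))) (?E t x) < e"
        by (auto simp: eventually_sequentially)
    qed
    then show ?thesis by (rule uniform_limit_theorem[rotated]) (simp_all add: alg)
  qed
  have bc: "(\<lambda>t. ?E t x) \<in> bcontfun" for x
    by (rule bcontfun_normI[OF cont, of _ "norm x"]) (rule norm_star_hom_le[OF hom])
  define P where "P x = Bcontfun (\<lambda>t. ?E t x)" for x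
  have P: "apply_bcontfun (P x) t = ?E t x" for x t by (simp add: P_def Bcontfun_inverse[OF bc])
  have "star_hom P" by (rule bcontfun_star_homI) (simp add: P hom)
  moreover have "P (f \<otimes> c) = Bcontfun (\<lambda>t. apply_bcontfun f t \<otimes> c)" for f c by (simp add: P_def E)
  ultimately have eq: "path_tensor = P"
    unfolding path_tensor_def by (intro tensor_lift_eq bounded_clinear_star_hom)
  show ?thesis unfolding eq by (rule P)
qed

lemma star_hom_path_tensor: "star_hom path_tensor"
  by (rule bcontfun_star_homI)
    (simp add: path_tensor tensor_map(1)[OF star_hom_apply_bcontfun star_hom_id])

lemma join_coaction_apply:
  fixes \<Delta> :: "'h::cstar_algebra \<Rightarrow> ('h, 'h) min_tensor"
    and f :: "unit_interval \<Rightarrow>\<^sub>C ('a::cstar_algebra, 'h) min_tensor"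
  assumes "star_hom \<Delta>"
  shows "apply_bcontfun (join_coaction \<Delta> f) t = tensor_assoc (tensor_map id \<Delta> (apply_bcontfun f t))"
proof -
  have "bounded_clinear (\<lambda>x :: ('a, 'h) min_tensor. tensor_assoc (tensor_map id \<Delta> x))"
    by (rule bounded_clinear_star_hom[OF star_hom_comp[OF tensor_assoc(1) tensor_map(1)[OF star_hom_id assms]]])
  then have "bounded_linear (\<lambda>x :: ('a, 'h) min_tensor. tensor_assoc (tensor_map id \<Delta> x))"
    by (simp add: bounded_clinear_def)
  from Bcontfun_inverse[OF bounded_linear_bcontfun[OF this, of f]] show ?thesis
    by (simp add: join_coaction_def)
qed

text \<open>This is how the density conditions in the definitions of quantum groups and actions are
  exploited: maps need to be compared only on the products that span densely.\<close>

lemma bounded_clinear_eq_cls: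
  assumes S: "bounded_clinear S" and T: "bounded_clinear T" and X: "cls X = UNIV"
    and eq: "\<And>x. x \<in> X \<Longrightarrow> S x = T x"
  shows "S x = T x"
proof -
  have L: "clinear S" "clinear T" "bounded_linear S" "bounded_linear T"
    using S T by (auto simp: bounded_clinear_def)
  have "S y = T y" if "y \<in> span {c *\<^sub>C x |c x. x \<in> X}" for y
    using that
  proof (rule span_induct)
    show "subspace {y. S y = T y}"
      by (simp add: subspace_def clinear_eqs[OF L(1)] clinear_eqs[OF L(2)] clinear_scaleR[OF L(1)] clinear_scaleR[OF L(2)])
    show "S y = T y" if "y \<in> {c *\<^sub>C x |c x. x \<in> X}" for y
      using that by (auto simp: clinear_eqs[OF L(1)] clinear_eqs[OF L(2)] eq)
  qed
  then have "cls X \<subseteq> {y. S y = T y}"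
    unfolding cls_def
    by (intro closure_minimal closed_Collect_eq linear_continuous_on L(3,4)) auto
  then show ?thesis using X by auto
qed

lemma star_hom_eq_cls:
  fixes S T :: "'a::cstar_algebra \<Rightarrow> 'b::cstar_algebra"
  assumes "star_hom S" "star_hom T" "cls X = UNIV" "\<And>x. x \<in> X \<Longrightarrow> S x = T x"
  shows "S x = T x"
  by (rule bounded_clinear_eq_cls[OF bounded_clinear_star_hom[OF assms(1)] bounded_clinear_star_hom[OF assms(2)] assms(3,4)])

section \<open>Cochains on labels of a cyclic join\<close>

text \<open>The alternating sum over omitted entries. The recursion makes
  \<open>coboundary_coboundary\<close> and the other rules plain inductions; the closed form
  \<open>coboundary_conv_sum\<close> serves the comparison with singular faces.\<close>

primrec coboundary :: "'v list \<Rightarrow> ('v list \<Rightarrow> int) \<Rightarrow> int"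
  where
    "coboundary [] \<theta> = 0"
  | "coboundary (x # xs) \<theta> = \<theta> xs - coboundary xs (\<lambda>ys. \<theta> (x # ys))"

lemma coboundary_diff: "coboundary xs (\<lambda>ys. \<theta> ys - \<eta> ys) = coboundary xs \<theta> - coboundary xs \<eta>"
  by (induction xs arbitrary: \<theta> \<eta>) simp_all

lemma coboundary_zero [simp]: "coboundary xs (\<lambda>ys. 0) = 0"
  using coboundary_diff[of xs "\<lambda>_. 0" "\<lambda>_. 0"] by simp

lemma coboundary_add: "coboundary xs (\<lambda>ys. \<theta> ys + \<eta> ys) = coboundary xs \<theta> + coboundary xs \<eta>"
  by (induction xs arbitrary: \<theta> \<eta>) simp_all

lemma coboundary_sum:
  "coboundary xs (\<lambda>ys. \<Sum>a\<in>A. \<theta> a ys) = (\<Sum>a\<in>A. coboundary xs (\<theta> a))"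
  by (induction A rule: infinite_finite_induct) (simp_all add: coboundary_add)

lemma coboundary_coboundary: "coboundary xs (\<lambda>ys. coboundary ys \<theta>) = 0"
  by (induction xs arbitrary: \<theta>) (simp_all add: coboundary_diff)

lemma coboundary_map: "coboundary xs (\<lambda>ys. \<theta> (map s ys)) = coboundary (map s xs) \<theta>"
  by (induction xs arbitrary: \<theta>) simp_all

lemma coboundary_conv_sum:
  "coboundary xs \<theta> = (\<Sum>c<length xs. (-1) ^ c * \<theta> (take c xs @ drop (Suc c) xs))"
proof (induction xs arbitrary: \<theta>)
  case (Cons x xs)
  show ?case
    by (simp add: Cons sum.lessThan_Suc_shift sum_negf del: sum.lessThan_Suc)
qed simp

lemma coboundary_cong_mod:
  assumes "\<And>ys. set ys \<subseteq> set xs \<Longrightarrow> Suc (length ys) = length xs \<Longrightarrow> [\<theta> ys = \<eta> ys] (mod n)"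
  shows "[coboundary xs \<theta> = coboundary xs \<eta>] (mod n)"
  using assms
proof (induction xs arbitrary: \<theta> \<eta>)
  case (Cons x xs)
  show ?case
    unfolding coboundary.simps
  proof (intro cong_diff Cons.IH)
    show "[\<theta> xs = \<eta> xs] (mod n)" by (rule Cons.prems) auto
    show "[\<theta> (x # ys) = \<eta> (x # ys)] (mod n)"
      if "set ys \<subseteq> set xs" "Suc (length ys) = length xs" for ys
      using that by (intro Cons.prems) auto
  qed
qed simp

definition alternating :: "('v list \<Rightarrow> int) \<Rightarrow> bool"
  where "alternating \<theta> \<longleftrightarrow> (\<forall>xs a b ys. \<theta> (xs @ a # b # ys) = - \<theta> (xs @ b # a # ys))"

lemma alternating_Cons: "alternating \<theta> \<Longrightarrow> alternating (\<lambda>ys. \<theta> (x # ys))"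
  unfolding alternating_def by (metis append_Cons)

lemma alternating_coboundary:
  assumes "alternating \<theta>"
  shows "alternating (\<lambda>xs. coboundary xs \<theta>)"
proof -
  have "coboundary (xs @ a # b # ys) \<theta> = - coboundary (xs @ b # a # ys) \<theta>" for xs a b ys
    using assms
  proof (induction xs arbitrary: \<theta>)
    case Nil
    then have "\<theta> (a # b # z) = 0 - \<theta> (b # a # z)" for z
      unfolding alternating_def by (metis append_Nil diff_0)
    then have "coboundary ys (\<lambda>z. \<theta> (a # b # z)) = - coboundary ys (\<lambda>z. \<theta> (b # a # z))"
      by (simp only: coboundary_diff coboundary_zero)
    then show ?case by simp
  next
    case (Cons x xs)
    moreover have "\<theta> (xs @ a # b # ys) = - \<theta> (xs @ b # a # ys)"
      using Cons.prems unfolding alternating_def by blast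
    ultimately show ?case using alternating_Cons by force
  qed
  then show ?thesis unfolding alternating_def by blast
qed

text \<open>Adjacent transpositions bring two equal entries together, and an integer equal to its
  negative is 0. This is what will annihilate simplices with more vertices than there are join
  factors.\<close>

lemma alternating_not_distinct:
  assumes \<theta>: "alternating \<theta>" and xs: "\<not> distinct xs"
  shows "\<theta> xs = 0"
proof -
  have "\<theta> (us @ y # vs @ y # ws) = 0" for us y vs ws
  proof (induction vs arbitrary: us)
    case Nil
    have "\<theta> (us @ y # y # ws) = - \<theta> (us @ y # y # ws)"
      using \<theta> unfolding alternating_def by blast
    then show ?case by simp
  next
    case (Cons b vs)
    have "\<theta> (us @ y # b # vs @ y # ws) = - \<theta> (us @ b # y # vs @ y # ws)"
      using \<theta> unfolding alternating_def by blast
    also have "\<dots> = 0" using Cons[of "us @ [b]"] by simp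
    finally show ?case by simp
  qed
  moreover obtain us y vs ws where "xs = us @ [y] @ vs @ [y] @ ws"
    using not_distinct_decomp[OF xs] by blast
  ultimately show ?thesis by simp
qed

section \<open>Simplices of a join of cyclic groups\<close>

definition rotate_label :: "nat \<Rightarrow> nat \<times> nat \<Rightarrow> nat \<times> nat"
  where "rotate_label k v = (Suc (fst v) mod k, snd v)"

text \<open>A label is a vertex of an iterated join of cyclic groups, with its group coordinate
  first and the number of its join factor second. Labels span a simplex iff no two of them share a
  factor.\<close>

definition transversal :: "nat \<Rightarrow> (nat \<times> nat) set \<Rightarrow> bool"
  where "transversal k V \<longleftrightarrow> fst ` V \<subseteq> {..<k} \<and> inj_on snd V"

lemma transversal_subset: "transversal k V \<Longrightarrow> U \<subseteq> V \<Longrightarrow> transversal k U"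
  unfolding transversal_def by (meson image_mono inj_on_subset order.trans)

lemma snd_rotate_label [simp]: "snd (rotate_label k v) = snd v"
  and fst_rotate_label: "fst (rotate_label k v) = Suc (fst v) mod k"
  by (simp_all add: rotate_label_def)

lemma funpow_rotate_label:
  assumes "fst v < k"
  shows "(rotate_label k ^^ a) v = ((fst v + a) mod k, snd v)"
  using assms by (induction a) (simp_all add: rotate_label_def mod_Suc_eq)

lemma funpow_rotate_label_full: "fst v < k \<Longrightarrow> (rotate_label k ^^ k) v = v"
  by (simp add: funpow_rotate_label)

lemma transversal_rotate:
  assumes "k > 0" "transversal k V"
  shows "transversal k (rotate_label k ` V)"
  using assms unfolding transversal_def inj_on_def by (auto simp: rotate_label_def)

lemma transversal_funpow_rotate:
  assumes "k > 0" "transversal k V"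
  shows "transversal k ((rotate_label k ^^ a) ` V)"
proof (induction a)
  case (Suc a)
  then show ?case using transversal_rotate[OF assms(1) Suc] by (simp add: image_comp)
qed (use assms in simp)

text \<open>The group coordinate in the lowest join factor that occurs. On simplices of the join
  this is an equivariant map to the cyclic group, so phase 0 marks a fundamental domain.\<close>

definition phase :: "(nat \<times> nat) list \<Rightarrow> nat"
  where "phase xs = fst (arg_min_on snd (set xs))"

lemma phase_swap: "phase (xs @ a # b # ys) = phase (xs @ b # a # ys)"
  unfolding phase_def by (simp add: insert_commute)

lemma phase_less: "transversal k (set xs) \<Longrightarrow> xs \<noteq> [] \<Longrightarrow> phase xs < k"
  using arg_min_if_finite(1)[of "set xs" snd] by (auto simp: phase_def transversal_def)

lemma phase_rotate:
  assumes "transversal k (set xs)" "xs \<noteq> []"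
  shows "phase (map (rotate_label k) xs) = Suc (phase xs) mod k"
proof -
  let ?m = "arg_min_on snd (set xs)" and ?m' = "arg_min_on snd (rotate_label k ` set xs)"
  have m: "?m \<in> set xs" "\<And>y. y \<in> set xs \<Longrightarrow> snd ?m \<le> snd y"
    using arg_min_if_finite[of "set xs" snd] assms(2) by (auto simp: not_less)
  have m': "?m' \<in> rotate_label k ` set xs" "\<And>y. y \<in> set xs \<Longrightarrow> snd ?m' \<le> snd y"
    using arg_min_if_finite[of "rotate_label k ` set xs" snd] assms(2) by (force simp: not_less)+
  then obtain z where z: "z \<in> set xs" "?m' = rotate_label k z" by blast
  then have "snd z = snd ?m" using m m'(2)[OF m(1)] m(2)[OF z(1)] by simp
  then have "z = ?m" using z m assms(1) unfolding transversal_def inj_on_def by blast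
  then show ?thesis using z(2) by (simp add: phase_def fst_rotate_label)
qed

lemma phase_funpow_rotate:
  assumes "transversal k (set xs)" "xs \<noteq> []" "k > 0"
  shows "phase (map (rotate_label k ^^ a) xs) = (phase xs + a) mod k"
proof (induction a)
  case 0
  then show ?case using phase_less[OF assms(1,2)] by simp
next
  case (Suc a)
  have "map (rotate_label k ^^ Suc a) xs = map (rotate_label k) (map (rotate_label k ^^ a) xs)" by simp
  moreover have "transversal k (set (map (rotate_label k ^^ a) xs))"
    using transversal_funpow_rotate[OF assms(3,1)] by simp
  ultimately show ?case using phase_rotate[of k "map (rotate_label k ^^ a) xs"] Suc assms(2)
    by (simp only: map_is_Nil_conv mod_Suc_eq add_Suc_right) simp
qed

text \<open>The operators \<open>\<sigma> - 1\<close> and \<open>1 + \<sigma> + \<dots> + \<sigma> ^ (k - 1)\<close> of the group ring of the cyclic group, in even and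
  odd degrees; each annihilates the other.\<close>

definition cyclic_op :: "nat \<Rightarrow> nat \<Rightarrow> ((nat \<times> nat) list \<Rightarrow> int) \<Rightarrow> (nat \<times> nat) list \<Rightarrow> int"
  where "cyclic_op k d \<theta> xs = (if even d then \<theta> (map (rotate_label k) xs) - \<theta> xs
    else (\<Sum>a<k. \<theta> (map (rotate_label k ^^ a) xs)))"

text \<open>Sections of the two operators on the cochains killed by the other one.\<close>

definition cyclic_section :: "nat \<Rightarrow> nat \<Rightarrow> ((nat \<times> nat) list \<Rightarrow> int) \<Rightarrow> (nat \<times> nat) list \<Rightarrow> int"
  where "cyclic_section k d \<theta> xs = (if even d then - (\<Sum>a<k - phase xs. \<theta> (map (rotate_label k ^^ a) xs))
    else if phase xs = 0 then \<theta> xs else 0)"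

lemma alternating_cyclic_section:
  assumes "alternating \<theta>"
  shows "alternating (cyclic_section k d \<theta>)"
  unfolding alternating_def
proof (intro allI)
  fix xs ys :: "(nat \<times> nat) list" and a b :: "nat \<times> nat"
  let ?us = "xs @ a # b # ys" and ?vs = "xs @ b # a # ys"
  have *: "\<theta> (map s ?us) = - \<theta> (map s ?vs)" for s
    unfolding map_append list.map by (rule assms[unfolded alternating_def, rule_format])
  have "(\<Sum>c<n. \<theta> (map (rotate_label k ^^ c) ?us)) = (\<Sum>c<n. - \<theta> (map (rotate_label k ^^ c) ?vs))" for n
    by (rule sum.cong[OF refl *])
  then have 1: "(\<Sum>c<n. \<theta> (map (rotate_label k ^^ c) ?us)) = - (\<Sum>c<n. \<theta> (map (rotate_label k ^^ c) ?vs))" for n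
    unfolding sum_negf .
  have 2: "\<theta> ?us = - \<theta> ?vs"
    by (rule assms[unfolded alternating_def, rule_format])
  show "cyclic_section k d \<theta> ?us = - cyclic_section k d \<theta> ?vs"
    unfolding cyclic_section_def phase_swap[of xs a b ys] 
    by (cases "even d"; cases "phase ?vs = 0") (simp_all only: 1 2 if_True if_False minus_zero simp_thms)
qed

lemma cyclic_op_Suc_Suc: "cyclic_op k (Suc (Suc d)) = cyclic_op k d"
  by (intro ext) (simp add: cyclic_op_def)

lemma cyclic_op_coboundary:
  "cyclic_op k d (\<lambda>ys. coboundary ys \<theta>) xs = coboundary xs (cyclic_op k d \<theta>)"
  unfolding cyclic_op_def
  by (simp add: coboundary_diff coboundary_sum coboundary_map[symmetric])

text \<open>For even \<open>d\<close> the partial sums telescope to \<open>\<theta> xs\<close>,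
  unless rotation wraps the phase around to 0; the defect is then the sum over the whole orbit,
  which vanishes modulo \<open>k\<close> by hypothesis. For odd \<open>d\<close> exactly one rotate
  of \<open>xs\<close> has phase 0, and the hypothesis makes \<theta> invariant under rotation
  modulo \<open>k\<close>.\<close>

lemma cyclic_op_section:
  assumes k: "k > 0" and xs: "transversal k (set xs)" "xs \<noteq> []"
    and \<theta>: "\<And>ys. transversal k (set ys) \<Longrightarrow> length ys = length xs \<Longrightarrow> [cyclic_op k (Suc d) \<theta> ys = 0] (mod int k)"
  shows "[cyclic_op k d (cyclic_section k d \<theta>) xs = \<theta> xs] (mod int k)"
proof -
  let ?r = "rotate_label k" and ?l = "phase xs"
  have l: "?l < k" by (rule phase_less[OF xs])
  have rk: "map (?r ^^ k) xs = xs"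
    using xs(1) by (intro map_idI funpow_rotate_label_full) (auto simp: transversal_def)
  note ph = phase_funpow_rotate[OF xs k]
  show ?thesis
  proof (cases "even d")
    case True
    let ?s = "\<lambda>a. \<theta> (map (?r ^^ a) xs)"
    have r1: "map (?r ^^ a) (map ?r xs) = map (?r ^^ Suc a) xs" for a
      by (simp add: funpow_swap1)
    have total: "[(\<Sum>a<k. ?s a) = 0] (mod int k)"
      using \<theta>[OF xs(1)] True by (simp add: cyclic_op_def)
    show ?thesis
    proof (cases "Suc ?l = k")
      case last: True
      then have "phase (map ?r xs) = 0" using ph[of 1] by simp
      then have e: "cyclic_op k d (cyclic_section k d \<theta>) xs = - (\<Sum>a<k. ?s (Suc a)) + (\<Sum>a<k - ?l. ?s a)"
        using True by (simp add: cyclic_op_def cyclic_section_def r1 del: map_map funpow.simps)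
      have "(\<Sum>a<k. ?s (Suc a)) = (\<Sum>a<Suc k. ?s a) - ?s 0"
        by (simp add: sum.lessThan_Suc_shift del: sum.lessThan_Suc)
      also have "\<dots> = (\<Sum>a<k. ?s a)" by (simp add: rk)
      finally have "cyclic_op k d (cyclic_section k d \<theta>) xs = - (\<Sum>a<k. ?s a) + (\<Sum>a<k - ?l. ?s a)"
        using e by simp
      moreover have "k - ?l = 1" using last by linarith
      ultimately have "cyclic_op k d (cyclic_section k d \<theta>) xs = \<theta> xs - (\<Sum>a<k. ?s a)"
        by simp
      then show ?thesis using cong_diff[OF cong_refl total, of "\<theta> xs"] by simp
    next
      case False
      with l have "phase (map ?r xs) = Suc ?l" using ph[of 1] by simp
      then have e: "cyclic_op k d (cyclic_section k d \<theta>) xs = - (\<Sum>a<k - Suc ?l. ?s (Suc a)) + (\<Sum>a<k - ?l. ?s a)"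
        using True by (simp add: cyclic_op_def cyclic_section_def r1 del: map_map funpow.simps)
      have "k - ?l = Suc (k - Suc ?l)" using l by simp
      then have "(\<Sum>a<k - ?l. ?s a) = ?s 0 + (\<Sum>a<k - Suc ?l. ?s (Suc a))"
        by (simp only: sum.lessThan_Suc_shift)
      then show ?thesis using e by simp
    qed
  next
    case False
    have "cyclic_op k d (cyclic_section k d \<theta>) xs
        = (\<Sum>a<k. if (?l + a) mod k = 0 then \<theta> (map (?r ^^ a) xs) else 0)"
      using False by (simp add: cyclic_op_def cyclic_section_def ph)
    also have "\<dots> = (\<Sum>a<k. if a = (k - ?l) mod k then \<theta> (map (?r ^^ a) xs) else 0)"
    proof (rule sum.cong[OF refl])
      fix a assume "a \<in> {..<k}"
      then have "(?l + a) mod k = 0 \<longleftrightarrow> a = (k - ?l) mod k"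
        using l by (cases "?l = 0") (auto simp: mod_if)
      then show "(if (?l + a) mod k = 0 then \<theta> (map (?r ^^ a) xs) else 0)
          = (if a = (k - ?l) mod k then \<theta> (map (?r ^^ a) xs) else 0)" by simp
    qed
    also have "\<dots> = \<theta> (map (?r ^^ ((k - ?l) mod k)) xs)" using k by simp
    finally have e: "cyclic_op k d (cyclic_section k d \<theta>) xs = \<theta> (map (?r ^^ ((k - ?l) mod k)) xs)" .
    have "[\<theta> (map (?r ^^ a) xs) = \<theta> xs] (mod int k)" for a
    proof (induction a)
      case (Suc a)
      have "transversal k (set (map (?r ^^ a) xs))"
        using transversal_funpow_rotate[OF k xs(1)] by simp
      from \<theta>[OF this] have "[\<theta> (map (?r ^^ Suc a) xs) - \<theta> (map (?r ^^ a) xs) = 0] (mod int k)"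
        using False by (simp add: cyclic_op_def)
      then show ?case using Suc by (metis cong_diff_iff_cong_0 cong_trans)
    qed simp
    then show ?thesis using e by simp
  qed
qed

text \<open>Cochains dual to the periodic resolution: modulo \<open>k\<close>, the operator of its
  degree takes each of them to the coboundary of its predecessor. Degree 0 is the group coordinate,
  which rotation raises by 1 modulo \<open>k\<close>; the value 0 on longer lists makes it
  alternating.\<close>

primrec cochain_tower :: "nat \<Rightarrow> nat \<Rightarrow> (nat \<times> nat) list \<Rightarrow> int"
  where
    "cochain_tower k 0 = (\<lambda>xs. if length xs = 1 then int (fst (hd xs)) else 0)"
  | "cochain_tower k (Suc d) = cyclic_section k (Suc d) (\<lambda>ys. coboundary ys (cochain_tower k d))"

lemma alternating_cochain_tower: "alternating (cochain_tower k d)"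
proof (induction d)
  case 0
  show ?case by (simp add: alternating_def)
qed (simp add: alternating_cyclic_section alternating_coboundary)

lemma cyclic_op_cochain_tower_0:
  "length xs = 1 \<Longrightarrow> [cyclic_op k 0 (cochain_tower k 0) xs = 1] (mod int k)"
proof -
  assume "length xs = 1"
  then obtain x where "xs = [x]" by (auto simp: length_Suc_conv)
  moreover have "[int (Suc n mod k) - int n = 1] (mod int k)" for n
    by (simp add: cong_def zmod_int mod_diff_left_eq)
  ultimately show ?thesis by (simp add: cyclic_op_def fst_rotate_label)
qed

text \<open>The section solves this equation once the complementary operator kills the right-hand
  side. On edges it does, because rotation shifts both group coordinates by 1 modulo
  \<open>k\<close>; in higher degrees because the operators commute with the coboundary, which
  squares to 0.\<close>

lemma cyclic_op_cochain_tower: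
  assumes k: "k > 0" and xs: "transversal k (set xs)" "length xs = Suc (Suc d)"
  shows "[cyclic_op k (Suc d) (cochain_tower k (Suc d)) xs = coboundary xs (cochain_tower k d)] (mod int k)"
proof -
  have ne: "xs \<noteq> []" if "length xs = Suc n" for xs :: "(nat \<times> nat) list" and n using that by auto
  have inv: "[cyclic_op k (Suc (Suc d)) (\<lambda>ys. coboundary ys (cochain_tower k d)) xs = 0] (mod int k)"
    if "transversal k (set xs)" "length xs = Suc (Suc d)" for xs d
    using that
  proof (induction d arbitrary: xs)
    case 0
    then obtain x y where xs: "xs = [x, y]" by (auto simp: length_Suc_conv)
    have 1: "[int (Suc n mod k) = int n + 1] (mod int k)" for n
      by (simp add: cong_def zmod_int add.commute[of 1])
    have "[int (Suc (fst y) mod k) - int (Suc (fst x) mod k) = (int (fst y) + 1) - (int (fst x) + 1)] (mod int k)"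
      by (intro cong_diff 1)
    then have "[int (Suc (fst y) mod k) - int (Suc (fst x) mod k) - (int (fst y) - int (fst x)) = 0] (mod int k)"
      by (simp only: cong_diff_iff_cong_0 add_diff_cancel_right)
    then show ?case by (simp add: xs cyclic_op_def fst_rotate_label)
  next
    case (Suc d)
    have "cyclic_op k (Suc (Suc (Suc d))) (\<lambda>ys. coboundary ys (cochain_tower k (Suc d))) xs
        = coboundary xs (cyclic_op k (Suc d) (cochain_tower k (Suc d)))"
      unfolding cyclic_op_coboundary cyclic_op_Suc_Suc ..
    also have "[\<dots> = coboundary xs (\<lambda>ys. coboundary ys (cochain_tower k d))] (mod int k)"
    proof (rule coboundary_cong_mod)
      fix ys assume "set ys \<subseteq> set xs" "Suc (length ys) = length xs"
      with Suc.prems have ys: "transversal k (set ys)" "length ys = Suc (Suc d)"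
        using transversal_subset by auto
      show "[cyclic_op k (Suc d) (cochain_tower k (Suc d)) ys = coboundary ys (cochain_tower k d)] (mod int k)"
        unfolding cochain_tower.simps
        by (rule cyclic_op_section[OF k ys(1) ne[OF ys(2)]]) (use Suc.IH ys in \<open>simp only:\<close>)
    qed
    finally show ?case by (simp add: coboundary_coboundary)
  qed
  show ?thesis
    unfolding cochain_tower.simps
    by (rule cyclic_op_section[OF k xs(1) ne[OF xs(2)]]) (use inv xs in \<open>simp only:\<close>)
qed

section \<open>Null-homotopic equivariant maps\<close>

definition simplex_labels :: "('a \<Rightarrow> 'v) \<Rightarrow> nat \<Rightarrow> ((nat \<Rightarrow> real) \<Rightarrow> 'a) \<Rightarrow> 'v list"
  where "simplex_labels l p f = map (\<lambda>i. l (f (\<lambda>j. if j = i then 1 else 0))) [0..<Suc p]"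

definition chain_eval :: "('a \<Rightarrow> 'v) \<Rightarrow> nat \<Rightarrow> ('v list \<Rightarrow> int) \<Rightarrow> 'a chain \<Rightarrow> int"
  where "chain_eval l p \<theta> c = (\<Sum>f\<in>Poly_Mapping.keys c. Poly_Mapping.lookup c f * \<theta> (simplex_labels l p f))"

lemma length_simplex_labels [simp]: "length (simplex_labels l p f) = Suc p"
  by (simp add: simplex_labels_def)

lemma chain_eval_conv_frag_extend:
  "chain_eval l p \<theta> c
    = Poly_Mapping.lookup (frag_extend (\<lambda>f. frag_cmul (\<theta> (simplex_labels l p f)) (frag_of ())) c) ()"
  by (simp add: chain_eval_def frag_extend_def lookup_sum)

lemma chain_eval_0 [simp]: "chain_eval l p \<theta> 0 = 0"
  by (simp add: chain_eval_def)

lemma chain_eval_of [simp]: "chain_eval l p \<theta> (frag_of f) = \<theta> (simplex_labels l p f)"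
  by (simp add: chain_eval_conv_frag_extend)

lemma chain_eval_diff: "chain_eval l p \<theta> (c - c') = chain_eval l p \<theta> c - chain_eval l p \<theta> c'"
  by (simp add: chain_eval_conv_frag_extend frag_extend_diff lookup_minus)

lemma chain_eval_cmul: "chain_eval l p \<theta> (frag_cmul n c) = n * chain_eval l p \<theta> c"
  by (simp add: chain_eval_conv_frag_extend frag_extend_cmul)

lemma chain_eval_sum: "finite A \<Longrightarrow> chain_eval l p \<theta> (\<Sum>a\<in>A. c a) = (\<Sum>a\<in>A. chain_eval l p \<theta> (c a))"
  by (simp add: chain_eval_conv_frag_extend frag_extend_sum lookup_sum)

lemma chain_eval_cong_mod:
  assumes "\<And>f. f \<in> Poly_Mapping.keys c \<Longrightarrow> [\<theta> (simplex_labels l p f) = \<eta> (simplex_labels l p f)] (mod n)"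
  shows "[chain_eval l p \<theta> c = chain_eval l p \<eta> c] (mod n)"
  unfolding chain_eval_def by (intro cong_sum cong_mult cong_refl assms)

lemma simplical_face_vertex:
  "simplical_face k (\<lambda>j. if j = i then 1 else 0) = (\<lambda>j. if j = (if i < k then i else Suc i) then 1 else 0)"
  by (rule ext) (auto simp: simplical_face_def)

lemma simplex_labels_face:
  assumes "k \<le> Suc p"
  shows "simplex_labels l p (singular_face (Suc p) k f)
    = take k (simplex_labels l (Suc p) f) @ drop (Suc k) (simplex_labels l (Suc p) f)"
proof (rule nth_equalityI)
  show "length (simplex_labels l p (singular_face (Suc p) k f))
      = length (take k (simplex_labels l (Suc p) f) @ drop (Suc k) (simplex_labels l (Suc p) f))"
    using assms by simp
  fix i assume "i < length (simplex_labels l p (singular_face (Suc p) k f))"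
  then have i: "i \<le> p" by simp
  have n: "simplex_labels l q g ! j = l (g (\<lambda>m. if m = j then 1 else 0))" if "j \<le> q" for q g j
    using that unfolding simplex_labels_def by (subst nth_map) (auto simp del: upt_Suc)
  have "simplex_labels l p (singular_face (Suc p) k f) ! i
      = l (f (\<lambda>j. if j = (if i < k then i else Suc i) then 1 else 0))"
    using i by (simp add: n singular_face_def simplical_face_vertex)
  also have "\<dots> = (take k (simplex_labels l (Suc p) f) @ drop (Suc k) (simplex_labels l (Suc p) f)) ! i"
    using assms i by (auto simp: nth_append n)
  finally show "simplex_labels l p (singular_face (Suc p) k f) ! i
      = (take k (simplex_labels l (Suc p) f) @ drop (Suc k) (simplex_labels l (Suc p) f)) ! i" .
qed

text \<open>Stokes' formula. By linearity it concerns one simplex, and the vertex labels of a face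
  are those of the simplex with one entry omitted.\<close>

lemma chain_eval_boundary:
  "chain_eval l p \<theta> (chain_boundary (Suc p) c) = chain_eval l (Suc p) (\<lambda>xs. coboundary xs \<theta>) c"
  using subset_UNIV
proof (induction c rule: frag_induction)
  case (one f)
  have "chain_eval l p \<theta> (chain_boundary (Suc p) (frag_of f))
      = (\<Sum>k\<le>Suc p. (-1) ^ k * \<theta> (simplex_labels l p (singular_face (Suc p) k f)))"
    by (simp add: chain_boundary_of chain_eval_sum chain_eval_cmul del: sum.atMost_Suc)
  also have "\<dots> = coboundary (simplex_labels l (Suc p) f) \<theta>"
    by (simp add: coboundary_conv_sum simplex_labels_face lessThan_Suc_atMost del: sum.atMost_Suc sum.lessThan_Suc)
  finally show ?case by simp
qed (simp_all add: chain_boundary_diff chain_eval_diff)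

lemma chain_eval_chain_map:
  assumes "singular_chain p X c" and "\<And>x. x \<in> topspace X \<Longrightarrow> l (s x) = r (l x)"
  shows "chain_eval l p \<theta> (chain_map p s c) = chain_eval l p (\<lambda>xs. \<theta> (map r xs)) c"
  using assms(1) unfolding singular_chain_def
proof (induction c rule: frag_induction)
  case (one f)
  then have "f x \<in> topspace X" if "x \<in> standard_simplex p" for x
    using that by (auto simp: singular_simplex_def continuous_map_def)
  then have "simplex_labels l p (simplex_map p s f) = map r (simplex_labels l p f)"
    unfolding simplex_labels_def simplex_map_def using assms(2) by (simp del: upt_Suc)
  then show ?case by simp
qed (simp_all add: chain_map_diff chain_eval_diff)

section \<open>Equivariant chains\<close>

definition cyclic_chain_op :: "nat \<Rightarrow> nat \<Rightarrow> ('a \<Rightarrow> 'a) \<Rightarrow> 'a chain \<Rightarrow> 'a chain"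
  where "cyclic_chain_op k d s c = (if even d then chain_map d s c - c else (\<Sum>a<k. chain_map d (s ^^ a) c))"

lemma continuous_map_funpow: "continuous_map X X s \<Longrightarrow> continuous_map X X (s ^^ a)"
  by (induction a) (simp_all add: continuous_map_compose)

text \<open>The operators on chains and on cochains follow the same parity convention, so that the
  pairing makes them adjoint.\<close>

lemma chain_eval_cyclic_chain_op:
  assumes c: "singular_chain p X c" and s: "continuous_map X X s"
    and l: "\<And>x. x \<in> topspace X \<Longrightarrow> l (s x) = rotate_label k (l x)"
  shows "chain_eval l p \<theta> (cyclic_chain_op k p s c) = chain_eval l p (cyclic_op k p \<theta>) c"
proof -
  have mem: "(s ^^ a) x \<in> topspace X" if "x \<in> topspace X" for a x
    using continuous_map_funpow[OF s, of a] that by (auto simp: continuous_map_def)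
  have "l ((s ^^ a) x) = (rotate_label k ^^ a) (l x)" if "x \<in> topspace X" for a x
    by (induction a) (use that l mem in auto)
  then have 1: "chain_eval l p \<theta> (chain_map p (s ^^ a) c) = chain_eval l p (\<lambda>xs. \<theta> (map (rotate_label k ^^ a) xs)) c" for a
    by (rule chain_eval_chain_map[OF c])
  have 2: "chain_eval l p \<theta> (chain_map p s c) = chain_eval l p (\<lambda>xs. \<theta> (map (rotate_label k) xs)) c"
    by (rule chain_eval_chain_map[OF c]) (rule l)
  have 3: "chain_eval l p (\<lambda>xs. \<theta> (map (rotate_label k) xs)) c - chain_eval l p \<theta> c
      = chain_eval l p (\<lambda>xs. \<theta> (map (rotate_label k) xs) - \<theta> xs) c"
    by (simp add: chain_eval_def right_diff_distrib sum_subtractf)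
  have 4: "(\<Sum>a<k. chain_eval l p (\<lambda>xs. \<theta> (map (rotate_label k ^^ a) xs)) c)
      = chain_eval l p (\<lambda>xs. \<Sum>a<k. \<theta> (map (rotate_label k ^^ a) xs)) c"
    unfolding chain_eval_def sum_distrib_left by (rule sum.swap)
  show ?thesis
    unfolding cyclic_chain_op_def cyclic_op_def
    by (simp add: chain_eval_diff chain_eval_sum 1 2 3 4)
qed

lemma chain_map_funpow_compose:
  "chain_map p (s ^^ a) (chain_map p s c) = chain_map p (s ^^ Suc a) c"
  by (simp only: funpow_Suc_right chain_map_compose o_apply)

lemma chain_boundary_cyclic_chain_op:
  assumes "singular_chain p X c"
  shows "chain_boundary p (cyclic_chain_op k p s c)
    = (if even p then chain_map (p - 1) s (chain_boundary p c) - chain_boundary p c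
       else (\<Sum>a<k. chain_map (p - 1) (s ^^ a) (chain_boundary p c)))"
  using assms by (simp add: cyclic_chain_op_def chain_boundary_diff chain_boundary_sum chain_boundary_chain_map)

lemma singular_chain_cyclic_chain_op:
  assumes "singular_chain p X c" "continuous_map X X s"
  shows "singular_chain p X (cyclic_chain_op k p s c)"
  unfolding cyclic_chain_op_def
  using assms by (auto intro!: singular_chain_diff singular_chain_sum singular_chain_chain_map
      continuous_map_funpow)

text \<open>In either order, \<open>s - 1\<close> and the sum of the powers of \<open>s\<close>
  compose to \<open>s ^^ k - 1\<close>, which is 0 on chains of \<open>X\<close>. Hence the boundary
  prescribed for the next chain is a cycle.\<close>

lemma cyclic_chain_op_zero:
  assumes c: "singular_chain (Suc p) X c" "singular_chain p X c'" "chain_boundary (Suc p) c = cyclic_chain_op k p s c'"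
    and s: "continuous_map X X s" "\<And>x. x \<in> topspace X \<Longrightarrow> (s ^^ k) x = x"
  shows "chain_boundary (Suc p) (cyclic_chain_op k (Suc p) s c) = 0"
proof -
  have full: "chain_map p (s ^^ k) c' = c'"
    using chain_map_id_gen[OF c(2)] s(2) by blast
  have shift: "(\<Sum>a<k. chain_map p (s ^^ Suc a) c') = (\<Sum>a<k. chain_map p (s ^^ a) c')"
  proof -
    have "(\<Sum>a<Suc k. chain_map p (s ^^ a) c') = chain_map p (s ^^ 0) c' + (\<Sum>a<k. chain_map p (s ^^ Suc a) c')"
      by (rule sum.lessThan_Suc_shift)
    moreover have "chain_map p (s ^^ 0) c' = c'"
      using chain_map_ident[OF c(2)] by (simp add: id_def)
    ultimately show ?thesis by (simp add: full)
  qed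
  show ?thesis
  proof (cases "even p")
    case True
    then show ?thesis
      unfolding chain_boundary_cyclic_chain_op[OF c(1)] c(3)
      by (simp add: cyclic_chain_op_def chain_map_diff chain_map_funpow_compose sum_subtractf shift del: funpow.simps)
  next
    case False
    have "chain_map p s (\<Sum>a<k. chain_map p (s ^^ a) c') = (\<Sum>a<k. chain_map p (s ^^ Suc a) c')"
      by (simp add: chain_map_sum chain_map_compose)
    with False show ?thesis
      unfolding chain_boundary_cyclic_chain_op[OF c(1)] c(3)
      by (simp add: cyclic_chain_op_def shift del: funpow.simps)
  qed
qed

text \<open>Homotopy invariance replaces \<open>g\<close> by a constant, and cycles in a one-point
  space bound in positive degrees. In degree 0 the image under the constant is a multiple of a
  point, so its vanishing is assumed.\<close>

lemma chain_boundary_nullhomotopic: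
  assumes z: "singular_chain p X z" "chain_boundary p z = 0"
    and g: "homotopic_with (\<lambda>_. True) X X g (\<lambda>_. q)"
    and 0: "p = 0 \<Longrightarrow> chain_map p (\<lambda>_. q) z = 0"
  shows "\<exists>e. singular_chain (Suc p) X e \<and> chain_boundary (Suc p) e = chain_map p g z"
proof -
  have cont: "continuous_map X X (\<lambda>_. q)"
    using homotopic_with_imp_continuous_maps[OF g] by blast
  have cyc: "singular_relcycle p X {} z" using z by (simp add: singular_cycle)
  have hom: "homologous_rel p X {} (chain_map p g z) (chain_map p (\<lambda>_. q) z)"
    by (rule homotopic_imp_homologous_rel_chain_maps[OF _ cyc]) (use g in simp)
  have bd: "singular_relboundary p X {} (chain_map p (\<lambda>_. q) z)"
  proof (cases "p = 0 \<or> topspace X = {}")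
    case True
    then show ?thesis using 0 z(1) by (auto simp: singular_chain_empty)
  next
    case False
    let ?Y = "subtopology X {q}"
    have q: "q \<in> topspace X" using cont False by (auto simp: continuous_map_def)
    then have Y: "topspace ?Y = {q}" by auto
    have "continuous_map X ?Y (\<lambda>_. q)"
      using cont by (simp add: continuous_map_in_subtopology)
    then have "singular_relcycle p ?Y {} (chain_map p (\<lambda>_. q) z)"
      using singular_relcycle_chain_map[OF cyc] by blast
    then have "singular_relboundary p ?Y {} (chain_map p (\<lambda>_. q) z)"
      using singular_boundary_eq_cycle_singleton[OF Y] False by simp
    then show ?thesis
      using singular_boundary_mono[of "{q}" "topspace X" p X] q by simp
  qed
  have "singular_relboundary p X {} (chain_map p g z - chain_map p (\<lambda>_. q) z + chain_map p (\<lambda>_. q) z)"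
    using hom bd unfolding homologous_rel_def by (rule singular_relboundary_add)
  then show ?thesis by (simp add: singular_boundary)
qed

text \<open>A null-homotopic equivariant self-map \<open>g\<close> lets one climb one dimension at a time, at the price of applying
  \<open>g\<close> to the chains already constructed.\<close>

lemma ex_cyclic_chains:
  assumes s: "continuous_map X X s" "\<And>x. x \<in> topspace X \<Longrightarrow> (s ^^ k) x = x"
    and g: "homotopic_with (\<lambda>_. True) X X g (\<lambda>_. q)" "\<And>x. x \<in> topspace X \<Longrightarrow> g (s x) = s (g x)"
    and p: "p \<in> topspace X"
  shows "\<exists>c :: nat \<Rightarrow> 'a chain. (\<forall>d\<le>n. singular_chain d X (c d)) \<and> (\<exists>f. c 0 = frag_of f) \<and>
    (\<forall>d<n. chain_boundary (Suc d) (c (Suc d)) = cyclic_chain_op k d s (c d))"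
proof (induction n)
  case 0
  let ?f = "restrict (\<lambda>_. p) (standard_simplex 0)"
  have "singular_simplex 0 X ?f"
    using p by (simp add: singular_simplex_def)
  then show ?case by (intro exI[of _ "\<lambda>_. frag_of ?f"]) (auto simp: singular_chain_of)
next
  case (Suc n)
  then obtain c f where c: "\<And>d. d \<le> n \<Longrightarrow> singular_chain d X (c d)" "c 0 = frag_of f"
      "\<And>d. d < n \<Longrightarrow> chain_boundary (Suc d) (c (Suc d)) = cyclic_chain_op k d s (c d)"
    by blast
  have cont: "continuous_map X X g" "continuous_map X X (\<lambda>_. q)"
    using homotopic_with_imp_continuous_maps[OF g(1)] by blast+
  have gs: "chain_map d g (cyclic_chain_op k d s a) = cyclic_chain_op k d s (chain_map d g a)"
    if a: "singular_chain d X a" for d a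
  proof -
    have mem: "(s ^^ i) x \<in> topspace X" if "x \<in> topspace X" for i x
      using continuous_map_funpow[OF s(1), of i] that by (auto simp: continuous_map_def)
    have "g ((s ^^ i) x) = (s ^^ i) (g x)" if "x \<in> topspace X" for i x
      by (induction i) (use that mem g(2) in auto)
    then have "chain_map d (g \<circ> s ^^ i) a = chain_map d (s ^^ i \<circ> g) a" for i
      by (intro chain_map_eq[OF a]) simp
    from this this[of 1] show ?thesis
      by (simp add: cyclic_chain_op_def chain_map_diff chain_map_sum chain_map_compose)
  qed
  let ?z = "cyclic_chain_op k n s (c n)"
  have "chain_boundary n ?z = 0"
  proof (cases n)
    case 0
    then show ?thesis by (simp add: chain_boundary_def)
  next
    case (Suc m)
    then show ?thesis using c s by (auto intro!: cyclic_chain_op_zero[of _ X _ "c m"])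
  qed
  \<comment> \<open>In degree 0 the cycle is the difference of two points, which a constant map
    identifies.\<close>
  moreover have "chain_map n (\<lambda>_. q) ?z = 0" if "n = 0"
  proof -
    have "simplex_map 0 (\<lambda>_. q) (simplex_map 0 s f) = simplex_map 0 (\<lambda>_. q) f"
      by (simp add: simplex_map_def)
    then show ?thesis using that c(2) by (simp add: cyclic_chain_op_def chain_map_diff)
  qed
  ultimately obtain e where e: "singular_chain (Suc n) X e" "chain_boundary (Suc n) e = chain_map n g ?z"
    using chain_boundary_nullhomotopic[OF singular_chain_cyclic_chain_op[OF c(1)[OF order.refl] s(1)] _ g(1)] by blast
  define c' where "c' d = (if d \<le> n then chain_map d g (c d) else e)" for d
  have 1: "singular_chain d X (c' d)" if "d \<le> Suc n" for d
    using that c(1) e(1) cont(1) by (auto simp: c'_def le_Suc_eq intro: singular_chain_chain_map)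
  have 2: "\<exists>f. c' 0 = frag_of f" by (auto simp: c'_def c(2))
  have 3: "chain_boundary (Suc d) (c' (Suc d)) = cyclic_chain_op k d s (c' d)" if "d < Suc n" for d
  proof (cases "d = n")
    case True
    then show ?thesis using e(2) gs[OF c(1)] by (simp add: c'_def)
  next
    case False
    with that show ?thesis
      using c(3)[of d] gs[OF c(1), of d] chain_boundary_chain_map[OF c(1), of "Suc d" g] by (simp add: c'_def)
  qed
  from 1 2 3 show ?case by blast
qed

section \<open>Subdivision, and the pairing with labels\<close>

lemma singular_chain_iterated_subdivision:
  "singular_chain p X c \<Longrightarrow> singular_chain p X ((singular_subdivision p ^^ n) c)"
  by (induction n) (simp_all add: singular_chain_singular_subdivision)

lemma chain_boundary_iterated_subdivision:
  assumes "singular_chain (Suc p) X c"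
  shows "chain_boundary (Suc p) ((singular_subdivision (Suc p) ^^ n) c)
    = (singular_subdivision p ^^ n) (chain_boundary (Suc p) c)"
  by (induction n)
    (simp_all add: chain_boundary_singular_subdivision[OF singular_chain_iterated_subdivision[OF assms]])

lemma iterated_subdivision_chain_map:
  assumes "singular_chain p X c"
  shows "(singular_subdivision p ^^ n) (chain_map p g c) = chain_map p g ((singular_subdivision p ^^ n) c)"
  by (induction n) (simp_all add: naturality_singular_subdivision[OF singular_chain_iterated_subdivision[OF assms]])

lemma iterated_subdivision_sum:
  fixes c :: "'i \<Rightarrow> 'a chain"
  shows "finite A \<Longrightarrow> (singular_subdivision p ^^ n) (\<Sum>a\<in>A. c a) = (\<Sum>a\<in>A. (singular_subdivision p ^^ n) (c a))"
proof (induction A rule: finite_induct)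
  case (insert a A)
  have "(singular_subdivision p ^^ n) (x + y) = (singular_subdivision p ^^ n) x + (singular_subdivision p ^^ n) y"
    for x y :: "'a chain"
    by (induction n) (simp_all add: singular_subdivision_add)
  with insert show ?case by simp
qed simp

lemma iterated_subdivision_cyclic_chain_op:
  assumes "singular_chain p X c"
  shows "(singular_subdivision p ^^ n) (cyclic_chain_op k p s c) = cyclic_chain_op k p s ((singular_subdivision p ^^ n) c)"
  by (simp add: cyclic_chain_op_def singular_subdivision_power_diff iterated_subdivision_sum
      iterated_subdivision_chain_map[OF assms])

text \<open>The labels play the role of an equivariant map from \<open>X\<close> to the \<open>m\<close>-fold join of the cyclic group with itself,
  which has dimension \<open>m - 1\<close> and therefore kills the chain of dimension \<open>m\<close>.\<close>

theorem no_nullhomotopic_equivariant_map: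
  fixes l :: "'a \<Rightarrow> nat \<times> nat"
  assumes k: "k \<ge> 2"
    and s: "continuous_map X X s" "\<And>x. x \<in> topspace X \<Longrightarrow> (s ^^ k) x = x"
    and g: "homotopic_with (\<lambda>_. True) X X g (\<lambda>_. q)" "\<And>x. x \<in> topspace X \<Longrightarrow> g (s x) = s (g x)"
    and p: "p \<in> topspace X"
    and l: "\<And>x. x \<in> topspace X \<Longrightarrow> fst (l x) < k \<and> snd (l x) < m" "\<And>x. x \<in> topspace X \<Longrightarrow> l (s x) = rotate_label k (l x)"
    and \<U>: "\<And>U. U \<in> \<U> \<Longrightarrow> openin X U" "topspace X \<subseteq> \<Union>\<U>" "\<And>U. U \<in> \<U> \<Longrightarrow> inj_on snd (l ` U)"
  shows False
proof -
  obtain c f0 where c: "\<And>d. d \<le> m \<Longrightarrow> singular_chain d X (c d)" and c0: "c 0 = frag_of f0"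
      and cb: "\<And>d. d < m \<Longrightarrow> chain_boundary (Suc d) (c (Suc d)) = cyclic_chain_op k d s (c d)"
    using ex_cyclic_chains[where X = X and s = s and k = k and g = g and q = q and p = p and n = m, OF s g p] by blast
  have "\<exists>n. \<forall>n'\<ge>n. \<forall>f\<in>Poly_Mapping.keys ((singular_subdivision d ^^ n') (c d)). \<exists>V\<in>\<U>. f \<in> standard_simplex d \<rightarrow> V"
    if "d \<le> m" for d
    using sufficient_iterated_singular_subdivision_exists[OF \<U>(1,2) c[OF that]] by metis
  then obtain N where N: "\<And>d n f. d \<le> m \<Longrightarrow> N d \<le> n \<Longrightarrow> f \<in> Poly_Mapping.keys ((singular_subdivision d ^^ n) (c d))
      \<Longrightarrow> \<exists>V\<in>\<U>. f \<in> standard_simplex d \<rightarrow> V" by metis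
  \<comment> \<open>The relations between the chains survive only if all of them are subdivided
    equally often; the sum dominates every \<open>N d\<close>.\<close>
  define n where "n = (\<Sum>d\<le>m. N d)"
  have n: "N d \<le> n" if "d \<le> m" for d
    unfolding n_def using that by (intro member_le_sum) auto
  define e where "e d = (singular_subdivision d ^^ n) (c d)" for d
  have e: "singular_chain d X (e d)" if "d \<le> m" for d
    unfolding e_def by (rule singular_chain_iterated_subdivision[OF c[OF that]])
  have eb: "chain_boundary (Suc d) (e (Suc d)) = cyclic_chain_op k d s (e d)" if "d < m" for d
    using that c[of "Suc d"] c[of d] cb[of d]
    by (simp add: e_def chain_boundary_iterated_subdivision iterated_subdivision_cyclic_chain_op)
  \<comment> \<open>Subdivision does not affect dimension 0, so the first pairing is the value of a
    single label list.\<close>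
  have "(singular_subdivision 0 ^^ n') (c 0) = c 0" for n'
    by (induction n') (use singular_subdivision_zero c in force)+
  then have e0: "e 0 = frag_of f0" by (simp add: e_def c0)
  have labels: "transversal k (set (simplex_labels l d f)) \<and> set (simplex_labels l d f) \<subseteq> {..<k} \<times> {..<m}"
    if d: "d \<le> m" and key: "f \<in> Poly_Mapping.keys (e d)" for d f
  proof -
    have f: "f x \<in> topspace X" if x: "x \<in> standard_simplex d" for x
    proof -
      have "singular_simplex d X f"
        using e[OF d] key by (auto simp: singular_chain_def)
      then show ?thesis using x by (auto simp: singular_simplex_def continuous_map_def)
    qed
    obtain V where V: "V \<in> \<U>" "f \<in> standard_simplex d \<rightarrow> V"
      using N[OF d n[OF d]] key unfolding e_def by blast
    have sub: "set (simplex_labels l d f) \<subseteq> l ` (f ` standard_simplex d)"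
      by (auto simp: simplex_labels_def simp del: upt_Suc)
    also have "\<dots> \<subseteq> l ` V" using V(2) by auto
    finally have "inj_on snd (set (simplex_labels l d f))"
      using \<U>(3)[OF V(1)] inj_on_subset by blast
    moreover have "set (simplex_labels l d f) \<subseteq> {..<k} \<times> {..<m}"
    proof
      fix v assume "v \<in> set (simplex_labels l d f)"
      then obtain x where "x \<in> standard_simplex d" "v = l (f x)" using sub by auto
      then show "v \<in> {..<k} \<times> {..<m}" using l(1)[OF f] by (simp add: mem_Times_iff)
    qed
    ultimately show ?thesis unfolding transversal_def by auto
  qed
  have op: "chain_eval l d \<theta> (cyclic_chain_op k d s (e d)) = chain_eval l d (cyclic_op k d \<theta>) (e d)" if "d \<le> m" for d \<theta>
    by (rule chain_eval_cyclic_chain_op[OF e[OF that] s(1)]) (rule l(2))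
  \<comment> \<open>The induction step combines adjointness, the relation between consecutive
    cochains and Stokes' formula, which together lower the dimension of the pairing by 1.\<close>
  have main: "[chain_eval l d (cochain_tower k d) (chain_boundary (Suc d) (e (Suc d))) = 1] (mod int k)"
    if "d < m" for d
    using that
  proof (induction d)
    case 0
    then show ?case
      using cyclic_op_cochain_tower_0[of "simplex_labels l 0 f0" k] by (simp add: eb op) (simp add: e0)
  next
    case (Suc d)
    have "[chain_eval l (Suc d) (cyclic_op k (Suc d) (cochain_tower k (Suc d))) (e (Suc d))
        = chain_eval l (Suc d) (\<lambda>xs. coboundary xs (cochain_tower k d)) (e (Suc d))] (mod int k)"
      using Suc.prems k labels[of "Suc d"] by (intro chain_eval_cong_mod cyclic_op_cochain_tower) auto
    then show ?case
      using Suc by (metis chain_eval_boundary cong_trans eb op Suc_lessD less_imp_le)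
  qed
  have "m > 0" using l(1)[OF p] by auto
  then obtain d where d: "m = Suc d" by (cases m) auto
  have "chain_eval l d (cochain_tower k d) (chain_boundary (Suc d) (e (Suc d)))
      = chain_eval l m (\<lambda>xs. coboundary xs (cochain_tower k d)) (e m)"
    by (simp add: chain_eval_boundary d)
  also have "\<dots> = 0"
    unfolding chain_eval_def
  proof (intro sum.neutral ballI)
    fix f assume f: "f \<in> Poly_Mapping.keys (e m)"
    let ?xs = "simplex_labels l m f"
    \<comment> \<open>Distinct labels of a simplex of the join would lie in \<open>Suc m\<close>
      different factors, but there are only \<open>m\<close>.\<close>
    have "\<not> distinct ?xs"
    proof
      assume "distinct ?xs"
      then have "card (snd ` set ?xs) = Suc m"
        using labels[OF order.refl f] by (simp add: transversal_def card_image distinct_card)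
      moreover have "snd ` set ?xs \<subseteq> {..<m}" using labels[OF order.refl f] by force
      ultimately show False using card_mono[of "{..<m}" "snd ` set ?xs"] by simp
    qed
    then have "coboundary ?xs (cochain_tower k d) = 0"
      by (rule alternating_not_distinct[OF alternating_coboundary[OF alternating_cochain_tower]])
    then show "Poly_Mapping.lookup (e m) f * coboundary ?xs (cochain_tower k d) = 0" by simp
  qed
  finally show False using main[of d] k d by (simp add: cong_def)
qed

text \<open>The functions \<open>u i\<close> are discretized by a grid fine enough to distinguish the points of an orbit; the label
  of \<open>x\<close> consists of the least grid cell met by the orbit of \<open>x\<close> and of the position at which it is met.\<close>

theorem no_nullhomotopic_equivariant_map_free:
  fixes u :: "'i \<Rightarrow> 'a \<Rightarrow> complex"
  assumes k: "k \<ge> 2"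
    and s: "continuous_map X X s" "\<And>x. x \<in> topspace X \<Longrightarrow> (s ^^ k) x = x"
    and g: "homotopic_with (\<lambda>_. True) X X g (\<lambda>_. q)" "\<And>x. x \<in> topspace X \<Longrightarrow> g (s x) = s (g x)"
    and p: "p \<in> topspace X"
    and I: "finite I" "\<And>i. i \<in> I \<Longrightarrow> continuous_map X euclidean (u i)"
      "\<And>i x. i \<in> I \<Longrightarrow> x \<in> topspace X \<Longrightarrow> cmod (u i x) \<le> B"
    and c: "c > 0" "\<And>x j. x \<in> topspace X \<Longrightarrow> 0 < j \<Longrightarrow> j < k \<Longrightarrow> \<exists>i\<in>I. cmod (u i x - u i ((s ^^ j) x)) \<ge> c"
  shows False
proof -
  have mem: "(s ^^ j) x \<in> topspace X" if "x \<in> topspace X" for j x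
    using continuous_map_funpow[OF s(1), of j] that by (auto simp: continuous_map_def)
  have period: "(s ^^ (j mod k)) x = (s ^^ j) x" if x: "x \<in> topspace X" for j x
  proof -
    have "(s ^^ (k * n)) x = x" for n
      by (induction n) (simp_all add: funpow_add s(2) x)
    then have "(s ^^ (j mod k + k * (j div k))) x = (s ^^ (j mod k)) x"
      unfolding funpow_add o_apply by (simp only:)
    then show ?thesis by (simp only: mod_mult_div_eq)
  qed
  have sep: "i1 = i2"
    if x: "x \<in> topspace X" and i: "i1 < k" "i2 < k" and close: "\<And>i. i \<in> I \<Longrightarrow> cmod (u i ((s ^^ i1) x) - u i ((s ^^ i2) x)) < c"
    for x i1 i2
  proof -
    have False if "j1 < j2" "j2 < k" "\<And>i. i \<in> I \<Longrightarrow> cmod (u i ((s ^^ j1) x) - u i ((s ^^ j2) x)) < c" for j1 j2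
    proof -
      obtain i where i: "i \<in> I" "cmod (u i ((s ^^ j1) x) - u i ((s ^^ (j2 - j1)) ((s ^^ j1) x))) \<ge> c"
        using c(2)[OF mem[OF x], of "j2 - j1" j1] \<open>j1 < j2\<close> \<open>j2 < k\<close> by (meson less_imp_diff_less zero_less_diff)
      have "(s ^^ (j2 - j1)) ((s ^^ j1) x) = (s ^^ j2) x"
        using \<open>j1 < j2\<close> by (simp flip: funpow_add[THEN fun_cong, unfolded o_apply])
      with i that(3)[OF i(1)] show False by simp
    qed
    then show ?thesis using i close by (metis linorder_neqE_nat norm_minus_commute)
  qed
  \<comment> \<open>Cells of width \<open>c / 4\<close> for the real and for the imaginary part, so
    that two complex values in the same cell are less than \<open>c / 2\<close> apart.\<close>
  define h where "h r = \<lfloor>4 * r / c\<rfloor>" for r :: real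
  have h: "\<bar>r - r'\<bar> < c / 4" if "h r = h r'" for r r'
  proof -
    have "\<bar>4 * r / c - 4 * r' / c\<bar> < 1" using that unfolding h_def by linarith
    then have "\<bar>(r - r') * (4 / c)\<bar> < 1" by (simp add: algebra_simps diff_divide_distrib)
    then have "\<bar>r - r'\<bar> * (4 / c) < 1" using c(1) by (simp only: abs_mult) simp
    then show ?thesis using c(1) by (simp add: pos_divide_less_eq)
  qed
  define code where "code x = (\<lambda>i\<in>I. (h (Re (u i x)), h (Im (u i x))))" for x
  have code: "cmod (u i x - u i y) < c / 2" if "code x = code y" "i \<in> I" for x y i
  proof -
    have "(h (Re (u i x)), h (Im (u i x))) = (h (Re (u i y)), h (Im (u i y)))"
      using fun_cong[OF that(1), of i] that(2) by (simp add: code_def)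
    then have "\<bar>Re (u i x - u i y)\<bar> < c / 4" "\<bar>Im (u i x - u i y)\<bar> < c / 4" using h by auto
    then show ?thesis using cmod_le[of "u i x - u i y"] by linarith
  qed
  have "finite (code ` topspace X)"
  proof (rule finite_subset)
    let ?J = "{\<lfloor>- (4 * B / c)\<rfloor>..\<lfloor>4 * B / c\<rfloor>}"
    have hJ: "h r \<in> ?J" if "\<bar>r\<bar> \<le> B" for r
    proof -
      have "4 * (- B) / c \<le> 4 * r / c" "4 * r / c \<le> 4 * B / c"
        by (intro divide_right_mono; use that c(1) in linarith)+
      then show ?thesis by (auto simp: h_def intro!: floor_mono)
    qed
    show "code ` topspace X \<subseteq> PiE I (\<lambda>_. ?J \<times> ?J)"
    proof
      fix f assume "f \<in> code ` topspace X"
      then obtain x where x: "x \<in> topspace X" "f = code x" by blast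
      have "\<bar>Re (u i x)\<bar> \<le> B" "\<bar>Im (u i x)\<bar> \<le> B" if "i \<in> I" for i
        using I(3)[OF that x(1)] abs_Re_le_cmod[of "u i x"] abs_Im_le_cmod[of "u i x"] by linarith+
      then show "f \<in> PiE I (\<lambda>_. ?J \<times> ?J)" using hJ by (auto simp: x(2) code_def)
    qed
    show "finite (PiE I (\<lambda>_. ?J \<times> ?J))" by (intro finite_PiE I(1)) auto
  qed
  then obtain \<iota> m where \<iota>: "bij_betw \<iota> (code ` topspace X) {0..<m :: nat}"
    using ex_bij_betw_finite_nat by blast
  define N where "N x j = \<iota> (code ((s ^^ j) x))" for x j
  have N_close: "cmod (u i ((s ^^ j) x) - u i ((s ^^ j') x')) < c / 2"
    if "x \<in> topspace X" "x' \<in> topspace X" "N x j = N x' j'" "i \<in> I" for x x' j j' i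
  proof (rule code[OF _ that(4)])
    show "code ((s ^^ j) x) = code ((s ^^ j') x')"
      using bij_betw_imp_inj_on[OF \<iota>] that(3) mem[OF that(1)] mem[OF that(2)] unfolding N_def
      by (meson imageI inj_onD)
  qed
  have N_less: "N x j < m" if "x \<in> topspace X" for x j
    using bij_betwE[OF \<iota>] mem[OF that] unfolding N_def by fastforce
  have N_inj: "j = j'" if "x \<in> topspace X" "j < k" "j' < k" "N x j = N x j'" for x j j'
  proof (rule sep[OF that(1-3)])
    show "cmod (u i ((s ^^ j) x) - u i ((s ^^ j') x)) < c" if "i \<in> I" for i
      using N_close[OF \<open>x \<in> topspace X\<close> \<open>x \<in> topspace X\<close> \<open>N x j = N x j'\<close> that] c(1) by simp
  qed
  define j0 where "j0 x = (ARG_MIN (N x) j. j < k)" for x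
  have j0: "j0 x < k" "\<And>j. j < k \<Longrightarrow> N x (j0 x) \<le> N x j" for x
    using arg_min_nat_lemma[of "\<lambda>j. j < k" 0 "N x"] k unfolding j0_def by auto
  \<comment> \<open>Applying \<open>s\<close> to \<open>x\<close> lowers the position of the minimal
    cell by 1, so it is minus the position that rotates forward. By \<open>N_inj\<close> the minimum
    is attained at only one position.\<close>
  define l where "l x = ((k - j0 x) mod k, N x (j0 x))" for x
  have N_s: "N (s x) j = N x (Suc j mod k)" if "x \<in> topspace X" for x j
    unfolding N_def period[OF that] by (simp add: funpow_swap1)
  have l_s: "l (s x) = rotate_label k (l x)" if x: "x \<in> topspace X" for x
  proof -
    have sx: "s x \<in> topspace X" using mem[OF x, of 1] by simp
    define j where "j = (if j0 x = 0 then k - 1 else j0 x - 1)"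
    have j: "j < k" "Suc j mod k = j0 x" using j0(1)[of x] k by (auto simp: j_def)
    have "N (s x) (j0 (s x)) \<le> N (s x) j" by (rule j0(2)[OF j(1)])
    moreover have "N (s x) j \<le> N (s x) (j0 (s x))"
      using j0(2)[of "Suc (j0 (s x)) mod k" x] k by (simp add: N_s[OF x] j(2))
    ultimately have e: "N (s x) (j0 (s x)) = N (s x) j" by simp
    then have "j0 (s x) = j" using N_inj[OF sx j0(1) j(1)] by simp
    moreover have "(k - j) mod k = Suc ((k - j0 x) mod k) mod k"
    proof (cases "j0 x = 0")
      case False
      then show ?thesis using j0(1)[of x] by (simp add: j_def Suc_diff_le)
    qed (use k in \<open>simp add: j_def\<close>)
    ultimately show ?thesis using e by (simp add: l_def rotate_label_def N_s[OF x] j(2))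
  qed
  \<comment> \<open>Two points of \<open>U x\<close> stay less than \<open>c / 4\<close> apart along
    their orbits. Added to the \<open>c / 2\<close> for values in the same cell this is below
    \<open>c\<close>, so equal cells are met at equal positions. The label may still jump within
    \<open>U x\<close>; only injectivity on its second component is required.\<close>
  define U where "U x = {x' \<in> topspace X. \<forall>j<k. \<forall>i\<in>I. cmod (u i ((s ^^ j) x') - u i ((s ^^ j) x)) < c / 8}" for x
  show False
  proof (rule no_nullhomotopic_equivariant_map[OF k s g p, where l = l and m = m and \<U> = "U ` topspace X"])
    show "fst (l x) < k \<and> snd (l x) < m" if "x \<in> topspace X" for x
      using N_less[OF that] k by (simp add: l_def)
    show "openin X V" if "V \<in> U ` topspace X" for V
    proof -
      from that obtain x where V: "V = U x" by blast
      have "V = (\<Inter>j\<in>{..<k}. \<Inter>i\<in>I. {x' \<in> topspace X. u i ((s ^^ j) x') \<in> ball (u i ((s ^^ j) x)) (c / 8)}) \<inter> topspace X"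
        by (auto simp: V U_def dist_norm norm_minus_commute)
      moreover have "openin X {x' \<in> topspace X. u i ((s ^^ j) x') \<in> ball (u i ((s ^^ j) x)) (c / 8)}" if "i \<in> I" for i j
        using openin_continuous_map_preimage[OF continuous_map_compose[OF continuous_map_funpow[OF s(1)] I(2)[OF that]], of "ball (u i ((s ^^ j) x)) (c / 8)" j]
        by (simp add: o_def)
      ultimately show ?thesis
        using I(1) by (cases "I = {}") (auto intro!: openin_Int openin_INT)
    qed
    show "topspace X \<subseteq> \<Union> (U ` topspace X)" using c(1) by (auto simp: U_def)
    show "inj_on snd (l ` V)" if "V \<in> U ` topspace X" for V
    proof -
      from that obtain x where V: "V = U x" by blast
      have "l y = l z" if yz: "y \<in> U x" "z \<in> U x" "snd (l y) = snd (l z)" for y z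
      proof -
        have X: "y \<in> topspace X" "z \<in> topspace X" using yz by (auto simp: U_def)
        have "j0 y = j0 z"
        proof (rule sep[OF X(1) j0(1) j0(1)])
          fix i assume i: "i \<in> I"
          have "cmod (u i ((s ^^ j0 y) y) - u i ((s ^^ j0 z) z)) < c / 2"
            using yz(3) by (intro N_close X i) (simp add: l_def)
          moreover have "cmod (u i ((s ^^ j0 z) z) - u i ((s ^^ j0 z) x)) < c / 8"
            "cmod (u i ((s ^^ j0 z) y) - u i ((s ^^ j0 z) x)) < c / 8"
            using yz(1,2) i j0(1)[of z] by (auto simp: U_def)
          ultimately have "cmod (u i ((s ^^ j0 y) y) - u i ((s ^^ j0 z) y)) < c / 2 + c / 8 + c / 8"
            by (meson norm_diff_triangle_less norm_minus_commute[THEN eq_refl, THEN le_less_trans])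
          then show "cmod (u i ((s ^^ j0 y) y) - u i ((s ^^ j0 z) y)) < c" using c(1) by simp
        qed
        then show ?thesis using yz(3) by (simp add: l_def)
      qed
      then show ?thesis unfolding inj_on_def V by blast
    qed
  qed (use l_s in auto)
qed

section \<open>Convolution of characters and the counit\<close>

text \<open>If \<open>H\<close> consists of the functions on a compact group, \<kappa> is evaluation
  at a group element and this is the map by which that element acts.\<close>

definition character_action ::
    "('a::cstar_algebra \<Rightarrow> ('a, 'h::cstar_algebra) min_tensor) \<Rightarrow> ('h \<Rightarrow> complex) \<Rightarrow> 'a \<Rightarrow> 'a"
  where "character_action \<delta> \<kappa> a = slice_right \<kappa> (\<delta> a)"

lemma star_hom_character_action:
  fixes \<delta> :: "'a::nonzero_cstar_algebra \<Rightarrow> ('a, 'h::cstar_algebra) min_tensor"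
  shows "star_hom \<delta> \<Longrightarrow> star_hom \<kappa> \<Longrightarrow> star_hom (character_action \<delta> \<kappa>)"
  unfolding character_action_def by (rule star_hom_comp[OF slice_right(1)])

lemma slice_right_tensor_map:
  fixes f :: "'a::nonzero_cstar_algebra \<Rightarrow> 'b::nonzero_cstar_algebra" and \<kappa> :: "'h::cstar_algebra \<Rightarrow> complex"
  assumes "star_hom f" "star_hom \<kappa>"
  shows "slice_right \<kappa> (tensor_map f id x) = f (slice_right \<kappa> x)"
proof (rule star_hom_tensor_eqI[of "\<lambda>x. slice_right \<kappa> (tensor_map f id x)" "\<lambda>x. f (slice_right \<kappa> x)"])
  show "star_hom (\<lambda>x. slice_right \<kappa> (tensor_map f id x))"
    by (rule star_hom_comp[OF slice_right(1)[OF assms(2)] tensor_map(1)[OF assms(1) star_hom_id]])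
  show "star_hom (\<lambda>x. f (slice_right \<kappa> x))"
    by (rule star_hom_comp[OF assms(1) slice_right(1)[OF assms(2)]])
qed (simp add: tensor_map(2)[OF assms(1) star_hom_id] slice_right(2)[OF assms(2)] star_homD[OF assms(1)])

lemma tensor_map_comp_left:
  assumes "star_hom f" "star_hom g"
  shows "tensor_map f id (tensor_map g id x) = tensor_map (\<lambda>x. f (g x)) id x"
  using tensor_map_comp[OF assms(1) star_hom_id assms(2) star_hom_id, of x] by (simp add: id_def)

lemma bounded_clinear_tensor_right: "bounded_clinear (\<lambda>y. a \<otimes> y)"
proof -
  have eq: "(\<lambda>y. a \<otimes> y) = (\<lambda>y. (a \<otimes> 1) * (1 \<otimes> y))" by (simp add: tensor_mult)
  have "bounded_clinear (\<lambda>y. (a \<otimes> 1) * (1 \<otimes> y))"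
    by (rule bounded_clinear_compose[OF bounded_clinear_mult_left bounded_clinear_star_hom[OF star_hom_tensor_right]])
  then show ?thesis by (subst eq)
qed

lemma star_hom_convolution:
  fixes \<Delta> :: "'h::nonzero_cstar_algebra \<Rightarrow> ('h, 'h) min_tensor"
  assumes "star_hom \<Delta>" "star_hom \<kappa>" "star_hom \<mu>"
  shows "star_hom (convolution \<Delta> \<kappa> \<mu>)" "convolution \<Delta> \<kappa> \<mu> g = \<kappa> (character_action \<Delta> \<mu> g)"
proof -
  have eq: "convolution \<Delta> \<kappa> \<mu> = (\<lambda>g. \<kappa> (character_action \<Delta> \<mu> g))"
    by (simp add: convolution_def tensor_lift_characters[OF assms(2,3)] o_def character_action_def)
  show "convolution \<Delta> \<kappa> \<mu> g = \<kappa> (character_action \<Delta> \<mu> g)" by (simp only: eq)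
  show "star_hom (convolution \<Delta> \<kappa> \<mu>)"
    unfolding eq by (rule star_hom_comp[OF assms(2) star_hom_character_action[OF assms(1,3)]])
qed

lemma slice_slice_assoc:
  fixes \<kappa> \<mu> :: "'h::nonzero_cstar_algebra \<Rightarrow> complex" and a :: "'a::nonzero_cstar_algebra"
  assumes "star_hom \<kappa>" "star_hom \<mu>"
  shows "slice_right \<mu> (tensor_map (slice_right \<kappa>) id (tensor_assoc (a \<otimes> y))) = \<kappa> (slice_right \<mu> y) *\<^sub>C a"
proof (rule fun_cong[OF bounded_clinear_tensor_unique[where
        S = "\<lambda>y. slice_right \<mu> (tensor_map (slice_right \<kappa>) id (tensor_assoc (a \<otimes> y)))"
        and T = "\<lambda>y. \<kappa> (slice_right \<mu> y) *\<^sub>C a"]])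
  show "bounded_clinear (\<lambda>y. slice_right \<mu> (tensor_map (slice_right \<kappa>) id (tensor_assoc (a \<otimes> y))))"
    by (rule bounded_clinear_compose[OF bounded_clinear_star_hom[OF
            star_hom_comp[OF slice_right(1)[OF assms(2)] star_hom_comp[OF tensor_map(1)[OF slice_right(1)[OF assms(1)] star_hom_id] tensor_assoc(1)]]]
          bounded_clinear_tensor_right])
  have "(\<lambda>y. \<kappa> (slice_right \<mu> y) *\<^sub>C a) = (\<lambda>y. (\<kappa> (slice_right \<mu> y) *\<^sub>C 1) * a)" by (simp add: mult_scaleC_left)
  moreover have "bounded_clinear (\<lambda>y. (\<kappa> (slice_right \<mu> y) *\<^sub>C 1) * a)"
    by (rule bounded_clinear_compose[OF bounded_clinear_mult_right bounded_clinear_star_hom[OF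
            star_hom_scalar[OF star_hom_comp[OF assms(1) slice_right(1)[OF assms(2)]]]]])
  ultimately show "bounded_clinear (\<lambda>y. \<kappa> (slice_right \<mu> y) *\<^sub>C a)" by (simp only:)
  show "slice_right \<mu> (tensor_map (slice_right \<kappa>) id (tensor_assoc (a \<otimes> (g \<otimes> h)))) = \<kappa> (slice_right \<mu> (g \<otimes> h)) *\<^sub>C a" for g h
    by (simp add: tensor_assoc(2) tensor_map(2)[OF slice_right(1)[OF assms(1)] star_hom_id] slice_right(2)[OF assms(1)]
        slice_right(2)[OF assms(2)] star_homD[OF assms(1)] scaleC_scaleC)
qed

lemma actionD:
  assumes "action \<Delta> \<delta>"
  shows "star_hom \<delta>" "tensor_map \<delta> id (\<delta> a) = tensor_assoc (tensor_map id \<Delta> (\<delta> a))"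
    "cls {\<delta> a * (1 \<otimes> h) |a h. True} = UNIV" "inj \<delta>"
  using assms unfolding action_def by (auto dest: fun_cong[of _ _ a])

lemma compact_quantum_group_action: "compact_quantum_group \<Delta> \<Longrightarrow> action \<Delta> \<Delta>"
  by (simp add: compact_quantum_group_def action_def)

text \<open>The coaction identity read through two slices. For \<delta> equal to \<Delta> it also
  yields associativity of convolution.\<close>

lemma character_action_convolution:
  fixes \<Delta> :: "'h::nonzero_cstar_algebra \<Rightarrow> ('h, 'h) min_tensor"
    and \<delta> :: "'a::nonzero_cstar_algebra \<Rightarrow> ('a, 'h) min_tensor"
  assumes act: "action \<Delta> \<delta>" and \<Delta>: "star_hom \<Delta>" and \<kappa>: "star_hom \<kappa>" and \<mu>: "star_hom \<mu>"
  shows "character_action \<delta> \<kappa> (character_action \<delta> \<mu> a) = character_action \<delta> (convolution \<Delta> \<kappa> \<mu>) a"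
proof -
  note A = actionD[OF act]
  have "character_action \<delta> \<kappa> (character_action \<delta> \<mu> a) = slice_right \<mu> (tensor_map (character_action \<delta> \<kappa>) id (\<delta> a))"
    by (simp add: slice_right_tensor_map star_hom_character_action A(1) \<kappa> \<mu> character_action_def[of \<delta> \<mu>])
  also have "\<dots> = slice_right \<mu> (tensor_map (slice_right \<kappa>) id (tensor_map \<delta> id (\<delta> a)))"
    unfolding tensor_map_comp_left[OF slice_right(1)[OF \<kappa>] A(1)] character_action_def[abs_def] ..
  also have "\<dots> = slice_right \<mu> (tensor_map (slice_right \<kappa>) id (tensor_assoc (tensor_map id \<Delta> (\<delta> a))))"
    unfolding A(2) ..
  also have "\<dots> = slice_right (convolution \<Delta> \<kappa> \<mu>) (\<delta> a)"
  proof (rule star_hom_tensor_eqI[of "\<lambda>x :: ('a, 'h) min_tensor. slice_right \<mu> (tensor_map (slice_right \<kappa>) id (tensor_assoc (tensor_map id \<Delta> x)))"])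
    show "star_hom (\<lambda>x :: ('a, 'h) min_tensor. slice_right \<mu> (tensor_map (slice_right \<kappa>) id (tensor_assoc (tensor_map id \<Delta> x))))"
      by (rule star_hom_comp[OF slice_right(1)[OF \<mu>] star_hom_comp[OF tensor_map(1)[OF slice_right(1)[OF \<kappa>] star_hom_id]
              star_hom_comp[OF tensor_assoc(1) tensor_map(1)[OF star_hom_id \<Delta>]]]])
    show "star_hom (slice_right (convolution \<Delta> \<kappa> \<mu>) :: ('a, 'h) min_tensor \<Rightarrow> 'a)"
      by (rule slice_right(1)[OF star_hom_convolution(1)[OF \<Delta> \<kappa> \<mu>]])
    show "slice_right \<mu> (tensor_map (slice_right \<kappa>) id (tensor_assoc (tensor_map id \<Delta> (a \<otimes> h))))
        = slice_right (convolution \<Delta> \<kappa> \<mu>) (a \<otimes> h)" for a :: 'a and h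
      by (simp add: tensor_map(2)[OF star_hom_id \<Delta>] slice_slice_assoc[OF \<kappa> \<mu>]
          slice_right(2)[OF star_hom_convolution(1)[OF \<Delta> \<kappa> \<mu>]] star_hom_convolution(2)[OF \<Delta> \<kappa> \<mu>] character_action_def)
  qed
  finally show ?thesis by (simp add: character_action_def)
qed

context
  fixes \<Delta> :: "'h::nonzero_cstar_algebra \<Rightarrow> ('h, 'h) min_tensor"
  assumes cqg: "compact_quantum_group \<Delta>"
begin

lemma star_hom_comultiplication: "star_hom \<Delta>"
  using cqg by (simp add: compact_quantum_group_def)

lemma convolution_assoc:
  assumes "star_hom \<kappa>" "star_hom \<mu>" "star_hom \<nu>"
  shows "convolution \<Delta> (convolution \<Delta> \<kappa> \<mu>) \<nu> = convolution \<Delta> \<kappa> (convolution \<Delta> \<mu> \<nu>)"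
  by (rule ext)
    (simp add: star_hom_convolution[OF star_hom_comultiplication] assms
      character_action_convolution[OF compact_quantum_group_action[OF cqg] star_hom_comultiplication])

text \<open>The product of \<kappa> and \<nu> sends \<open>\<Delta> g * (1 \<otimes> h)\<close> to
  \<open>convolution \<Delta> \<kappa> \<nu> g * \<nu> h\<close>, and these elements span densely.
  So \<nu> and the convolution determine the product, and with it \<kappa>.\<close>

lemma convolution_cancel_right:
  assumes \<kappa>: "star_hom \<kappa>" and \<mu>: "star_hom \<mu>" and \<nu>: "star_hom \<nu>"
    and eq: "convolution \<Delta> \<kappa> \<nu> = convolution \<Delta> \<mu> \<nu>"
  shows "\<kappa> = \<mu>"
proof
  fix g
  let ?T = "\<lambda>\<kappa> x. \<kappa> (slice_right \<nu> x)"
  have T: "star_hom (?T \<kappa>)" if "star_hom \<kappa>" for \<kappa> :: "'h \<Rightarrow> complex"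
    by (rule star_hom_comp[OF that slice_right(1)[OF \<nu>]])
  have "?T \<kappa> (\<Delta> g * (1 \<otimes> h)) = ?T \<mu> (\<Delta> g * (1 \<otimes> h))" for g h
  proof -
    have 1: "?T \<kappa>' (\<Delta> g * (1 \<otimes> h)) = convolution \<Delta> \<kappa>' \<nu> g * \<nu> h" if "star_hom \<kappa>'" for \<kappa>'
      using that by (simp add: star_homD(2)[OF T] star_homD(2)[OF slice_right(1)[OF \<nu>]] star_homD[OF that] slice_right(2)[OF \<nu>]
          star_hom_convolution(2)[OF star_hom_comultiplication that \<nu>] character_action_def)
    show ?thesis unfolding 1[OF \<kappa>] 1[OF \<mu>] eq ..
  qed
  moreover have "cls {\<Delta> g * (1 \<otimes> h) |g h. True} = UNIV"
    using cqg by (simp add: compact_quantum_group_def)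
  ultimately have "?T \<kappa> x = ?T \<mu> x" for x
    using star_hom_eq_cls[OF T[OF \<kappa>] T[OF \<mu>]] by blast
  from this[of "g \<otimes> 1"]
  show "\<kappa> g = \<mu> g"
    by (simp add: slice_right(2)[OF \<nu>] star_homD[OF \<nu>] scaleC_one)
qed

lemma convolution_cancel_left:
  assumes \<kappa>: "star_hom \<kappa>" and \<mu>: "star_hom \<mu>" and \<nu>: "star_hom \<nu>"
    and eq: "convolution \<Delta> \<nu> \<kappa> = convolution \<Delta> \<nu> \<mu>"
  shows "\<kappa> = \<mu>"
proof
  fix g
  let ?T = "\<lambda>\<kappa> x. \<nu> (slice_right \<kappa> x)"
  have T: "star_hom (?T \<kappa>)" if "star_hom \<kappa>" for \<kappa> :: "'h \<Rightarrow> complex"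
    by (rule star_hom_comp[OF \<nu> slice_right(1)[OF that]])
  have "?T \<kappa> ((h \<otimes> 1) * \<Delta> g) = ?T \<mu> ((h \<otimes> 1) * \<Delta> g)" for g h
  proof -
    have 1: "?T \<kappa>' ((h \<otimes> 1) * \<Delta> g) = \<nu> h * convolution \<Delta> \<nu> \<kappa>' g" if "star_hom \<kappa>'" for \<kappa>'
      by (simp add: star_homD(2)[OF slice_right(1)[OF that]] star_homD[OF \<nu>] slice_right(2)[OF that] star_homD(4)[OF that]
          scaleC_one star_hom_convolution(2)[OF star_hom_comultiplication \<nu> that] character_action_def)
    show ?thesis unfolding 1[OF \<kappa>] 1[OF \<mu>] eq ..
  qed
  moreover have "cls {(g \<otimes> 1) * \<Delta> h |g h. True} = UNIV"
    using cqg by (simp add: compact_quantum_group_def)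
  ultimately have "?T \<kappa> x = ?T \<mu> x" for x
    using star_hom_eq_cls[OF T[OF \<kappa>] T[OF \<mu>]] by blast
  from this[of "1 \<otimes> g"]
  show "\<kappa> g = \<mu> g"
    by (simp add: slice_right(2)[OF \<kappa>] slice_right(2)[OF \<mu>] star_homD[OF \<nu>])
qed

end

section \<open>The compact semigroup of characters\<close>

lemma closed_characters: "closed {\<kappa> :: 'h::cstar_algebra \<Rightarrow> complex. star_hom \<kappa>}"
proof -
  have c: "continuous_on UNIV (\<lambda>\<kappa> :: 'h \<Rightarrow> complex. \<kappa> g)" for g by simp
  have "{\<kappa> :: 'h \<Rightarrow> complex. star_hom \<kappa>} =
      (\<Inter>x. \<Inter>y. {\<kappa>. \<kappa> (x + y) = \<kappa> x + \<kappa> y}) \<inter> (\<Inter>c. \<Inter>x. {\<kappa>. \<kappa> (c *\<^sub>C x) = c * \<kappa> x}) \<inter>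
      (\<Inter>x. \<Inter>y. {\<kappa>. \<kappa> (x * y) = \<kappa> x * \<kappa> y}) \<inter> (\<Inter>x. {\<kappa>. \<kappa> (star x) = cnj (\<kappa> x)}) \<inter> {\<kappa>. \<kappa> 1 = 1}"
    by (auto simp: star_hom_def clinear_def)
  then show ?thesis
    by (simp only:) (intro closed_Int closed_INT ballI closed_Collect_eq continuous_intros c)
qed

text \<open>The Banach-Alaoglu argument: characters are contractive, so they form a closed subset of
  a product of discs.\<close>

lemma compact_characters: "compact {\<kappa> :: 'h::cstar_algebra \<Rightarrow> complex. star_hom \<kappa>}"
proof -
  have "compactin (product_topology (\<lambda>_ :: 'h. euclidean) UNIV) (PiE UNIV (\<lambda>g. cball (0 :: complex) (norm g)))"
    unfolding compactin_PiE by simp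
  then have "compact (PiE UNIV (\<lambda>g :: 'h. cball (0 :: complex) (norm g)))"
    by (simp add: euclidean_product_topology)
  moreover have "{\<kappa> :: 'h \<Rightarrow> complex. star_hom \<kappa>} \<subseteq> PiE UNIV (\<lambda>g. cball 0 (norm g))"
    using norm_star_hom_le by (auto simp: PiE_def)
  ultimately show ?thesis
    using closed_characters by (metis compact_Int_closed inf.absorb_iff2)
qed

lemma compact_imp_closed_fun:
  fixes K :: "('i \<Rightarrow> complex) set"
  assumes "compact K"
  shows "closed K"
proof -
  have "Hausdorff_space (product_topology (\<lambda>_ :: 'i. euclidean :: complex topology) UNIV)"
    unfolding Hausdorff_space_product_topology by simp
  then have "Hausdorff_space (euclidean :: ('i \<Rightarrow> complex) topology)"
    by (simp only: euclidean_product_topology)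
  from compactin_imp_closedin[OF this, of K] assms show ?thesis by simp
qed

text \<open>Ellis' lemma, with the last step shortened by cancellation: a minimal closed subsemigroup \<open>M\<close> satisfies
  \<open>M e = M\<close> for each \<open>e\<close> in \<open>M\<close>, so \<open>y e = e\<close> for some \<open>y\<close>, and then \<open>y y e = y e\<close>.\<close>

lemma ex_idempotent_character:
  fixes \<Delta> :: "'h::nonzero_cstar_algebra \<Rightarrow> ('h, 'h) min_tensor"
  assumes cqg: "compact_quantum_group \<Delta>" and \<kappa>: "star_hom (\<kappa> :: 'h \<Rightarrow> complex)"
  shows "\<exists>\<epsilon>. star_hom \<epsilon> \<and> convolution \<Delta> \<epsilon> \<epsilon> = \<epsilon>"
proof -
  let ?X = "{\<kappa> :: 'h \<Rightarrow> complex. star_hom \<kappa>}" and ?c = "convolution \<Delta>"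
  note \<Delta> = star_hom_comultiplication[OF cqg]
  note conv = star_hom_convolution[OF \<Delta>]
  define \<S> where "\<S> = {M. M \<noteq> {} \<and> closed M \<and> M \<subseteq> ?X \<and> (\<forall>x\<in>M. \<forall>y\<in>M. ?c x y \<in> M)}"
  have X: "?X \<in> \<S>" using \<kappa> closed_characters by (auto simp: \<S>_def conv)
  have po: "partial_order_on \<S> (relation_of (\<lambda>M N. N \<subseteq> M) \<S>)"
    by (rule partial_order_on_relation_ofI) auto
  have "\<exists>u\<in>\<S>. \<forall>M\<in>C. u \<subseteq> M" if C: "C \<in> Chains (relation_of (\<lambda>M N. N \<subseteq> M) \<S>)" for C
  proof (cases "C = {}")
    case False
    have CS: "M \<in> \<S>" if "M \<in> C" for M using C that by (auto simp: Chains_def relation_of_def)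
    have chain: "M \<subseteq> N \<or> N \<subseteq> M" if "M \<in> C" "N \<in> C" for M N
      using C that by (auto simp: Chains_def relation_of_def)
    have "?X \<inter> \<Inter>C \<noteq> {}"
    proof (rule compact_imp_fip[OF compact_characters])
      show "closed M" if "M \<in> C" for M using CS[OF that] by (simp add: \<S>_def)
      fix F assume "finite F" "F \<subseteq> C"
      have "\<exists>M\<in>\<S>. \<forall>N\<in>F. M \<subseteq> N"
      proof (cases "F = {}")
        case False
        then obtain M where M: "M \<in> F" "\<forall>N\<in>F. N \<subseteq> M \<longrightarrow> M = N"
          using finite_has_minimal[OF \<open>finite F\<close>] by blast
        then have "\<forall>N\<in>F. M \<subseteq> N" using chain \<open>F \<subseteq> C\<close> by blast
        with M(1) show ?thesis using CS \<open>F \<subseteq> C\<close> by blast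
      qed (use X in blast)
      then obtain M where "M \<in> \<S>" "\<forall>N\<in>F. M \<subseteq> N" by blast
      then show "?X \<inter> \<Inter>F \<noteq> {}" unfolding \<S>_def by blast
    qed
    moreover have "closed (\<Inter>C)" by (rule closed_Inter) (use CS in \<open>auto simp: \<S>_def\<close>)
    moreover obtain M0 where "M0 \<in> C" using False by blast
    then have "\<Inter>C \<subseteq> ?X" using CS[of M0] by (auto simp: \<S>_def)
    moreover have "?c x y \<in> \<Inter>C" if "x \<in> \<Inter>C" "y \<in> \<Inter>C" for x y
      using CS that by (auto simp: \<S>_def)
    ultimately have "\<Inter>C \<in> \<S>" unfolding \<S>_def by blast
    then show ?thesis by blast
  qed (use X in auto)
  from predicate_Zorn[OF po this] obtain M where M: "M \<in> \<S>" "\<And>N. N \<in> \<S> \<Longrightarrow> N \<subseteq> M \<Longrightarrow> N = M" by blast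
  then obtain e where e: "e \<in> M" by (auto simp: \<S>_def)
  have MX: "star_hom x" if "x \<in> M" for x using M(1) that by (auto simp: \<S>_def)
  have Mc: "?c x y \<in> M" if "x \<in> M" "y \<in> M" for x y using M(1) that by (simp add: \<S>_def)
  let ?N = "(\<lambda>x. ?c x e) ` M"
  \<comment> \<open>Right translation by \<open>e\<close> evaluates \<open>x\<close> at elements
    that do not depend on \<open>x\<close>. It is therefore continuous for pointwise convergence,
    and its image is compact.\<close>
  have "?N = (\<lambda>x g. x (character_action \<Delta> e g)) ` M"
    using conv(2)[OF MX MX[OF e]] by (intro image_cong) auto
  moreover have "compact M"
  proof -
    have "closed M" "?X \<inter> M = M" using M(1) by (auto simp: \<S>_def)
    then show ?thesis using compact_Int_closed[OF compact_characters] by metis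
  qed
  moreover have "continuous_on M (\<lambda>x g. x (character_action \<Delta> e g))"
    by (intro continuous_on_coordinatewise_then_product continuous_on_subset[OF continuous_on_product_coordinates]) simp
  ultimately have "closed ?N" by (metis compact_continuous_image compact_imp_closed_fun)
  moreover have "?c (?c x e) (?c y e) = ?c (?c (?c x e) y) e" if "x \<in> M" "y \<in> M" for x y
    using convolution_assoc[OF cqg conv(1)[OF MX[OF that(1)] MX[OF e]] MX[OF that(2)] MX[OF e]] by simp
  ultimately have "?N \<in> \<S>" using e MX Mc by (auto simp: \<S>_def)
  then have "?N = M" using M(2) Mc e by blast
  then obtain y where y: "y \<in> M" "?c y e = e" using e by (metis imageE)
  have "?c (?c y y) e = ?c y e"
    using convolution_assoc[OF cqg MX[OF y(1)] MX[OF y(1)] MX[OF e]] y(2) by simp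
  then have "?c y y = y"
    using convolution_cancel_right[OF cqg MX[OF Mc[OF y(1) y(1)]] MX[OF y(1)] MX[OF e]] by blast
  with MX[OF y(1)] show ?thesis by blast
qed

text \<open>In a cancellative semigroup an idempotent is neutral: cancel one \<epsilon> in the
  equality of \<epsilon> \<epsilon> \<mu> and \<epsilon> \<mu>, and similarly on the right.\<close>

theorem counit:
  fixes \<Delta> :: "'h::nonzero_cstar_algebra \<Rightarrow> ('h, 'h) min_tensor"
  assumes cqg: "compact_quantum_group \<Delta>" and \<kappa>: "star_hom (\<kappa> :: 'h \<Rightarrow> complex)"
  shows "star_hom (counit \<Delta>)"
    "star_hom \<mu> \<Longrightarrow> convolution \<Delta> (counit \<Delta>) \<mu> = \<mu>" "star_hom \<mu> \<Longrightarrow> convolution \<Delta> \<mu> (counit \<Delta>) = \<mu>"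
proof -
  note \<Delta> = star_hom_comultiplication[OF cqg]
  obtain \<epsilon> where \<epsilon>: "star_hom \<epsilon>" "convolution \<Delta> \<epsilon> \<epsilon> = \<epsilon>" using ex_idempotent_character[OF cqg \<kappa>] by blast
  have l: "convolution \<Delta> \<epsilon> \<mu> = \<mu>" if "star_hom \<mu>" for \<mu>
    using convolution_cancel_left[OF cqg star_hom_convolution(1)[OF \<Delta> \<epsilon>(1) that] that \<epsilon>(1)]
      convolution_assoc[OF cqg \<epsilon>(1) \<epsilon>(1) that] \<epsilon>(2) by simp
  have r: "convolution \<Delta> \<mu> \<epsilon> = \<mu>" if "star_hom \<mu>" for \<mu>
    using convolution_cancel_right[OF cqg star_hom_convolution(1)[OF \<Delta> that \<epsilon>(1)] that \<epsilon>(1)]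
      convolution_assoc[OF cqg that \<epsilon>(1) \<epsilon>(1)] \<epsilon>(2) by simp
  have "counit \<Delta> = \<epsilon>"
    unfolding counit_def character_def
  proof (rule the_equality)
    show "star_hom \<epsilon> \<and> (\<forall>\<kappa>. star_hom \<kappa> \<longrightarrow> convolution \<Delta> \<epsilon> \<kappa> = \<kappa> \<and> convolution \<Delta> \<kappa> \<epsilon> = \<kappa>)"
      using \<epsilon> l r by blast
    show "\<epsilon>' = \<epsilon>" if "star_hom \<epsilon>' \<and> (\<forall>\<kappa>. star_hom \<kappa> \<longrightarrow> convolution \<Delta> \<epsilon>' \<kappa> = \<kappa> \<and> convolution \<Delta> \<kappa> \<epsilon>' = \<kappa>)" for \<epsilon>'
      using that \<epsilon>(1) r by metis
  qed
  then show "star_hom (counit \<Delta>)"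
    "star_hom \<mu> \<Longrightarrow> convolution \<Delta> (counit \<Delta>) \<mu> = \<mu>" "star_hom \<mu> \<Longrightarrow> convolution \<Delta> \<mu> (counit \<Delta>) = \<mu>"
    using \<epsilon> l r by simp_all
qed

text \<open>The action \<open>F\<close> of the counit is idempotent, so it fixes its range. The
  slice of \<open>\<delta> a * (1 \<otimes> h)\<close> is a multiple of \<open>F a\<close>; by
  density all slices are fixed, and every element is the slice of
  \<open>a \<otimes> 1\<close>.\<close>

lemma character_action_counit:
  fixes \<Delta> :: "'h::nonzero_cstar_algebra \<Rightarrow> ('h, 'h) min_tensor"
    and \<delta> :: "'a::nonzero_cstar_algebra \<Rightarrow> ('a, 'h) min_tensor"
  assumes cqg: "compact_quantum_group \<Delta>" and act: "action \<Delta> \<delta>" and \<kappa>: "star_hom (\<kappa> :: 'h \<Rightarrow> complex)"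
  shows "character_action \<delta> (counit \<Delta>) a = a"
proof -
  note A = actionD[OF act] and \<epsilon> = counit(1)[OF cqg \<kappa>]
  let ?F = "character_action \<delta> (counit \<Delta>)" and ?s = "slice_right (counit \<Delta>)"
  have F: "star_hom ?F" by (rule star_hom_character_action[OF A(1) \<epsilon>])
  have FF: "?F (?F a) = ?F a" for a
    using character_action_convolution[OF act star_hom_comultiplication[OF cqg] \<epsilon> \<epsilon>] counit(2)[OF cqg \<kappa> \<epsilon>] by simp
  have "?F (?s y) = ?s y" for y
  proof (rule star_hom_eq_cls[OF star_hom_comp[OF F slice_right(1)[OF \<epsilon>]] slice_right(1)[OF \<epsilon>] A(3)])
    fix x assume "x \<in> {\<delta> a * (1 \<otimes> h) |a h. True}"
    then obtain a h where x: "x = \<delta> a * (1 \<otimes> h)" by blast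
    have "?s x = counit \<Delta> h *\<^sub>C ?F a"
      by (simp add: x star_homD(2)[OF slice_right(1)[OF \<epsilon>]] slice_right(2)[OF \<epsilon>] mult_scaleC_right character_action_def)
    then show "?F (?s x) = ?s x" by (simp add: star_homD(7)[OF F] FF)
  qed
  from this[of "a \<otimes> 1"] show ?thesis by (simp add: slice_right(2)[OF \<epsilon>] star_homD(4)[OF \<epsilon>] scaleC_one)
qed

section \<open>Maps into the join and into the cone\<close>

lemma scaleC_one_inject: "c *\<^sub>C (1 :: 'a::nonzero_cstar_algebra) = d *\<^sub>C 1 \<longleftrightarrow> c = d"
proof
  assume "c *\<^sub>C (1 :: 'a) = d *\<^sub>C 1"
  then have "(c - d) *\<^sub>C (1 :: 'a) = 0"
    using scaleC_add_left[of "c - d" d "1 :: 'a"] by simp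
  then show "c = d" using norm_scaleC[of "c - d" "1 :: 'a"] by simp
qed simp

lemma ex_character_if_scalar:
  fixes f :: "'a::star_algebra \<Rightarrow> 'b::nonzero_cstar_algebra"
  assumes f: "star_hom f" "\<And>a. f a \<in> range (\<lambda>c. c *\<^sub>C 1)"
  shows "\<exists>\<kappa>. star_hom \<kappa> \<and> (\<forall>a. f a = \<kappa> a *\<^sub>C 1)"
proof -
  have "\<forall>a. \<exists>c. f a = c *\<^sub>C 1" using f(2) by blast
  then obtain \<kappa> where \<kappa>: "\<And>a. f a = \<kappa> a *\<^sub>C 1" by metis
  note F = star_homD[OF f(1)]
  have "star_hom \<kappa>"
    unfolding star_hom_def clinear_def
  proof (intro conjI allI)
    show "\<kappa> (x + y) = \<kappa> x + \<kappa> y" for x y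
      using F(5)[of x y] by (simp add: \<kappa> scaleC_one_inject flip: scaleC_add_left)
    show "\<kappa> (c *\<^sub>C x) = c *\<^sub>C \<kappa> x" for c x
      using F(7)[of c x] by (simp add: \<kappa> scaleC_one_inject scaleC_scaleC)
    show "\<kappa> (x * y) = \<kappa> x * \<kappa> y" for x y
      using F(2)[of x y] by (simp add: \<kappa> scaleC_one_inject scaleC_scaleC mult_scaleC_left mult_scaleC_right mult.commute)
    show "\<kappa> (star x) = star (\<kappa> x)" for x
      using F(3)[of x] by (simp add: \<kappa> scaleC_one_inject star_scaleC star_one)
    have "\<kappa> 1 *\<^sub>C (1 :: 'b) = 1 *\<^sub>C 1" using F(4) by (simp only: \<kappa> scaleC_one)
    then show "\<kappa> 1 = 1" by (simp only: scaleC_one_inject)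
  qed
  with \<kappa> show ?thesis by blast
qed

lemma tensor_assoc_natural:
  fixes g :: "'a::cstar_algebra \<Rightarrow> 'b::cstar_algebra" and y :: "('h::cstar_algebra, 'k::cstar_algebra) min_tensor"
  assumes g: "star_hom g"
  shows "tensor_assoc (g a \<otimes> y) = tensor_map (tensor_map g id) id (tensor_assoc (a \<otimes> y))"
proof (rule fun_cong[OF bounded_clinear_tensor_unique[where S = "\<lambda>y. tensor_assoc (g a \<otimes> y)"
        and T = "\<lambda>y. tensor_map (tensor_map g id) id (tensor_assoc (a \<otimes> y))"]])
  show "bounded_clinear (\<lambda>y :: ('h, 'k) min_tensor. tensor_assoc (g a \<otimes> y))"
    by (rule bounded_clinear_compose[OF bounded_clinear_star_hom[OF tensor_assoc(1)] bounded_clinear_tensor_right])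
  show "bounded_clinear (\<lambda>y :: ('h, 'k) min_tensor. tensor_map (tensor_map g id) id (tensor_assoc (a \<otimes> y)))"
    by (rule bounded_clinear_compose[OF bounded_clinear_star_hom[OF star_hom_comp[OF
            tensor_map(1)[OF tensor_map(1)[OF g star_hom_id] star_hom_id] tensor_assoc(1)]] bounded_clinear_tensor_right])
  show "tensor_assoc (g a \<otimes> (h \<otimes> k)) = tensor_map (tensor_map g id) id (tensor_assoc (a \<otimes> (h \<otimes> k)))" for h :: 'h and k :: 'k
    by (simp add: tensor_assoc(2) tensor_map(2)[OF tensor_map(1)[OF g star_hom_id] star_hom_id] tensor_map(2)[OF g star_hom_id])
qed

lemma tensor_map_id: "tensor_map id id x = x"
  by (rule star_hom_tensor_eqI[of _ "\<lambda>x. x", OF tensor_map(1)[OF star_hom_id star_hom_id] star_hom_ident])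
    (simp add: tensor_map(2)[OF star_hom_id star_hom_id])

text \<open>Evaluating at each \<open>t\<close> removes the identification
  \<open>path_tensor\<close> and leaves identities in the threefold tensor product.\<close>

lemma join_equivariant_iff:
  fixes \<Delta> :: "'h::cstar_algebra \<Rightarrow> ('h, 'h) min_tensor" and \<delta> :: "'a::cstar_algebra \<Rightarrow> ('a, 'h) min_tensor"
  assumes "star_hom \<Delta>" "star_hom f"
  shows "join_equivariant \<Delta> \<delta> f \<longleftrightarrow> (\<forall>a t. tensor_assoc (tensor_map id \<Delta> (apply_bcontfun (f a) t))
    = tensor_map (\<lambda>a. apply_bcontfun (f a) t) id (\<delta> a))"
proof -
  have "apply_bcontfun (path_tensor (tensor_map f id (\<delta> a))) t = tensor_map (\<lambda>a. apply_bcontfun (f a) t) id (\<delta> a)" for a t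
    by (simp only: path_tensor tensor_map_comp_left[OF star_hom_apply_bcontfun assms(2)])
  moreover have "F = G \<longleftrightarrow> (\<forall>t. apply_bcontfun F t = apply_bcontfun G t)"
    for F G :: "unit_interval \<Rightarrow>\<^sub>C (('a, 'h) min_tensor, 'h) min_tensor"
    by (auto intro: bcontfun_eqI)
  ultimately show ?thesis
    unfolding join_equivariant_def fun_eq_iff o_apply by (simp add: join_coaction_apply[OF assms(1)])
qed

context
  fixes \<Delta> :: "'h::nonzero_cstar_algebra \<Rightarrow> ('h, 'h) min_tensor"
    and \<delta> :: "'a::nonzero_cstar_algebra \<Rightarrow> ('a, 'h) min_tensor"
  assumes cqg: "compact_quantum_group \<Delta>" and act: "action \<Delta> \<delta>"
begin

text \<open>At 0 the map \<gamma> is a character times 1, and at 1 it is colinear; these facts give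
  the two endpoint conditions of the join. Equivariance is the coaction identity for \<delta> with
  \<gamma> applied to the first leg.\<close>

lemma ex_join_map_if_cone_map:
  fixes \<gamma> :: "'a \<Rightarrow> (unit_interval \<Rightarrow>\<^sub>C 'a)"
  assumes \<gamma>: "star_hom \<gamma>" "range \<gamma> \<subseteq> nc_cone" "equivariant \<delta> \<delta> (\<lambda>a. \<gamma> a 1)"
  shows "\<exists>f. star_hom f \<and> range f \<subseteq> nc_join \<delta> \<and> join_equivariant \<Delta> \<delta> f"
proof -
  note \<Delta> = star_hom_comultiplication[OF cqg] and A = actionD[OF act]
  define f where "f a = path_tensor (tensor_map \<gamma> id (\<delta> a))" for a
  have f: "star_hom f"
    unfolding f_def by (rule star_hom_comp[OF star_hom_path_tensor star_hom_comp[OF tensor_map(1)[OF \<gamma>(1) star_hom_id] A(1)]])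
  have \<gamma>t: "star_hom (\<lambda>a. \<gamma> a t)" for t by (rule star_hom_apply_bcontfun_comp[OF \<gamma>(1)])
  have ft: "f a t = tensor_map (\<lambda>a. \<gamma> a t) id (\<delta> a)" for a t
    unfolding f_def path_tensor by (rule tensor_map_comp_left[OF star_hom_apply_bcontfun \<gamma>(1)])
  have "\<gamma> a 0 \<in> range (\<lambda>c. c *\<^sub>C 1)" for a using \<gamma>(2) unfolding nc_cone_def by blast
  then obtain \<mu> where \<mu>: "star_hom \<mu>" "\<And>a. \<gamma> a 0 = \<mu> a *\<^sub>C 1" using ex_character_if_scalar[OF \<gamma>t] by blast
  have "tensor_map (\<lambda>a. \<gamma> a 0) id x = 1 \<otimes> slice_left \<mu> x" for x :: "('a, 'h) min_tensor"
    by (rule star_hom_tensor_eqI[OF tensor_map(1)[OF \<gamma>t star_hom_id] star_hom_comp[OF star_hom_tensor_right slice_left(1)[OF \<mu>(1)]]])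
      (simp only: tensor_map(2)[OF \<gamma>t star_hom_id], simp only: slice_left(2)[OF \<mu>(1)] \<mu>(2) tensor_scaleC_left tensor_scaleC_right id_apply)
  moreover have "tensor_map (\<lambda>a. \<gamma> a 1) id (\<delta> a) = \<delta> (\<gamma> a 1)" for a
    using \<gamma>(3) unfolding equivariant_def by (metis o_apply)
  ultimately have "range f \<subseteq> nc_join \<delta>" by (auto simp: nc_join_def ft)
  moreover have "join_equivariant \<Delta> \<delta> f"
    unfolding join_equivariant_iff[OF \<Delta> f] ft
  proof (intro allI)
    fix a t
    let ?g = "\<lambda>a. \<gamma> a t"
    have "tensor_assoc (tensor_map id \<Delta> (tensor_map ?g id x)) = tensor_map (tensor_map ?g id) id (tensor_assoc (tensor_map id \<Delta> x))"
      for x :: "('a, 'h) min_tensor"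
    proof (rule star_hom_tensor_eqI[of "\<lambda>x :: ('a, 'h) min_tensor. tensor_assoc (tensor_map id \<Delta> (tensor_map ?g id x))"
          "\<lambda>x :: ('a, 'h) min_tensor. tensor_map (tensor_map ?g id) id (tensor_assoc (tensor_map id \<Delta> x))"])
      show "star_hom (\<lambda>x :: ('a, 'h) min_tensor. tensor_assoc (tensor_map id \<Delta> (tensor_map ?g id x)))"
        by (rule star_hom_comp[OF tensor_assoc(1) star_hom_comp[OF tensor_map(1)[OF star_hom_id \<Delta>] tensor_map(1)[OF \<gamma>t star_hom_id]]])
      show "star_hom (\<lambda>x :: ('a, 'h) min_tensor. tensor_map (tensor_map ?g id) id (tensor_assoc (tensor_map id \<Delta> x)))"
        by (rule star_hom_comp[OF tensor_map(1)[OF tensor_map(1)[OF \<gamma>t star_hom_id] star_hom_id]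
              star_hom_comp[OF tensor_assoc(1) tensor_map(1)[OF star_hom_id \<Delta>]]])
      show "tensor_assoc (tensor_map id \<Delta> (tensor_map ?g id (b \<otimes> h)))
          = tensor_map (tensor_map ?g id) id (tensor_assoc (tensor_map id \<Delta> (b \<otimes> h)))" for b :: 'a and h :: 'h
        by (simp only: tensor_map(2)[OF star_hom_id \<Delta>] tensor_map(2)[OF \<gamma>t star_hom_id] id_apply
            tensor_assoc_natural[OF \<gamma>t])
    qed
    then have "tensor_assoc (tensor_map id \<Delta> (tensor_map ?g id (\<delta> a))) = tensor_map (tensor_map ?g id) id (tensor_map \<delta> id (\<delta> a))"
      by (simp only: A(2))
    also have "\<dots> = tensor_map (\<lambda>a. tensor_map ?g id (\<delta> a)) id (\<delta> a)"
      by (rule tensor_map_comp_left[OF tensor_map(1)[OF \<gamma>t star_hom_id] A(1)])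
    finally show "tensor_assoc (tensor_map id \<Delta> (tensor_map ?g id (\<delta> a))) = tensor_map (\<lambda>a. tensor_map ?g id (\<delta> a)) id (\<delta> a)" .
  qed
  ultimately show ?thesis using f by blast
qed

text \<open>At time 1 the values of \<open>f\<close> have the form \<open>\<delta> b\<close>, and
  the counit recovers \<open>b\<close>. Slicing the middle leg of the equivariance identity at that
  time gives colinearity.\<close>

lemma ex_cone_map_if_join_map:
  fixes f :: "'a \<Rightarrow> (unit_interval \<Rightarrow>\<^sub>C ('a, 'h) min_tensor)"
  assumes \<kappa>: "star_hom (\<kappa> :: 'h \<Rightarrow> complex)"
    and f: "star_hom f" "range f \<subseteq> nc_join \<delta>" "join_equivariant \<Delta> \<delta> f"
  shows "\<exists>\<gamma>. star_hom \<gamma> \<and> range \<gamma> \<subseteq> nc_cone \<and> equivariant \<delta> \<delta> (\<lambda>a. apply_bcontfun (\<gamma> a) 1)"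
proof -
  note \<Delta> = star_hom_comultiplication[OF cqg] and A = actionD[OF act] and \<epsilon> = counit(1)[OF cqg \<kappa>]
  let ?s = "slice_right (counit \<Delta>) :: ('a, 'h) min_tensor \<Rightarrow> 'a"
  have s: "star_hom ?s" by (rule slice_right(1)[OF \<epsilon>])
  define \<gamma> where "\<gamma> a = Bcontfun (\<lambda>t. ?s (f a t))" for a
  have "bounded_linear ?s" using bounded_clinear_star_hom[OF s] by (simp add: bounded_clinear_def)
  then have \<gamma>: "apply_bcontfun (\<gamma> a) t = ?s (f a t)" for a t
    unfolding \<gamma>_def by (simp add: Bcontfun_inverse[OF bounded_linear_bcontfun])
  have ft: "star_hom (\<lambda>a. f a t)" for t by (rule star_hom_apply_bcontfun_comp[OF f(1)])
  have "star_hom \<gamma>" by (rule bcontfun_star_homI) (simp add: \<gamma> star_hom_comp[OF s ft])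
  moreover have "\<gamma> a \<in> nc_cone" for a
  proof -
    obtain h where "f a 0 = 1 \<otimes> h" using f(2) unfolding nc_join_def by blast
    then show ?thesis by (simp add: nc_cone_def \<gamma> slice_right(2)[OF \<epsilon>])
  qed
  moreover have "\<delta> (\<gamma> a 1) = tensor_map (\<lambda>a. \<gamma> a 1) id (\<delta> a)" for a
  proof -
    obtain b where b: "f a 1 = \<delta> b" using f(2) unfolding nc_join_def by blast
    have s\<delta>: "?s (\<delta> b) = b" for b
      using character_action_counit[OF cqg act \<kappa>] by (simp add: character_action_def)
    have "tensor_map (\<lambda>a. \<gamma> a 1) id (\<delta> a) = tensor_map ?s id (tensor_map (\<lambda>a. f a 1) id (\<delta> a))"
      unfolding \<gamma> by (rule tensor_map_comp_left[OF s ft, symmetric])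
    also have "tensor_map (\<lambda>a. f a 1) id (\<delta> a) = tensor_map \<delta> id (\<delta> b)"
      using f(3) unfolding join_equivariant_iff[OF \<Delta> f(1)] A(2) by (metis b)
    also have "tensor_map ?s id \<dots> = tensor_map id id (\<delta> b)"
      unfolding tensor_map_comp_left[OF s A(1)] by (simp add: s\<delta> id_def)
    also have "\<dots> = \<delta> (\<gamma> a 1)" by (simp add: tensor_map_id \<gamma> b s\<delta>)
    finally show ?thesis ..
  qed
  ultimately show ?thesis by (auto simp: equivariant_def fun_eq_iff)
qed

end

section \<open>Separation of orbits by freeness\<close>

lemma ex_separating_element:
  fixes \<epsilon> :: "'h::cstar_algebra \<Rightarrow> complex"
  assumes \<epsilon>: "star_hom \<epsilon>" and S: "finite S" "\<And>\<kappa>. \<kappa> \<in> S \<Longrightarrow> star_hom \<kappa> \<and> \<kappa> \<noteq> \<epsilon>"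
  shows "\<exists>h. \<epsilon> h = 1 \<and> (\<forall>\<kappa>\<in>S. \<kappa> h = 0)"
  using S
proof (induction S rule: finite_induct)
  case empty
  show ?case using star_homD(4)[OF \<epsilon>] by auto
next
  case (insert \<kappa> S)
  then obtain h where h: "\<epsilon> h = 1" "\<And>\<mu>. \<mu> \<in> S \<Longrightarrow> \<mu> h = 0" by auto
  have \<kappa>: "star_hom \<kappa>" "\<kappa> \<noteq> \<epsilon>" using insert.prems by auto
  obtain g where g: "\<kappa> g \<noteq> \<epsilon> g" using \<kappa>(2) by blast
  \<comment> \<open>Normalized to be 1 under \<epsilon> and 0 under \<kappa>; by multiplicativity
    such elements can be multiplied together.\<close>
  define g' where "g' = (1 / (\<epsilon> g - \<kappa> g)) *\<^sub>C (g - \<kappa> g *\<^sub>C 1)"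
  have "\<epsilon> g' = 1" "\<kappa> g' = 0"
    using g by (simp_all add: g'_def star_homD[OF \<epsilon>] star_homD[OF \<kappa>(1)])
  moreover have "\<mu> (g' * h) = 0" if "\<mu> \<in> S" for \<mu>
    using h(2)[OF that] insert.prems that by (simp add: star_homD(2))
  ultimately show ?case
    using h(1) by (intro exI[of _ "g' * h"]) (auto simp: star_homD(2)[OF \<epsilon>] star_homD(2)[OF \<kappa>(1)])
qed

lemma ex_free_sum:
  fixes \<delta> :: "'a::cstar_algebra \<Rightarrow> ('a, 'h::cstar_algebra) min_tensor"
  assumes \<delta>: "star_hom \<delta>" and free: "cls {(x \<otimes> 1) * \<delta> y |x y. True} = UNIV" and e: "e > 0"
  shows "\<exists>L. norm (z - (\<Sum>(x, y)\<leftarrow>L. (x \<otimes> 1) * \<delta> y)) < e"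
proof -
  let ?P = "\<lambda>w. \<exists>L. w = (\<Sum>(x, y)\<leftarrow>L. (x \<otimes> 1) * \<delta> y)"
  have span: "?P w" if "w \<in> span {c *\<^sub>C v |c v. v \<in> {(x \<otimes> 1) * \<delta> y |x y. True}}" for w
    using that
  proof (rule span_induct)
    have zero: "?P 0" by (rule exI[of _ "[]"]) simp
    have add: "?P (v + w)" if "?P v" "?P w" for v w
    proof -
      from that obtain L L' where "v = (\<Sum>(x, y)\<leftarrow>L. (x \<otimes> 1) * \<delta> y)" "w = (\<Sum>(x, y)\<leftarrow>L'. (x \<otimes> 1) * \<delta> y)" by blast
      then show ?thesis by (intro exI[of _ "L @ L'"]) simp
    qed
    have scale: "?P (r *\<^sub>R v)" if "?P v" for r v
    proof -
      from that obtain L where L: "v = (\<Sum>(x, y)\<leftarrow>L. (x \<otimes> 1) * \<delta> y)" by blast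
      have "r *\<^sub>R (\<Sum>(x, y)\<leftarrow>L. (x \<otimes> 1) * \<delta> y) = (\<Sum>(x, y)\<leftarrow>map (\<lambda>(x, y). (complex_of_real r *\<^sub>C x, y)) L. (x \<otimes> 1) * \<delta> y)"
        by (induction L)
          (auto simp: tensor_scaleC_left[of "complex_of_real r", unfolded scaleC_of_real] mult_scaleR_left scaleR_right_distrib scaleC_of_real)
      then show ?thesis unfolding L by blast
    qed
    show "subspace (Collect ?P)" using zero add scale unfolding subspace_def by blast
    show "?P w" if "w \<in> {c *\<^sub>C v |c v. v \<in> {(x \<otimes> 1) * \<delta> y |x y. True}}" for w
    proof -
      from that obtain c x y where "w = c *\<^sub>C ((x \<otimes> 1) * \<delta> y)" by blast
      then show ?thesis by (intro exI[of _ "[(c *\<^sub>C x, y)]"]) (simp add: tensor_scaleC_left mult_scaleC_left)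
    qed
  qed
  have "z \<in> closure (span {c *\<^sub>C v |c v. v \<in> {(x \<otimes> 1) * \<delta> y |x y. True}})"
    using free unfolding cls_def by blast
  then obtain w where "w \<in> span {c *\<^sub>C v |c v. v \<in> {(x \<otimes> 1) * \<delta> y |x y. True}}" "dist w z < e"
    using e unfolding closure_approachable by blast
  with span[OF this(1)] show ?thesis by (auto simp: dist_norm norm_minus_commute)
qed

section \<open>Characters of finite order\<close>

lemma star_hom_complex_dist_le:
  assumes "star_hom (x :: 'a::cstar_algebra \<Rightarrow> complex)"
  shows "dist (x a) (x b) \<le> dist a b"
  using norm_star_hom_le[OF assms, of "a - b"] by (simp add: star_homD[OF assms] dist_norm)

text \<open>Reversed because the homotopy below starts with evaluation at 1 and ends with evaluation
  at 0.\<close>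

lemma continuous_on_reversed_path:
  fixes f :: "unit_interval \<Rightarrow>\<^sub>C 'a::cstar_algebra"
  shows "continuous_on {0..1} (\<lambda>t. apply_bcontfun f (Abs_unit_interval (1 - t)))"
proof -
  have "continuous_on {0..1} (\<lambda>t :: real. Abs_unit_interval (1 - t))"
    unfolding continuous_on_iff
    by (auto simp: dist_unit_interval_def Abs_unit_interval_inverse dist_real_def abs_minus_commute)
  from continuous_on_compose2[OF continuous_on_apply_bcontfun this, of UNIV] show ?thesis by simp
qed

text \<open>The homotopy composes a character with \<gamma> at time \<open>1 - t\<close>. It is
  jointly continuous because characters, being contractive, are equicontinuous, while the dependence
  on \<open>x\<close> at a fixed element is continuous by definition of the topology.\<close>

lemma homotopic_with_character_path:
  fixes \<gamma> :: "'a::cstar_algebra \<Rightarrow> (unit_interval \<Rightarrow>\<^sub>C 'a)"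
  assumes \<gamma>: "star_hom \<gamma>" and q: "\<And>a. apply_bcontfun (\<gamma> a) 0 = q a *\<^sub>C 1"
  defines "X \<equiv> top_of_set {x :: 'a \<Rightarrow> complex. star_hom x}"
  shows "homotopic_with (\<lambda>_. True) X X (\<lambda>x a. x (apply_bcontfun (\<gamma> a) 1)) (\<lambda>_. q)"
proof -
  let ?C = "{x :: 'a \<Rightarrow> complex. star_hom x}"
  let ?b = "\<lambda>a t. apply_bcontfun (\<gamma> a) (Abs_unit_interval (1 - t))"
  let ?h = "\<lambda>(t, x) a. x (?b a t)"
  have b: "continuous_on {0..1} (?b a)" for a by (rule continuous_on_reversed_path)
  have c: "continuous_on ({0..1} \<times> ?C) (\<lambda>z. ?h z a)" for a
    unfolding continuous_on_def
  proof (clarify)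
    fix t0 :: real and x0 :: "'a \<Rightarrow> complex"
    assume t0: "t0 \<in> {0..1}" and x0: "star_hom x0"
    let ?F = "at (t0, x0) within {0..1} \<times> ?C"
    have z0: "(t0, x0) \<in> {0..1} \<times> ?C" using t0 x0 by simp
    have "continuous_on ({0..1} \<times> ?C) (\<lambda>z. ?b a (fst z))"
      by (rule continuous_on_compose2[OF b continuous_on_fst[OF continuous_on_id]]) (simp add: fst_image_times)
    then have "((\<lambda>z. ?b a (fst z)) \<longlongrightarrow> ?b a t0) ?F"
      using z0 unfolding continuous_on_def by fastforce
    moreover have "continuous_on ({0..1} \<times> ?C) (\<lambda>z. snd z (?b a t0))"
      by (rule continuous_on_compose2[OF continuous_on_product_coordinates continuous_on_snd[OF continuous_on_id]]) simp
    then have "((\<lambda>z. snd z (?b a t0)) \<longlongrightarrow> x0 (?b a t0)) ?F"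
      using z0 unfolding continuous_on_def by fastforce
    ultimately have lim: "((\<lambda>z. dist (?b a (fst z)) (?b a t0) + dist (snd z (?b a t0)) (x0 (?b a t0))) \<longlongrightarrow> 0 + 0) ?F"
      by (intro tendsto_add tendsto_dist_iff[THEN iffD1]) auto
    have "\<forall>\<^sub>F z in ?F. dist (?h z a) (x0 (?b a t0)) \<le> dist (?b a (fst z)) (?b a t0) + dist (snd z (?b a t0)) (x0 (?b a t0))"
      unfolding eventually_at_filter
    proof (rule always_eventually, clarify)
      fix t :: real and x :: "'a \<Rightarrow> complex" assume x: "star_hom x"
      show "dist (x (?b a t)) (x0 (?b a t0)) \<le> dist (?b a (fst (t, x))) (?b a t0) + dist (snd (t, x) (?b a t0)) (x0 (?b a t0))"
        using dist_triangle[of "x (?b a t)" "x0 (?b a t0)" "x (?b a t0)"] star_hom_complex_dist_le[OF x, of "?b a t" "?b a t0"]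
        by simp
    qed
    then show "((\<lambda>z. ?h z a) \<longlongrightarrow> x0 (?b a t0)) ?F"
      using tendsto_sandwich[OF _ _ tendsto_const lim[unfolded add_0]] by (subst tendsto_dist_iff) simp
  qed
  have "continuous_on ({0..1} \<times> ?C) ?h"
    by (rule continuous_on_coordinatewise_then_product) (rule c)
  moreover have "?h z \<in> ?C" if "z \<in> {0..1} \<times> ?C" for z
    using that by (auto intro: star_hom_comp star_hom_apply_bcontfun_comp[OF \<gamma>])
  ultimately have "continuous_map (prod_topology (top_of_set {0..1}) X) X ?h"
    unfolding X_def by (auto simp: continuous_map_subtopology_eu image_subset_iff simp flip: subtopology_Times)
  moreover have "?h (0, x) = (\<lambda>a. x (apply_bcontfun (\<gamma> a) 1))" "?h (1, x) = q" if "x \<in> topspace X" for x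
    using that by (auto simp: X_def q star_homD simp flip: zero_unit_interval_def one_unit_interval_def)
  ultimately show ?thesis
    by (subst homotopic_with) blast+
qed

lemma character_action_power:
  fixes \<Delta> :: "'h::nonzero_cstar_algebra \<Rightarrow> ('h, 'h) min_tensor"
    and \<delta> :: "'a::nonzero_cstar_algebra \<Rightarrow> ('a, 'h) min_tensor"
  assumes cqg: "compact_quantum_group \<Delta>" and act: "action \<Delta> \<delta>" and \<kappa>: "star_hom (\<kappa> :: 'h \<Rightarrow> complex)"
  shows "star_hom (convolution_power \<Delta> \<kappa> n)"
    "character_action \<delta> (convolution_power \<Delta> \<kappa> n) = character_action \<delta> \<kappa> ^^ n"
proof -
  note \<Delta> = star_hom_comultiplication[OF cqg]
  show hom: "star_hom (convolution_power \<Delta> \<kappa> n)" for n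
    by (induction n) (simp_all add: counit(1)[OF cqg \<kappa>] star_hom_convolution(1)[OF \<Delta> _ \<kappa>])
  show "character_action \<delta> (convolution_power \<Delta> \<kappa> n) = character_action \<delta> \<kappa> ^^ n"
  proof (induction n)
    case 0
    show ?case by (rule ext) (simp add: character_action_counit[OF cqg act \<kappa>])
  next
    case (Suc n)
    show ?case
    proof
      fix a
      show "character_action \<delta> (convolution_power \<Delta> \<kappa> (Suc n)) a = (character_action \<delta> \<kappa> ^^ Suc n) a"
        using character_action_convolution[OF act \<Delta> hom \<kappa>, of n a] by (simp only: Suc.IH funpow_Suc_right o_apply convolution_power.simps)
    qed
  qed
qed

text \<open>Freeness approximates \<open>1 \<otimes> h\<close> by a finite sum of elements
  \<open>(b \<otimes> 1) * \<delta> y\<close>. Evaluated with \<open>x\<close> and \<epsilon> the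
  sum is close to 1, with \<open>x\<close> and \<kappa> in \<open>S\<close> close to 0; so
  \<open>x\<close> must distinguish some \<open>y\<close> of the sum from its translate, by an
  amount that depends only on the sum and not on \<open>x\<close>.\<close>

lemma ex_orbit_separation:
  fixes \<Delta> :: "'h::nonzero_cstar_algebra \<Rightarrow> ('h, 'h) min_tensor"
    and \<delta> :: "'a::nonzero_cstar_algebra \<Rightarrow> ('a, 'h) min_tensor" and \<epsilon> :: "'h \<Rightarrow> complex"
  assumes free: "free_action \<Delta> \<delta>" and \<epsilon>: "star_hom \<epsilon>" "\<And>a. character_action \<delta> \<epsilon> a = a"
    and S: "finite S" "\<And>\<kappa>. \<kappa> \<in> S \<Longrightarrow> star_hom \<kappa> \<and> \<kappa> \<noteq> \<epsilon>"
  shows "\<exists>Y c. finite Y \<and> c > 0 \<and>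
    (\<forall>x :: 'a \<Rightarrow> complex. star_hom x \<longrightarrow> (\<forall>\<kappa>\<in>S. \<exists>y\<in>Y. cmod (x y - x (character_action \<delta> \<kappa> y)) \<ge> c))"
proof -
  have \<delta>: "star_hom \<delta>" and cls: "cls {(x \<otimes> 1) * \<delta> y |x y. True} = UNIV"
    using free by (auto simp: free_action_def action_def)
  obtain h where h: "\<epsilon> h = 1" "\<And>\<kappa>. \<kappa> \<in> S \<Longrightarrow> \<kappa> h = 0" using ex_separating_element[OF \<epsilon>(1) S] by blast
  obtain L where L: "norm (1 \<otimes> h - (\<Sum>(x, y)\<leftarrow>L. (x \<otimes> 1) * \<delta> y)) < 1 / 4"
    using ex_free_sum[OF \<delta> cls, of "1 / 4" "1 \<otimes> h"] by auto
  define N where "N = (\<Sum>(b, y)\<leftarrow>L. norm b)"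
  have N0: "N \<ge> 0" unfolding N_def by (intro sum_list_nonneg) auto
  have approx: "norm (\<mu> h - (\<Sum>(b, y)\<leftarrow>L. x b * x (character_action \<delta> \<mu> y))) < 1 / 4"
    if x: "star_hom x" and \<mu>: "star_hom \<mu>" for x :: "'a \<Rightarrow> complex" and \<mu> :: "'h \<Rightarrow> complex"
  proof -
    let ?T = "\<lambda>z. x (slice_right \<mu> z)"
    have T: "star_hom ?T" by (rule star_hom_comp[OF x slice_right(1)[OF \<mu>]])
    have "?T (\<Sum>(b, y)\<leftarrow>L. (b \<otimes> 1) * \<delta> y) = (\<Sum>(b, y)\<leftarrow>L. x b * x (character_action \<delta> \<mu> y))"
      by (induction L)
        (auto simp: star_homD[OF T, simplified] star_homD[OF slice_right(1)[OF \<mu>]] star_homD[OF x] slice_right(2)[OF \<mu>] star_homD(4)[OF \<mu>]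
          scaleC_one character_action_def)
    then have "?T (1 \<otimes> h - (\<Sum>(b, y)\<leftarrow>L. (b \<otimes> 1) * \<delta> y)) = \<mu> h - (\<Sum>(b, y)\<leftarrow>L. x b * x (character_action \<delta> \<mu> y))"
      unfolding star_homD(6)[OF T] by (simp add: slice_right(2)[OF \<mu>] star_homD[OF x])
    with le_less_trans[OF norm_star_hom_le[OF T] L] show ?thesis by (simp only:)
  qed
  \<comment> \<open>If all differences were below \<open>?c\<close>, the two evaluations would
    differ by at most \<open>N * ?c < 1 / 2\<close>, whereas the errors below \<open>1 / 4\<close>
    keep them more than \<open>1 / 2\<close> apart. Adding 1 to \<open>N\<close> avoids a division
    by 0.\<close>
  let ?Y = "snd ` set L" and ?c = "1 / (2 * (N + 1))"
  have "\<exists>y\<in>?Y. cmod (x y - x (character_action \<delta> \<kappa> y)) \<ge> ?c" if x: "star_hom x" and \<kappa>: "\<kappa> \<in> S" for x :: "'a \<Rightarrow> complex" and \<kappa>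
  proof (rule ccontr)
    assume "\<not> ?thesis"
    then have lt: "cmod (x y - x (character_action \<delta> \<kappa> y)) \<le> ?c" if "(b, y) \<in> set L" for b y
      using that by (force simp: not_le)
    let ?d = "\<Sum>(b, y)\<leftarrow>L. x b * (x y - x (character_action \<delta> \<kappa> y))"
    have "cmod (\<Sum>(b, y)\<leftarrow>L'. x b * (x y - x (character_action \<delta> \<kappa> y))) \<le> (\<Sum>(b, y)\<leftarrow>L'. norm b) * ?c" if "set L' \<subseteq> set L" for L'
      using that
    proof (induction L')
      case (Cons p L')
      obtain b y where p: "p = (b, y)" by force
      have "cmod (x b * (x y - x (character_action \<delta> \<kappa> y))) \<le> norm b * ?c"
        unfolding norm_mult by (rule mult_mono[OF norm_star_hom_le[OF x] lt]) (use Cons.prems p in auto)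
      with Cons show ?case
        by (simp only: p list.map sum_list.Cons case_prod_conv distrib_right)
          (meson add_mono dual_order.trans list.set_intros(2) norm_triangle_ineq subset_code(1))
    qed simp
    from this[of L] have "cmod ?d \<le> N * ?c" by (simp add: N_def)
    also have "\<dots> < 1 / 2" using N0 by (simp add: field_simps)
    finally have d: "cmod ?d < 1 / 2" .
    define v w where "v = (\<Sum>(b, y)\<leftarrow>L. x b * x y)" and "w = (\<Sum>(b, y)\<leftarrow>L. x b * x (character_action \<delta> \<kappa> y))"
    have "?d = v - w" unfolding v_def w_def by (induction L) (auto simp: algebra_simps)
    moreover have "cmod (1 - v) < 1 / 4" using approx[OF x \<epsilon>(1)] by (simp add: h(1) \<epsilon>(2) v_def)
    moreover have "cmod w < 1 / 4" using approx[OF x, of \<kappa>] S(2)[OF \<kappa>] by (simp add: h(2)[OF \<kappa>] w_def)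
    ultimately have "cmod (1 - v) + cmod (v - w) + cmod w < 1" using d by simp
    then show False using norm_triangle_ineq[of "1 - v + (v - w)" w] norm_triangle_ineq[of "1 - v" "v - w"] by simp
  qed
  moreover have "?c > 0" using N0 by simp
  ultimately show ?thesis by (intro exI[of _ ?Y] exI[of _ ?c]) auto
qed

theorem no_cone_map_if_torsion:
  fixes \<Delta> :: "'h::nonzero_cstar_algebra \<Rightarrow> ('h, 'h) min_tensor"
    and \<delta> :: "'a::nonzero_cstar_algebra \<Rightarrow> ('a, 'h) min_tensor"
    and \<gamma> :: "'a \<Rightarrow> (unit_interval \<Rightarrow>\<^sub>C 'a)"
  assumes cqg: "compact_quantum_group \<Delta>" and free: "free_action \<Delta> \<delta>"
    and \<kappa>: "star_hom (\<kappa> :: 'h \<Rightarrow> complex)" "\<kappa> \<noteq> counit \<Delta>" "n \<ge> 1" "convolution_power \<Delta> \<kappa> n = counit \<Delta>"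
    and \<gamma>: "star_hom \<gamma>" "range \<gamma> \<subseteq> nc_cone" "equivariant \<delta> \<delta> (\<lambda>a. \<gamma> a 1)"
  shows False
proof -
  have act: "action \<Delta> \<delta>" using free by (simp add: free_action_def)
  note A = actionD[OF act] and \<epsilon> = counit[OF cqg \<kappa>(1)]
  let ?p = "convolution_power \<Delta> \<kappa>"
  \<comment> \<open>The exact order of \<kappa>: smaller positive powers differ from the counit, so
    freeness separates all \<open>k\<close> positions of an orbit.\<close>
  define k where "k = (LEAST n. n \<ge> 1 \<and> ?p n = counit \<Delta>)"
  have k: "k \<ge> 1" "?p k = counit \<Delta>"
    unfolding k_def by (rule LeastI2[of _ n]; use \<kappa> in simp)+
  have "k \<noteq> 1"
  proof
    assume "k = 1"
    with k(2) \<epsilon>(2)[OF \<kappa>(1)] \<kappa>(2) show False by simp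
  qed
  with k(1) have k2: "k \<ge> 2" by simp
  have below: "?p j \<noteq> counit \<Delta>" if "0 < j" "j < k" for j
    using not_less_Least[of j "\<lambda>n. n \<ge> 1 \<and> ?p n = counit \<Delta>"] that by (auto simp: k_def)
  define \<alpha> where "\<alpha> = character_action \<delta> \<kappa>"
  note pow = character_action_power[OF cqg act \<kappa>(1), folded \<alpha>_def]
  have \<alpha>: "star_hom \<alpha>" unfolding \<alpha>_def by (rule star_hom_character_action[OF A(1) \<kappa>(1)])
  have "\<exists>Y c. finite Y \<and> c > 0 \<and> (\<forall>x :: 'a \<Rightarrow> complex. star_hom x \<longrightarrow>
      (\<forall>\<mu>\<in>?p ` {0<..<k}. \<exists>y\<in>Y. cmod (x y - x (character_action \<delta> \<mu> y)) \<ge> c))"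
    by (rule ex_orbit_separation[OF free \<epsilon>(1) character_action_counit[OF cqg act \<kappa>(1)]])
      (use pow(1) below in auto)
  then obtain Y c where Y: "finite Y" "c > 0"
    and sep: "\<And>x j. star_hom (x :: 'a \<Rightarrow> complex) \<Longrightarrow> 0 < j \<Longrightarrow> j < k \<Longrightarrow> \<exists>y\<in>Y. cmod (x y - x ((\<alpha> ^^ j) y)) \<ge> c"
    unfolding pow(2)[symmetric] by (metis greaterThanLessThan_iff imageI)
  have \<gamma>1: "star_hom (\<lambda>a. \<gamma> a t)" for t by (rule star_hom_apply_bcontfun_comp[OF \<gamma>(1)])
  have "\<gamma> a 0 \<in> range (\<lambda>c. c *\<^sub>C 1)" for a using \<gamma>(2) unfolding nc_cone_def by blast
  then obtain q where q: "star_hom q" "\<And>a. \<gamma> a 0 = q a *\<^sub>C 1" using ex_character_if_scalar[OF \<gamma>1] by blast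
  define X where "X = top_of_set {x :: 'a \<Rightarrow> complex. star_hom x}"
  have X: "topspace X = {x. star_hom x}" by (simp add: X_def)
  define s where "s = (\<lambda>(x :: 'a \<Rightarrow> complex) a. x (\<alpha> a))"
  have sj: "(s ^^ j) x = (\<lambda>a. x ((\<alpha> ^^ j) a))" for j x
    by (induction j) (auto simp: s_def funpow_swap1)
  have c: "continuous_on S (\<lambda>x :: 'a \<Rightarrow> complex. x a)" for S a
    by (rule continuous_on_subset[OF continuous_on_product_coordinates]) simp
  have "(\<alpha> ^^ k) a = a" for a
    using character_action_counit[OF cqg act \<kappa>(1)] by (simp add: k(2) flip: pow(2))
  then have period: "(s ^^ k) x = x" for x by (simp add: sj)
  \<comment> \<open>Colinearity at time 1, sliced by \<kappa>.\<close>
  have "\<alpha> (\<gamma> a 1) = \<gamma> (\<alpha> a) 1" for a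
    using slice_right_tensor_map[OF \<gamma>1 \<kappa>(1), of 1 "\<delta> a"] \<gamma>(3)
    unfolding \<alpha>_def character_action_def equivariant_def fun_eq_iff o_apply by metis
  then have comm: "(\<lambda>a. s x (\<gamma> a 1)) = s (\<lambda>a. x (\<gamma> a 1))" for x by (simp add: s_def)
  show False
  \<comment> \<open>The character \<open>q\<close> serves both as the end of the homotopy and as a
    point showing that the space is nonempty.\<close>
  proof (rule no_nullhomotopic_equivariant_map_free[of k X s "\<lambda>x a. x (\<gamma> a 1)" q q Y "\<lambda>y x. x y" "\<Sum>y\<in>Y. norm y" c])
    show "continuous_map X X s"
      unfolding X_def continuous_map_subtopology_eu s_def
      by (auto intro!: continuous_on_coordinatewise_then_product c star_hom_comp[OF _ \<alpha>])
    show "homotopic_with (\<lambda>_. True) X X (\<lambda>x a. x (\<gamma> a 1)) (\<lambda>_. q)"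
      unfolding X_def by (rule homotopic_with_character_path[OF \<gamma>(1) q(2)])
    show "continuous_map X euclidean (\<lambda>x. x y)" for y by (simp add: X_def c)
    show "cmod (x y) \<le> (\<Sum>y\<in>Y. norm y)" if "y \<in> Y" "x \<in> topspace X" for x y
      using norm_star_hom_le[of x y] member_le_sum[OF that(1), of norm] that(2) Y(1) by (simp add: X)
    show "\<exists>i\<in>Y. c \<le> cmod (x i - (s ^^ j) x i)" if "x \<in> topspace X" "0 < j" "j < k" for x j
      using sep[OF _ that(2,3)] that(1) by (simp add: X sj)
  qed (use k2 period comm q(1) Y in \<open>simp_all add: X\<close>)
qed

theorem theorem2p2:
  fixes \<Delta> :: "'h::nonzero_cstar_algebra \<Rightarrow> ('h, 'h) min_tensor"
    and \<delta> :: "'a::nonzero_cstar_algebra \<Rightarrow> ('a, 'h) min_tensor"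
    and \<kappa> :: "'h \<Rightarrow> complex"
  assumes "compact_quantum_group \<Delta>"
    and "free_action \<Delta> \<delta>"
    and "character \<kappa>"
  shows "((\<nexists>f :: 'a \<Rightarrow> (unit_interval \<Rightarrow>\<^sub>C ('a, 'h) min_tensor).
              star_hom f \<and> range f \<subseteq> nc_join \<delta> \<and> join_equivariant \<Delta> \<delta> f)
          \<longleftrightarrow> (\<nexists>\<gamma> :: 'a \<Rightarrow> (unit_interval \<Rightarrow>\<^sub>C 'a).
              star_hom \<gamma> \<and> range \<gamma> \<subseteq> nc_cone \<and> equivariant \<delta> \<delta> (\<lambda>a. \<gamma> a 1)))
       \<and> (\<kappa> \<noteq> counit \<Delta> \<and> (\<exists>n\<ge>1. convolution_power \<Delta> \<kappa> n = counit \<Delta>) \<longrightarrow>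
            (\<nexists>f :: 'a \<Rightarrow> (unit_interval \<Rightarrow>\<^sub>C ('a, 'h) min_tensor).
              star_hom f \<and> range f \<subseteq> nc_join \<delta> \<and> join_equivariant \<Delta> \<delta> f)
          \<and> (\<nexists>\<gamma> :: 'a \<Rightarrow> (unit_interval \<Rightarrow>\<^sub>C 'a).
              star_hom \<gamma> \<and> range \<gamma> \<subseteq> nc_cone \<and> equivariant \<delta> \<delta> (\<lambda>a. \<gamma> a 1)))"
    (is "((\<nexists>f. ?join f) \<longleftrightarrow> (\<nexists>\<gamma>. ?cone \<gamma>)) \<and> _")
proof -
  have act: "action \<Delta> \<delta>" using assms(2) by (simp add: free_action_def)
  have \<kappa>: "star_hom \<kappa>" using assms(3) by (simp add: character_def)
  have iff: "(\<exists>f. ?join f) \<longleftrightarrow> (\<exists>\<gamma>. ?cone \<gamma>)"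
    using ex_join_map_if_cone_map[OF assms(1) act] ex_cone_map_if_join_map[OF assms(1) act \<kappa>] by blast
  \<comment> \<open>Proved for the cone only; the equivalence carries it over to the join.\<close>
  have "\<not> ?cone \<gamma>" if "\<kappa> \<noteq> counit \<Delta> \<and> (\<exists>n\<ge>1. convolution_power \<Delta> \<kappa> n = counit \<Delta>)" for \<gamma>
    using no_cone_map_if_torsion[OF assms(1,2) \<kappa>] that by blast
  with iff show ?thesis by blast
qed

end
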